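(* Let $\mathcal{C}$ be a model category with normal functorial factorizations (see context) and class of weak equivalences $\mathcal{W}$. Let $r:\mathcal{C}\to\mathcal{C}_{fc}$ be the corestriction of the fibrant-cofibrant replacement functor $RQ$, let $i':\mathcal{C}_{fc}\to\mathcal{H}o(\mathcal{C}_{fc})$ be the inclusion into the homotopy 2-category of $(\mathcal{C}_{fc},\mathcal{W}\cap\mathcal{C}_{fc})$, and let $q=i'r:\mathcal{C}\to\mathcal{H}o(\mathcal{C}_{fc})$. Then $q$ is the 2-localization of $\mathcal{C}$ at $\mathcal{W}$; that is, $q$ sends the elements of $\mathcal{W}$ to equivalences, and for every 2-category $\mathcal{D}$ the 2-functor of precomposition with $q$, $$q^*: Hom_p(\mathcal{H}o(\mathcal{C}_{fc}),\mathcal{D})\longrightarrow Hom_{p}(\mathcal{C},\mathcal{D})_+ ,$$ is a pseudoequivalence of 2-categories.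
   Context: Model category means Quillen's closed model category (finite limits and colimits; three classes closed under retracts and composition; lifting; factorization; 3-for-2). $\mathcal{C}_{fc}$ is the full subcategory of fibrant-cofibrant objects. Standing assumption (normal functorial factorizations). Both factorizations, (cofibration, trivial fibration) and (trivial cofibration, fibration), are functorial: each $f$ has a chosen factorization $f=\rho_f\lambda_f$, and each commutative square $(u,v):f\to g$ induces a map $F(u,v)$ between the middle objects commuting with the $\lambda$'s and $\rho$'s, with $F(id,id)=id$ and $F(uu',vv')=F(u,v)F(u',v')$. Factoring $0\to X$ as a cofibration $0\to QX$ followed by a trivial fibration $p_X:QX\to X$ gives a functor $Q$ and a natural transformation $p:Q\Rightarrow Id$; factoring $X\to 1$ as a trivial cofibration $v_X:X\to RX$ followed by a fibration gives a functor $R$ and a natural transformation $v:Id\Rightarrow R$. Normality: if $X$ is cofibrant then $QX=X$, $p_X=id_X$; if $X$ is fibrant then $RX=X$, $v_X=id_X$. $RQ$ takes values in $\mathcal{C}_{fc}$. Conventions. A category is regarded as a 2-category with only identity 2-cells; an arrow is identified with its identity 2-cell. An arrow $f:X\to Y$ of a 2-category is an equivalence if there are $g:Y\to X$ and invertible 2-cells $id_X\Rightarrow gf$, $fg\Rightarrow id_Y$. $Hom_p(\mathcal{B},\mathcal{D})$ is the 2-category of (strict) 2-functors, pseudonatural transformations (with invertible structure 2-cells) and modifications; the subscript $+$ denotes the full sub-2-category on the 2-functors sending $\mathcal{W}$ to equivalences. A 2-functor $F:\mathcal{B}\to\mathcal{B}'$ is a pseudoequivalence if there are a 2-functor $G:\mathcal{B}'\to\mathcal{B}$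 and pseudonatural transformations $Id\Rightarrow GF$, $FG\Rightarrow Id$ that are equivalences in $Hom_p(\mathcal{B},\mathcal{B})$, $Hom_p(\mathcal{B}',\mathcal{B}')$. The homotopy 2-category $\mathcal{H}o(\mathcal{A})$ of a category $\mathcal{A}$ with a class $\Sigma$ of arrows containing identities (here $\mathcal{A}=\mathcal{C}_{fc}$, $\Sigma=\mathcal{W}\cap\mathcal{C}_{fc}$). A cylinder $C=(W,Z,d_0,d_1,s,x)$ for an object $X$ consists of arrows $d_0,d_1:X\to W$, $s:W\to Z$, $x:X\to Z$ of $\mathcal{A}$ with $s\in\Sigma$ and $sd_0=sd_1=x$. A homotopy $H=(C,h)$ from $f$ to $g$ ($f,g:X\to Y$) is a cylinder $C$ for $X$ with an arrow $h:W\to Y$ such that $hd_0=f$, $hd_1=g$. If $F:\mathcal{A}\to\mathcal{D}$ is a 2-functor into a 2-category sending $\Sigma$ to equivalences, there is a unique 2-cell $\widehat{FC}:Fd_0\Rightarrow Fd_1$ with $Fs\,\widehat{FC}=Fx$ (the identity 2-cell); put $\widehat{FH}=Fh\,\widehat{FC}:Ff\Rightarrow Fg$. $\mathcal{H}o(\mathcal{A})$ has the objects and arrows of $\mathcal{A}$. A 2-cell $f\Rightarrow g$ is a class $[H_n,\dots,H_1]$ of a finite sequence of composable homotopies from $f$ to $g$, where two sequences $(H_n,\dots,H_1)$, $(K_m,\dots,K_1)$ are equivalent iff $\widehat{FH_n}\circ\cdots\circ\widehat{FH_1}=\widehat{FK_m}\circ\cdots\circ\widehat{FK_1}$ for every 2-category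 $\mathcal{D}$ and every 2-functor $F:\mathcal{A}\to\mathcal{D}$ sending $\Sigma$ to equivalences. Vertical composition is juxtaposition of sequences; the identity of $f$ is the class of the homotopy with cylinder $(X,X,id,id,id,id)$ and $h=f$. Whiskering is $r[H]=[(C,rh)]$ and $[H]l=[(Cl,h)]$ with $Cl=(W,Z,d_0l,d_1l,s,xl)$, extended termwise; this determines horizontal composition. The inclusion $\mathcal{A}\to\mathcal{H}o(\mathcal{A})$ is the identity on objects and arrows. *)

theory Defs
  imports Main "HOL-Library.FuncSet"
begin

section \<open>Categories\<close>

record ('o, 'm) cat =
  Ob :: "'o set"
  Ar :: "'m set"
  Src :: "'m \<Rightarrow> 'o"
  Tgt :: "'m \<Rightarrow> 'o"
  Idn :: "'o \<Rightarrow> 'm"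
  Cmp :: "'m \<Rightarrow> 'm \<Rightarrow> 'm"  \<comment> \<open>\<open>Cmp C g f\<close> is \<open>g f\<close>, first \<open>f\<close>, then \<open>g\<close>\<close>

definition hom :: "('o, 'm, 'z) cat_scheme \<Rightarrow> 'o \<Rightarrow> 'o \<Rightarrow> 'm set" where
  "hom C a b = {f \<in> Ar C. Src C f = a \<and> Tgt C f = b}"

locale category =
  fixes C :: "('o, 'm, 'z) cat_scheme"
  assumes Src_Ob: "f \<in> Ar C \<Longrightarrow> Src C f \<in> Ob C"
    and Tgt_Ob: "f \<in> Ar C \<Longrightarrow> Tgt C f \<in> Ob C"
    and Idn_hom: "a \<in> Ob C \<Longrightarrow> Idn C a \<in> hom C a a"
    and Cmp_hom: "f \<in> hom C a b \<Longrightarrow> g \<in> hom C b c \<Longrightarrow> Cmp C g f \<in> hom C a c"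
    and Cmp_Idn_right: "f \<in> hom C a b \<Longrightarrow> Cmp C f (Idn C a) = f"
    and Cmp_Idn_left: "f \<in> hom C a b \<Longrightarrow> Cmp C (Idn C b) f = f"
    and Cmp_assoc: "f \<in> hom C a b \<Longrightarrow> g \<in> hom C b c \<Longrightarrow> h \<in> hom C c d \<Longrightarrow>
      Cmp C h (Cmp C g f) = Cmp C (Cmp C h g) f"

definition opposite :: "('o, 'm) cat \<Rightarrow> ('o, 'm) cat" where
  "opposite C = \<lparr>Ob = Ob C, Ar = Ar C, Src = Tgt C, Tgt = Src C, Idn = Idn C,
     Cmp = (\<lambda>g f. Cmp C f g)\<rparr>"

definition full_subcategory :: "('o, 'm) cat \<Rightarrow> 'o set \<Rightarrow> ('o, 'm) cat" where
  "full_subcategory C S = \<lparr>Ob = Ob C \<inter> S, Ar = {f \<in> Ar C. Src C f \<in> S \<and> Tgt C f \<in> S},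
     Src = Src C, Tgt = Tgt C, Idn = Idn C, Cmp = Cmp C\<rparr>"

definition initial :: "('o, 'm) cat \<Rightarrow> 'o \<Rightarrow> bool" where
  "initial C z \<longleftrightarrow> z \<in> Ob C \<and> (\<forall>a\<in>Ob C. \<exists>!f. f \<in> hom C z a)"

definition terminal :: "('o, 'm) cat \<Rightarrow> 'o \<Rightarrow> bool" where
  "terminal C t \<longleftrightarrow> t \<in> Ob C \<and> (\<forall>a\<in>Ob C. \<exists>!f. f \<in> hom C a t)"

definition diagram ::
  "('j, 'u) cat \<Rightarrow> ('o, 'm) cat \<Rightarrow> ('j \<Rightarrow> 'o) \<Rightarrow> ('u \<Rightarrow> 'm) \<Rightarrow> bool" where
  "diagram J C dO dA \<longleftrightarrow>
     (\<forall>j\<in>Ob J. dO j \<in> Ob C) \<and>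
     (\<forall>u\<in>Ar J. dA u \<in> hom C (dO (Src J u)) (dO (Tgt J u))) \<and>
     (\<forall>j\<in>Ob J. dA (Idn J j) = Idn C (dO j)) \<and>
     (\<forall>u\<in>Ar J. \<forall>v\<in>Ar J. Tgt J u = Src J v \<longrightarrow> dA (Cmp J v u) = Cmp C (dA v) (dA u))"

definition cone ::
  "('j, 'u) cat \<Rightarrow> ('o, 'm) cat \<Rightarrow> ('j \<Rightarrow> 'o) \<Rightarrow> ('u \<Rightarrow> 'm) \<Rightarrow> 'o \<Rightarrow> ('j \<Rightarrow> 'm) \<Rightarrow> bool" where
  "cone J C dO dA l \<pi> \<longleftrightarrow> l \<in> Ob C \<and> (\<forall>j\<in>Ob J. \<pi> j \<in> hom C l (dO j)) \<and>
     (\<forall>u\<in>Ar J. Cmp C (dA u) (\<pi> (Src J u)) = \<pi> (Tgt J u))"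

definition limit_cone ::
  "('j, 'u) cat \<Rightarrow> ('o, 'm) cat \<Rightarrow> ('j \<Rightarrow> 'o) \<Rightarrow> ('u \<Rightarrow> 'm) \<Rightarrow> 'o \<Rightarrow> ('j \<Rightarrow> 'm) \<Rightarrow> bool" where
  "limit_cone J C dO dA l \<pi> \<longleftrightarrow> cone J C dO dA l \<pi> \<and>
     (\<forall>l' \<pi>'. cone J C dO dA l' \<pi>' \<longrightarrow>
       (\<exists>!k. k \<in> hom C l' l \<and> (\<forall>j\<in>Ob J. Cmp C (\<pi> j) k = \<pi>' j)))"

text \<open>Every finite category is isomorphic to one whose objects and arrows are natural numbers,
  so quantifying over the latter covers all finite diagrams.\<close>

definition has_finite_limits :: "('o, 'm) cat \<Rightarrow> bool" where
  "has_finite_limits C \<longleftrightarrow>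
     (\<forall>(J :: (nat, nat) cat) dO dA.
        category J \<and> finite (Ob J) \<and> finite (Ar J) \<and> diagram J C dO dA \<longrightarrow>
        (\<exists>l \<pi>. limit_cone J C dO dA l \<pi>))"

definition has_finite_colimits :: "('o, 'm) cat \<Rightarrow> bool" where
  "has_finite_colimits C \<longleftrightarrow> has_finite_limits (opposite C)"


section \<open>Model categories\<close>

definition closed_under_composition :: "('o, 'm) cat \<Rightarrow> 'm set \<Rightarrow> bool" where
  "closed_under_composition C K \<longleftrightarrow>
     (\<forall>f\<in>K. \<forall>g\<in>K. Tgt C f = Src C g \<longrightarrow> Cmp C g f \<in> K)"

definition retract_of :: "('o, 'm) cat \<Rightarrow> 'm \<Rightarrow> 'm \<Rightarrow> bool" where
  "retract_of C f g \<longleftrightarrow> f \<in> Ar C \<and> g \<in> Ar C \<and>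
     (\<exists>i\<in>hom C (Src C f) (Src C g). \<exists>r\<in>hom C (Src C g) (Src C f).
      \<exists>j\<in>hom C (Tgt C f) (Tgt C g). \<exists>s\<in>hom C (Tgt C g) (Tgt C f).
        Cmp C r i = Idn C (Src C f) \<and> Cmp C s j = Idn C (Tgt C f) \<and>
        Cmp C g i = Cmp C j f \<and> Cmp C f r = Cmp C s g)"

definition closed_under_retracts :: "('o, 'm) cat \<Rightarrow> 'm set \<Rightarrow> bool" where
  "closed_under_retracts C K \<longleftrightarrow> (\<forall>f g. g \<in> K \<and> retract_of C f g \<longrightarrow> f \<in> K)"

definition three_for_two :: "('o, 'm) cat \<Rightarrow> 'm set \<Rightarrow> bool" where
  "three_for_two C K \<longleftrightarrow>
     (\<forall>f\<in>Ar C. \<forall>g\<in>Ar C. Tgt C f = Src C g \<longrightarrow>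
        (f \<in> K \<and> g \<in> K \<longrightarrow> Cmp C g f \<in> K) \<and>
        (f \<in> K \<and> Cmp C g f \<in> K \<longrightarrow> g \<in> K) \<and>
        (g \<in> K \<and> Cmp C g f \<in> K \<longrightarrow> f \<in> K))"

text \<open>A commutative square \<open>(u, v) : f \<rightarrow> g\<close> in the arrow category, with \<open>g u = v f\<close>.\<close>

definition comm_square :: "('o, 'm) cat \<Rightarrow> 'm \<Rightarrow> 'm \<Rightarrow> 'm \<Rightarrow> 'm \<Rightarrow> bool" where
  "comm_square C f g u v \<longleftrightarrow> f \<in> Ar C \<and> g \<in> Ar C \<and>
     u \<in> hom C (Src C f) (Src C g) \<and> v \<in> hom C (Tgt C f) (Tgt C g) \<and> Cmp C g u = Cmp C v f"

definition lifting_property :: "('o, 'm) cat \<Rightarrow> 'm \<Rightarrow> 'm \<Rightarrow> bool" where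
  "lifting_property C i p \<longleftrightarrow>
     (\<forall>u v. comm_square C i p u v \<longrightarrow>
        (\<exists>l\<in>hom C (Tgt C i) (Src C p). Cmp C l i = u \<and> Cmp C p l = v))"

definition factorizes :: "('o, 'm) cat \<Rightarrow> 'm set \<Rightarrow> 'm set \<Rightarrow> bool" where
  "factorizes C L R \<longleftrightarrow>
     (\<forall>f\<in>Ar C. \<exists>l\<in>L. \<exists>r\<in>R. Src C l = Src C f \<and> Tgt C l = Src C r \<and> Tgt C r = Tgt C f \<and>
        Cmp C r l = f)"

locale model_category = category C
  for C :: "('o, 'm) cat" +
  fixes W Fib Cof :: "'m set"
  assumes W_Ar: "W \<subseteq> Ar C" and Fib_Ar: "Fib \<subseteq> Ar C" and Cof_Ar: "Cof \<subseteq> Ar C"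
    and finite_limits: "has_finite_limits C"
    and finite_colimits: "has_finite_colimits C"
    and retracts: "\<And>K. K \<in> {W, Fib, Cof} \<Longrightarrow> closed_under_retracts C K"
    and compositions: "\<And>K. K \<in> {W, Fib, Cof} \<Longrightarrow> closed_under_composition C K"
    and W_three_for_two: "three_for_two C W"
    and lifting_triv_cof: "i \<in> W \<inter> Cof \<Longrightarrow> p \<in> Fib \<Longrightarrow> lifting_property C i p"
    and lifting_triv_fib: "i \<in> Cof \<Longrightarrow> p \<in> W \<inter> Fib \<Longrightarrow> lifting_property C i p"
    and factorization_triv_fib: "factorizes C Cof (W \<inter> Fib)"
    and factorization_triv_cof: "factorizes C (W \<inter> Cof) Fib"

text \<open>The chosen factorization of \<open>f\<close> is \<open>Rho \<Phi> f\<close> after \<open>Lam \<Phi> f\<close>, with middle object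
  \<open>Tgt C (Lam \<Phi> f)\<close>; \<open>Fmap \<Phi> f g u v\<close> is the arrow \<open>F(u, v)\<close> between middle objects induced
  by a square \<open>(u, v) : f \<rightarrow> g\<close>.\<close>

record 'm factorization =
  Lam :: "'m \<Rightarrow> 'm"
  Rho :: "'m \<Rightarrow> 'm"
  Fmap :: "'m \<Rightarrow> 'm \<Rightarrow> 'm \<Rightarrow> 'm \<Rightarrow> 'm"

definition functorial_factorization ::
  "('o, 'm) cat \<Rightarrow> 'm set \<Rightarrow> 'm set \<Rightarrow> 'm factorization \<Rightarrow> bool" where
  "functorial_factorization C L R \<Phi> \<longleftrightarrow>
     (\<forall>f\<in>Ar C. Lam \<Phi> f \<in> L \<and> Rho \<Phi> f \<in> R \<and>
        Lam \<Phi> f \<in> hom C (Src C f) (Tgt C (Lam \<Phi> f)) \<and>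
        Rho \<Phi> f \<in> hom C (Tgt C (Lam \<Phi> f)) (Tgt C f) \<and>
        Cmp C (Rho \<Phi> f) (Lam \<Phi> f) = f) \<and>
     (\<forall>f g u v. comm_square C f g u v \<longrightarrow>
        Fmap \<Phi> f g u v \<in> hom C (Tgt C (Lam \<Phi> f)) (Tgt C (Lam \<Phi> g)) \<and>
        Cmp C (Fmap \<Phi> f g u v) (Lam \<Phi> f) = Cmp C (Lam \<Phi> g) u \<and>
        Cmp C (Rho \<Phi> g) (Fmap \<Phi> f g u v) = Cmp C v (Rho \<Phi> f)) \<and>
     (\<forall>f\<in>Ar C. Fmap \<Phi> f f (Idn C (Src C f)) (Idn C (Tgt C f)) = Idn C (Tgt C (Lam \<Phi> f))) \<and>
     (\<forall>f g h u v u' v'. comm_square C f g u' v' \<and> comm_square C g h u v \<longrightarrow>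
        Fmap \<Phi> f h (Cmp C u u') (Cmp C v v') = Cmp C (Fmap \<Phi> g h u v) (Fmap \<Phi> f g u' v'))"

definition from_initial :: "('o, 'm) cat \<Rightarrow> 'o \<Rightarrow> 'o \<Rightarrow> 'm" where
  "from_initial C z X = (THE f. f \<in> hom C z X)"

definition to_terminal :: "('o, 'm) cat \<Rightarrow> 'o \<Rightarrow> 'o \<Rightarrow> 'm" where
  "to_terminal C t X = (THE f. f \<in> hom C X t)"

definition cofibrant :: "('o, 'm) cat \<Rightarrow> 'm set \<Rightarrow> 'o \<Rightarrow> 'o \<Rightarrow> bool" where
  "cofibrant C Cof z X \<longleftrightarrow> X \<in> Ob C \<and> from_initial C z X \<in> Cof"

definition fibrant :: "('o, 'm) cat \<Rightarrow> 'm set \<Rightarrow> 'o \<Rightarrow> 'o \<Rightarrow> bool" where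
  "fibrant C Fib t X \<longleftrightarrow> X \<in> Ob C \<and> to_terminal C t X \<in> Fib"

definition Q_ob :: "('o, 'm) cat \<Rightarrow> 'o \<Rightarrow> 'm factorization \<Rightarrow> 'o \<Rightarrow> 'o" where
  "Q_ob C z \<Phi> X = Tgt C (Lam \<Phi> (from_initial C z X))"

definition Q_ar :: "('o, 'm) cat \<Rightarrow> 'o \<Rightarrow> 'm factorization \<Rightarrow> 'm \<Rightarrow> 'm" where
  "Q_ar C z \<Phi> f =
     Fmap \<Phi> (from_initial C z (Src C f)) (from_initial C z (Tgt C f)) (Idn C z) f"

definition R_ob :: "('o, 'm) cat \<Rightarrow> 'o \<Rightarrow> 'm factorization \<Rightarrow> 'o \<Rightarrow> 'o" where
  "R_ob C t \<Psi> X = Tgt C (Lam \<Psi> (to_terminal C t X))"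

definition R_ar :: "('o, 'm) cat \<Rightarrow> 'o \<Rightarrow> 'm factorization \<Rightarrow> 'm \<Rightarrow> 'm" where
  "R_ar C t \<Psi> f =
     Fmap \<Psi> (to_terminal C t (Src C f)) (to_terminal C t (Tgt C f)) f (Idn C t)"

definition normal_factorizations ::
  "('o, 'm) cat \<Rightarrow> 'm set \<Rightarrow> 'm set \<Rightarrow> 'o \<Rightarrow> 'o \<Rightarrow> 'm factorization \<Rightarrow> 'm factorization \<Rightarrow> bool" where
  "normal_factorizations C Fib Cof z t \<Phi> \<Psi> \<longleftrightarrow>
     (\<forall>X. cofibrant C Cof z X \<longrightarrow>
        Q_ob C z \<Phi> X = X \<and> Rho \<Phi> (from_initial C z X) = Idn C X) \<and>
     (\<forall>X. fibrant C Fib t X \<longrightarrow>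
        R_ob C t \<Psi> X = X \<and> Lam \<Psi> (to_terminal C t X) = Idn C X)"

definition fibrant_cofibrant ::
  "('o, 'm) cat \<Rightarrow> 'm set \<Rightarrow> 'm set \<Rightarrow> 'o \<Rightarrow> 'o \<Rightarrow> ('o, 'm) cat" where
  "fibrant_cofibrant C Fib Cof z t =
     full_subcategory C {X. fibrant C Fib t X \<and> cofibrant C Cof z X}"


section \<open>2-categories\<close>

record ('o, 'm, 'c) twocat = "('o, 'm) cat" +
  Cl :: "'c set"
  Dm :: "'c \<Rightarrow> 'm"
  Cd :: "'c \<Rightarrow> 'm"
  Id2 :: "'m \<Rightarrow> 'c"
  VC :: "'c \<Rightarrow> 'c \<Rightarrow> 'c"  \<comment> \<open>vertical: \<open>VC B \<beta> \<alpha>\<close> is \<open>\<beta> \<circ> \<alpha>\<close>, first \<open>\<alpha>\<close>, then \<open>\<beta>\<close>\<close>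
  HC :: "'c \<Rightarrow> 'c \<Rightarrow> 'c"  \<comment> \<open>horizontal: \<open>HC B \<beta> \<alpha>\<close> is \<open>\<beta> \<alpha>\<close>, in the order of \<open>Cmp\<close>\<close>

definition cell :: "('o, 'm, 'c) twocat \<Rightarrow> 'm \<Rightarrow> 'm \<Rightarrow> 'c set" where
  "cell B f g = {\<alpha> \<in> Cl B. Dm B \<alpha> = f \<and> Cd B \<alpha> = g}"

locale two_category = category B
  for B :: "('o, 'm, 'c) twocat" +
  assumes Dm_Ar: "\<alpha> \<in> Cl B \<Longrightarrow> Dm B \<alpha> \<in> Ar B"
    and Cd_Ar: "\<alpha> \<in> Cl B \<Longrightarrow> Cd B \<alpha> \<in> Ar B"
    and Src_Cd: "\<alpha> \<in> Cl B \<Longrightarrow> Src B (Cd B \<alpha>) = Src B (Dm B \<alpha>)"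
    and Tgt_Cd: "\<alpha> \<in> Cl B \<Longrightarrow> Tgt B (Cd B \<alpha>) = Tgt B (Dm B \<alpha>)"
    and Id2_cell: "f \<in> Ar B \<Longrightarrow> Id2 B f \<in> cell B f f"
    and VC_cell: "\<alpha> \<in> cell B f g \<Longrightarrow> \<beta> \<in> cell B g h \<Longrightarrow> VC B \<beta> \<alpha> \<in> cell B f h"
    and VC_Id2_right: "\<alpha> \<in> cell B f g \<Longrightarrow> VC B \<alpha> (Id2 B f) = \<alpha>"
    and VC_Id2_left: "\<alpha> \<in> cell B f g \<Longrightarrow> VC B (Id2 B g) \<alpha> = \<alpha>"
    and VC_assoc: "\<alpha> \<in> cell B f g \<Longrightarrow> \<beta> \<in> cell B g h \<Longrightarrow> \<gamma> \<in> cell B h k \<Longrightarrow>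
      VC B \<gamma> (VC B \<beta> \<alpha>) = VC B (VC B \<gamma> \<beta>) \<alpha>"
    and HC_cell: "\<alpha> \<in> cell B f g \<Longrightarrow> \<beta> \<in> cell B k l \<Longrightarrow> Tgt B f = Src B k \<Longrightarrow>
      HC B \<beta> \<alpha> \<in> cell B (Cmp B k f) (Cmp B l g)"
    and HC_Id2_right: "\<alpha> \<in> cell B f g \<Longrightarrow> HC B \<alpha> (Id2 B (Idn B (Src B f))) = \<alpha>"
    and HC_Id2_left: "\<alpha> \<in> cell B f g \<Longrightarrow> HC B (Id2 B (Idn B (Tgt B f))) \<alpha> = \<alpha>"
    and HC_assoc: "\<alpha> \<in> cell B f f' \<Longrightarrow> \<beta> \<in> cell B g g' \<Longrightarrow> \<gamma> \<in> cell B h h' \<Longrightarrow>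
      Tgt B f = Src B g \<Longrightarrow> Tgt B g = Src B h \<Longrightarrow>
      HC B \<gamma> (HC B \<beta> \<alpha>) = HC B (HC B \<gamma> \<beta>) \<alpha>"
    and HC_Id2_Id2: "f \<in> hom B a b \<Longrightarrow> g \<in> hom B b c \<Longrightarrow>
      HC B (Id2 B g) (Id2 B f) = Id2 B (Cmp B g f)"
    and interchange: "\<alpha> \<in> cell B f g \<Longrightarrow> \<alpha>' \<in> cell B g h \<Longrightarrow> \<beta> \<in> cell B k l \<Longrightarrow>
      \<beta>' \<in> cell B l m \<Longrightarrow> Tgt B f = Src B k \<Longrightarrow>
      HC B (VC B \<beta>' \<beta>) (VC B \<alpha>' \<alpha>) = VC B (HC B \<beta>' \<alpha>') (HC B \<beta> \<alpha>)"

text \<open>A category as a 2-category: every arrow is its own (and only) identity 2-cell.\<close>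

definition disc :: "('o, 'm) cat \<Rightarrow> ('o, 'm, 'm) twocat" where
  "disc C = \<lparr>Ob = Ob C, Ar = Ar C, Src = Src C, Tgt = Tgt C, Idn = Idn C, Cmp = Cmp C,
     Cl = Ar C, Dm = (\<lambda>f. f), Cd = (\<lambda>f. f), Id2 = (\<lambda>f. f), VC = (\<lambda>g f. f), HC = Cmp C\<rparr>"

definition full_sub_two_category ::
  "('o, 'm, 'c) twocat \<Rightarrow> 'o set \<Rightarrow> ('o, 'm, 'c) twocat" where
  "full_sub_two_category B S = B\<lparr>Ob := Ob B \<inter> S,
     Ar := {f \<in> Ar B. Src B f \<in> S \<and> Tgt B f \<in> S},
     Cl := {\<alpha> \<in> Cl B. Src B (Dm B \<alpha>) \<in> S \<and> Tgt B (Dm B \<alpha>) \<in> S}\<rparr>"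

definition invertible_cell :: "('o, 'm, 'c) twocat \<Rightarrow> 'c \<Rightarrow> bool" where
  "invertible_cell B \<alpha> \<longleftrightarrow> \<alpha> \<in> Cl B \<and>
     (\<exists>\<beta>\<in>cell B (Cd B \<alpha>) (Dm B \<alpha>). VC B \<beta> \<alpha> = Id2 B (Dm B \<alpha>) \<and> VC B \<alpha> \<beta> = Id2 B (Cd B \<alpha>))"

definition equivalence :: "('o, 'm, 'c) twocat \<Rightarrow> 'm \<Rightarrow> bool" where
  "equivalence B f \<longleftrightarrow> f \<in> Ar B \<and>
     (\<exists>g\<in>hom B (Tgt B f) (Src B f).
        (\<exists>\<eta>\<in>cell B (Idn B (Src B f)) (Cmp B g f). invertible_cell B \<eta>) \<and>
        (\<exists>\<epsilon>\<in>cell B (Cmp B f g) (Idn B (Tgt B f)). invertible_cell B \<epsilon>))"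

text \<open>All functions on cells are extensional (\<^term>\<open>undefined\<close> outside the carrier), so that
  2-functors, transformations and modifications are equal exactly when they agree on the carriers.\<close>

record ('o, 'm, 'c, 'p, 'n, 'd) twofun =
  FO :: "'o \<Rightarrow> 'p"
  FA :: "'m \<Rightarrow> 'n"
  FC :: "'c \<Rightarrow> 'd"

definition two_functor ::
  "('o, 'm, 'c) twocat \<Rightarrow> ('p, 'n, 'd) twocat \<Rightarrow> ('o, 'm, 'c, 'p, 'n, 'd) twofun \<Rightarrow> bool" where
  "two_functor B D F \<longleftrightarrow> two_category B \<and> two_category D \<and>
     FO F \<in> extensional (Ob B) \<and> FA F \<in> extensional (Ar B) \<and> FC F \<in> extensional (Cl B) \<and>
     (\<forall>a\<in>Ob B. FO F a \<in> Ob D) \<and>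
     (\<forall>f\<in>Ar B. FA F f \<in> hom D (FO F (Src B f)) (FO F (Tgt B f))) \<and>
     (\<forall>\<alpha>\<in>Cl B. FC F \<alpha> \<in> cell D (FA F (Dm B \<alpha>)) (FA F (Cd B \<alpha>))) \<and>
     (\<forall>a\<in>Ob B. FA F (Idn B a) = Idn D (FO F a)) \<and>
     (\<forall>f\<in>Ar B. \<forall>g\<in>Ar B. Tgt B f = Src B g \<longrightarrow> FA F (Cmp B g f) = Cmp D (FA F g) (FA F f)) \<and>
     (\<forall>f\<in>Ar B. FC F (Id2 B f) = Id2 D (FA F f)) \<and>
     (\<forall>\<alpha>\<in>Cl B. \<forall>\<beta>\<in>Cl B. Cd B \<alpha> = Dm B \<beta> \<longrightarrow>
        FC F (VC B \<beta> \<alpha>) = VC D (FC F \<beta>) (FC F \<alpha>)) \<and>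
     (\<forall>\<alpha>\<in>Cl B. \<forall>\<beta>\<in>Cl B. Tgt B (Dm B \<alpha>) = Src B (Dm B \<beta>) \<longrightarrow>
        FC F (HC B \<beta> \<alpha>) = HC D (FC F \<beta>) (FC F \<alpha>))"

definition id_twofun :: "('o, 'm, 'c) twocat \<Rightarrow> ('o, 'm, 'c, 'o, 'm, 'c) twofun" where
  "id_twofun B = \<lparr>FO = (\<lambda>a\<in>Ob B. a), FA = (\<lambda>f\<in>Ar B. f), FC = (\<lambda>\<alpha>\<in>Cl B. \<alpha>)\<rparr>"

definition comp_twofun ::
  "('o, 'm, 'c) twocat \<Rightarrow> ('p, 'n, 'd, 'r, 'k, 'e) twofun \<Rightarrow> ('o, 'm, 'c, 'p, 'n, 'd) twofun \<Rightarrow>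
   ('o, 'm, 'c, 'r, 'k, 'e) twofun" where
  "comp_twofun B G F = \<lparr>FO = (\<lambda>a\<in>Ob B. FO G (FO F a)), FA = (\<lambda>f\<in>Ar B. FA G (FA F f)),
     FC = (\<lambda>\<alpha>\<in>Cl B. FC G (FC F \<alpha>))\<rparr>"

definition sends_to_equivalences ::
  "('p, 'n, 'd) twocat \<Rightarrow> 'm set \<Rightarrow> ('o, 'm, 'c, 'p, 'n, 'd) twofun \<Rightarrow> bool" where
  "sends_to_equivalences D K F \<longleftrightarrow> (\<forall>w\<in>K. equivalence D (FA F w))"


section \<open>The 2-category of 2-functors, pseudonatural transformations and modifications\<close>

text \<open>A pseudonatural transformation \<open>\<theta> : F \<Rightarrow> G\<close> has components \<open>\<theta>\<^sub>X : F X \<rightarrow> G X\<close>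
  and, for \<open>f : X \<rightarrow> Y\<close>, invertible 2-cells \<open>\<theta>\<^sub>f : (G f) \<theta>\<^sub>X \<Rightarrow> \<theta>\<^sub>Y (F f)\<close>.\<close>

record ('o, 'm, 'c, 'p, 'n, 'd) pnat =
  PDom :: "('o, 'm, 'c, 'p, 'n, 'd) twofun"
  PCod :: "('o, 'm, 'c, 'p, 'n, 'd) twofun"
  PO :: "'o \<Rightarrow> 'n"
  PA :: "'m \<Rightarrow> 'd"

definition pseudonatural ::
  "('o, 'm, 'c) twocat \<Rightarrow> ('p, 'n, 'd) twocat \<Rightarrow> ('o, 'm, 'c, 'p, 'n, 'd) pnat \<Rightarrow> bool" where
  "pseudonatural B D \<theta> \<longleftrightarrow> (let F = PDom \<theta>; G = PCod \<theta> in
     two_functor B D F \<and> two_functor B D G \<and>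
     PO \<theta> \<in> extensional (Ob B) \<and> PA \<theta> \<in> extensional (Ar B) \<and>
     (\<forall>X\<in>Ob B. PO \<theta> X \<in> hom D (FO F X) (FO G X)) \<and>
     (\<forall>f\<in>Ar B. PA \<theta> f \<in> cell D (Cmp D (FA G f) (PO \<theta> (Src B f)))
                              (Cmp D (PO \<theta> (Tgt B f)) (FA F f)) \<and>
                invertible_cell D (PA \<theta> f)) \<and>
     (\<forall>X\<in>Ob B. PA \<theta> (Idn B X) = Id2 D (PO \<theta> X)) \<and>
     (\<forall>f\<in>Ar B. \<forall>g\<in>Ar B. Tgt B f = Src B g \<longrightarrow>
        PA \<theta> (Cmp B g f) =
          VC D (HC D (PA \<theta> g) (Id2 D (FA F f))) (HC D (Id2 D (FA G g)) (PA \<theta> f))) \<and>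
     (\<forall>\<gamma>\<in>Cl B.
        VC D (PA \<theta> (Cd B \<gamma>)) (HC D (FC G \<gamma>) (Id2 D (PO \<theta> (Src B (Dm B \<gamma>))))) =
        VC D (HC D (Id2 D (PO \<theta> (Tgt B (Dm B \<gamma>)))) (FC F \<gamma>)) (PA \<theta> (Dm B \<gamma>))))"

record ('o, 'm, 'c, 'p, 'n, 'd) modif =
  MDom :: "('o, 'm, 'c, 'p, 'n, 'd) pnat"
  MCod :: "('o, 'm, 'c, 'p, 'n, 'd) pnat"
  MC :: "'o \<Rightarrow> 'd"

definition modification ::
  "('o, 'm, 'c) twocat \<Rightarrow> ('p, 'n, 'd) twocat \<Rightarrow> ('o, 'm, 'c, 'p, 'n, 'd) modif \<Rightarrow> bool" where
  "modification B D \<rho> \<longleftrightarrow> (let \<theta> = MDom \<rho>; \<theta>' = MCod \<rho>; F = PDom \<theta>; G = PCod \<theta> in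
     pseudonatural B D \<theta> \<and> pseudonatural B D \<theta>' \<and> PDom \<theta>' = F \<and> PCod \<theta>' = G \<and>
     MC \<rho> \<in> extensional (Ob B) \<and>
     (\<forall>X\<in>Ob B. MC \<rho> X \<in> cell D (PO \<theta> X) (PO \<theta>' X)) \<and>
     (\<forall>f\<in>Ar B.
        VC D (HC D (MC \<rho> (Tgt B f)) (Id2 D (FA F f))) (PA \<theta> f) =
        VC D (PA \<theta>' f) (HC D (Id2 D (FA G f)) (MC \<rho> (Src B f)))))"

definition id_pnat ::
  "('o, 'm, 'c) twocat \<Rightarrow> ('p, 'n, 'd) twocat \<Rightarrow> ('o, 'm, 'c, 'p, 'n, 'd) twofun \<Rightarrow>
   ('o, 'm, 'c, 'p, 'n, 'd) pnat" where
  "id_pnat B D F = \<lparr>PDom = F, PCod = F, PO = (\<lambda>X\<in>Ob B. Idn D (FO F X)),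
     PA = (\<lambda>f\<in>Ar B. Id2 D (FA F f))\<rparr>"

text \<open>For \<open>\<theta> : F \<Rightarrow> G\<close> and \<open>\<phi> : G \<Rightarrow> H\<close>, the structure 2-cell of \<open>\<phi> \<theta>\<close> at \<open>f : X \<rightarrow> Y\<close> is the
  pasting \<open>(H f) \<phi>\<^sub>X \<theta>\<^sub>X \<Rightarrow> \<phi>\<^sub>Y (G f) \<theta>\<^sub>X \<Rightarrow> \<phi>\<^sub>Y \<theta>\<^sub>Y (F f)\<close>.\<close>

definition comp_pnat ::
  "('o, 'm, 'c) twocat \<Rightarrow> ('p, 'n, 'd) twocat \<Rightarrow> ('o, 'm, 'c, 'p, 'n, 'd) pnat \<Rightarrow>
   ('o, 'm, 'c, 'p, 'n, 'd) pnat \<Rightarrow> ('o, 'm, 'c, 'p, 'n, 'd) pnat" where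
  "comp_pnat B D \<phi> \<theta> = \<lparr>PDom = PDom \<theta>, PCod = PCod \<phi>,
     PO = (\<lambda>X\<in>Ob B. Cmp D (PO \<phi> X) (PO \<theta> X)),
     PA = (\<lambda>f\<in>Ar B. VC D (HC D (Id2 D (PO \<phi> (Tgt B f))) (PA \<theta> f))
                        (HC D (PA \<phi> f) (Id2 D (PO \<theta> (Src B f)))))\<rparr>"

definition Hom_p ::
  "('o, 'm, 'c) twocat \<Rightarrow> ('p, 'n, 'd) twocat \<Rightarrow>
   (('o, 'm, 'c, 'p, 'n, 'd) twofun, ('o, 'm, 'c, 'p, 'n, 'd) pnat,
    ('o, 'm, 'c, 'p, 'n, 'd) modif) twocat" where
  "Hom_p B D = \<lparr>Ob = {F. two_functor B D F}, Ar = {\<theta>. pseudonatural B D \<theta>},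
     Src = PDom, Tgt = PCod, Idn = id_pnat B D, Cmp = comp_pnat B D,
     Cl = {\<rho>. modification B D \<rho>}, Dm = MDom, Cd = MCod,
     Id2 = (\<lambda>\<theta>. \<lparr>MDom = \<theta>, MCod = \<theta>, MC = (\<lambda>X\<in>Ob B. Id2 D (PO \<theta> X))\<rparr>),
     VC = (\<lambda>\<sigma> \<rho>. \<lparr>MDom = MDom \<rho>, MCod = MCod \<sigma>, MC = (\<lambda>X\<in>Ob B. VC D (MC \<sigma> X) (MC \<rho> X))\<rparr>),
     HC = (\<lambda>\<sigma> \<rho>. \<lparr>MDom = comp_pnat B D (MDom \<sigma>) (MDom \<rho>), MCod = comp_pnat B D (MCod \<sigma>) (MCod \<rho>),
                   MC = (\<lambda>X\<in>Ob B. HC D (MC \<sigma> X) (MC \<rho> X))\<rparr>)\<rparr>"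

definition Hom_p_plus ::
  "('o, 'm, 'c) twocat \<Rightarrow> 'm set \<Rightarrow> ('p, 'n, 'd) twocat \<Rightarrow>
   (('o, 'm, 'c, 'p, 'n, 'd) twofun, ('o, 'm, 'c, 'p, 'n, 'd) pnat,
    ('o, 'm, 'c, 'p, 'n, 'd) modif) twocat" where
  "Hom_p_plus B W D = full_sub_two_category (Hom_p B D) {F. sends_to_equivalences D W F}"

definition pseudoequivalence ::
  "('o, 'm, 'c) twocat \<Rightarrow> ('p, 'n, 'd) twocat \<Rightarrow> ('o, 'm, 'c, 'p, 'n, 'd) twofun \<Rightarrow> bool" where
  "pseudoequivalence B B' F \<longleftrightarrow> two_functor B B' F \<and>
     (\<exists>G. two_functor B' B G \<and>
        (\<exists>\<theta>\<in>hom (Hom_p B B) (id_twofun B) (comp_twofun B G F). equivalence (Hom_p B B) \<theta>) \<and>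
        (\<exists>\<phi>\<in>hom (Hom_p B' B') (comp_twofun B' F G) (id_twofun B'). equivalence (Hom_p B' B') \<phi>))"

definition precomp_pnat ::
  "('o, 'm, 'c) twocat \<Rightarrow> ('o, 'm, 'c, 'p, 'n, 'd) twofun \<Rightarrow> ('p, 'n, 'd, 'r, 'k, 'e) pnat \<Rightarrow>
   ('o, 'm, 'c, 'r, 'k, 'e) pnat" where
  "precomp_pnat B q \<theta> = \<lparr>PDom = comp_twofun B (PDom \<theta>) q, PCod = comp_twofun B (PCod \<theta>) q,
     PO = (\<lambda>X\<in>Ob B. PO \<theta> (FO q X)), PA = (\<lambda>f\<in>Ar B. PA \<theta> (FA q f))\<rparr>"

definition precomp_modif ::
  "('o, 'm, 'c) twocat \<Rightarrow> ('o, 'm, 'c, 'p, 'n, 'd) twofun \<Rightarrow> ('p, 'n, 'd, 'r, 'k, 'e) modif \<Rightarrow>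
   ('o, 'm, 'c, 'r, 'k, 'e) modif" where
  "precomp_modif B q \<rho> = \<lparr>MDom = precomp_pnat B q (MDom \<rho>), MCod = precomp_pnat B q (MCod \<rho>),
     MC = (\<lambda>X\<in>Ob B. MC \<rho> (FO q X))\<rparr>"

text \<open>For \<open>q : B \<rightarrow> H\<close>, the 2-functor \<open>q\<^sup>*\<close> from \<open>Hom_p H D\<close> to (a full sub-2-category of)
  \<open>Hom_p B D\<close>.\<close>

definition precomposition ::
  "('o, 'm, 'c) twocat \<Rightarrow> ('p, 'n, 'd) twocat \<Rightarrow> ('r, 'k, 'e) twocat \<Rightarrow>
   ('o, 'm, 'c, 'p, 'n, 'd) twofun \<Rightarrow>
   (('p, 'n, 'd, 'r, 'k, 'e) twofun, ('p, 'n, 'd, 'r, 'k, 'e) pnat, ('p, 'n, 'd, 'r, 'k, 'e) modif,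
    ('o, 'm, 'c, 'r, 'k, 'e) twofun, ('o, 'm, 'c, 'r, 'k, 'e) pnat, ('o, 'm, 'c, 'r, 'k, 'e) modif)
   twofun" where
  "precomposition B H D q = \<lparr>FO = (\<lambda>F\<in>Ob (Hom_p H D). comp_twofun B F q),
     FA = (\<lambda>\<theta>\<in>Ar (Hom_p H D). precomp_pnat B q \<theta>),
     FC = (\<lambda>\<rho>\<in>Cl (Hom_p H D). precomp_modif B q \<rho>)\<rparr>"


section \<open>Homotopies and the homotopy 2-category\<close>

record ('o, 'm) cylinder =
  cyl_W :: 'o
  cyl_Z :: 'o
  cyl_d0 :: 'm
  cyl_d1 :: 'm
  cyl_s :: 'm
  cyl_x :: 'm

definition is_cylinder :: "('o, 'm) cat \<Rightarrow> 'm set \<Rightarrow> 'o \<Rightarrow> ('o, 'm) cylinder \<Rightarrow> bool" where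
  "is_cylinder A \<Sigma> X c \<longleftrightarrow> cyl_W c \<in> Ob A \<and> cyl_Z c \<in> Ob A \<and>
     cyl_d0 c \<in> hom A X (cyl_W c) \<and> cyl_d1 c \<in> hom A X (cyl_W c) \<and>
     cyl_s c \<in> hom A (cyl_W c) (cyl_Z c) \<and> cyl_s c \<in> \<Sigma> \<and> cyl_x c \<in> hom A X (cyl_Z c) \<and>
     Cmp A (cyl_s c) (cyl_d0 c) = cyl_x c \<and> Cmp A (cyl_s c) (cyl_d1 c) = cyl_x c"

type_synonym ('o, 'm) homotopy = "('o, 'm) cylinder \<times> 'm"

definition is_homotopy ::
  "('o, 'm) cat \<Rightarrow> 'm set \<Rightarrow> 'm \<Rightarrow> 'm \<Rightarrow> ('o, 'm) homotopy \<Rightarrow> bool" where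
  "is_homotopy A \<Sigma> f g H \<longleftrightarrow> (case H of (c, h) \<Rightarrow>
     (\<exists>X Y. f \<in> hom A X Y \<and> g \<in> hom A X Y \<and> is_cylinder A \<Sigma> X c \<and> h \<in> hom A (cyl_W c) Y \<and>
        Cmp A h (cyl_d0 c) = f \<and> Cmp A h (cyl_d1 c) = g))"

text \<open>Sequences are written as in \<open>(H\<^sub>n, \<dots>, H\<^sub>1)\<close>: the head of the list is the last homotopy.\<close>

inductive homotopy_seq ::
  "('o, 'm) cat \<Rightarrow> 'm set \<Rightarrow> 'm \<Rightarrow> 'm \<Rightarrow> ('o, 'm) homotopy list \<Rightarrow> bool"
  for A :: "('o, 'm) cat" and \<Sigma> :: "'m set" where
  single: "is_homotopy A \<Sigma> f g H \<Longrightarrow> homotopy_seq A \<Sigma> f g [H]"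
| step: "homotopy_seq A \<Sigma> f e Hs \<Longrightarrow> is_homotopy A \<Sigma> e g H \<Longrightarrow> homotopy_seq A \<Sigma> f g (H # Hs)"

definition hat_cyl ::
  "('p, 'n, 'd) twocat \<Rightarrow> ('o, 'm, 'm, 'p, 'n, 'd) twofun \<Rightarrow> ('o, 'm) cylinder \<Rightarrow> 'd" where
  "hat_cyl D F c = (THE \<gamma>. \<gamma> \<in> cell D (FA F (cyl_d0 c)) (FA F (cyl_d1 c)) \<and>
     HC D (Id2 D (FA F (cyl_s c))) \<gamma> = Id2 D (FA F (cyl_x c)))"

definition hat ::
  "('p, 'n, 'd) twocat \<Rightarrow> ('o, 'm, 'm, 'p, 'n, 'd) twofun \<Rightarrow> ('o, 'm) homotopy \<Rightarrow> 'd" where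
  "hat D F H = (case H of (c, h) \<Rightarrow> HC D (Id2 D (FA F h)) (hat_cyl D F c))"

fun hat_seq ::
  "('p, 'n, 'd) twocat \<Rightarrow> ('o, 'm, 'm, 'p, 'n, 'd) twofun \<Rightarrow> ('o, 'm) homotopy list \<Rightarrow> 'd" where
  "hat_seq D F [] = undefined"
| "hat_seq D F [H] = hat D F H"
| "hat_seq D F (H # K # Hs) = VC D (hat D F H) (hat_seq D F (K # Hs))"

text \<open>HOL cannot quantify over all types inside a formula, so the 2-categories \<open>D\<close> in the
  definition of the equivalence of sequences have cells in the fixed type \<open>('m + nat) list\<close>.
  This type has \<open>max(|'m|, \<aleph>\<^sub>0)\<close> elements, enough for an isomorphic copy of the sub-2-category
  generated by the image of any \<open>F : A \<rightarrow> D\<close> and chosen equivalence data; lemma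
  \<open>ho_rel_hat_seq\<close> below shows that the restriction on \<open>D\<close> is therefore harmless.\<close>

type_synonym 'm test_twocat =
  "(('m + nat) list, ('m + nat) list, ('m + nat) list) twocat"

definition ho_rel ::
  "('o, 'm) cat \<Rightarrow> 'm set \<Rightarrow> 'm \<Rightarrow> 'm \<Rightarrow>
   ('o, 'm) homotopy list \<Rightarrow> ('o, 'm) homotopy list \<Rightarrow> bool" where
  "ho_rel A \<Sigma> f g Hs Ks \<longleftrightarrow> homotopy_seq A \<Sigma> f g Hs \<and> homotopy_seq A \<Sigma> f g Ks \<and>
     (\<forall>(D :: 'm test_twocat) F.
        two_functor (disc A) D F \<and> sends_to_equivalences D \<Sigma> F \<longrightarrow>
        hat_seq D F Hs = hat_seq D F Ks)"

text \<open>A 2-cell \<open>f \<Rightarrow> g\<close> is a triple of \<open>f\<close>, \<open>g\<close> and an equivalence class of sequences.\<close>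

type_synonym ('o, 'm) ho_cell = "'m \<times> 'm \<times> ('o, 'm) homotopy list set"

definition ho_class ::
  "('o, 'm) cat \<Rightarrow> 'm set \<Rightarrow> 'm \<Rightarrow> 'm \<Rightarrow> ('o, 'm) homotopy list \<Rightarrow> ('o, 'm) ho_cell" where
  "ho_class A \<Sigma> f g Hs = (f, g, {Ks. ho_rel A \<Sigma> f g Hs Ks})"

definition ho_rep :: "('o, 'm) ho_cell \<Rightarrow> ('o, 'm) homotopy list" where
  "ho_rep \<alpha> = (SOME Hs. Hs \<in> snd (snd \<alpha>))"

definition id_homotopy :: "('o, 'm) cat \<Rightarrow> 'm \<Rightarrow> ('o, 'm) homotopy" where
  "id_homotopy A f = (let X = Src A f in
     (\<lparr>cyl_W = X, cyl_Z = X, cyl_d0 = Idn A X, cyl_d1 = Idn A X, cyl_s = Idn A X,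
       cyl_x = Idn A X\<rparr>, f))"

definition whisker_left :: "('o, 'm) cat \<Rightarrow> 'm \<Rightarrow> ('o, 'm) homotopy \<Rightarrow> ('o, 'm) homotopy" where
  "whisker_left A r H = (case H of (c, h) \<Rightarrow> (c, Cmp A r h))"

definition whisker_right :: "('o, 'm) cat \<Rightarrow> ('o, 'm) homotopy \<Rightarrow> 'm \<Rightarrow> ('o, 'm) homotopy" where
  "whisker_right A H l = (case H of (c, h) \<Rightarrow>
     (c\<lparr>cyl_d0 := Cmp A (cyl_d0 c) l, cyl_d1 := Cmp A (cyl_d1 c) l, cyl_x := Cmp A (cyl_x c) l\<rparr>, h))"

text \<open>Compositions of classes are defined through representatives. For \<open>\<alpha> : f \<Rightarrow> g : X \<rightarrow> Y\<close> and
  \<open>\<beta> : k \<Rightarrow> l : Y \<rightarrow> Z\<close> the horizontal composite is \<open>(\<beta> g) \<circ> (k \<alpha>) : k f \<Rightarrow> l g\<close>.\<close>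

definition Ho :: "('o, 'm) cat \<Rightarrow> 'm set \<Rightarrow> ('o, 'm, ('o, 'm) ho_cell) twocat" where
  "Ho A \<Sigma> = \<lparr>Ob = Ob A, Ar = Ar A, Src = Src A, Tgt = Tgt A, Idn = Idn A, Cmp = Cmp A,
     Cl = {ho_class A \<Sigma> f g Hs | f g Hs. homotopy_seq A \<Sigma> f g Hs},
     Dm = (\<lambda>\<alpha>. fst \<alpha>), Cd = (\<lambda>\<alpha>. fst (snd \<alpha>)),
     Id2 = (\<lambda>f. ho_class A \<Sigma> f f [id_homotopy A f]),
     VC = (\<lambda>\<beta> \<alpha>. ho_class A \<Sigma> (fst \<alpha>) (fst (snd \<beta>)) (ho_rep \<beta> @ ho_rep \<alpha>)),
     HC = (\<lambda>\<beta> \<alpha>. let f = fst \<alpha>; g = fst (snd \<alpha>); k = fst \<beta>; l = fst (snd \<beta>) in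
       ho_class A \<Sigma> (Cmp A k f) (Cmp A l g)
         (map (\<lambda>H. whisker_right A H g) (ho_rep \<beta>) @ map (whisker_left A k) (ho_rep \<alpha>)))\<rparr>"

definition ho_inclusion ::
  "('o, 'm) cat \<Rightarrow> 'm set \<Rightarrow> ('o, 'm, 'm, 'o, 'm, ('o, 'm) ho_cell) twofun" where
  "ho_inclusion A \<Sigma> = \<lparr>FO = (\<lambda>X\<in>Ob A. X), FA = (\<lambda>f\<in>Ar A. f), FC = (\<lambda>f\<in>Ar A. Id2 (Ho A \<Sigma>) f)\<rparr>"


section \<open>The replacement functor\<close>

text \<open>The corestriction of \<open>R Q\<close> to the fibrant-cofibrant objects, as a 2-functor between
  categories.\<close>

definition fc_replacement ::
  "('o, 'm) cat \<Rightarrow> 'o \<Rightarrow> 'o \<Rightarrow> 'm factorization \<Rightarrow> 'm factorization \<Rightarrow>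
   ('o, 'm, 'm, 'o, 'm, 'm) twofun" where
  "fc_replacement C z t \<Phi> \<Psi> = \<lparr>FO = (\<lambda>X\<in>Ob C. R_ob C t \<Psi> (Q_ob C z \<Phi> X)),
     FA = (\<lambda>f\<in>Ar C. R_ar C t \<Psi> (Q_ar C z \<Phi> f)),
     FC = (\<lambda>f\<in>Ar C. R_ar C t \<Psi> (Q_ar C z \<Phi> f))\<rparr>"

section \<open>Adequacy of the test type\<close>

context two_category
begin

lemma cell_Ar: "\<alpha> \<in> cell B f g \<Longrightarrow> f \<in> Ar B \<and> g \<in> Ar B \<and> Src B g = Src B f \<and> Tgt B g = Tgt B f"
  using Dm_Ar Cd_Ar Src_Cd Tgt_Cd by (auto simp: cell_def)

lemma slide:
  assumes c: "c \<in> cell B a b" and k: "\<eta> \<in> cell B (Idn B (Tgt B a)) k"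
  shows "VC B (HC B \<eta> (Id2 B b)) c = VC B (HC B (Id2 B k) c) (HC B \<eta> (Id2 B a))"
proof -
  note ca = cell_Ar[OF c]
  have id: "Idn B (Tgt B a) \<in> hom B (Tgt B a) (Tgt B a)"
    using ca Tgt_Ob Idn_hom by blast
  have e: "Id2 B (Idn B (Tgt B a)) \<in> cell B (Idn B (Tgt B a)) (Idn B (Tgt B a))"
    using id Id2_cell by (auto simp: hom_def)
  have ib: "Id2 B b \<in> cell B b b" and ia: "Id2 B a \<in> cell B a a" using ca Id2_cell by auto
  have kA: "k \<in> Ar B" using cell_Ar[OF k] by blast
  have ik: "Id2 B k \<in> cell B k k" using kA Id2_cell by blast
  have s: "Tgt B a = Src B (Idn B (Tgt B a))" using id by (simp add: hom_def)
  have "HC B \<eta> c = HC B (VC B \<eta> (Id2 B (Idn B (Tgt B a)))) (VC B (Id2 B b) c)"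
    using VC_Id2_right[OF k] VC_Id2_left[OF c] by simp
  also have "\<dots> = VC B (HC B \<eta> (Id2 B b)) (HC B (Id2 B (Idn B (Tgt B a))) c)"
    by (rule interchange[OF c ib e k s])
  also have "\<dots> = VC B (HC B \<eta> (Id2 B b)) c" using HC_Id2_left[OF c] by simp
  finally have 1: "HC B \<eta> c = VC B (HC B \<eta> (Id2 B b)) c" .
  have "HC B \<eta> c = HC B (VC B (Id2 B k) \<eta>) (VC B c (Id2 B a))"
    using VC_Id2_left[OF k] VC_Id2_right[OF c] by simp
  also have "\<dots> = VC B (HC B (Id2 B k) c) (HC B \<eta> (Id2 B a))"
    by (rule interchange[OF ia c k ik s])
  finally show ?thesis using 1 by simp
qed

lemma whisker_inverse:
  assumes \<eta>: "\<eta> \<in> cell B u v" and \<eta>': "\<eta>' \<in> cell B v u"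
    and inv: "VC B \<eta>' \<eta> = Id2 B u" and b: "b \<in> Ar B" "Tgt B b = Src B u"
  shows "VC B (HC B \<eta>' (Id2 B b)) (HC B \<eta> (Id2 B b)) = Id2 B (Cmp B u b)"
proof -
  have ib: "Id2 B b \<in> cell B b b" using b Id2_cell by auto
  have "VC B (HC B \<eta>' (Id2 B b)) (HC B \<eta> (Id2 B b)) = HC B (VC B \<eta>' \<eta>) (VC B (Id2 B b) (Id2 B b))"
    using interchange[OF ib ib \<eta> \<eta>' b(2)] by simp
  also have "\<dots> = HC B (Id2 B u) (Id2 B b)" using inv VC_Id2_left[OF ib] by simp
  also have "\<dots> = Id2 B (Cmp B u b)"
    using HC_Id2_Id2 b cell_Ar[OF \<eta>] by (auto simp: hom_def)
  finally show ?thesis .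
qed

lemma equivalenceE:
  assumes "equivalence B s"
  obtains g \<eta> \<eta>' \<epsilon> \<epsilon>' where "s \<in> Ar B" "g \<in> hom B (Tgt B s) (Src B s)"
    "\<eta> \<in> cell B (Idn B (Src B s)) (Cmp B g s)" "\<eta>' \<in> cell B (Cmp B g s) (Idn B (Src B s))"
    "VC B \<eta>' \<eta> = Id2 B (Idn B (Src B s))" "VC B \<eta> \<eta>' = Id2 B (Cmp B g s)"
    "\<epsilon> \<in> cell B (Cmp B s g) (Idn B (Tgt B s))" "\<epsilon>' \<in> cell B (Idn B (Tgt B s)) (Cmp B s g)"
    "VC B \<epsilon>' \<epsilon> = Id2 B (Cmp B s g)" "VC B \<epsilon> \<epsilon>' = Id2 B (Idn B (Tgt B s))"
proof -
  from assms obtain g \<eta> \<epsilon> where 1: "s \<in> Ar B" "g \<in> hom B (Tgt B s) (Src B s)"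
    "\<eta> \<in> cell B (Idn B (Src B s)) (Cmp B g s)" "\<epsilon> \<in> cell B (Cmp B s g) (Idn B (Tgt B s))"
    "invertible_cell B \<eta>" "invertible_cell B \<epsilon>"
    unfolding equivalence_def by blast
  from 1(5) 1(3) obtain \<eta>' where "\<eta>' \<in> cell B (Cmp B g s) (Idn B (Src B s))"
    "VC B \<eta>' \<eta> = Id2 B (Idn B (Src B s))" "VC B \<eta> \<eta>' = Id2 B (Cmp B g s)"
    unfolding invertible_cell_def by (auto simp: cell_def)
  moreover from 1(6) 1(4) obtain \<epsilon>' where "\<epsilon>' \<in> cell B (Idn B (Tgt B s)) (Cmp B s g)"
    "VC B \<epsilon>' \<epsilon> = Id2 B (Cmp B s g)" "VC B \<epsilon> \<epsilon>' = Id2 B (Idn B (Tgt B s))"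
    unfolding invertible_cell_def by (auto simp: cell_def)
  ultimately show ?thesis using that 1 by blast
qed

lemma equivalenceI:
  assumes "s \<in> Ar B" "g \<in> hom B (Tgt B s) (Src B s)"
    "\<eta> \<in> cell B (Idn B (Src B s)) (Cmp B g s)" "\<eta>' \<in> cell B (Cmp B g s) (Idn B (Src B s))"
    "VC B \<eta>' \<eta> = Id2 B (Idn B (Src B s))" "VC B \<eta> \<eta>' = Id2 B (Cmp B g s)"
    "\<epsilon> \<in> cell B (Cmp B s g) (Idn B (Tgt B s))" "\<epsilon>' \<in> cell B (Idn B (Tgt B s)) (Cmp B s g)"
    "VC B \<epsilon>' \<epsilon> = Id2 B (Cmp B s g)" "VC B \<epsilon> \<epsilon>' = Id2 B (Idn B (Tgt B s))"
  shows "equivalence B s"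
proof -
  have "invertible_cell B \<eta>" "invertible_cell B \<epsilon>"
    using assms unfolding invertible_cell_def by (auto simp: cell_def)
  then show ?thesis using assms unfolding equivalence_def by blast
qed

lemma equivalence_faithful:
  assumes s: "equivalence B s" and c: "c \<in> cell B a b" "c' \<in> cell B a b" and t: "Tgt B a = Src B s"
    and eq: "HC B (Id2 B s) c = HC B (Id2 B s) c'"
  shows "c = c'"
  using s
proof (rule equivalenceE)
  fix g \<eta> \<eta>' \<epsilon> \<epsilon>'
  assume *: "s \<in> Ar B" "g \<in> hom B (Tgt B s) (Src B s)"
    "\<eta> \<in> cell B (Idn B (Src B s)) (Cmp B g s)" "\<eta>' \<in> cell B (Cmp B g s) (Idn B (Src B s))"
    "VC B \<eta>' \<eta> = Id2 B (Idn B (Src B s))"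
  note ca = cell_Ar[OF c(1)]
  have sh: "s \<in> hom B (Src B s) (Tgt B s)" using * by (simp add: hom_def)
  have is': "Id2 B s \<in> cell B s s" and ig: "Id2 B g \<in> cell B g g"
    using * Id2_cell by (auto simp: hom_def)
  have gs: "HC B (Id2 B (Cmp B g s)) d = HC B (Id2 B g) (HC B (Id2 B s) d)"
    if d: "d \<in> cell B a b" for d
    using HC_assoc[OF d is' ig t] HC_Id2_Id2[OF sh *(2)] * by (auto simp: hom_def)
  have key: "VC B (HC B \<eta> (Id2 B b)) d = VC B (HC B (Id2 B (Cmp B g s)) d) (HC B \<eta> (Id2 B a))"
    if d: "d \<in> cell B a b" for d using slide[OF d] *(3) t by simp
  have eq2: "VC B (HC B \<eta> (Id2 B b)) c = VC B (HC B \<eta> (Id2 B b)) c'"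
    using key c gs eq by simp
  have sId: "Src B (Idn B (Src B s)) = Src B s"
    using Idn_hom Src_Ob *(1) by (simp add: hom_def)
  have tb: "b \<in> Ar B" "Tgt B b = Src B (Idn B (Src B s))" using ca t sId by auto
  have ib: "Id2 B b \<in> cell B b b" using tb Id2_cell by blast
  have Ib: "Cmp B (Idn B (Src B s)) b = b"
    using Cmp_Idn_left[of b "Src B b" "Src B s"] tb sId by (simp add: hom_def)
  have h1: "HC B \<eta> (Id2 B b) \<in> cell B b (Cmp B (Cmp B g s) b)"
    using HC_cell[OF ib *(3) tb(2)] Ib by simp
  have sgs: "Src B (Cmp B g s) = Src B s"
    using Cmp_hom[OF sh *(2)] by (simp add: hom_def)
  have h2: "HC B \<eta>' (Id2 B b) \<in> cell B (Cmp B (Cmp B g s) b) b"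
    using HC_cell[OF ib *(4)] Ib tb sId sgs by simp
  have w: "VC B (HC B \<eta>' (Id2 B b)) (HC B \<eta> (Id2 B b)) = Id2 B b"
    using whisker_inverse[OF *(3,4,5) tb] Ib by simp
  have "d = VC B (HC B \<eta>' (Id2 B b)) (VC B (HC B \<eta> (Id2 B b)) d)" if d: "d \<in> cell B a b" for d
    using VC_assoc[OF d h1 h2] w VC_Id2_left[OF d] by simp
  then show ?thesis using eq2 c by metis
qed

lemma equivalence_full:
  assumes s: "equivalence B s" and ab: "a \<in> hom B X (Src B s)" "b \<in> hom B X (Src B s)"
    and \<beta>: "\<beta> \<in> cell B (Cmp B s a) (Cmp B s b)"
  shows "\<exists>c\<in>cell B a b. HC B (Id2 B s) c = \<beta>"
  using s
proof (rule equivalenceE)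
  fix g \<eta> \<eta>' \<epsilon> \<epsilon>'
  assume *: "s \<in> Ar B" "g \<in> hom B (Tgt B s) (Src B s)"
    "\<eta> \<in> cell B (Idn B (Src B s)) (Cmp B g s)" "\<eta>' \<in> cell B (Cmp B g s) (Idn B (Src B s))"
    "VC B \<eta>' \<eta> = Id2 B (Idn B (Src B s))" "VC B \<eta> \<eta>' = Id2 B (Cmp B g s)"
    "\<epsilon> \<in> cell B (Cmp B s g) (Idn B (Tgt B s))" "\<epsilon>' \<in> cell B (Idn B (Tgt B s)) (Cmp B s g)"
    "VC B \<epsilon>' \<epsilon> = Id2 B (Cmp B s g)" "VC B \<epsilon> \<epsilon>' = Id2 B (Idn B (Tgt B s))"
  have ge: "equivalence B g"
    using * by (intro equivalenceI[of g s \<epsilon>' \<epsilon> \<eta>' \<eta>]) (auto simp: hom_def)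
  have sh: "s \<in> hom B (Src B s) (Tgt B s)" using * by (simp add: hom_def)
  have is': "Id2 B s \<in> cell B s s" and ig: "Id2 B g \<in> cell B g g"
    using * Id2_cell by (auto simp: hom_def)
  have ia: "Id2 B a \<in> cell B a a" and ib: "Id2 B b \<in> cell B b b"
    using ab Id2_cell by (auto simp: hom_def)
  have sI: "Src B (Idn B (Src B s)) = Src B s"
    using Idn_hom Src_Ob *(1) by (simp add: hom_def)
  have gsh: "Cmp B g s \<in> hom B (Src B s) (Src B s)" using Cmp_hom[OF sh *(2)] .
  have Ia: "Cmp B (Idn B (Src B s)) a = a" and Ib: "Cmp B (Idn B (Src B s)) b = b"
    using Cmp_Idn_left ab by auto
  let ?gs = "Cmp B g s"
  have ta: "Tgt B a = Src B s" "Tgt B b = Src B s" "a \<in> Ar B" "b \<in> Ar B"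
    using ab by (auto simp: hom_def)
  have e1: "HC B \<eta> (Id2 B a) \<in> cell B a (Cmp B ?gs a)"
    using HC_cell[OF ia *(3)] Ia ta sI by simp
  have e1': "HC B \<eta>' (Id2 B a) \<in> cell B (Cmp B ?gs a) a"
    using HC_cell[OF ia *(4)] Ia ta gsh by (simp add: hom_def)
  have e2: "HC B \<eta> (Id2 B b) \<in> cell B b (Cmp B ?gs b)"
    using HC_cell[OF ib *(3)] Ib ta sI by simp
  have e2': "HC B \<eta>' (Id2 B b) \<in> cell B (Cmp B ?gs b) b"
    using HC_cell[OF ib *(4)] Ib ta gsh by (simp add: hom_def)
  have tsa: "Tgt B (Cmp B s a) = Tgt B s" using Cmp_hom[OF ab(1) sh] by (simp add: hom_def)
  have g\<beta>: "HC B (Id2 B g) \<beta> \<in> cell B (Cmp B ?gs a) (Cmp B ?gs b)"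
    using HC_cell[OF \<beta> ig] tsa *(2) Cmp_assoc[OF ab(1) sh *(2)] Cmp_assoc[OF ab(2) sh *(2)]
    by (simp add: hom_def)
  define m where "m = VC B (HC B (Id2 B g) \<beta>) (HC B \<eta> (Id2 B a))"
  have m: "m \<in> cell B a (Cmp B ?gs b)" unfolding m_def by (rule VC_cell[OF e1 g\<beta>])
  define c where "c = VC B (HC B \<eta>' (Id2 B b)) m"
  have c: "c \<in> cell B a b" unfolding c_def by (rule VC_cell[OF m e2'])
  have w1: "VC B (HC B \<eta> (Id2 B b)) (HC B \<eta>' (Id2 B b)) = Id2 B (Cmp B ?gs b)"
    using whisker_inverse[OF *(4,3,6)] ta gsh by (simp add: hom_def)
  have w2: "VC B (HC B \<eta> (Id2 B a)) (HC B \<eta>' (Id2 B a)) = Id2 B (Cmp B ?gs a)"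
    using whisker_inverse[OF *(4,3,6)] ta gsh by (simp add: hom_def)
  have "VC B (HC B \<eta> (Id2 B b)) c = m"
    unfolding c_def using VC_assoc[OF m e2' e2] w1 VC_Id2_left[OF m] by simp
  moreover have "VC B (HC B \<eta> (Id2 B b)) c = VC B (HC B (Id2 B ?gs) c) (HC B \<eta> (Id2 B a))"
    using slide[OF c] *(3) ta by simp
  ultimately have eq: "VC B (HC B (Id2 B ?gs) c) (HC B \<eta> (Id2 B a)) =
      VC B (HC B (Id2 B g) \<beta>) (HC B \<eta> (Id2 B a))" by (simp add: m_def)
  have igs: "Id2 B ?gs \<in> cell B ?gs ?gs" using gsh Id2_cell by (auto simp: hom_def)
  have gc: "HC B (Id2 B ?gs) c \<in> cell B (Cmp B ?gs a) (Cmp B ?gs b)"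
    using HC_cell[OF c igs] ta gsh by (simp add: hom_def)
  have canc: "VC B (VC B d (HC B \<eta> (Id2 B a))) (HC B \<eta>' (Id2 B a)) = d"
    if d: "d \<in> cell B (Cmp B ?gs a) (Cmp B ?gs b)" for d
    using VC_assoc[OF e1' e1 d] w2 VC_Id2_right[OF d] by simp
  have "HC B (Id2 B ?gs) c = HC B (Id2 B g) \<beta>" using eq canc gc g\<beta> by metis
  moreover have "HC B (Id2 B ?gs) c = HC B (Id2 B g) (HC B (Id2 B s) c)"
    using HC_assoc[OF c is' ig] HC_Id2_Id2[OF sh *(2)] ta * by (auto simp: hom_def)
  ultimately have "HC B (Id2 B g) (HC B (Id2 B s) c) = HC B (Id2 B g) \<beta>" by simp
  moreover have sc: "HC B (Id2 B s) c \<in> cell B (Cmp B s a) (Cmp B s b)"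
    using HC_cell[OF c is'] ta by simp
  moreover have "Tgt B (Cmp B s a) = Src B g" using tsa *(2) by (simp add: hom_def)
  ultimately have "HC B (Id2 B s) c = \<beta>" using equivalence_faithful[OF ge sc \<beta>] by blast
  then show ?thesis using c by blast
qed

end

lemma two_functorD:
  assumes "two_functor B D F"
  shows "two_category B" "two_category D"
    "a \<in> Ob B \<Longrightarrow> FO F a \<in> Ob D"
    "f \<in> hom B a b \<Longrightarrow> FA F f \<in> hom D (FO F a) (FO F b)"
    "\<alpha> \<in> cell B f g \<Longrightarrow> FC F \<alpha> \<in> cell D (FA F f) (FA F g)"
    "a \<in> Ob B \<Longrightarrow> FA F (Idn B a) = Idn D (FO F a)"
    "f \<in> hom B a b \<Longrightarrow> g \<in> hom B b c \<Longrightarrow> FA F (Cmp B g f) = Cmp D (FA F g) (FA F f)"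
    "f \<in> Ar B \<Longrightarrow> FC F (Id2 B f) = Id2 D (FA F f)"
    "\<alpha> \<in> cell B f g \<Longrightarrow> \<beta> \<in> cell B g h \<Longrightarrow> FC F (VC B \<beta> \<alpha>) = VC D (FC F \<beta>) (FC F \<alpha>)"
    "\<alpha> \<in> cell B f g \<Longrightarrow> \<beta> \<in> cell B k l \<Longrightarrow> Tgt B f = Src B k \<Longrightarrow>
      FC F (HC B \<beta> \<alpha>) = HC D (FC F \<beta>) (FC F \<alpha>)"
  using assms unfolding two_functor_def by (auto simp: hom_def cell_def)

lemma two_functor_Ar: "two_functor B D F \<Longrightarrow> f \<in> Ar B \<Longrightarrow>
    FA F f \<in> hom D (FO F (Src B f)) (FO F (Tgt B f))"
  by (auto simp: two_functor_def)

lemma hat_cyl_unique: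
  assumes F: "two_functor (disc A) D F" and E: "sends_to_equivalences D \<Sigma> F"
    and c: "is_cylinder A \<Sigma> X c"
  shows "\<exists>!\<gamma>. \<gamma> \<in> cell D (FA F (cyl_d0 c)) (FA F (cyl_d1 c)) \<and>
     HC D (Id2 D (FA F (cyl_s c))) \<gamma> = Id2 D (FA F (cyl_x c))"
proof -
  interpret D: two_category D using two_functorD(2)[OF F] .
  have h: "f \<in> hom (disc A) a b \<longleftrightarrow> f \<in> hom A a b" for f a b by (simp add: hom_def disc_def)
  let ?W = "cyl_W c" and ?Z = "cyl_Z c"
  have c': "cyl_d0 c \<in> hom A X ?W" "cyl_d1 c \<in> hom A X ?W" "cyl_s c \<in> hom A ?W ?Z"
    "cyl_x c \<in> hom A X ?Z" "cyl_s c \<in> \<Sigma>"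
    and sd: "Cmp A (cyl_s c) (cyl_d0 c) = cyl_x c" "Cmp A (cyl_s c) (cyl_d1 c) = cyl_x c"
    using c by (auto simp: is_cylinder_def)
  note Fh = two_functorD(4)[OF F, unfolded h]
  have Fc: "FA F (Cmp A g f) = Cmp D (FA F g) (FA F f)" if "f \<in> hom A a b" "g \<in> hom A b d" for f g a b d
    using two_functorD(7)[OF F, unfolded h] that by (auto simp: disc_def)
  have s: "equivalence D (FA F (cyl_s c))" using E c' by (simp add: sends_to_equivalences_def)
  have src: "Src D (FA F (cyl_s c)) = FO F ?W" using Fh[OF c'(3)] by (simp add: hom_def)
  have x0: "Cmp D (FA F (cyl_s c)) (FA F (cyl_d0 c)) = FA F (cyl_x c)"
    "Cmp D (FA F (cyl_s c)) (FA F (cyl_d1 c)) = FA F (cyl_x c)"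
    using Fc c' sd by metis+
  have "Id2 D (FA F (cyl_x c)) \<in> cell D (FA F (cyl_x c)) (FA F (cyl_x c))"
    using D.Id2_cell Fh[OF c'(4)] by (auto simp: hom_def)
  then obtain \<gamma> where g: "\<gamma> \<in> cell D (FA F (cyl_d0 c)) (FA F (cyl_d1 c))"
    "HC D (Id2 D (FA F (cyl_s c))) \<gamma> = Id2 D (FA F (cyl_x c))"
    using D.equivalence_full[OF s, of "FA F (cyl_d0 c)" "FO F X" "FA F (cyl_d1 c)"]
      Fh[OF c'(1)] Fh[OF c'(2)] src x0 by metis
  show ?thesis
  proof (rule ex1I[of _ \<gamma>])
    fix \<gamma>' assume "\<gamma>' \<in> cell D (FA F (cyl_d0 c)) (FA F (cyl_d1 c)) \<and>
     HC D (Id2 D (FA F (cyl_s c))) \<gamma>' = Id2 D (FA F (cyl_x c))"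
    moreover have "Tgt D (FA F (cyl_d0 c)) = Src D (FA F (cyl_s c))"
      using Fh[OF c'(1)] src by (simp add: hom_def)
    ultimately show "\<gamma>' = \<gamma>" using g D.equivalence_faithful[OF s] by metis
  qed (use g in blast)
qed

lemma hat_cyl_props:
  assumes "two_functor (disc A) D F" "sends_to_equivalences D \<Sigma> F" "is_cylinder A \<Sigma> X c"
  shows "hat_cyl D F c \<in> cell D (FA F (cyl_d0 c)) (FA F (cyl_d1 c))"
    and "HC D (Id2 D (FA F (cyl_s c))) (hat_cyl D F c) = Id2 D (FA F (cyl_x c))"
  using theI'[OF hat_cyl_unique[OF assms]] unfolding hat_cyl_def by blast+

lemma hat_cell:
  assumes F: "two_functor (disc A) D F" and E: "sends_to_equivalences D \<Sigma> F"
    and H: "is_homotopy A \<Sigma> f g H"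
  shows "hat D F H \<in> cell D (FA F f) (FA F g)"
proof -
  interpret D: two_category D using two_functorD(2)[OF F] .
  obtain c h where Hc: "H = (c, h)" by force
  obtain X Y where 1: "is_cylinder A \<Sigma> X c" "h \<in> hom A (cyl_W c) Y" "Cmp A h (cyl_d0 c) = f"
    "Cmp A h (cyl_d1 c) = g" using H Hc by (auto simp: is_homotopy_def)
  have d: "cyl_d0 c \<in> hom A X (cyl_W c)" "cyl_d1 c \<in> hom A X (cyl_W c)"
    using 1(1) by (auto simp: is_cylinder_def)
  have hh: "f \<in> hom (disc A) a b \<longleftrightarrow> f \<in> hom A a b" for f a b by (simp add: hom_def disc_def)
  note Fh = two_functorD(4)[OF F, unfolded hh]
  have Fc: "FA F (Cmp A g f) = Cmp D (FA F g) (FA F f)" if "f \<in> hom A a b" "g \<in> hom A b d" for f g a b d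
    using two_functorD(7)[OF F, unfolded hh] that by (auto simp: disc_def)
  have "Id2 D (FA F h) \<in> cell D (FA F h) (FA F h)" using D.Id2_cell Fh[OF 1(2)] by (simp add: hom_def)
  from D.HC_cell[OF hat_cyl_props(1)[OF F E 1(1)] this] show ?thesis
    using Fh[OF 1(2)] Fh[OF d(1)] Fc[OF d(1) 1(2)] Fc[OF d(2) 1(2)] 1
    by (simp add: hat_def Hc hom_def)
qed

lemma hat_seq_Cons: "Hs \<noteq> [] \<Longrightarrow> hat_seq D F (H # Hs) = VC D (hat D F H) (hat_seq D F Hs)"
  by (cases Hs) auto

lemma homotopy_seq_nonempty: "homotopy_seq A \<Sigma> f g Hs \<Longrightarrow> Hs \<noteq> []"
  by (induction rule: homotopy_seq.induct) auto

lemma hat_seq_cell: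
  assumes F: "two_functor (disc A) D F" and E: "sends_to_equivalences D \<Sigma> F"
  shows "homotopy_seq A \<Sigma> f g Hs \<Longrightarrow> hat_seq D F Hs \<in> cell D (FA F f) (FA F g)"
proof (induction rule: homotopy_seq.induct)
  case (single f g H)
  then show ?case using hat_cell[OF F E] by simp
next
  case (step f e Hs g H)
  then show ?case
    using hat_cell[OF F E] two_category.VC_cell[OF two_functorD(2)[OF F]]
      hat_seq_Cons[OF homotopy_seq_nonempty] by metis
qed

lemma two_functor_comp:
  assumes F: "two_functor B D F" and G: "two_functor D E G"
  shows "two_functor B E (comp_twofun B G F)"
proof -
  interpret B: two_category B using two_functorD(1)[OF F] .
  note B.Src_Ob[simp] B.Tgt_Ob[simp] B.Dm_Ar[simp] B.Cd_Ar[simp]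
  have id: "Idn B a \<in> Ar B" if "a \<in> Ob B" for a using B.Idn_hom that by (auto simp: hom_def)
  have cm: "Cmp B g f \<in> Ar B" if "f \<in> Ar B" "g \<in> Ar B" "Tgt B f = Src B g" for f g
    using B.Cmp_hom[of f "Src B f" "Tgt B f" g "Tgt B g"] that by (auto simp: hom_def)
  have i2: "Id2 B f \<in> Cl B" if "f \<in> Ar B" for f using B.Id2_cell that by (auto simp: cell_def)
  have vc: "VC B \<beta> \<alpha> \<in> Cl B" if "\<alpha> \<in> Cl B" "\<beta> \<in> Cl B" "Cd B \<alpha> = Dm B \<beta>" for \<alpha> \<beta>
    using B.VC_cell[of \<alpha> "Dm B \<alpha>" "Cd B \<alpha>" \<beta> "Cd B \<beta>"] that by (auto simp: cell_def)
  have hc: "HC B \<beta> \<alpha> \<in> Cl B" if "\<alpha> \<in> Cl B" "\<beta> \<in> Cl B" "Tgt B (Dm B \<alpha>) = Src B (Dm B \<beta>)" for \<alpha> \<beta>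
    using B.HC_cell[of \<alpha> "Dm B \<alpha>" "Cd B \<alpha>" \<beta> "Dm B \<beta>" "Cd B \<beta>"] that by (auto simp: cell_def)
  show ?thesis
    using F G two_functorD(2)[OF G] B.two_category_axioms unfolding two_functor_def comp_twofun_def
    apply (simp add: id cm i2 vc hc)
    by (auto simp: hom_def cell_def)
qed

lemma equivalence_image:
  assumes J: "two_functor D E J" and s: "equivalence D s"
  shows "equivalence E (FA J s)"
proof -
  interpret D: two_category D using two_functorD(1)[OF J] .
  interpret E: two_category E using two_functorD(2)[OF J] .
  show ?thesis using s
  proof (rule D.equivalenceE)
    fix g \<eta> \<eta>' \<epsilon> \<epsilon>'
    assume *: "s \<in> Ar D" "g \<in> hom D (Tgt D s) (Src D s)"
      "\<eta> \<in> cell D (Idn D (Src D s)) (Cmp D g s)" "\<eta>' \<in> cell D (Cmp D g s) (Idn D (Src D s))"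
      "VC D \<eta>' \<eta> = Id2 D (Idn D (Src D s))" "VC D \<eta> \<eta>' = Id2 D (Cmp D g s)"
      "\<epsilon> \<in> cell D (Cmp D s g) (Idn D (Tgt D s))" "\<epsilon>' \<in> cell D (Idn D (Tgt D s)) (Cmp D s g)"
      "VC D \<epsilon>' \<epsilon> = Id2 D (Cmp D s g)" "VC D \<epsilon> \<epsilon>' = Id2 D (Idn D (Tgt D s))"
    have sh: "s \<in> hom D (Src D s) (Tgt D s)" using * by (simp add: hom_def)
    have ob: "Src D s \<in> Ob D" "Tgt D s \<in> Ob D" using * D.Src_Ob D.Tgt_Ob by auto
    have st: "Src E (FA J s) = FO J (Src D s)" "Tgt E (FA J s) = FO J (Tgt D s)"
      "FA J s \<in> Ar E"
      using two_functorD(4)[OF J sh] by (auto simp: hom_def)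
    have sg: "Cmp D s g \<in> Ar D" and gs: "Cmp D g s \<in> Ar D"
      using D.Cmp_hom[OF sh *(2)] D.Cmp_hom[OF *(2) sh] by (auto simp: hom_def)
    have idA: "Idn D (Src D s) \<in> Ar D" "Idn D (Tgt D s) \<in> Ar D"
      using ob D.Idn_hom by (auto simp: hom_def)
    note JI = two_functorD(6)[OF J ob(1)] two_functorD(6)[OF J ob(2)]
    note JC = two_functorD(7)[OF J sh *(2)] two_functorD(7)[OF J *(2) sh]
    note J2 = two_functorD(8)[OF J]
    note JV = two_functorD(9)[OF J]
    show ?thesis
      using E.equivalenceI[of "FA J s" "FA J g" "FC J \<eta>" "FC J \<eta>'" "FC J \<epsilon>" "FC J \<epsilon>'"]
        st two_functorD(4)[OF J *(2)]
        two_functorD(5)[OF J *(3)] two_functorD(5)[OF J *(4)]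
        two_functorD(5)[OF J *(7)] two_functorD(5)[OF J *(8)]
        JV[OF *(3,4)] JV[OF *(4,3)] JV[OF *(7,8)] JV[OF *(8,7)] *(5,6,9,10)
        J2[OF sg] J2[OF gs] J2[OF idA(1)] J2[OF idA(2)] JI JC
      by simp
  qed
qed

lemma sends_to_equivalences_comp:
  assumes "two_functor D E J" "sends_to_equivalences D \<Sigma> F" "\<Sigma> \<subseteq> Ar B"
  shows "sends_to_equivalences E \<Sigma> (comp_twofun B J F)"
  using assms equivalence_image[OF assms(1)]
  by (auto simp: sends_to_equivalences_def comp_twofun_def)

lemma hat_comp:
  assumes F: "two_functor (disc A) D F" and E: "sends_to_equivalences D \<Sigma> F"
    and S: "\<Sigma> \<subseteq> Ar A" and J: "two_functor D E J" and H: "is_homotopy A \<Sigma> f g H"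
  shows "hat E (comp_twofun (disc A) J F) H = FC J (hat D F H)"
proof -
  interpret D: two_category D using two_functorD(2)[OF F] .
  let ?G = "comp_twofun (disc A) J F"
  have G: "two_functor (disc A) E ?G" using two_functor_comp[OF F J] .
  have GE: "sends_to_equivalences E \<Sigma> ?G"
    using sends_to_equivalences_comp[OF J E] S by (simp add: disc_def)
  obtain c h where Hc: "H = (c, h)" by force
  obtain X Y where 1: "is_cylinder A \<Sigma> X c" "h \<in> hom A (cyl_W c) Y"
    using H Hc by (auto simp: is_homotopy_def)
  have d: "cyl_d0 c \<in> hom A X (cyl_W c)" "cyl_d1 c \<in> hom A X (cyl_W c)"
    "cyl_s c \<in> hom A (cyl_W c) (cyl_Z c)" "cyl_x c \<in> hom A X (cyl_Z c)"
    using 1(1) by (auto simp: is_cylinder_def)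
  have hh: "f \<in> hom (disc A) a b \<longleftrightarrow> f \<in> hom A a b" for f a b by (simp add: hom_def disc_def)
  note Fh = two_functorD(4)[OF F, unfolded hh]
  have GA: "FA ?G f = FA J (FA F f)" if "f \<in> hom A a b" for f a b
    using that by (auto simp: comp_twofun_def disc_def hom_def)
  have FAr: "FA F f \<in> Ar D" if "f \<in> hom A a b" for f a b using Fh[OF that] by (simp add: hom_def)
  have I2: "FC J (Id2 D (FA F f)) = Id2 E (FA ?G f)" if "f \<in> hom A a b" for f a b
    using two_functorD(8)[OF J FAr[OF that]] GA[OF that] by simp
  have I2c: "Id2 D (FA F f) \<in> cell D (FA F f) (FA F f)" if "f \<in> hom A a b" for f a b
    using D.Id2_cell[OF FAr[OF that]] .
  note hc = hat_cyl_props[OF F E 1(1)]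
  have t: "Tgt D (FA F (cyl_d0 c)) = FO F (cyl_W c)" using Fh[OF d(1)] by (simp add: hom_def)
  have t2: "Src D (FA F (cyl_s c)) = FO F (cyl_W c)" "Src D (FA F h) = FO F (cyl_W c)"
    using Fh[OF d(3)] Fh[OF 1(2)] by (auto simp: hom_def)
  have "FC J (hat_cyl D F c) \<in> cell E (FA ?G (cyl_d0 c)) (FA ?G (cyl_d1 c))"
    using two_functorD(5)[OF J hc(1)] GA d by metis
  moreover have "HC E (Id2 E (FA ?G (cyl_s c))) (FC J (hat_cyl D F c)) = Id2 E (FA ?G (cyl_x c))"
    using two_functorD(10)[OF J hc(1) I2c[OF d(3)]] t t2 hc(2) I2[OF d(3)] I2[OF d(4)] by simp
  ultimately have "hat_cyl E ?G c = FC J (hat_cyl D F c)"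
    using hat_cyl_unique[OF G GE 1(1)] hat_cyl_props[OF G GE 1(1)] by blast
  then show ?thesis
    using two_functorD(10)[OF J hc(1) I2c[OF 1(2)]] t t2 I2[OF 1(2)]
    by (simp add: hat_def Hc)
qed

lemma hat_seq_comp:
  assumes F: "two_functor (disc A) D F" and E: "sends_to_equivalences D \<Sigma> F"
    and S: "\<Sigma> \<subseteq> Ar A" and J: "two_functor D E J"
  shows "homotopy_seq A \<Sigma> f g Hs \<Longrightarrow>
    hat_seq E (comp_twofun (disc A) J F) Hs = FC J (hat_seq D F Hs)"
proof (induction rule: homotopy_seq.induct)
  case (single f g H)
  then show ?case using hat_comp[OF assms] by simp
next
  case (step f e Hs g H)
  have "hat_seq E (comp_twofun (disc A) J F) (H # Hs) =
      VC E (FC J (hat D F H)) (FC J (hat_seq D F Hs))"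
    using step hat_comp[OF assms step(2)] hat_seq_Cons[OF homotopy_seq_nonempty[OF step(1)]] by metis
  also have "\<dots> = FC J (VC D (hat D F H) (hat_seq D F Hs))"
    using two_functorD(9)[OF J hat_seq_cell[OF F E step(1)] hat_cell[OF F E step(2)]] by simp
  also have "\<dots> = FC J (hat_seq D F (H # Hs))"
    using hat_seq_Cons[OF homotopy_seq_nonempty[OF step(1)]] by metis
  finally show ?case .
qed

lemma two_category_sub:
  assumes D: "two_category D" and N: "N \<subseteq> Ob D" and M: "M \<subseteq> Ar D" and K: "K \<subseteq> Cl D"
    and st: "\<And>f. f \<in> M \<Longrightarrow> Src D f \<in> N \<and> Tgt D f \<in> N"
    and i: "\<And>a. a \<in> N \<Longrightarrow> Idn D a \<in> M"
    and cm: "\<And>f g. f \<in> M \<Longrightarrow> g \<in> M \<Longrightarrow> Tgt D f = Src D g \<Longrightarrow> Cmp D g f \<in> M"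
    and dc: "\<And>\<alpha>. \<alpha> \<in> K \<Longrightarrow> Dm D \<alpha> \<in> M \<and> Cd D \<alpha> \<in> M"
    and i2: "\<And>f. f \<in> M \<Longrightarrow> Id2 D f \<in> K"
    and vc: "\<And>\<alpha> \<beta>. \<alpha> \<in> K \<Longrightarrow> \<beta> \<in> K \<Longrightarrow> Cd D \<alpha> = Dm D \<beta> \<Longrightarrow> VC D \<beta> \<alpha> \<in> K"
    and hc: "\<And>\<alpha> \<beta>. \<alpha> \<in> K \<Longrightarrow> \<beta> \<in> K \<Longrightarrow> Tgt D (Dm D \<alpha>) = Src D (Dm D \<beta>) \<Longrightarrow> HC D \<beta> \<alpha> \<in> K"
  shows "two_category (D\<lparr>Ob := N, Ar := M, Cl := K\<rparr>)" (is "two_category ?E")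
proof -
  interpret D: two_category D by (rule D)
  have h: "f \<in> hom ?E a b \<longleftrightarrow> f \<in> hom D a b \<and> f \<in> M" for f a b
    using M by (auto simp: hom_def)
  have c: "\<alpha> \<in> cell ?E f g \<longleftrightarrow> \<alpha> \<in> cell D f g \<and> \<alpha> \<in> K" for \<alpha> f g
    using K by (auto simp: cell_def)
  show ?thesis
  proof (unfold_locales, unfold h c)
    fix f assume "f \<in> Ar ?E" then show "Src ?E f \<in> Ob ?E" "Tgt ?E f \<in> Ob ?E" using st by auto
  next
    fix a assume "a \<in> Ob ?E"
    then show "Idn ?E a \<in> hom D a a \<and> Idn ?E a \<in> M" using i N D.Idn_hom by auto
  next
    fix f g a b d assume "f \<in> hom D a b \<and> f \<in> M" "g \<in> hom D b d \<and> g \<in> M"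
    then show "Cmp ?E g f \<in> hom D a d \<and> Cmp ?E g f \<in> M"
      using D.Cmp_hom cm by (auto simp: hom_def)
  qed (use D.Cmp_Idn_right D.Cmp_Idn_left D.Cmp_assoc dc D.Src_Cd D.Tgt_Cd K i2 D.Id2_cell M
        D.VC_cell vc D.VC_Id2_right D.VC_Id2_left D.VC_assoc D.HC_cell hc D.HC_Id2_right
        D.HC_Id2_left D.HC_assoc D.HC_Id2_Id2 D.interchange in \<open>auto simp: cell_def\<close>)
qed

definition copy_twocat ::
  "('o \<Rightarrow> 'p) \<Rightarrow> ('m \<Rightarrow> 'n) \<Rightarrow> ('c \<Rightarrow> 'd) \<Rightarrow> ('o, 'm, 'c) twocat \<Rightarrow> ('p, 'n, 'd) twocat" where
  "copy_twocat i j k D = (let pi = inv_into (Ob D) i; pj = inv_into (Ar D) j; pk = inv_into (Cl D) k in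
     \<lparr>Ob = i ` Ob D, Ar = j ` Ar D, Src = (\<lambda>f. i (Src D (pj f))), Tgt = (\<lambda>f. i (Tgt D (pj f))),
      Idn = (\<lambda>a. j (Idn D (pi a))), Cmp = (\<lambda>g f. j (Cmp D (pj g) (pj f))),
      Cl = k ` Cl D, Dm = (\<lambda>\<alpha>. j (Dm D (pk \<alpha>))), Cd = (\<lambda>\<alpha>. j (Cd D (pk \<alpha>))),
      Id2 = (\<lambda>f. k (Id2 D (pj f))), VC = (\<lambda>\<beta> \<alpha>. k (VC D (pk \<beta>) (pk \<alpha>))),
      HC = (\<lambda>\<beta> \<alpha>. k (HC D (pk \<beta>) (pk \<alpha>)))\<rparr>)"

lemma copy_twocat:
  assumes D: "two_category D"
    and inj: "inj_on i (Ob D)" "inj_on j (Ar D)" "inj_on k (Cl D)"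
  shows "two_functor D (copy_twocat i j k D)
    \<lparr>FO = restrict i (Ob D), FA = restrict j (Ar D), FC = restrict k (Cl D)\<rparr>"
proof -
  let ?E = "copy_twocat i j k D"
  interpret D: two_category D by (rule D)
  note pinv = inv_into_f_f[OF inj(1)] inv_into_f_f[OF inj(2)] inv_into_f_f[OF inj(3)]
  have id: "Idn D a \<in> Ar D" if "a \<in> Ob D" for a using D.Idn_hom that by (auto simp: hom_def)
  have cm: "Cmp D g f \<in> Ar D" "Src D (Cmp D g f) = Src D f" "Tgt D (Cmp D g f) = Tgt D g"
    if "f \<in> Ar D" "g \<in> Ar D" "Tgt D f = Src D g" for f g
    using D.Cmp_hom[of f "Src D f" "Tgt D f" g "Tgt D g"] that by (auto simp: hom_def)
  have i2: "Id2 D f \<in> Cl D" "Dm D (Id2 D f) = f" "Cd D (Id2 D f) = f" if "f \<in> Ar D" for f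
    using D.Id2_cell that by (auto simp: cell_def)
  have vc: "VC D \<beta> \<alpha> \<in> Cl D" "Dm D (VC D \<beta> \<alpha>) = Dm D \<alpha>" "Cd D (VC D \<beta> \<alpha>) = Cd D \<beta>"
    if "\<alpha> \<in> Cl D" "\<beta> \<in> Cl D" "Cd D \<alpha> = Dm D \<beta>" for \<alpha> \<beta>
    using D.VC_cell[of \<alpha> "Dm D \<alpha>" "Cd D \<alpha>" \<beta> "Cd D \<beta>"] that by (auto simp: cell_def)
  have hc: "HC D \<beta> \<alpha> \<in> Cl D" "Dm D (HC D \<beta> \<alpha>) = Cmp D (Dm D \<beta>) (Dm D \<alpha>)"
      "Cd D (HC D \<beta> \<alpha>) = Cmp D (Cd D \<beta>) (Cd D \<alpha>)"
    if "\<alpha> \<in> Cl D" "\<beta> \<in> Cl D" "Tgt D (Dm D \<alpha>) = Src D (Dm D \<beta>)" for \<alpha> \<beta>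
    using D.HC_cell[of \<alpha> "Dm D \<alpha>" "Cd D \<alpha>" \<beta> "Dm D \<beta>" "Cd D \<beta>"] that by (auto simp: cell_def)
  have sI: "Src D (Idn D a) = a" "Tgt D (Idn D a) = a" if "a \<in> Ob D" for a
    using D.Idn_hom that by (auto simp: hom_def)
  have sel: "Ob ?E = i ` Ob D" "Ar ?E = j ` Ar D" "Cl ?E = k ` Cl D"
    by (auto simp: copy_twocat_def Let_def)
  have ops: "f \<in> Ar D \<Longrightarrow> Src ?E (j f) = i (Src D f)" "f \<in> Ar D \<Longrightarrow> Tgt ?E (j f) = i (Tgt D f)"
    "a \<in> Ob D \<Longrightarrow> Idn ?E (i a) = j (Idn D a)"
    "f \<in> Ar D \<Longrightarrow> g \<in> Ar D \<Longrightarrow> Cmp ?E (j g) (j f) = j (Cmp D g f)"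
    "\<alpha> \<in> Cl D \<Longrightarrow> Dm ?E (k \<alpha>) = j (Dm D \<alpha>)" "\<alpha> \<in> Cl D \<Longrightarrow> Cd ?E (k \<alpha>) = j (Cd D \<alpha>)"
    "f \<in> Ar D \<Longrightarrow> Id2 ?E (j f) = k (Id2 D f)"
    "\<alpha> \<in> Cl D \<Longrightarrow> \<beta> \<in> Cl D \<Longrightarrow> VC ?E (k \<beta>) (k \<alpha>) = k (VC D \<beta> \<alpha>)"
    "\<alpha> \<in> Cl D \<Longrightarrow> \<beta> \<in> Cl D \<Longrightarrow> HC ?E (k \<beta>) (k \<alpha>) = k (HC D \<beta> \<alpha>)" for a f g \<alpha> \<beta>
    by (simp_all add: copy_twocat_def Let_def pinv)
  have ii: "i a = i b \<longleftrightarrow> a = b" if "a \<in> Ob D" "b \<in> Ob D" for a b using inj(1) that by (auto dest: inj_onD)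
  have jj: "j a = j b \<longleftrightarrow> a = b" if "a \<in> Ar D" "b \<in> Ar D" for a b using inj(2) that by (auto dest: inj_onD)
  have hE: "f \<in> hom ?E a b \<longleftrightarrow> (\<exists>f'. f' \<in> Ar D \<and> f = j f' \<and> a = i (Src D f') \<and> b = i (Tgt D f'))"
    for f a b using ops by (auto simp: hom_def sel)
  have cE: "\<alpha> \<in> cell ?E f g \<longleftrightarrow> (\<exists>\<alpha>'. \<alpha>' \<in> Cl D \<and> \<alpha> = k \<alpha>' \<and> f = j (Dm D \<alpha>') \<and> g = j (Cd D \<alpha>'))"
    for \<alpha> f g using ops by (auto simp: cell_def sel)
  have laws: "f \<in> Ar D \<Longrightarrow> Cmp D f (Idn D (Src D f)) = f" "f \<in> Ar D \<Longrightarrow> Cmp D (Idn D (Tgt D f)) f = f"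
    "f \<in> Ar D \<Longrightarrow> g \<in> Ar D \<Longrightarrow> h \<in> Ar D \<Longrightarrow> Tgt D f = Src D g \<Longrightarrow> Tgt D g = Src D h \<Longrightarrow>
      Cmp D h (Cmp D g f) = Cmp D (Cmp D h g) f"
    "\<alpha> \<in> Cl D \<Longrightarrow> VC D \<alpha> (Id2 D (Dm D \<alpha>)) = \<alpha>" "\<alpha> \<in> Cl D \<Longrightarrow> VC D (Id2 D (Cd D \<alpha>)) \<alpha> = \<alpha>"
    "\<alpha> \<in> Cl D \<Longrightarrow> \<beta> \<in> Cl D \<Longrightarrow> \<gamma> \<in> Cl D \<Longrightarrow> Cd D \<alpha> = Dm D \<beta> \<Longrightarrow> Cd D \<beta> = Dm D \<gamma> \<Longrightarrow>
      VC D \<gamma> (VC D \<beta> \<alpha>) = VC D (VC D \<gamma> \<beta>) \<alpha>"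
    "\<alpha> \<in> Cl D \<Longrightarrow> HC D \<alpha> (Id2 D (Idn D (Src D (Dm D \<alpha>)))) = \<alpha>"
    "\<alpha> \<in> Cl D \<Longrightarrow> HC D (Id2 D (Idn D (Tgt D (Dm D \<alpha>)))) \<alpha> = \<alpha>"
    "\<alpha> \<in> Cl D \<Longrightarrow> \<beta> \<in> Cl D \<Longrightarrow> \<gamma> \<in> Cl D \<Longrightarrow> Tgt D (Dm D \<alpha>) = Src D (Dm D \<beta>) \<Longrightarrow>
      Tgt D (Dm D \<beta>) = Src D (Dm D \<gamma>) \<Longrightarrow> HC D \<gamma> (HC D \<beta> \<alpha>) = HC D (HC D \<gamma> \<beta>) \<alpha>"
    "f \<in> Ar D \<Longrightarrow> g \<in> Ar D \<Longrightarrow> Tgt D f = Src D g \<Longrightarrow> HC D (Id2 D g) (Id2 D f) = Id2 D (Cmp D g f)"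
    "\<alpha> \<in> Cl D \<Longrightarrow> \<alpha>' \<in> Cl D \<Longrightarrow> \<beta> \<in> Cl D \<Longrightarrow> \<beta>' \<in> Cl D \<Longrightarrow> Cd D \<alpha> = Dm D \<alpha>' \<Longrightarrow> Cd D \<beta> = Dm D \<beta>' \<Longrightarrow>
      Tgt D (Dm D \<alpha>) = Src D (Dm D \<beta>) \<Longrightarrow>
      HC D (VC D \<beta>' \<beta>) (VC D \<alpha>' \<alpha>) = VC D (HC D \<beta>' \<alpha>') (HC D \<beta> \<alpha>)" for f g h \<alpha> \<beta> \<gamma> \<alpha>' \<beta>'
              apply (rule D.Cmp_Idn_right[of f _ "Tgt D f"], simp add: hom_def)
             apply (rule D.Cmp_Idn_left[of f "Src D f"], simp add: hom_def)
            apply (rule D.Cmp_assoc[of f "Src D f" "Src D g" g "Src D h" h "Tgt D h"]; simp add: hom_def)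
           apply (rule D.VC_Id2_right[of \<alpha> _ "Cd D \<alpha>"], simp add: cell_def)
          apply (rule D.VC_Id2_left[of \<alpha> "Dm D \<alpha>"], simp add: cell_def)
         apply (rule D.VC_assoc[of \<alpha> "Dm D \<alpha>" "Dm D \<beta>" \<beta> "Dm D \<gamma>" \<gamma> "Cd D \<gamma>"]; simp add: cell_def)
        apply (rule D.HC_Id2_right[of \<alpha> "Dm D \<alpha>" "Cd D \<alpha>"], simp add: cell_def)
       apply (rule D.HC_Id2_left[of \<alpha> "Dm D \<alpha>" "Cd D \<alpha>"], simp add: cell_def)
      apply (rule D.HC_assoc[of \<alpha> "Dm D \<alpha>" "Cd D \<alpha>" \<beta> "Dm D \<beta>" "Cd D \<beta>" \<gamma> "Dm D \<gamma>" "Cd D \<gamma>"];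
        simp add: cell_def)
     apply (rule D.HC_Id2_Id2[of f "Src D f" "Src D g" g "Tgt D g"]; simp add: hom_def)
    apply (rule D.interchange[of \<alpha> "Dm D \<alpha>" "Cd D \<alpha>" \<alpha>' "Cd D \<alpha>'" \<beta> "Dm D \<beta>" "Cd D \<beta>" \<beta>' "Cd D \<beta>'"];
      simp add: cell_def)
    done
  have E: "two_category ?E"
  proof (unfold_locales, goal_cases)
    case (1 f) then show ?case using ops(1) D.Src_Ob by (auto simp: sel)
  next
    case (2 f) then show ?case using ops(2) D.Tgt_Ob by (auto simp: sel)
  next
    case (3 a)
    then obtain a' where *: "a' \<in> Ob D" "a = i a'" by (auto simp: sel)
    show ?case unfolding hE by (rule exI[of _ "Idn D a'"]) (use * ops(3) id sI in auto)
  next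
    case (4 f a b g c)
    then obtain f' g' where *: "f' \<in> Ar D" "g' \<in> Ar D" "f = j f'" "g = j g'" "a = i (Src D f')"
      "c = i (Tgt D g')" "i (Tgt D f') = i (Src D g')" unfolding hE by auto
    have c': "Tgt D f' = Src D g'" using * ii D.Src_Ob D.Tgt_Ob by blast
    show ?case unfolding hE
      by (rule exI[of _ "Cmp D g' f'"]) (use * c' ops(4) cm in auto)
  next
    case (5 f a b)
    then obtain f' where *: "f' \<in> Ar D" "f = j f'" "a = i (Src D f')" unfolding hE by auto
    then show ?case using ops(3,4) id D.Src_Ob laws(1) by simp
  next
    case (6 f a b)
    then obtain f' where *: "f' \<in> Ar D" "f = j f'" "b = i (Tgt D f')" unfolding hE by auto
    then show ?case using ops(3,4) id D.Tgt_Ob laws(2) by simp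
  next
    case (7 f a b g c h d)
    then obtain f' g' h' where *: "f' \<in> Ar D" "g' \<in> Ar D" "h' \<in> Ar D" "f = j f'" "g = j g'" "h = j h'"
      "i (Tgt D f') = i (Src D g')" "i (Tgt D g') = i (Src D h')" unfolding hE by auto
    have c': "Tgt D f' = Src D g'" "Tgt D g' = Src D h'" using * ii D.Src_Ob D.Tgt_Ob by blast+
    show ?case using * c' ops(4) cm laws(3)[of f' g' h'] by simp
  next
    case (8 \<alpha>) then show ?case using ops(5) D.Dm_Ar by (auto simp: sel)
  next
    case (9 \<alpha>) then show ?case using ops(6) D.Cd_Ar by (auto simp: sel)
  next
    case (10 \<alpha>) then show ?case using ops(1,5,6) D.Dm_Ar D.Cd_Ar D.Src_Cd by (auto simp: sel)
  next
    case (11 \<alpha>) then show ?case using ops(2,5,6) D.Dm_Ar D.Cd_Ar D.Tgt_Cd by (auto simp: sel)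
  next
    case (12 f)
    then obtain f' where *: "f' \<in> Ar D" "f = j f'" by (auto simp: sel)
    show ?case unfolding cE by (rule exI[of _ "Id2 D f'"]) (use * ops(7) i2 in auto)
  next
    case (13 \<alpha> f g \<beta> h)
    then obtain \<alpha>' \<beta>' where *: "\<alpha>' \<in> Cl D" "\<beta>' \<in> Cl D" "\<alpha> = k \<alpha>'" "\<beta> = k \<beta>'" "f = j (Dm D \<alpha>')"
      "h = j (Cd D \<beta>')" "j (Cd D \<alpha>') = j (Dm D \<beta>')" unfolding cE by auto
    have c': "Cd D \<alpha>' = Dm D \<beta>'" using * jj D.Cd_Ar D.Dm_Ar by blast
    show ?case unfolding cE by (rule exI[of _ "VC D \<beta>' \<alpha>'"]) (use * c' ops(8) vc in auto)
  next
    case (14 \<alpha> f g)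
    then obtain \<alpha>' where *: "\<alpha>' \<in> Cl D" "\<alpha> = k \<alpha>'" "f = j (Dm D \<alpha>')" unfolding cE by auto
    then show ?case using ops(7,8) i2(1) D.Dm_Ar laws(4) by simp
  next
    case (15 \<alpha> f g)
    then obtain \<alpha>' where *: "\<alpha>' \<in> Cl D" "\<alpha> = k \<alpha>'" "g = j (Cd D \<alpha>')" unfolding cE by auto
    then show ?case using ops(7,8) i2(1) D.Cd_Ar laws(5) by simp
  next
    case (16 \<alpha> f g \<beta> h \<gamma> l)
    then obtain \<alpha>' \<beta>' \<gamma>' where *: "\<alpha>' \<in> Cl D" "\<beta>' \<in> Cl D" "\<gamma>' \<in> Cl D" "\<alpha> = k \<alpha>'" "\<beta> = k \<beta>'" "\<gamma> = k \<gamma>'"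
      "j (Cd D \<alpha>') = j (Dm D \<beta>')" "j (Cd D \<beta>') = j (Dm D \<gamma>')" unfolding cE by auto
    have c': "Cd D \<alpha>' = Dm D \<beta>'" "Cd D \<beta>' = Dm D \<gamma>'" using * jj D.Cd_Ar D.Dm_Ar by blast+
    show ?case using * c' ops(8) vc laws(6)[of \<alpha>' \<beta>' \<gamma>'] by simp
  next
    case (17 \<alpha> f g \<beta> l m)
    then obtain \<alpha>' \<beta>' where *: "\<alpha>' \<in> Cl D" "\<beta>' \<in> Cl D" "\<alpha> = k \<alpha>'" "\<beta> = k \<beta>'" "f = j (Dm D \<alpha>')"
      "g = j (Cd D \<alpha>')" "l = j (Dm D \<beta>')" "m = j (Cd D \<beta>')" unfolding cE by auto
    have A: "Dm D \<alpha>' \<in> Ar D" "Cd D \<alpha>' \<in> Ar D" "Dm D \<beta>' \<in> Ar D" "Cd D \<beta>' \<in> Ar D"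
      using * D.Cd_Ar D.Dm_Ar by auto
    have "i (Tgt D (Dm D \<alpha>')) = i (Src D (Dm D \<beta>'))" using 17(3) * A ops(1,2) by simp
    then have c': "Tgt D (Dm D \<alpha>') = Src D (Dm D \<beta>')" using A ii D.Src_Ob D.Tgt_Ob by blast
    show ?case unfolding cE by (rule exI[of _ "HC D \<beta>' \<alpha>'"]) (use * c' A ops(4,9) hc in auto)
  next
    case (18 \<alpha> f g)
    then obtain \<alpha>' where *: "\<alpha>' \<in> Cl D" "\<alpha> = k \<alpha>'" "f = j (Dm D \<alpha>')" unfolding cE by auto
    then show ?case using ops(1,3,7,9) i2(1) D.Dm_Ar D.Src_Ob id laws(7) by simp
  next
    case (19 \<alpha> f g)
    then obtain \<alpha>' where *: "\<alpha>' \<in> Cl D" "\<alpha> = k \<alpha>'" "f = j (Dm D \<alpha>')" unfolding cE by auto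
    then show ?case using ops(2,3,7,9) i2(1) D.Dm_Ar D.Tgt_Ob id laws(8) by simp
  next
    case (20 \<alpha> f f' \<beta> g g' \<gamma> h h')
    then obtain \<alpha>' \<beta>' \<gamma>' where *: "\<alpha>' \<in> Cl D" "\<beta>' \<in> Cl D" "\<gamma>' \<in> Cl D" "\<alpha> = k \<alpha>'" "\<beta> = k \<beta>'" "\<gamma> = k \<gamma>'"
      "f = j (Dm D \<alpha>')" "g = j (Dm D \<beta>')" "h = j (Dm D \<gamma>')" unfolding cE by auto
    have A: "Dm D \<alpha>' \<in> Ar D" "Dm D \<beta>' \<in> Ar D" "Dm D \<gamma>' \<in> Ar D" using * D.Dm_Ar by auto
    have "i (Tgt D (Dm D \<alpha>')) = i (Src D (Dm D \<beta>'))" "i (Tgt D (Dm D \<beta>')) = i (Src D (Dm D \<gamma>'))"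
      using 20(4,5) * A ops(1,2) by simp_all
    then have c': "Tgt D (Dm D \<alpha>') = Src D (Dm D \<beta>')" "Tgt D (Dm D \<beta>') = Src D (Dm D \<gamma>')"
      using A ii D.Src_Ob D.Tgt_Ob by blast+
    show ?case using * c' ops(9) hc(1) laws(9)[of \<alpha>' \<beta>' \<gamma>'] by simp
  next
    case (21 f a b g c)
    then obtain f' g' where *: "f' \<in> Ar D" "g' \<in> Ar D" "f = j f'" "g = j g'"
      "i (Tgt D f') = i (Src D g')" unfolding hE by auto
    have c': "Tgt D f' = Src D g'" using * ii D.Src_Ob D.Tgt_Ob by blast
    show ?case using * c' ops(4,7,9) i2(1) cm laws(10) by simp
  next
    case (22 \<alpha> f g \<alpha>' h \<beta> l m \<beta>' n)
    then obtain a a' b b' where *: "a \<in> Cl D" "a' \<in> Cl D" "b \<in> Cl D" "b' \<in> Cl D" "\<alpha> = k a" "\<alpha>' = k a'"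
      "\<beta> = k b" "\<beta>' = k b'" "f = j (Dm D a)" "l = j (Dm D b)" "j (Cd D a) = j (Dm D a')"
      "j (Cd D b) = j (Dm D b')" unfolding cE by auto
    have A: "Dm D a \<in> Ar D" "Dm D b \<in> Ar D" using * D.Dm_Ar by auto
    have c': "Cd D a = Dm D a'" "Cd D b = Dm D b'" using * jj D.Cd_Ar D.Dm_Ar by blast+
    have "i (Tgt D (Dm D a)) = i (Src D (Dm D b))" using 22(5) * A ops(1,2) by simp
    then have t: "Tgt D (Dm D a) = Src D (Dm D b)" using A ii D.Src_Ob D.Tgt_Ob by blast
    have t': "Tgt D (Dm D a') = Src D (Dm D b')"
      using D.Src_Cd[OF *(3)] D.Tgt_Cd[OF *(1)] t c' by simp
    show ?case using * c' t t' ops(8,9) vc(1) hc(1) laws(11)[of a a' b b'] by simp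
  qed
  show ?thesis unfolding two_functor_def hE cE
    using D E id cm(1) i2(1) vc(1) hc(1)
    by (auto simp: sel ops D.Src_Ob D.Tgt_Ob D.Dm_Ar D.Cd_Ar)
qed

text \<open>Names for the 1- and 2-cells of the sub-2-category generated by the image of a 2-functor.\<close>

datatype 'm tm = Gen nat 'm | Node nat "'m tm" "'m tm"

primrec enc :: "'m tm \<Rightarrow> ('m + nat) list" where
  "enc (Gen n m) = [Inl m, Inr n]"
| "enc (Node n s t) = Inr n # enc s @ enc t"

lemma enc_append: "enc s @ xs = enc t @ ys \<Longrightarrow> s = t \<and> xs = ys"
proof (induction s arbitrary: t xs ys)
  case (Gen n m)
  then show ?case by (cases t) auto
next
  case (Node n s1 s2)
  from Node.prems obtain t1 t2 where t: "t = Node n t1 t2" by (cases t) auto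
  then have "enc s1 @ (enc s2 @ xs) = enc t1 @ (enc t2 @ ys)" using Node.prems by simp
  with Node.IH t show ?case by blast
qed

lemma enc_inj: "inj enc"
  using enc_append[of _ "[]" _ "[]"] by (auto simp: inj_on_def)

primrec tm_ar :: "('p, 'n, 'd) twocat \<Rightarrow> (nat \<Rightarrow> 'm \<Rightarrow> 'n) \<Rightarrow> 'm tm \<Rightarrow> 'n" where
  "tm_ar D ga (Gen n m) = ga n m"
| "tm_ar D ga (Node n s t) = Cmp D (tm_ar D ga s) (tm_ar D ga t)"

primrec tm_cl :: "('p, 'n, 'd) twocat \<Rightarrow> (nat \<Rightarrow> 'm \<Rightarrow> 'n) \<Rightarrow> (nat \<Rightarrow> 'm \<Rightarrow> 'd) \<Rightarrow> 'm tm \<Rightarrow> 'd" where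
  "tm_cl D ga gc (Gen n m) = gc n m"
| "tm_cl D ga gc (Node n s t) = (if n = 0 then Id2 D (tm_ar D ga s)
     else if n = 1 then VC D (tm_cl D ga gc s) (tm_cl D ga gc t)
     else HC D (tm_cl D ga gc s) (tm_cl D ga gc t))"

lemma inj_on_of_range:
  fixes ev :: "'m tm \<Rightarrow> 'n"
  assumes "M \<subseteq> range ev"
  shows "\<exists>j :: 'n \<Rightarrow> ('m + nat) list. inj_on j M"
proof
  show "inj_on (\<lambda>x. enc (SOME t. ev t = x)) M"
  proof (rule inj_onI)
    fix x y assume xy: "x \<in> M" "y \<in> M" and e: "enc (SOME t. ev t = x) = enc (SOME t. ev t = y)"
    have "ev (SOME t. ev t = x) = x" if "x \<in> M" for x
    proof -
      have "\<exists>t. ev t = x" using assms that by blast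
      then show ?thesis by (rule someI_ex)
    qed
    then show "x = y" using xy injD[OF enc_inj e] by metis
  qed
qed

definition equivalence_data ::
  "('p, 'n, 'd) twocat \<Rightarrow> 'n \<Rightarrow> 'n \<times> 'd \<times> 'd \<times> 'd \<times> 'd \<Rightarrow> bool" where
  "equivalence_data D f = (\<lambda>(g, h, h', e, e'). g \<in> hom D (Tgt D f) (Src D f) \<and>
     h \<in> cell D (Idn D (Src D f)) (Cmp D g f) \<and> h' \<in> cell D (Cmp D g f) (Idn D (Src D f)) \<and>
     VC D h' h = Id2 D (Idn D (Src D f)) \<and> VC D h h' = Id2 D (Cmp D g f) \<and>
     e \<in> cell D (Cmp D f g) (Idn D (Tgt D f)) \<and> e' \<in> cell D (Idn D (Tgt D f)) (Cmp D f g) \<and>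
     VC D e' e = Id2 D (Cmp D f g) \<and> VC D e e' = Id2 D (Idn D (Tgt D f)))"

lemma equivalence_data_ex:
  assumes D: "two_category D" and f: "equivalence D f"
  shows "\<exists>p. equivalence_data D f p"
  using f
proof (rule two_category.equivalenceE[OF D], goal_cases)
  case (1 g h h' e e')
  then have "equivalence_data D f (g, h, h', e, e')" by (simp add: equivalence_data_def)
  then show ?case ..
qed

lemma small_factorization:
  fixes A :: "('o, 'm) cat" and D :: "('p, 'n, 'd) twocat"
  assumes F: "two_functor (disc A) D F" and E: "sends_to_equivalences D \<Sigma> F" and S: "\<Sigma> \<subseteq> Ar A"
  obtains D' :: "('p, 'n, 'd) twocat" and F' I
    and i :: "'p \<Rightarrow> ('m + nat) list" and j :: "'n \<Rightarrow> ('m + nat) list" and k :: "'d \<Rightarrow> ('m + nat) list"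
  where "two_functor (disc A) D' F'" "sends_to_equivalences D' \<Sigma> F'" "two_functor D' D I"
    "comp_twofun (disc A) I F' = F" "inj_on i (Ob D')" "inj_on j (Ar D')" "inj_on k (Cl D')"
proof -
  interpret A: two_category "disc A" using two_functorD(1)[OF F] .
  interpret D: two_category D using two_functorD(2)[OF F] .
  have sd: "Ob (disc A) = Ob A" "Ar (disc A) = Ar A" "Cl (disc A) = Ar A" "Src (disc A) = Src A"
    "Tgt (disc A) = Tgt A" "Idn (disc A) = Idn A" "Cmp (disc A) = Cmp A" "Id2 (disc A) = (\<lambda>f. f)"
    "Dm (disc A) = (\<lambda>f. f)" "Cd (disc A) = (\<lambda>f. f)"
    by (simp_all add: disc_def)
  define p where "p = (\<lambda>w. SOME p. equivalence_data D (FA F w) p)"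
  have p: "equivalence_data D (FA F w) (p w)" if "w \<in> \<Sigma>" for w
  proof -
    have "equivalence D (FA F w)" using E that by (simp add: sends_to_equivalences_def)
    from equivalence_data_ex[OF D.two_category_axioms this] show ?thesis
      unfolding p_def by (rule someI_ex)
  qed
  define g h h' e e' where geq: "g = (\<lambda>w. fst (p w))" "h = (\<lambda>w. fst (snd (p w)))"
    "h' = (\<lambda>w. fst (snd (snd (p w))))" "e = (\<lambda>w. fst (snd (snd (snd (p w)))))"
    "e' = (\<lambda>w. snd (snd (snd (snd (p w)))))"
  have q: "g w \<in> hom D (Tgt D (FA F w)) (Src D (FA F w)) \<and>
    h w \<in> cell D (Idn D (Src D (FA F w))) (Cmp D (g w) (FA F w)) \<and>
    h' w \<in> cell D (Cmp D (g w) (FA F w)) (Idn D (Src D (FA F w))) \<and>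
    VC D (h' w) (h w) = Id2 D (Idn D (Src D (FA F w))) \<and>
    VC D (h w) (h' w) = Id2 D (Cmp D (g w) (FA F w)) \<and>
    e w \<in> cell D (Cmp D (FA F w) (g w)) (Idn D (Tgt D (FA F w))) \<and>
    e' w \<in> cell D (Idn D (Tgt D (FA F w))) (Cmp D (FA F w) (g w)) \<and>
    VC D (e' w) (e w) = Id2 D (Cmp D (FA F w) (g w)) \<and>
    VC D (e w) (e' w) = Id2 D (Idn D (Tgt D (FA F w)))" if "w \<in> \<Sigma>" for w
    using p[OF that] unfolding geq equivalence_data_def by (simp add: case_prod_unfold)
  define ga where "ga = (\<lambda>n m. if n = (0::nat) then FA F m else g m)"
  define gc where "gc = (\<lambda>n m. if n = (0::nat) then h m else if n = 1 then h' m else if n = 2 then e m else e' m)"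
  define N where "N = FO F ` Ob A"
  define M where "M = {f \<in> Ar D. f \<in> range (tm_ar D ga) \<and> Src D f \<in> N \<and> Tgt D f \<in> N}"
  define K where "K = {\<alpha> \<in> Cl D. \<alpha> \<in> range (tm_cl D ga gc) \<and> Dm D \<alpha> \<in> M \<and> Cd D \<alpha> \<in> M}"
  define D' where "D' = D\<lparr>Ob := N, Ar := M, Cl := K\<rparr>"
  have Fh: "FA F f \<in> Ar D" "Src D (FA F f) = FO F (Src A f)" "Tgt D (FA F f) = FO F (Tgt A f)"
    if "f \<in> Ar A" for f using two_functor_Ar[OF F] that by (auto simp: sd hom_def)
  have ob: "Src A f \<in> Ob A" "Tgt A f \<in> Ob A" if "f \<in> Ar A" for f
    using A.Src_Ob A.Tgt_Ob that by (auto simp: sd)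
  have FM: "FA F f \<in> M" if "f \<in> Ar A" for f
  proof -
    have "FA F f \<in> range (tm_ar D ga)" by (rule range_eqI[of _ _ "Gen 0 f"]) (simp add: ga_def)
    then show ?thesis unfolding M_def N_def using Fh[OF that] ob[OF that] by simp
  qed
  have NO: "N \<subseteq> Ob D" using two_functorD(3)[OF F] by (auto simp: N_def sd)
  have iM: "Idn D a \<in> M" if a: "a \<in> N" for a
  proof -
    obtain x where x: "x \<in> Ob A" "a = FO F x" using a by (auto simp: N_def)
    then have "Idn D a = FA F (Idn A x)" using two_functorD(6)[OF F] by (simp add: sd)
    moreover have "Idn A x \<in> Ar A" using A.Idn_hom x by (simp add: sd hom_def)
    ultimately show ?thesis using FM by simp
  qed
  have cM: "Cmp D v u \<in> M" if u: "u \<in> M" "v \<in> M" "Tgt D u = Src D v" for u v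
  proof -
    obtain s t where "u = tm_ar D ga s" "v = tm_ar D ga t" using u by (auto simp: M_def)
    then have "Cmp D v u \<in> range (tm_ar D ga)" by (intro range_eqI[of _ _ "Node 0 t s"]) simp
    moreover have "Cmp D v u \<in> hom D (Src D u) (Tgt D v)"
      using u by (intro D.Cmp_hom[of _ _ "Tgt D u"]) (auto simp: M_def hom_def)
    ultimately show ?thesis using u unfolding M_def hom_def by simp
  qed
  have KI: "\<alpha> \<in> K" if "\<alpha> = tm_cl D ga gc s" "\<alpha> \<in> cell D u v" "u \<in> M" "v \<in> M" for \<alpha> s u v
    using that unfolding K_def cell_def by auto
  have D': "two_category D'"
    unfolding D'_def
  proof (rule two_category_sub[OF D.two_category_axioms NO])
    show "M \<subseteq> Ar D" by (auto simp: M_def)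
    show "K \<subseteq> Cl D" by (auto simp: K_def)
    show "Src D f \<in> N \<and> Tgt D f \<in> N" if "f \<in> M" for f using that by (auto simp: M_def)
    show "Idn D a \<in> M" if "a \<in> N" for a using iM that .
    show "Cmp D g f \<in> M" if "f \<in> M" "g \<in> M" "Tgt D f = Src D g" for f g using cM that .
    show "Dm D \<alpha> \<in> M \<and> Cd D \<alpha> \<in> M" if "\<alpha> \<in> K" for \<alpha> using that by (auto simp: K_def)
  next
    fix f assume f: "f \<in> M"
    then obtain s where "f = tm_ar D ga s" by (auto simp: M_def)
    then have "Id2 D f = tm_cl D ga gc (Node 0 s s)" by simp
    moreover have "Id2 D f \<in> cell D f f" using D.Id2_cell f by (auto simp: M_def)
    ultimately show "Id2 D f \<in> K" using KI f by blast
  next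
    fix \<alpha> \<beta> assume a: "\<alpha> \<in> K" "\<beta> \<in> K" "Cd D \<alpha> = Dm D \<beta>"
    then obtain s t where "\<alpha> = tm_cl D ga gc s" "\<beta> = tm_cl D ga gc t" by (auto simp: K_def)
    then have 1: "VC D \<beta> \<alpha> = tm_cl D ga gc (Node 1 t s)" by simp
    have 2: "VC D \<beta> \<alpha> \<in> cell D (Dm D \<alpha>) (Cd D \<beta>)"
      using a by (intro D.VC_cell[of _ _ "Cd D \<alpha>"]) (auto simp: K_def cell_def)
    show "VC D \<beta> \<alpha> \<in> K" by (rule KI[OF 1 2]) (use a in \<open>simp_all add: K_def\<close>)
  next
    fix \<alpha> \<beta> assume a: "\<alpha> \<in> K" "\<beta> \<in> K" "Tgt D (Dm D \<alpha>) = Src D (Dm D \<beta>)"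
    then obtain s t where "\<alpha> = tm_cl D ga gc s" "\<beta> = tm_cl D ga gc t" by (auto simp: K_def)
    then have 1: "HC D \<beta> \<alpha> = tm_cl D ga gc (Node 2 t s)" by simp
    have 2: "HC D \<beta> \<alpha> \<in> cell D (Cmp D (Dm D \<beta>) (Dm D \<alpha>)) (Cmp D (Cd D \<beta>) (Cd D \<alpha>))"
      using a by (intro D.HC_cell) (auto simp: K_def cell_def)
    have 3: "Tgt D (Cd D \<alpha>) = Src D (Cd D \<beta>)" using a D.Src_Cd D.Tgt_Cd by (auto simp: K_def)
    show "HC D \<beta> \<alpha> \<in> K" by (rule KI[OF 1 2]) (use a 3 cM in \<open>simp_all add: K_def\<close>)
  qed
  have cD': "cell D' u v = {\<alpha> \<in> cell D u v. \<alpha> \<in> K}" for u v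
    by (auto simp: cell_def D'_def K_def)
  have hD': "hom D' a b = {f \<in> hom D a b. f \<in> M}" for a b
    by (auto simp: hom_def D'_def M_def)
  have IdK: "Id2 D f \<in> K" if "f \<in> M" for f
    using two_category.Id2_cell[OF D', of f] that by (simp add: cD' cell_def D'_def)
  have F': "two_functor (disc A) D' F"
  proof -
    have "FC F f \<in> K" if "f \<in> Ar A" for f
      using two_functorD(8)[OF F, of f] that IdK[OF FM[OF that]] by (simp add: sd)
    then show ?thesis
      using F D' FM unfolding two_functor_def cD' hD'
      by (auto simp: D'_def N_def sd)
  qed
  define I where "I = \<lparr>FO = (\<lambda>a\<in>N. a), FA = (\<lambda>f\<in>M. f), FC = (\<lambda>\<alpha>\<in>K. \<alpha>)\<rparr>"
  interpret D': two_category D' by (rule D')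
  have I: "two_functor D' D I"
  proof -
    have "a \<in> N \<Longrightarrow> Idn D' a \<in> M" "f \<in> M \<Longrightarrow> Src D' f \<in> N \<and> Tgt D' f \<in> N" for a f
      using iM by (auto simp: D'_def M_def)
    moreover have "f \<in> M \<Longrightarrow> Id2 D f \<in> K" for f using IdK .
    moreover have "\<alpha> \<in> K \<Longrightarrow> \<beta> \<in> K \<Longrightarrow> Cd D \<alpha> = Dm D \<beta> \<Longrightarrow> VC D \<beta> \<alpha> \<in> K" for \<alpha> \<beta>
      using D'.VC_cell[of \<alpha> "Dm D \<alpha>" "Cd D \<alpha>" \<beta> "Cd D \<beta>"] by (simp add: cell_def D'_def)
    moreover have "\<alpha> \<in> K \<Longrightarrow> \<beta> \<in> K \<Longrightarrow> Tgt D (Dm D \<alpha>) = Src D (Dm D \<beta>) \<Longrightarrow> HC D \<beta> \<alpha> \<in> K" for \<alpha> \<beta>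
      using D'.HC_cell[of \<alpha> "Dm D \<alpha>" "Cd D \<alpha>" \<beta> "Dm D \<beta>" "Cd D \<beta>"] by (simp add: cell_def D'_def)
    moreover have "\<alpha> \<in> K \<Longrightarrow> \<alpha> \<in> Cl D \<and> Dm D \<alpha> \<in> M \<and> Cd D \<alpha> \<in> M" for \<alpha> by (simp add: K_def)
    moreover have "f \<in> M \<Longrightarrow> f \<in> Ar D" for f by (simp add: M_def)
    ultimately show ?thesis
      using D' D.two_category_axioms NO cM unfolding two_functor_def I_def
      by (auto simp: D'_def hom_def cell_def)
  qed
  have IF: "comp_twofun (disc A) I F = F"
  proof -
    have "FC F f \<in> K" if "f \<in> Ar A" for f
      using two_functorD(5)[OF F', of f f f] that by (simp add: sd cell_def D'_def)
    moreover have "FO F \<in> extensional (Ob A)" "FA F \<in> extensional (Ar A)" "FC F \<in> extensional (Ar A)"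
      using F by (auto simp: two_functor_def sd)
    ultimately have "FO (comp_twofun (disc A) I F) = FO F" "FA (comp_twofun (disc A) I F) = FA F"
      "FC (comp_twofun (disc A) I F) = FC F"
      using FM by (auto simp: comp_twofun_def I_def sd N_def fun_eq_iff extensional_def)
    then show ?thesis by simp
  qed
  have E': "sends_to_equivalences D' \<Sigma> F"
    unfolding sends_to_equivalences_def
  proof
    fix w assume w: "w \<in> \<Sigma>"
    then have wA: "w \<in> Ar A" using S by blast
    note qw = q[OF w]
    have op: "Src D' = Src D" "Tgt D' = Tgt D" "Idn D' = Idn D" "Cmp D' = Cmp D" "VC D' = VC D"
      "Id2 D' = Id2 D" "Ar D' = M" by (auto simp: D'_def)
    have sw: "Src D (FA F w) \<in> N" "Tgt D (FA F w) \<in> N" "FA F w \<in> M"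
      using FM[OF wA] by (auto simp: M_def)
    have "g w \<in> range (tm_ar D ga)" by (rule range_eqI[of _ _ "Gen 1 w"]) (simp add: ga_def)
    then have gM: "g w \<in> M" unfolding M_def using qw sw by (simp add: hom_def)
    have m: "Cmp D (g w) (FA F w) \<in> M" "Cmp D (FA F w) (g w) \<in> M"
      using cM gM sw qw by (auto simp: hom_def)
    have k: "h w = tm_cl D ga gc (Gen 0 w)" "h' w = tm_cl D ga gc (Gen 1 w)"
      "e w = tm_cl D ga gc (Gen 2 w)" "e' w = tm_cl D ga gc (Gen 3 w)" by (simp_all add: gc_def)
    have "h w \<in> K" "h' w \<in> K" "e w \<in> K" "e' w \<in> K"
      using KI[OF k(1)] KI[OF k(2)] KI[OF k(3)] KI[OF k(4)] qw m iM sw by blast+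
    then show "equivalence D' (FA F w)"
      using qw gM sw by (intro D'.equivalenceI[of "FA F w" "g w" "h w" "h' w" "e w" "e' w"])
        (auto simp: op cD' hD')
  qed
  define pre where "pre = (\<lambda>a. SOME x. x \<in> Ob A \<and> FO F x = a)"
  have pre: "pre a \<in> Ob A \<and> FO F (pre a) = a" if "a \<in> N" for a
  proof -
    have "\<exists>x. x \<in> Ob A \<and> FO F x = a" using that by (auto simp: N_def)
    then show ?thesis unfolding pre_def by (rule someI_ex)
  qed
  have src: "Src A (Idn A x) = x" if "x \<in> Ob A" for x
    using A.Idn_hom that by (simp add: sd hom_def)
  have "inj_on (\<lambda>a. [Inl (Idn A (pre a)) :: 'm + nat]) N"
  proof (rule inj_onI)
    fix a b assume ab: "a \<in> N" "b \<in> N"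
      and "[Inl (Idn A (pre a)) :: 'm + nat] = [Inl (Idn A (pre b))]"
    then have "Idn A (pre a) = Idn A (pre b)" by simp
    then have "pre a = pre b" using src pre ab by metis
    then show "a = b" using pre ab by metis
  qed
  then have "inj_on (\<lambda>a. [Inl (Idn A (pre a)) :: 'm + nat]) (Ob D')" by (simp add: D'_def)
  moreover obtain j :: "'n \<Rightarrow> ('m + nat) list" where "inj_on j (Ar D')"
    using inj_on_of_range[of "Ar D'" "tm_ar D ga"] by (auto simp: D'_def M_def)
  moreover obtain k :: "'d \<Rightarrow> ('m + nat) list" where "inj_on k (Cl D')"
    using inj_on_of_range[of "Cl D'" "tm_cl D ga gc"] by (auto simp: D'_def K_def)
  ultimately show ?thesis using that[OF F' E' I IF] by blast
qed

text \<open>Sequences related by \<^const>\<open>ho_rel\<close> are identified by every 2-functor into any 2-category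
  of any type.\<close>

lemma ho_rel_hat_seq:
  fixes D :: "('p, 'n, 'd) twocat"
  assumes rel: "ho_rel A \<Sigma> f g Hs Ks" and S: "\<Sigma> \<subseteq> Ar A"
    and F: "two_functor (disc A) D F" and E: "sends_to_equivalences D \<Sigma> F"
  shows "hat_seq D F Hs = hat_seq D F Ks"
proof (rule small_factorization[OF F E S])
  fix D' :: "('p, 'n, 'd) twocat" and F' I
    and i :: "'p \<Rightarrow> ('b + nat) list" and j :: "'n \<Rightarrow> ('b + nat) list" and k :: "'d \<Rightarrow> ('b + nat) list"
  assume F': "two_functor (disc A) D' F'" and E': "sends_to_equivalences D' \<Sigma> F'"
    and I: "two_functor D' D I" and IF: "comp_twofun (disc A) I F' = F"
    and inj: "inj_on i (Ob D')" "inj_on j (Ar D')" "inj_on k (Cl D')"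
  have seq: "homotopy_seq A \<Sigma> f g Hs" "homotopy_seq A \<Sigma> f g Ks" using rel by (auto simp: ho_rel_def)
  let ?T = "copy_twocat i j k D'"
  let ?J = "\<lparr>FO = restrict i (Ob D'), FA = restrict j (Ar D'), FC = restrict k (Cl D')\<rparr>"
  have J: "two_functor D' ?T ?J" by (rule copy_twocat[OF two_functorD(2)[OF F'] inj])
  have "sends_to_equivalences ?T \<Sigma> (comp_twofun (disc A) ?J F')"
    using sends_to_equivalences_comp[OF J E'] S by (simp add: disc_def)
  then have "hat_seq ?T (comp_twofun (disc A) ?J F') Hs = hat_seq ?T (comp_twofun (disc A) ?J F') Ks"
    using rel two_functor_comp[OF F' J] unfolding ho_rel_def by blast
  then have "FC ?J (hat_seq D' F' Hs) = FC ?J (hat_seq D' F' Ks)"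
    using hat_seq_comp[OF F' E' S J] seq by metis
  moreover have "hat_seq D' F' Hs \<in> Cl D'" "hat_seq D' F' Ks \<in> Cl D'"
    using hat_seq_cell[OF F' E'] seq by (auto simp: cell_def)
  ultimately have "hat_seq D' F' Hs = hat_seq D' F' Ks" using inj(3) by (auto dest: inj_onD)
  then show ?thesis using hat_seq_comp[OF F' E' S I] seq IF by metis
qed

end

theory Submission
  imports Defs
begin

text \<open>Let \<open>j\<close> be the inclusion of the fibrant-cofibrant objects into \<open>C\<close>. A 2-functor \<open>F\<close> that sends weak
  equivalences to equivalences restricts along \<open>j\<close> and then extends uniquely to the homotopy
  2-category, a 2-cell \<open>[H\<^sub>n, \<dots>, H\<^sub>1]\<close> going to the composite of the cells that \<open>F\<close> assigns to the
  homotopies. Call the extension \<open>G F\<close>. Normality gives \<open>r j = id\<close>, hence \<open>G q\<^sup>* = id\<close> on the nose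
  (uniqueness of extensions uses that weak equivalences are equivalences in the homotopy
  2-category, where a homotopy induces its own class). In the other direction \<open>q\<^sup>* G F = F R Q\<close>,
  which is joined to \<open>F\<close> by \<open>F R Q \<Leftarrow> F Q \<Rightarrow> F\<close>; these are pointwise equivalences because \<open>p\<close> and
  \<open>v\<close> are weak equivalences,
  and a pseudonatural transformation whose components are equivalences is an equivalence.\<close>

section \<open>Cells in a 2-category\<close>

text \<open>There is no natural map between \<open>Id\<close> and \<open>RQ\<close>, only the span
  of \<open>p : Q \<Rightarrow> Id\<close> and \<open>v Q : Q \<Rightarrow> RQ\<close>. Its leg
  \<open>v Q\<close> must be inverted, which is possible only after a 2-functor into
  \<open>D\<close> is applied, and then only up to invertible 2-cells. The comparison must also vary
  with the 2-functor: for a pseudonatural \<theta> and a weak equivalence \<open>n\<close>, the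
  square commutes only up to the cell \<open>\<theta>_n\<close>. So the inversion takes place in
  \<open>Hom_p E E\<close>, where \<open>E\<close> consists of the 2-functors on \<open>C\<close>
  that send \<open>W\<close> to equivalences, and the criterion on pointwise equivalences is used at
  two levels: for a single 2-functor and for the family of all of them.

  A second principle carries the homotopy 2-category: its 2-cells are separated by the test
  2-functors, so every law is checked after evaluation, where it is a law of the target.

  Cylinders carry no fibrancy or cofibrancy conditions. A retraction in \<open>\<Sigma>\<close> is
  therefore itself a collapse map, and equivalences arise from one-step homotopies without a theory
  of cylinder objects.\<close>

context category
begin

text \<open>The axioms of \<open>category\<close> use membership in \<open>hom\<close>, whose
  endpoints the simplifier would have to guess. Conditions on \<open>Src\<close> and
  \<open>Tgt\<close> can be computed instead. Composites are kept nested to the right.\<close>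

lemma category_simps [simp]:
  "f \<in> Ar C \<Longrightarrow> Src C f \<in> Ob C"
  "f \<in> Ar C \<Longrightarrow> Tgt C f \<in> Ob C"
  "a \<in> Ob C \<Longrightarrow> Idn C a \<in> Ar C"
  "a \<in> Ob C \<Longrightarrow> Src C (Idn C a) = a"
  "a \<in> Ob C \<Longrightarrow> Tgt C (Idn C a) = a"
  "f \<in> Ar C \<Longrightarrow> g \<in> Ar C \<Longrightarrow> Tgt C f = Src C g \<Longrightarrow> Cmp C g f \<in> Ar C"
  "f \<in> Ar C \<Longrightarrow> g \<in> Ar C \<Longrightarrow> Tgt C f = Src C g \<Longrightarrow> Src C (Cmp C g f) = Src C f"
  "f \<in> Ar C \<Longrightarrow> g \<in> Ar C \<Longrightarrow> Tgt C f = Src C g \<Longrightarrow> Tgt C (Cmp C g f) = Tgt C g"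
  "f \<in> Ar C \<Longrightarrow> Src C f = a \<Longrightarrow> Cmp C f (Idn C a) = f"
  "f \<in> Ar C \<Longrightarrow> Tgt C f = a \<Longrightarrow> Cmp C (Idn C a) f = f"
  "f \<in> Ar C \<Longrightarrow> g \<in> Ar C \<Longrightarrow> h \<in> Ar C \<Longrightarrow> Tgt C f = Src C g \<Longrightarrow> Tgt C g = Src C h \<Longrightarrow>
    Cmp C (Cmp C h g) f = Cmp C h (Cmp C g f)"
  using Src_Ob Tgt_Ob Idn_hom Cmp_hom[of f "Src C f" "Tgt C f" g "Tgt C g"]
    Cmp_Idn_right[of f "Src C f" "Tgt C f"] Cmp_Idn_left[of f "Src C f" "Tgt C f"]
    Cmp_assoc[of f "Src C f" "Tgt C f" g "Tgt C g" h "Tgt C h"]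
  by (auto simp: hom_def)

end

context two_category
begin

text \<open>Endpoints of a 2-cell are normalised to those of its domain: \<open>Src\<close> and
  \<open>Tgt\<close> of \<open>Cd\<close> are rewritten to those of \<open>Dm\<close>.\<close>

lemma cell_simps [simp]:
  "\<alpha> \<in> Cl B \<Longrightarrow> Dm B \<alpha> \<in> Ar B"
  "\<alpha> \<in> Cl B \<Longrightarrow> Cd B \<alpha> \<in> Ar B"
  "\<alpha> \<in> Cl B \<Longrightarrow> Src B (Cd B \<alpha>) = Src B (Dm B \<alpha>)"
  "\<alpha> \<in> Cl B \<Longrightarrow> Tgt B (Cd B \<alpha>) = Tgt B (Dm B \<alpha>)"
  "f \<in> Ar B \<Longrightarrow> Id2 B f \<in> Cl B"
  "f \<in> Ar B \<Longrightarrow> Dm B (Id2 B f) = f"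
  "f \<in> Ar B \<Longrightarrow> Cd B (Id2 B f) = f"
  "\<alpha> \<in> Cl B \<Longrightarrow> \<beta> \<in> Cl B \<Longrightarrow> Cd B \<alpha> = Dm B \<beta> \<Longrightarrow> VC B \<beta> \<alpha> \<in> Cl B"
  "\<alpha> \<in> Cl B \<Longrightarrow> \<beta> \<in> Cl B \<Longrightarrow> Cd B \<alpha> = Dm B \<beta> \<Longrightarrow> Dm B (VC B \<beta> \<alpha>) = Dm B \<alpha>"
  "\<alpha> \<in> Cl B \<Longrightarrow> \<beta> \<in> Cl B \<Longrightarrow> Cd B \<alpha> = Dm B \<beta> \<Longrightarrow> Cd B (VC B \<beta> \<alpha>) = Cd B \<beta>"
  "\<alpha> \<in> Cl B \<Longrightarrow> \<beta> \<in> Cl B \<Longrightarrow> Tgt B (Dm B \<alpha>) = Src B (Dm B \<beta>) \<Longrightarrow> HC B \<beta> \<alpha> \<in> Cl B"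
  "\<alpha> \<in> Cl B \<Longrightarrow> \<beta> \<in> Cl B \<Longrightarrow> Tgt B (Dm B \<alpha>) = Src B (Dm B \<beta>) \<Longrightarrow>
    Dm B (HC B \<beta> \<alpha>) = Cmp B (Dm B \<beta>) (Dm B \<alpha>)"
  "\<alpha> \<in> Cl B \<Longrightarrow> \<beta> \<in> Cl B \<Longrightarrow> Tgt B (Dm B \<alpha>) = Src B (Dm B \<beta>) \<Longrightarrow>
    Cd B (HC B \<beta> \<alpha>) = Cmp B (Cd B \<beta>) (Cd B \<alpha>)"
  using Dm_Ar Cd_Ar Src_Cd Tgt_Cd Id2_cell VC_cell[of \<alpha> "Dm B \<alpha>" "Cd B \<alpha>" \<beta> "Cd B \<beta>"]
    HC_cell[of \<alpha> "Dm B \<alpha>" "Cd B \<alpha>" \<beta> "Dm B \<beta>" "Cd B \<beta>"]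
  by (auto simp: cell_def)

lemma cell_iff: "\<alpha> \<in> cell B f g \<longleftrightarrow> \<alpha> \<in> Cl B \<and> Dm B \<alpha> = f \<and> Cd B \<alpha> = g"
  by (auto simp: cell_def)

lemma VC_simps [simp]:
  "\<alpha> \<in> Cl B \<Longrightarrow> Dm B \<alpha> = f \<Longrightarrow> VC B \<alpha> (Id2 B f) = \<alpha>"
  "\<alpha> \<in> Cl B \<Longrightarrow> Cd B \<alpha> = f \<Longrightarrow> VC B (Id2 B f) \<alpha> = \<alpha>"
  "\<alpha> \<in> Cl B \<Longrightarrow> \<beta> \<in> Cl B \<Longrightarrow> \<gamma> \<in> Cl B \<Longrightarrow> Cd B \<alpha> = Dm B \<beta> \<Longrightarrow> Cd B \<beta> = Dm B \<gamma> \<Longrightarrow>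
    VC B (VC B \<gamma> \<beta>) \<alpha> = VC B \<gamma> (VC B \<beta> \<alpha>)"
  using VC_Id2_right[of \<alpha>] VC_Id2_left[of \<alpha>] VC_assoc[of \<alpha> _ _ \<beta> _ \<gamma>] by (auto simp: cell_iff)

lemma HC_VC:
  "\<alpha> \<in> Cl B \<Longrightarrow> \<alpha>' \<in> Cl B \<Longrightarrow> \<beta> \<in> Cl B \<Longrightarrow> \<beta>' \<in> Cl B \<Longrightarrow> Cd B \<alpha> = Dm B \<alpha>' \<Longrightarrow> Cd B \<beta> = Dm B \<beta>' \<Longrightarrow>
    Tgt B (Dm B \<alpha>) = Src B (Dm B \<beta>) \<Longrightarrow>
    HC B (VC B \<beta>' \<beta>) (VC B \<alpha>' \<alpha>) = VC B (HC B \<beta>' \<alpha>') (HC B \<beta> \<alpha>)"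
  using interchange[of \<alpha> _ _ \<alpha>' _ \<beta> _ _ \<beta>'] by (auto simp: cell_iff)

text \<open>Normal form of whiskered cells: right-nested left whiskerings by single arrows around one
  right whiskering by a composite.\<close>

lemma HC_simps [simp]:
  "\<alpha> \<in> Cl B \<Longrightarrow> Src B (Dm B \<alpha>) = a \<Longrightarrow> HC B \<alpha> (Id2 B (Idn B a)) = \<alpha>"
  "\<alpha> \<in> Cl B \<Longrightarrow> Tgt B (Dm B \<alpha>) = a \<Longrightarrow> HC B (Id2 B (Idn B a)) \<alpha> = \<alpha>"
  "f \<in> Ar B \<Longrightarrow> g \<in> Ar B \<Longrightarrow> Tgt B f = Src B g \<Longrightarrow> HC B (Id2 B g) (Id2 B f) = Id2 B (Cmp B g f)"
  "\<alpha> \<in> Cl B \<Longrightarrow> \<beta> \<in> Cl B \<Longrightarrow> \<gamma> \<in> Cl B \<Longrightarrow> Tgt B (Dm B \<alpha>) = Src B (Dm B \<beta>) \<Longrightarrow>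
    Tgt B (Dm B \<beta>) = Src B (Dm B \<gamma>) \<Longrightarrow> HC B (HC B \<gamma> \<beta>) \<alpha> = HC B \<gamma> (HC B \<beta> \<alpha>)"
  "\<alpha> \<in> Cl B \<Longrightarrow> f \<in> Ar B \<Longrightarrow> g \<in> Ar B \<Longrightarrow> Tgt B (Dm B \<alpha>) = Src B f \<Longrightarrow> Tgt B f = Src B g \<Longrightarrow>
    HC B (Id2 B (Cmp B g f)) \<alpha> = HC B (Id2 B g) (HC B (Id2 B f) \<alpha>)"
  "\<alpha> \<in> Cl B \<Longrightarrow> \<beta> \<in> Cl B \<Longrightarrow> f \<in> Ar B \<Longrightarrow> Cd B \<alpha> = Dm B \<beta> \<Longrightarrow> Tgt B (Dm B \<alpha>) = Src B f \<Longrightarrow>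
    HC B (Id2 B f) (VC B \<beta> \<alpha>) = VC B (HC B (Id2 B f) \<beta>) (HC B (Id2 B f) \<alpha>)"
  "\<alpha> \<in> Cl B \<Longrightarrow> \<beta> \<in> Cl B \<Longrightarrow> f \<in> Ar B \<Longrightarrow> Cd B \<alpha> = Dm B \<beta> \<Longrightarrow> Src B (Dm B \<alpha>) = Tgt B f \<Longrightarrow>
    HC B (VC B \<beta> \<alpha>) (Id2 B f) = VC B (HC B \<beta> (Id2 B f)) (HC B \<alpha> (Id2 B f))"
proof -
  show i: "HC B (Id2 B g) (Id2 B f) = Id2 B (Cmp B g f)"
    if "f \<in> Ar B" "g \<in> Ar B" "Tgt B f = Src B g" for f g
    using HC_Id2_Id2[of f _ _ g] that by (auto simp: hom_def)
  show a: "HC B (HC B \<gamma> \<beta>) \<alpha> = HC B \<gamma> (HC B \<beta> \<alpha>)"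
    if "\<alpha> \<in> Cl B" "\<beta> \<in> Cl B" "\<gamma> \<in> Cl B" "Tgt B (Dm B \<alpha>) = Src B (Dm B \<beta>)"
      "Tgt B (Dm B \<beta>) = Src B (Dm B \<gamma>)" for \<alpha> \<beta> \<gamma>
    using HC_assoc[of \<alpha> _ _ \<beta> _ _ \<gamma>] that by (auto simp: cell_iff)
  show "HC B (Id2 B (Cmp B g f)) \<alpha> = HC B (Id2 B g) (HC B (Id2 B f) \<alpha>)"
    if "\<alpha> \<in> Cl B" "f \<in> Ar B" "g \<in> Ar B" "Tgt B (Dm B \<alpha>) = Src B f" "Tgt B f = Src B g"
    using a[of \<alpha> "Id2 B f" "Id2 B g"] i that by simp
  show "HC B (Id2 B f) (VC B \<beta> \<alpha>) = VC B (HC B (Id2 B f) \<beta>) (HC B (Id2 B f) \<alpha>)"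
    if "\<alpha> \<in> Cl B" "\<beta> \<in> Cl B" "f \<in> Ar B" "Cd B \<alpha> = Dm B \<beta>" "Tgt B (Dm B \<alpha>) = Src B f"
    using HC_VC[of \<alpha> \<beta> "Id2 B f" "Id2 B f"] that by simp
  show "HC B (VC B \<beta> \<alpha>) (Id2 B f) = VC B (HC B \<beta> (Id2 B f)) (HC B \<alpha> (Id2 B f))"
    if "\<alpha> \<in> Cl B" "\<beta> \<in> Cl B" "f \<in> Ar B" "Cd B \<alpha> = Dm B \<beta>" "Src B (Dm B \<alpha>) = Tgt B f"
    using HC_VC[of "Id2 B f" "Id2 B f" \<alpha> \<beta>] that by simp
qed (use HC_Id2_right[of \<alpha>] HC_Id2_left[of \<alpha>] in \<open>auto simp: cell_iff\<close>)

lemma HC_left_first: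
  assumes "\<alpha> \<in> Cl B" "\<beta> \<in> Cl B" "Tgt B (Dm B \<alpha>) = Src B (Dm B \<beta>)"
  shows "HC B \<beta> \<alpha> = VC B (HC B \<beta> (Id2 B (Cd B \<alpha>))) (HC B (Id2 B (Dm B \<beta>)) \<alpha>)"
  using HC_VC[of \<alpha> "Id2 B (Cd B \<alpha>)" "Id2 B (Dm B \<beta>)" \<beta>] assms by simp

lemma HC_right_first:
  assumes "\<alpha> \<in> Cl B" "\<beta> \<in> Cl B" "Tgt B (Dm B \<alpha>) = Src B (Dm B \<beta>)"
  shows "HC B \<beta> \<alpha> = VC B (HC B (Id2 B (Cd B \<beta>)) \<alpha>) (HC B \<beta> (Id2 B (Dm B \<alpha>)))"
  using HC_VC[of "Id2 B (Dm B \<alpha>)" \<alpha> \<beta> "Id2 B (Cd B \<beta>)"] assms by simp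

text \<open>Both orders compute the horizontal composite. The equation has no preferred direction,
  so it is no simp rule, and each pasting argument instantiates it by hand.\<close>

lemma whisker_swap:
  assumes "\<alpha> \<in> Cl B" "\<beta> \<in> Cl B" "Tgt B (Dm B \<alpha>) = Src B (Dm B \<beta>)"
  shows "VC B (HC B \<beta> (Id2 B (Cd B \<alpha>))) (HC B (Id2 B (Dm B \<beta>)) \<alpha>) =
    VC B (HC B (Id2 B (Cd B \<beta>)) \<alpha>) (HC B \<beta> (Id2 B (Dm B \<alpha>)))"
  using HC_left_first[OF assms] HC_right_first[OF assms] by simp

text \<open>Vertical composites are nested to the right, so an equation between two-fold composites
  does not match inside a longer one. Here it receives a tail \<open>x\<close>.\<close>

lemma VC_assoc_eq:
  assumes "VC B \<beta> \<alpha> = VC B \<beta>' \<alpha>'"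
    and "\<alpha> \<in> Cl B" "\<beta> \<in> Cl B" "Cd B \<alpha> = Dm B \<beta>" "\<alpha>' \<in> Cl B" "\<beta>' \<in> Cl B" "Cd B \<alpha>' = Dm B \<beta>'"
    and "x \<in> Cl B" "Cd B x = Dm B \<alpha>"
  shows "VC B \<beta> (VC B \<alpha> x) = VC B \<beta>' (VC B \<alpha>' x)"
proof -
  have "Dm B \<alpha> = Dm B \<alpha>'" using assms(2-7) arg_cong[OF assms(1), of "Dm B"] by simp
  then show ?thesis using assms VC_simps(3)[of x \<alpha> \<beta>] VC_simps(3)[of x \<alpha>' \<beta>'] by simp
qed

end

section \<open>Invertible 2-cells and their inverses\<close>

definition inv_cell :: "('o, 'm, 'c) twocat \<Rightarrow> 'c \<Rightarrow> 'c" where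
  "inv_cell B \<alpha> = (SOME \<beta>. \<beta> \<in> cell B (Cd B \<alpha>) (Dm B \<alpha>) \<and>
     VC B \<beta> \<alpha> = Id2 B (Dm B \<alpha>) \<and> VC B \<alpha> \<beta> = Id2 B (Cd B \<alpha>))"

context two_category
begin

lemma inv_cell [simp]:
  assumes "invertible_cell B \<alpha>"
  shows "inv_cell B \<alpha> \<in> Cl B" "Dm B (inv_cell B \<alpha>) = Cd B \<alpha>" "Cd B (inv_cell B \<alpha>) = Dm B \<alpha>"
    "VC B (inv_cell B \<alpha>) \<alpha> = Id2 B (Dm B \<alpha>)" "VC B \<alpha> (inv_cell B \<alpha>) = Id2 B (Cd B \<alpha>)"
proof -
  have "inv_cell B \<alpha> \<in> cell B (Cd B \<alpha>) (Dm B \<alpha>) \<and>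
     VC B (inv_cell B \<alpha>) \<alpha> = Id2 B (Dm B \<alpha>) \<and> VC B \<alpha> (inv_cell B \<alpha>) = Id2 B (Cd B \<alpha>)"
    unfolding inv_cell_def by (rule someI_ex) (use assms in \<open>auto simp: invertible_cell_def\<close>)
  then show "inv_cell B \<alpha> \<in> Cl B" "Dm B (inv_cell B \<alpha>) = Cd B \<alpha>" "Cd B (inv_cell B \<alpha>) = Dm B \<alpha>"
    "VC B (inv_cell B \<alpha>) \<alpha> = Id2 B (Dm B \<alpha>)" "VC B \<alpha> (inv_cell B \<alpha>) = Id2 B (Cd B \<alpha>)"
    by (auto simp: cell_iff)
qed

lemma invertible_Cl: "invertible_cell B \<alpha> \<Longrightarrow> \<alpha> \<in> Cl B"
  by (simp add: invertible_cell_def)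

lemma inv_cell_VC [simp]:
  assumes "invertible_cell B \<alpha>" "x \<in> Cl B"
  shows "Cd B x = Dm B \<alpha> \<Longrightarrow> VC B (inv_cell B \<alpha>) (VC B \<alpha> x) = x"
    "Cd B x = Cd B \<alpha> \<Longrightarrow> VC B \<alpha> (VC B (inv_cell B \<alpha>) x) = x"
proof -
  note [simp] = invertible_Cl[OF assms(1)]
  show "VC B (inv_cell B \<alpha>) (VC B \<alpha> x) = x" if "Cd B x = Dm B \<alpha>"
    by (subst VC_simps(3)[symmetric]) (use assms that in simp_all)
  show "VC B \<alpha> (VC B (inv_cell B \<alpha>) x) = x" if "Cd B x = Cd B \<alpha>"
    by (subst VC_simps(3)[symmetric]) (use assms that in simp_all)
qed

lemma invertible_cellI:
  assumes "\<alpha> \<in> Cl B" "\<beta> \<in> Cl B" "Dm B \<beta> = Cd B \<alpha>" "Cd B \<beta> = Dm B \<alpha>"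
    "VC B \<beta> \<alpha> = Id2 B (Dm B \<alpha>)" "VC B \<alpha> \<beta> = Id2 B (Cd B \<alpha>)"
  shows "invertible_cell B \<alpha>"
  unfolding invertible_cell_def using assms by (auto simp: cell_iff)

lemma inv_cell_eqI:
  assumes "\<alpha> \<in> Cl B" "\<beta> \<in> Cl B" "Dm B \<beta> = Cd B \<alpha>" "Cd B \<beta> = Dm B \<alpha>"
    "VC B \<beta> \<alpha> = Id2 B (Dm B \<alpha>)" "VC B \<alpha> \<beta> = Id2 B (Cd B \<alpha>)"
  shows "inv_cell B \<alpha> = \<beta>"
proof -
  have i: "invertible_cell B \<alpha>" using invertible_cellI assms .
  have "VC B (VC B \<beta> \<alpha>) (inv_cell B \<alpha>) = VC B \<beta> (VC B \<alpha> (inv_cell B \<alpha>))"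
    using assms i by (intro VC_simps(3)) simp_all
  then show ?thesis using assms i by simp
qed

lemma invertible_Id2 [simp]: "f \<in> Ar B \<Longrightarrow> invertible_cell B (Id2 B f)"
  by (rule invertible_cellI[of _ "Id2 B f"]) simp_all

lemma inv_cell_Id2 [simp]: "f \<in> Ar B \<Longrightarrow> inv_cell B (Id2 B f) = Id2 B f"
  by (rule inv_cell_eqI) simp_all

lemma invertible_inv_cell [simp]: "invertible_cell B \<alpha> \<Longrightarrow> invertible_cell B (inv_cell B \<alpha>)"
  by (rule invertible_cellI[of _ \<alpha>]) (simp_all add: invertible_Cl)

lemma invertible_VC_inverse:
  assumes "invertible_cell B \<alpha>" "invertible_cell B \<beta>" "Cd B \<alpha> = Dm B \<beta>"
  shows "invertible_cell B (VC B \<beta> \<alpha>)" (is ?A)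
    and "inv_cell B (VC B \<beta> \<alpha>) = VC B (inv_cell B \<alpha>) (inv_cell B \<beta>)" (is ?B)
proof -
  note [simp] = invertible_Cl[OF assms(1)] invertible_Cl[OF assms(2)]
  have 1: "VC B (VC B (inv_cell B \<alpha>) (inv_cell B \<beta>)) (VC B \<beta> \<alpha>) = Id2 B (Dm B \<alpha>)"
    "VC B (VC B \<beta> \<alpha>) (VC B (inv_cell B \<alpha>) (inv_cell B \<beta>)) = Id2 B (Cd B \<beta>)"
    using assms by simp_all
  show ?A
    by (rule invertible_cellI[of _ "VC B (inv_cell B \<alpha>) (inv_cell B \<beta>)"]) (use 1 assms in simp_all)
  show ?B by (rule inv_cell_eqI) (use 1 assms in simp_all)
qed

lemmas invertible_VC [simp] = invertible_VC_inverse(1)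

lemma invertible_lwhisker_inverse:
  assumes "invertible_cell B \<alpha>" "f \<in> Ar B" "Tgt B (Dm B \<alpha>) = Src B f"
  shows "invertible_cell B (HC B (Id2 B f) \<alpha>)" (is ?A)
    and "inv_cell B (HC B (Id2 B f) \<alpha>) = HC B (Id2 B f) (inv_cell B \<alpha>)" (is ?B)
proof -
  note [simp] = invertible_Cl[OF assms(1)]
  have "VC B (HC B (Id2 B f) (inv_cell B \<alpha>)) (HC B (Id2 B f) \<alpha>) =
      HC B (Id2 B f) (VC B (inv_cell B \<alpha>) \<alpha>)"
    "VC B (HC B (Id2 B f) \<alpha>) (HC B (Id2 B f) (inv_cell B \<alpha>)) =
      HC B (Id2 B f) (VC B \<alpha> (inv_cell B \<alpha>))"
    by (rule HC_simps(6)[symmetric]; use assms in simp)+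
  note 1 = this[unfolded inv_cell(4,5)[OF assms(1)]]
  show ?A by (rule invertible_cellI[of _ "HC B (Id2 B f) (inv_cell B \<alpha>)"]) (use 1 assms in simp_all)
  show ?B by (rule inv_cell_eqI) (use 1 assms in simp_all)
qed

lemma invertible_rwhisker_inverse:
  assumes "invertible_cell B \<alpha>" "f \<in> Ar B" "Src B (Dm B \<alpha>) = Tgt B f"
  shows "invertible_cell B (HC B \<alpha> (Id2 B f))" (is ?A)
    and "inv_cell B (HC B \<alpha> (Id2 B f)) = HC B (inv_cell B \<alpha>) (Id2 B f)" (is ?B)
proof -
  note [simp] = invertible_Cl[OF assms(1)]
  have "VC B (HC B (inv_cell B \<alpha>) (Id2 B f)) (HC B \<alpha> (Id2 B f)) =
      HC B (VC B (inv_cell B \<alpha>) \<alpha>) (Id2 B f)"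
    "VC B (HC B \<alpha> (Id2 B f)) (HC B (inv_cell B \<alpha>) (Id2 B f)) =
      HC B (VC B \<alpha> (inv_cell B \<alpha>)) (Id2 B f)"
    by (rule HC_simps(7)[symmetric]; use assms in simp)+
  note 1 = this[unfolded inv_cell(4,5)[OF assms(1)]]
  show ?A by (rule invertible_cellI[of _ "HC B (inv_cell B \<alpha>) (Id2 B f)"]) (use 1 assms in simp_all)
  show ?B by (rule inv_cell_eqI) (use 1 assms in simp_all)
qed

lemmas invertible_whisker [simp] = invertible_lwhisker_inverse(1) invertible_rwhisker_inverse(1)

lemma invertible_cancel_left:
  assumes "invertible_cell B \<alpha>" "x \<in> Cl B" "y \<in> Cl B" "Cd B x = Dm B \<alpha>" "Cd B y = Dm B \<alpha>"
    "VC B \<alpha> x = VC B \<alpha> y"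
  shows "x = y"
  using inv_cell_VC(1)[of \<alpha> x] inv_cell_VC(1)[of \<alpha> y] assms by metis

lemma invertible_cancel_right:
  assumes "invertible_cell B \<alpha>" "x \<in> Cl B" "y \<in> Cl B" "Dm B x = Cd B \<alpha>" "Dm B y = Cd B \<alpha>"
    "VC B x \<alpha> = VC B y \<alpha>"
  shows "x = y"
proof -
  note [simp] = invertible_Cl[OF assms(1)]
  have "z = VC B (VC B z \<alpha>) (inv_cell B \<alpha>)" if "z \<in> Cl B" "Dm B z = Cd B \<alpha>" for z
    using assms(1) that by simp
  then show ?thesis using assms by metis
qed

end

lemma two_categoryI:
  assumes Src: "\<And>f. f \<in> Ar B \<Longrightarrow> Src B f \<in> Ob B" and Tgt: "\<And>f. f \<in> Ar B \<Longrightarrow> Tgt B f \<in> Ob B"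
    and Idn: "\<And>a. a \<in> Ob B \<Longrightarrow> Idn B a \<in> Ar B \<and> Src B (Idn B a) = a \<and> Tgt B (Idn B a) = a"
    and Cmp: "\<And>f g. f \<in> Ar B \<Longrightarrow> g \<in> Ar B \<Longrightarrow> Tgt B f = Src B g \<Longrightarrow>
      Cmp B g f \<in> Ar B \<and> Src B (Cmp B g f) = Src B f \<and> Tgt B (Cmp B g f) = Tgt B g"
    and Cmp_Idn: "\<And>f. f \<in> Ar B \<Longrightarrow> Cmp B f (Idn B (Src B f)) = f"
      "\<And>f. f \<in> Ar B \<Longrightarrow> Cmp B (Idn B (Tgt B f)) f = f"
    and Cmp_assoc: "\<And>f g h. f \<in> Ar B \<Longrightarrow> g \<in> Ar B \<Longrightarrow> h \<in> Ar B \<Longrightarrow> Tgt B f = Src B g \<Longrightarrow>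
      Tgt B g = Src B h \<Longrightarrow> Cmp B h (Cmp B g f) = Cmp B (Cmp B h g) f"
    and Dm: "\<And>\<alpha>. \<alpha> \<in> Cl B \<Longrightarrow> Dm B \<alpha> \<in> Ar B" and Cd: "\<And>\<alpha>. \<alpha> \<in> Cl B \<Longrightarrow> Cd B \<alpha> \<in> Ar B"
    and par: "\<And>\<alpha>. \<alpha> \<in> Cl B \<Longrightarrow> Src B (Cd B \<alpha>) = Src B (Dm B \<alpha>) \<and> Tgt B (Cd B \<alpha>) = Tgt B (Dm B \<alpha>)"
    and Id2: "\<And>f. f \<in> Ar B \<Longrightarrow> Id2 B f \<in> Cl B \<and> Dm B (Id2 B f) = f \<and> Cd B (Id2 B f) = f"
    and VC: "\<And>\<alpha> \<beta>. \<alpha> \<in> Cl B \<Longrightarrow> \<beta> \<in> Cl B \<Longrightarrow> Cd B \<alpha> = Dm B \<beta> \<Longrightarrow>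
      VC B \<beta> \<alpha> \<in> Cl B \<and> Dm B (VC B \<beta> \<alpha>) = Dm B \<alpha> \<and> Cd B (VC B \<beta> \<alpha>) = Cd B \<beta>"
    and VC_Id2: "\<And>\<alpha>. \<alpha> \<in> Cl B \<Longrightarrow> VC B \<alpha> (Id2 B (Dm B \<alpha>)) = \<alpha>"
      "\<And>\<alpha>. \<alpha> \<in> Cl B \<Longrightarrow> VC B (Id2 B (Cd B \<alpha>)) \<alpha> = \<alpha>"
    and VC_assoc: "\<And>\<alpha> \<beta> \<gamma>. \<alpha> \<in> Cl B \<Longrightarrow> \<beta> \<in> Cl B \<Longrightarrow> \<gamma> \<in> Cl B \<Longrightarrow> Cd B \<alpha> = Dm B \<beta> \<Longrightarrow>
      Cd B \<beta> = Dm B \<gamma> \<Longrightarrow> VC B \<gamma> (VC B \<beta> \<alpha>) = VC B (VC B \<gamma> \<beta>) \<alpha>"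
    and HC: "\<And>\<alpha> \<beta>. \<alpha> \<in> Cl B \<Longrightarrow> \<beta> \<in> Cl B \<Longrightarrow> Tgt B (Dm B \<alpha>) = Src B (Dm B \<beta>) \<Longrightarrow>
      HC B \<beta> \<alpha> \<in> Cl B \<and> Dm B (HC B \<beta> \<alpha>) = Cmp B (Dm B \<beta>) (Dm B \<alpha>) \<and>
      Cd B (HC B \<beta> \<alpha>) = Cmp B (Cd B \<beta>) (Cd B \<alpha>)"
    and HC_Id2: "\<And>\<alpha>. \<alpha> \<in> Cl B \<Longrightarrow> HC B \<alpha> (Id2 B (Idn B (Src B (Dm B \<alpha>)))) = \<alpha>"
      "\<And>\<alpha>. \<alpha> \<in> Cl B \<Longrightarrow> HC B (Id2 B (Idn B (Tgt B (Dm B \<alpha>)))) \<alpha> = \<alpha>"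
    and HC_assoc: "\<And>\<alpha> \<beta> \<gamma>. \<alpha> \<in> Cl B \<Longrightarrow> \<beta> \<in> Cl B \<Longrightarrow> \<gamma> \<in> Cl B \<Longrightarrow> Tgt B (Dm B \<alpha>) = Src B (Dm B \<beta>) \<Longrightarrow>
      Tgt B (Dm B \<beta>) = Src B (Dm B \<gamma>) \<Longrightarrow> HC B \<gamma> (HC B \<beta> \<alpha>) = HC B (HC B \<gamma> \<beta>) \<alpha>"
    and HC_Id2_Id2: "\<And>f g. f \<in> Ar B \<Longrightarrow> g \<in> Ar B \<Longrightarrow> Tgt B f = Src B g \<Longrightarrow>
      HC B (Id2 B g) (Id2 B f) = Id2 B (Cmp B g f)"
    and interchange: "\<And>\<alpha> \<alpha>' \<beta> \<beta>'. \<alpha> \<in> Cl B \<Longrightarrow> \<alpha>' \<in> Cl B \<Longrightarrow> \<beta> \<in> Cl B \<Longrightarrow> \<beta>' \<in> Cl B \<Longrightarrow>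
      Cd B \<alpha> = Dm B \<alpha>' \<Longrightarrow> Cd B \<beta> = Dm B \<beta>' \<Longrightarrow> Tgt B (Dm B \<alpha>) = Src B (Dm B \<beta>) \<Longrightarrow>
      HC B (VC B \<beta>' \<beta>) (VC B \<alpha>' \<alpha>) = VC B (HC B \<beta>' \<alpha>') (HC B \<beta> \<alpha>)"
  shows "two_category B"
proof (unfold_locales, unfold cell_def hom_def, goal_cases)
  case 7 then show ?case using Cmp_assoc by simp
next
  case 16 then show ?case using VC_assoc by simp
next
  case 20 then show ?case using HC_assoc by simp
next
  case 22 then show ?case using interchange by simp
qed (use Src Tgt Idn Cmp Cmp_Idn Dm Cd par Id2 VC VC_Id2 HC HC_Id2 HC_Id2_Id2 in auto)

section \<open>The 2-category of 2-functors\<close>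

lemma two_functorI:
  assumes "two_category B" "two_category D" "FO F \<in> extensional (Ob B)"
    "FA F \<in> extensional (Ar B)" "FC F \<in> extensional (Cl B)"
    "\<And>a. a \<in> Ob B \<Longrightarrow> FO F a \<in> Ob D"
    "\<And>f. f \<in> Ar B \<Longrightarrow> FA F f \<in> Ar D"
    "\<And>f. f \<in> Ar B \<Longrightarrow> Src D (FA F f) = FO F (Src B f)"
    "\<And>f. f \<in> Ar B \<Longrightarrow> Tgt D (FA F f) = FO F (Tgt B f)"
    "\<And>\<alpha>. \<alpha> \<in> Cl B \<Longrightarrow> FC F \<alpha> \<in> Cl D"
    "\<And>\<alpha>. \<alpha> \<in> Cl B \<Longrightarrow> Dm D (FC F \<alpha>) = FA F (Dm B \<alpha>)"
    "\<And>\<alpha>. \<alpha> \<in> Cl B \<Longrightarrow> Cd D (FC F \<alpha>) = FA F (Cd B \<alpha>)"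
    "\<And>a. a \<in> Ob B \<Longrightarrow> FA F (Idn B a) = Idn D (FO F a)"
    "\<And>f g. f \<in> Ar B \<Longrightarrow> g \<in> Ar B \<Longrightarrow> Tgt B f = Src B g \<Longrightarrow>
      FA F (Cmp B g f) = Cmp D (FA F g) (FA F f)"
    "\<And>f. f \<in> Ar B \<Longrightarrow> FC F (Id2 B f) = Id2 D (FA F f)"
    "\<And>\<alpha> \<beta>. \<alpha> \<in> Cl B \<Longrightarrow> \<beta> \<in> Cl B \<Longrightarrow> Cd B \<alpha> = Dm B \<beta> \<Longrightarrow>
      FC F (VC B \<beta> \<alpha>) = VC D (FC F \<beta>) (FC F \<alpha>)"
    "\<And>\<alpha> \<beta>. \<alpha> \<in> Cl B \<Longrightarrow> \<beta> \<in> Cl B \<Longrightarrow> Tgt B (Dm B \<alpha>) = Src B (Dm B \<beta>) \<Longrightarrow>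
      FC F (HC B \<beta> \<alpha>) = HC D (FC F \<beta>) (FC F \<alpha>)"
  shows "two_functor B D F"
  unfolding two_functor_def hom_def cell_def using assms by simp

text \<open>Typing conditions are split so that the simplifier can close them one at a time. A proof
  through \<open>goal_cases\<close> usually has to treat only premises 11 to 13: unit, composites,
  and naturality in 2-cells.\<close>

lemma pseudonaturalI:
  assumes "two_functor B D (PDom \<theta>)" "two_functor B D (PCod \<theta>)"
    "PO \<theta> \<in> extensional (Ob B)" "PA \<theta> \<in> extensional (Ar B)"
    "\<And>X. X \<in> Ob B \<Longrightarrow> PO \<theta> X \<in> Ar D"
    "\<And>X. X \<in> Ob B \<Longrightarrow> Src D (PO \<theta> X) = FO (PDom \<theta>) X"
    "\<And>X. X \<in> Ob B \<Longrightarrow> Tgt D (PO \<theta> X) = FO (PCod \<theta>) X"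
    "\<And>f. f \<in> Ar B \<Longrightarrow> invertible_cell D (PA \<theta> f)"
    "\<And>f. f \<in> Ar B \<Longrightarrow> Dm D (PA \<theta> f) = Cmp D (FA (PCod \<theta>) f) (PO \<theta> (Src B f))"
    "\<And>f. f \<in> Ar B \<Longrightarrow> Cd D (PA \<theta> f) = Cmp D (PO \<theta> (Tgt B f)) (FA (PDom \<theta>) f)"
    "\<And>X. X \<in> Ob B \<Longrightarrow> PA \<theta> (Idn B X) = Id2 D (PO \<theta> X)"
    "\<And>f g. f \<in> Ar B \<Longrightarrow> g \<in> Ar B \<Longrightarrow> Tgt B f = Src B g \<Longrightarrow> PA \<theta> (Cmp B g f) =
      VC D (HC D (PA \<theta> g) (Id2 D (FA (PDom \<theta>) f))) (HC D (Id2 D (FA (PCod \<theta>) g)) (PA \<theta> f))"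
    "\<And>\<gamma>. \<gamma> \<in> Cl B \<Longrightarrow>
      VC D (PA \<theta> (Cd B \<gamma>)) (HC D (FC (PCod \<theta>) \<gamma>) (Id2 D (PO \<theta> (Src B (Dm B \<gamma>))))) =
      VC D (HC D (Id2 D (PO \<theta> (Tgt B (Dm B \<gamma>)))) (FC (PDom \<theta>) \<gamma>)) (PA \<theta> (Dm B \<gamma>))"
  shows "pseudonatural B D \<theta>"
  unfolding pseudonatural_def Let_def hom_def cell_def
  using assms by (simp add: invertible_cell_def)

lemma modificationI:
  assumes "pseudonatural B D (MDom \<rho>)" "pseudonatural B D (MCod \<rho>)"
    "PDom (MCod \<rho>) = PDom (MDom \<rho>)" "PCod (MCod \<rho>) = PCod (MDom \<rho>)"
    "MC \<rho> \<in> extensional (Ob B)"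
    "\<And>X. X \<in> Ob B \<Longrightarrow> MC \<rho> X \<in> Cl D"
    "\<And>X. X \<in> Ob B \<Longrightarrow> Dm D (MC \<rho> X) = PO (MDom \<rho>) X"
    "\<And>X. X \<in> Ob B \<Longrightarrow> Cd D (MC \<rho> X) = PO (MCod \<rho>) X"
    "\<And>f. f \<in> Ar B \<Longrightarrow>
      VC D (HC D (MC \<rho> (Tgt B f)) (Id2 D (FA (PDom (MDom \<rho>)) f))) (PA (MDom \<rho>) f) =
      VC D (PA (MCod \<rho>) f) (HC D (Id2 D (FA (PCod (MDom \<rho>)) f)) (MC \<rho> (Src B f)))"
  shows "modification B D \<rho>"
  unfolding modification_def Let_def cell_def using assms by simp

locale two_category_pair = B: two_category B + D: two_category D
  for B :: "('o, 'm, 'c) twocat" and D :: "('p, 'n, 'd) twocat"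
begin

abbreviation vcomp (infixr "\<cdot>" 70) where "\<beta> \<cdot> \<alpha> \<equiv> VC D \<beta> \<alpha>"
abbreviation hcomp (infixr "\<star>" 75) where "\<beta> \<star> \<alpha> \<equiv> HC D \<beta> \<alpha>"
abbreviation idcell ("\<iota>") where "\<iota> \<equiv> Id2 D"
abbreviation "\<P> \<equiv> Hom_p B D"

lemma two_functor_simps [simp]:
  assumes "two_functor B D F"
  shows "a \<in> Ob B \<Longrightarrow> FO F a \<in> Ob D"
    "f \<in> Ar B \<Longrightarrow> FA F f \<in> Ar D"
    "f \<in> Ar B \<Longrightarrow> Src D (FA F f) = FO F (Src B f)"
    "f \<in> Ar B \<Longrightarrow> Tgt D (FA F f) = FO F (Tgt B f)"
    "\<alpha> \<in> Cl B \<Longrightarrow> FC F \<alpha> \<in> Cl D"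
    "\<alpha> \<in> Cl B \<Longrightarrow> Dm D (FC F \<alpha>) = FA F (Dm B \<alpha>)"
    "\<alpha> \<in> Cl B \<Longrightarrow> Cd D (FC F \<alpha>) = FA F (Cd B \<alpha>)"
    "a \<in> Ob B \<Longrightarrow> FA F (Idn B a) = Idn D (FO F a)"
    "f \<in> Ar B \<Longrightarrow> g \<in> Ar B \<Longrightarrow> Tgt B f = Src B g \<Longrightarrow> FA F (Cmp B g f) = Cmp D (FA F g) (FA F f)"
    "f \<in> Ar B \<Longrightarrow> FC F (Id2 B f) = Id2 D (FA F f)"
    "\<alpha> \<in> Cl B \<Longrightarrow> \<beta> \<in> Cl B \<Longrightarrow> Cd B \<alpha> = Dm B \<beta> \<Longrightarrow> FC F (VC B \<beta> \<alpha>) = FC F \<beta> \<cdot> FC F \<alpha>"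
    "\<alpha> \<in> Cl B \<Longrightarrow> \<beta> \<in> Cl B \<Longrightarrow> Tgt B (Dm B \<alpha>) = Src B (Dm B \<beta>) \<Longrightarrow>
      FC F (HC B \<beta> \<alpha>) = FC F \<beta> \<star> FC F \<alpha>"
  using assms unfolding two_functor_def hom_def cell_def by auto

lemma pseudonatural_simps [simp]:
  assumes "pseudonatural B D \<theta>"
  shows "two_functor B D (PDom \<theta>)" "two_functor B D (PCod \<theta>)"
    "X \<in> Ob B \<Longrightarrow> PO \<theta> X \<in> Ar D"
    "X \<in> Ob B \<Longrightarrow> Src D (PO \<theta> X) = FO (PDom \<theta>) X"
    "X \<in> Ob B \<Longrightarrow> Tgt D (PO \<theta> X) = FO (PCod \<theta>) X"
    "f \<in> Ar B \<Longrightarrow> invertible_cell D (PA \<theta> f)"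
    "f \<in> Ar B \<Longrightarrow> PA \<theta> f \<in> Cl D"
    "f \<in> Ar B \<Longrightarrow> Dm D (PA \<theta> f) = Cmp D (FA (PCod \<theta>) f) (PO \<theta> (Src B f))"
    "f \<in> Ar B \<Longrightarrow> Cd D (PA \<theta> f) = Cmp D (PO \<theta> (Tgt B f)) (FA (PDom \<theta>) f)"
    "X \<in> Ob B \<Longrightarrow> PA \<theta> (Idn B X) = \<iota> (PO \<theta> X)"
    "f \<in> Ar B \<Longrightarrow> g \<in> Ar B \<Longrightarrow> Tgt B f = Src B g \<Longrightarrow> PA \<theta> (Cmp B g f) =
      (PA \<theta> g \<star> \<iota> (FA (PDom \<theta>) f)) \<cdot> (\<iota> (FA (PCod \<theta>) g) \<star> PA \<theta> f)"
  using assms unfolding pseudonatural_def Let_def hom_def cell_def by auto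

lemma pseudonatural_ext:
  assumes "pseudonatural B D \<theta>"
  shows "PO \<theta> \<in> extensional (Ob B)" "PA \<theta> \<in> extensional (Ar B)"
  using assms unfolding pseudonatural_def Let_def by auto

lemma pseudonatural_nat:
  assumes "pseudonatural B D \<theta>" "\<gamma> \<in> Cl B"
  shows "PA \<theta> (Cd B \<gamma>) \<cdot> (FC (PCod \<theta>) \<gamma> \<star> \<iota> (PO \<theta> (Src B (Dm B \<gamma>)))) =
    (\<iota> (PO \<theta> (Tgt B (Dm B \<gamma>))) \<star> FC (PDom \<theta>) \<gamma>) \<cdot> PA \<theta> (Dm B \<gamma>)"
  using assms unfolding pseudonatural_def Let_def by auto

lemma modification_simps [simp]:
  assumes "modification B D \<rho>"
  shows "pseudonatural B D (MDom \<rho>)" "pseudonatural B D (MCod \<rho>)"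
    "PDom (MCod \<rho>) = PDom (MDom \<rho>)" "PCod (MCod \<rho>) = PCod (MDom \<rho>)"
    "X \<in> Ob B \<Longrightarrow> MC \<rho> X \<in> Cl D"
    "X \<in> Ob B \<Longrightarrow> Dm D (MC \<rho> X) = PO (MDom \<rho>) X"
    "X \<in> Ob B \<Longrightarrow> Cd D (MC \<rho> X) = PO (MCod \<rho>) X"
  using assms unfolding modification_def Let_def cell_def by auto

lemma modification_ext: "modification B D \<rho> \<Longrightarrow> MC \<rho> \<in> extensional (Ob B)"
  unfolding modification_def Let_def by auto

lemma modification_nat:
  assumes "modification B D \<rho>" "f \<in> Ar B"
  shows "(MC \<rho> (Tgt B f) \<star> \<iota> (FA (PDom (MDom \<rho>)) f)) \<cdot> PA (MDom \<rho>) f =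
    PA (MCod \<rho>) f \<cdot> (\<iota> (FA (PCod (MDom \<rho>)) f) \<star> MC \<rho> (Src B f))"
  using assms unfolding modification_def Let_def by auto

lemma pseudonatural_id:
  assumes "two_functor B D F"
  shows "pseudonatural B D (id_pnat B D F)"
  by (rule pseudonaturalI) (use assms in \<open>simp_all add: id_pnat_def\<close>)

text \<open>In the law on composites the cell of \<phi> at \<open>g\<close> and the cell of \<theta>
  at \<open>f\<close> have to change places, which is interchange. In the law on 2-cells, \<gamma>
  passes first through the cell of \<phi> and then through that of \<theta>.\<close>

lemma pseudonatural_comp:
  assumes \<theta>: "pseudonatural B D \<theta>" and \<phi>: "pseudonatural B D \<phi>" and eq: "PDom \<phi> = PCod \<theta>"
  shows "pseudonatural B D (comp_pnat B D \<phi> \<theta>)"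
proof (rule pseudonaturalI, goal_cases)
  case a: (12 f g)
  let ?F = "FA (PDom \<theta>)" and ?G = "FA (PCod \<theta>)" and ?H = "FA (PCod \<phi>)"
  have "(PA \<phi> g \<star> \<iota> (Cmp D (PO \<theta> (Tgt B f)) (?F f))) \<cdot> (\<iota> (?H g) \<star> \<iota> (PO \<phi> (Tgt B f)) \<star> PA \<theta> f) =
    (\<iota> (PO \<phi> (Tgt B g)) \<star> \<iota> (?G g) \<star> PA \<theta> f) \<cdot> (PA \<phi> g \<star> \<iota> (Cmp D (?G f) (PO \<theta> (Src B f))))"
    using D.whisker_swap[of "PA \<theta> f" "PA \<phi> g"] a assms by simp
  note sw = D.VC_assoc_eq[OF this]
  show ?case
    using a assms sw by (simp add: comp_pnat_def)
next
  case \<gamma>: (13 \<gamma>)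
  let ?f = "Dm B \<gamma>" and ?g = "Cd B \<gamma>"
  let ?X = "Src B ?f" and ?Y = "Tgt B ?f"
  have "(\<iota> (PO \<phi> ?Y) \<star> PA \<theta> ?g) \<cdot> (PA \<phi> ?g \<star> \<iota> (PO \<theta> ?X)) \<cdot> (FC (PCod \<phi>) \<gamma> \<star> \<iota> (Cmp D (PO \<phi> ?X) (PO \<theta> ?X)))
    = (\<iota> (PO \<phi> ?Y) \<star> PA \<theta> ?g) \<cdot> ((PA \<phi> ?g \<cdot> (FC (PCod \<phi>) \<gamma> \<star> \<iota> (PO \<phi> ?X))) \<star> \<iota> (PO \<theta> ?X))"
    using \<gamma> assms by simp
  also have "\<dots> = (\<iota> (PO \<phi> ?Y) \<star> (PA \<theta> ?g \<cdot> (FC (PCod \<theta>) \<gamma> \<star> \<iota> (PO \<theta> ?X)))) \<cdot> (PA \<phi> ?f \<star> \<iota> (PO \<theta> ?X))"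
    unfolding pseudonatural_nat[OF \<phi> \<gamma>] using \<gamma> assms by simp
  also have "\<dots> = (\<iota> (PO \<phi> ?Y) \<star> \<iota> (PO \<theta> ?Y) \<star> FC (PDom \<theta>) \<gamma>) \<cdot>
      (\<iota> (PO \<phi> ?Y) \<star> PA \<theta> ?f) \<cdot> (PA \<phi> ?f \<star> \<iota> (PO \<theta> ?X))"
    unfolding pseudonatural_nat[OF \<theta> \<gamma>] using \<gamma> assms by simp
  finally show ?case
    using \<gamma> assms by (simp add: comp_pnat_def)
qed (use assms in \<open>simp_all add: comp_pnat_def\<close>)

lemma Hom_p_sel [simp]:
  "Ob \<P> = {F. two_functor B D F}" "Ar \<P> = {\<theta>. pseudonatural B D \<theta>}"
  "Src \<P> = PDom" "Tgt \<P> = PCod" "Idn \<P> = id_pnat B D"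
  "Cmp \<P> = comp_pnat B D" "Cl \<P> = {\<rho>. modification B D \<rho>}"
  "Dm \<P> = MDom" "Cd \<P> = MCod"
  by (simp_all add: Hom_p_def)

lemma MC_Hom_p [simp]:
  "X \<in> Ob B \<Longrightarrow> MC (Id2 \<P> \<theta>) X = \<iota> (PO \<theta> X)"
  "X \<in> Ob B \<Longrightarrow> MC (VC \<P> \<sigma> \<rho>) X = MC \<sigma> X \<cdot> MC \<rho> X"
  "X \<in> Ob B \<Longrightarrow> MC (HC \<P> \<sigma> \<rho>) X = MC \<sigma> X \<star> MC \<rho> X"
  by (simp_all add: Hom_p_def)

lemma modification_eqI:
  fixes \<rho> \<sigma> :: "('o, 'm, 'c, 'p, 'n, 'd) modif"
  assumes "MDom \<rho> = MDom \<sigma>" "MCod \<rho> = MCod \<sigma>" "\<And>X. X \<in> Ob B \<Longrightarrow> MC \<rho> X = MC \<sigma> X"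
    "MC \<rho> \<in> extensional (Ob B)" "MC \<sigma> \<in> extensional (Ob B)"
  shows "\<rho> = \<sigma>"
proof -
  have "MC \<rho> = MC \<sigma>" using extensionalityI[OF assms(4,5)] assms(3) by blast
  then show ?thesis using assms(1,2) by simp
qed

lemma pseudonatural_eqI:
  fixes \<theta> \<phi> :: "('o, 'm, 'c, 'p, 'n, 'd) pnat"
  assumes "PDom \<theta> = PDom \<phi>" "PCod \<theta> = PCod \<phi>" "\<And>X. X \<in> Ob B \<Longrightarrow> PO \<theta> X = PO \<phi> X"
    "\<And>f. f \<in> Ar B \<Longrightarrow> PA \<theta> f = PA \<phi> f"
    "PO \<theta> \<in> extensional (Ob B)" "PO \<phi> \<in> extensional (Ob B)"
    "PA \<theta> \<in> extensional (Ar B)" "PA \<phi> \<in> extensional (Ar B)"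
  shows "\<theta> = \<phi>"
proof -
  have "PO \<theta> = PO \<phi>" using extensionalityI[OF assms(5,6)] assms(3) by blast
  moreover have "PA \<theta> = PA \<phi>" using extensionalityI[OF assms(7,8)] assms(4) by blast
  ultimately show ?thesis using assms(1,2) by simp
qed

lemma comp_pnat_sel [simp]:
  "PDom (comp_pnat B D \<phi> \<theta>) = PDom \<theta>" "PCod (comp_pnat B D \<phi> \<theta>) = PCod \<phi>"
  "X \<in> Ob B \<Longrightarrow> PO (comp_pnat B D \<phi> \<theta>) X = Cmp D (PO \<phi> X) (PO \<theta> X)"
  "f \<in> Ar B \<Longrightarrow> PA (comp_pnat B D \<phi> \<theta>) f =
    (\<iota> (PO \<phi> (Tgt B f)) \<star> PA \<theta> f) \<cdot> (PA \<phi> f \<star> \<iota> (PO \<theta> (Src B f)))"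
  "PO (comp_pnat B D \<phi> \<theta>) \<in> extensional (Ob B)" "PA (comp_pnat B D \<phi> \<theta>) \<in> extensional (Ar B)"
  by (simp_all add: comp_pnat_def)

lemma id_pnat_sel [simp]:
  "PDom (id_pnat B D F) = F" "PCod (id_pnat B D F) = F"
  "X \<in> Ob B \<Longrightarrow> PO (id_pnat B D F) X = Idn D (FO F X)"
  "f \<in> Ar B \<Longrightarrow> PA (id_pnat B D F) f = \<iota> (FA F f)"
  "PO (id_pnat B D F) \<in> extensional (Ob B)" "PA (id_pnat B D F) \<in> extensional (Ar B)"
  by (simp_all add: id_pnat_def)

lemma Hom_p_cells [simp]:
  "MDom (Id2 \<P> \<theta>) = \<theta>" "MCod (Id2 \<P> \<theta>) = \<theta>"
  "MDom (VC \<P> \<sigma> \<rho>) = MDom \<rho>" "MCod (VC \<P> \<sigma> \<rho>) = MCod \<sigma>"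
  "MDom (HC \<P> \<sigma> \<rho>) = comp_pnat B D (MDom \<sigma>) (MDom \<rho>)"
  "MCod (HC \<P> \<sigma> \<rho>) = comp_pnat B D (MCod \<sigma>) (MCod \<rho>)"
  "MC (Id2 \<P> \<theta>) \<in> extensional (Ob B)"
  "MC (VC \<P> \<sigma> \<rho>) \<in> extensional (Ob B)"
  "MC (HC \<P> \<sigma> \<rho>) \<in> extensional (Ob B)"
  by (simp_all add: Hom_p_def)

lemma modification_Id2:
  assumes "pseudonatural B D \<theta>"
  shows "modification B D (Id2 \<P> \<theta>)"
  by (rule modificationI) (use assms in simp_all)

lemma modification_VC:
  assumes \<rho>: "modification B D \<rho>" and \<sigma>: "modification B D \<sigma>" and eq: "MDom \<sigma> = MCod \<rho>"
  shows "modification B D (VC \<P> \<sigma> \<rho>)"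
proof (rule modificationI, goal_cases)
  case f: (9 f)
  let ?X = "Src B f" and ?Y = "Tgt B f" and ?F = "FA (PDom (MDom \<rho>)) f" and ?G = "FA (PCod (MDom \<rho>)) f"
  have "((MC \<sigma> ?Y \<cdot> MC \<rho> ?Y) \<star> \<iota> ?F) \<cdot> PA (MDom \<rho>) f =
      (MC \<sigma> ?Y \<star> \<iota> ?F) \<cdot> ((MC \<rho> ?Y \<star> \<iota> ?F) \<cdot> PA (MDom \<rho>) f)"
    using f assms by simp
  also have "\<dots> = ((MC \<sigma> ?Y \<star> \<iota> ?F) \<cdot> PA (MDom \<sigma>) f) \<cdot> (\<iota> ?G \<star> MC \<rho> ?X)"
    unfolding modification_nat[OF \<rho> f] using f assms by simp
  also have "\<dots> = PA (MCod \<sigma>) f \<cdot> (\<iota> ?G \<star> (MC \<sigma> ?X \<cdot> MC \<rho> ?X))"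
    using modification_nat[OF \<sigma> f] f assms by simp
  finally show ?case
    using f by simp
qed (use assms in simp_all)

text \<open>The composite is split so that \<rho> acts before \<sigma>. Then \<rho> crosses the cell
  of its domain transformation at \<open>f\<close>; two interchanges bring \<sigma> next to the cell
  of the other transformation, which it crosses in turn; the two whiskerings are finally merged
  again.\<close>

lemma modification_HC:
  assumes \<rho>: "modification B D \<rho>" and \<sigma>: "modification B D \<sigma>" and eq: "PDom (MDom \<sigma>) = PCod (MDom \<rho>)"
  shows "modification B D (HC \<P> \<sigma> \<rho>)"
proof (rule modificationI, goal_cases)
  show "pseudonatural B D (MDom (HC \<P> \<sigma> \<rho>))" "pseudonatural B D (MCod (HC \<P> \<sigma> \<rho>))"
    using assms by (simp_all add: pseudonatural_comp)
next
  case f: (9 f)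
  let ?X = "Src B f" and ?Y = "Tgt B f"
  let ?F = "FA (PDom (MDom \<rho>)) f" and ?G = "FA (PCod (MDom \<rho>)) f" and ?H = "FA (PCod (MDom \<sigma>)) f"
  let ?\<theta> = "MDom \<rho>" and ?\<theta>' = "MCod \<rho>" and ?\<phi> = "MDom \<sigma>" and ?\<phi>' = "MCod \<sigma>"
  have "((MC \<sigma> ?Y \<star> MC \<rho> ?Y) \<star> \<iota> ?F) \<cdot> (\<iota> (PO ?\<phi> ?Y) \<star> PA ?\<theta> f) \<cdot> (PA ?\<phi> f \<star> \<iota> (PO ?\<theta> ?X)) =
    (MC \<sigma> ?Y \<star> \<iota> (Cmp D (PO ?\<theta>' ?Y) ?F)) \<cdot> (\<iota> (PO ?\<phi> ?Y) \<star> ((MC \<rho> ?Y \<star> \<iota> ?F) \<cdot> PA ?\<theta> f)) \<cdot>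
      (PA ?\<phi> f \<star> \<iota> (PO ?\<theta> ?X))"
    using f assms D.HC_left_first[of "MC \<rho> ?Y" "MC \<sigma> ?Y"] by simp
  also have "\<dots> = ((MC \<sigma> ?Y \<star> \<iota> (Cmp D (PO ?\<theta>' ?Y) ?F)) \<cdot> (\<iota> (PO ?\<phi> ?Y) \<star> PA ?\<theta>' f)) \<cdot>
      (\<iota> (PO ?\<phi> ?Y) \<star> \<iota> ?G \<star> MC \<rho> ?X) \<cdot> (PA ?\<phi> f \<star> \<iota> (PO ?\<theta> ?X))"
    unfolding modification_nat[OF \<rho> f] using f assms by simp
  also have "(MC \<sigma> ?Y \<star> \<iota> (Cmp D (PO ?\<theta>' ?Y) ?F)) \<cdot> (\<iota> (PO ?\<phi> ?Y) \<star> PA ?\<theta>' f) =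
      (\<iota> (PO ?\<phi>' ?Y) \<star> PA ?\<theta>' f) \<cdot> (MC \<sigma> ?Y \<star> \<iota> (Cmp D ?G (PO ?\<theta>' ?X)))"
    using D.whisker_swap[of "PA ?\<theta>' f" "MC \<sigma> ?Y"] f assms by simp
  also have "(\<iota> (PO ?\<phi> ?Y) \<star> \<iota> ?G \<star> MC \<rho> ?X) \<cdot> (PA ?\<phi> f \<star> \<iota> (PO ?\<theta> ?X)) =
      (PA ?\<phi> f \<star> \<iota> (PO ?\<theta>' ?X)) \<cdot> (\<iota> ?H \<star> \<iota> (PO ?\<phi> ?X) \<star> MC \<rho> ?X)"
    using D.whisker_swap[of "MC \<rho> ?X" "PA ?\<phi> f"] f assms by simp
  also have "((\<iota> (PO ?\<phi>' ?Y) \<star> PA ?\<theta>' f) \<cdot> (MC \<sigma> ?Y \<star> \<iota> (Cmp D ?G (PO ?\<theta>' ?X)))) \<cdot>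
      (PA ?\<phi> f \<star> \<iota> (PO ?\<theta>' ?X)) \<cdot> (\<iota> ?H \<star> \<iota> (PO ?\<phi> ?X) \<star> MC \<rho> ?X) =
    (\<iota> (PO ?\<phi>' ?Y) \<star> PA ?\<theta>' f) \<cdot> (((MC \<sigma> ?Y \<star> \<iota> ?G) \<cdot> PA ?\<phi> f) \<star> \<iota> (PO ?\<theta>' ?X)) \<cdot>
      (\<iota> ?H \<star> \<iota> (PO ?\<phi> ?X) \<star> MC \<rho> ?X)"
    using f assms by simp
  also have "(MC \<sigma> ?Y \<star> \<iota> ?G) \<cdot> PA ?\<phi> f = PA ?\<phi>' f \<cdot> (\<iota> ?H \<star> MC \<sigma> ?X)"
    using modification_nat[OF \<sigma> f] eq by simp
  also have "(\<iota> (PO ?\<phi>' ?Y) \<star> PA ?\<theta>' f) \<cdot> ((PA ?\<phi>' f \<cdot> (\<iota> ?H \<star> MC \<sigma> ?X)) \<star> \<iota> (PO ?\<theta>' ?X)) \<cdot>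
      (\<iota> ?H \<star> \<iota> (PO ?\<phi> ?X) \<star> MC \<rho> ?X) =
    ((\<iota> (PO ?\<phi>' ?Y) \<star> PA ?\<theta>' f) \<cdot> (PA ?\<phi>' f \<star> \<iota> (PO ?\<theta>' ?X))) \<cdot> (\<iota> ?H \<star> (MC \<sigma> ?X \<star> MC \<rho> ?X))"
    using f assms D.HC_left_first[of "MC \<rho> ?X" "MC \<sigma> ?X"] by simp
  finally show ?case
    using f by simp
qed (use assms in simp_all)

lemma two_category_Hom_p: "two_category (Hom_p B D)"
proof (rule two_categoryI)
  fix \<theta> assume \<theta>: "\<theta> \<in> Ar \<P>"
  show "Cmp \<P> \<theta> (Idn \<P> (Src \<P> \<theta>)) = \<theta>"
    "Cmp \<P> (Idn \<P> (Tgt \<P> \<theta>)) \<theta> = \<theta>"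
    by (rule pseudonatural_eqI; use \<theta> in \<open>simp add: pseudonatural_ext\<close>)+
next
  fix \<theta> \<phi> \<psi> assume a: "\<theta> \<in> Ar \<P>" "\<phi> \<in> Ar \<P>" "\<psi> \<in> Ar \<P>"
    "Tgt \<P> \<theta> = Src \<P> \<phi>" "Tgt \<P> \<phi> = Src \<P> \<psi>"
  show "Cmp \<P> \<psi> (Cmp \<P> \<phi> \<theta>) = Cmp \<P> (Cmp \<P> \<psi> \<phi>) \<theta>"
    by (rule pseudonatural_eqI; use a in \<open>simp add: pseudonatural_ext\<close>)
next
  fix \<rho> assume \<rho>: "\<rho> \<in> Cl \<P>"
  show "VC \<P> \<rho> (Id2 \<P> (Dm \<P> \<rho>)) = \<rho>"
    "VC \<P> (Id2 \<P> (Cd \<P> \<rho>)) \<rho> = \<rho>"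
    by (rule modification_eqI; use \<rho> in \<open>simp add: modification_ext\<close>)+
  \<comment> \<open>Equality of modifications includes equality of their boundary transformations,
    so the unit laws for transformations come before those for horizontal composition.\<close>
  have u: "comp_pnat B D \<theta> (id_pnat B D (PDom \<theta>)) = \<theta>" "comp_pnat B D (id_pnat B D (PCod \<theta>)) \<theta> = \<theta>"
    if "pseudonatural B D \<theta>" for \<theta>
    by (rule pseudonatural_eqI; use that in \<open>simp add: pseudonatural_ext\<close>)+
  show "HC \<P> \<rho> (Id2 \<P> (Idn \<P> (Src \<P> (Dm \<P> \<rho>)))) = \<rho>"
    "HC \<P> (Id2 \<P> (Idn \<P> (Tgt \<P> (Dm \<P> \<rho>)))) \<rho> = \<rho>"
    by (rule modification_eqI; use \<rho> u[of "MDom \<rho>"] u[of "MCod \<rho>"] in \<open>simp add: modification_ext\<close>)+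
next
  fix \<rho> \<sigma> \<tau> assume a: "\<rho> \<in> Cl \<P>" "\<sigma> \<in> Cl \<P>" "\<tau> \<in> Cl \<P>"
  show "VC \<P> \<tau> (VC \<P> \<sigma> \<rho>) = VC \<P> (VC \<P> \<tau> \<sigma>) \<rho>"
    if "Cd \<P> \<rho> = Dm \<P> \<sigma>" "Cd \<P> \<sigma> = Dm \<P> \<tau>"
    by (rule modification_eqI; use a that in simp)
  have u: "comp_pnat B D \<psi> (comp_pnat B D \<phi> \<theta>) = comp_pnat B D (comp_pnat B D \<psi> \<phi>) \<theta>"
    if "pseudonatural B D \<theta>" "pseudonatural B D \<phi>" "pseudonatural B D \<psi>" "PCod \<theta> = PDom \<phi>"
      "PCod \<phi> = PDom \<psi>" for \<theta> \<phi> \<psi>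
    by (rule pseudonatural_eqI; use that in \<open>simp add: pseudonatural_ext\<close>)
  show "HC \<P> \<tau> (HC \<P> \<sigma> \<rho>) = HC \<P> (HC \<P> \<tau> \<sigma>) \<rho>"
    if "Tgt \<P> (Dm \<P> \<rho>) = Src \<P> (Dm \<P> \<sigma>)"
      "Tgt \<P> (Dm \<P> \<sigma>) = Src \<P> (Dm \<P> \<tau>)"
    by (rule modification_eqI; use a that u in simp)
next
  fix \<rho> \<rho>' \<sigma> \<sigma>' assume a: "\<rho> \<in> Cl \<P>" "\<rho>' \<in> Cl \<P>" "\<sigma> \<in> Cl \<P>"
    "\<sigma>' \<in> Cl \<P>" "Cd \<P> \<rho> = Dm \<P> \<rho>'" "Cd \<P> \<sigma> = Dm \<P> \<sigma>'"
    "Tgt \<P> (Dm \<P> \<rho>) = Src \<P> (Dm \<P> \<sigma>)"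
  show "HC \<P> (VC \<P> \<sigma>' \<sigma>) (VC \<P> \<rho>' \<rho>) =
      VC \<P> (HC \<P> \<sigma>' \<rho>') (HC \<P> \<sigma> \<rho>)"
    by (rule modification_eqI; use a in \<open>simp add: D.HC_VC\<close>)
next
  fix \<theta> \<phi> assume a: "\<theta> \<in> Ar \<P>" "\<phi> \<in> Ar \<P>" "Tgt \<P> \<theta> = Src \<P> \<phi>"
  show "HC \<P> (Id2 \<P> \<phi>) (Id2 \<P> \<theta>) =
      Id2 \<P> (Cmp \<P> \<phi> \<theta>)"
    by (rule modification_eqI; use a in simp)
qed (simp_all add: pseudonatural_id pseudonatural_comp modification_Id2 modification_VC modification_HC)

end

section \<open>Pointwise equivalences\<close>

context two_category
begin

lemma equivalence_Ar: "equivalence B s \<Longrightarrow> s \<in> Ar B"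
  by (simp add: equivalence_def)

lemma equivalence_cancel:
  assumes "equivalence B s" "c \<in> Cl B" "c' \<in> Cl B" "Dm B c = Dm B c'" "Cd B c = Cd B c'"
    "Tgt B (Dm B c) = Src B s" "HC B (Id2 B s) c = HC B (Id2 B s) c'"
  shows "c = c'"
  by (rule equivalence_faithful[of s c "Dm B c" "Cd B c"]) (use assms in \<open>simp_all add: cell_iff\<close>)

lemma equivalence_lift:
  assumes s: "equivalence B s" and "a \<in> Ar B" "b \<in> Ar B" "Src B a = Src B b" "Tgt B a = Src B s"
    "Tgt B b = Src B s" "\<beta> \<in> Cl B" "Dm B \<beta> = Cmp B s a" "Cd B \<beta> = Cmp B s b"
  obtains c where "c \<in> Cl B" "Dm B c = a" "Cd B c = b" "HC B (Id2 B s) c = \<beta>"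
  using equivalence_full[OF s, of a "Src B b" b \<beta>] assms by (auto simp: hom_def cell_iff)

text \<open>Whiskering with \<open>s\<close> is full, so the inverse of the whiskered cell lifts; it
  is also faithful, so the lift satisfies the equations of an inverse.\<close>

lemma invertible_reflect:
  assumes s: "equivalence B s" and c: "c \<in> Cl B" and t: "Tgt B (Dm B c) = Src B s"
    and i: "invertible_cell B (HC B (Id2 B s) c)"
  shows "invertible_cell B c"
proof -
  note [simp] = equivalence_Ar[OF s]
  obtain d where d: "d \<in> Cl B" "Dm B d = Cd B c" "Cd B d = Dm B c"
    "HC B (Id2 B s) d = inv_cell B (HC B (Id2 B s) c)"
    by (rule equivalence_lift[OF s, of "Cd B c" "Dm B c" "inv_cell B (HC B (Id2 B s) c)"])
      (use c t i in simp_all)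
  show ?thesis
  proof (rule invertible_cellI[OF c d(1-3)])
    show "VC B d c = Id2 B (Dm B c)" "VC B c d = Id2 B (Cd B c)"
      by (rule equivalence_cancel[OF s]; use d c t i in simp)+
  qed
qed

text \<open>The unit is the lift of \<open>\<epsilon>\<inverse> s : s \<Rightarrow> s g s\<close>
  through whiskering with \<open>s\<close>, and its inverse is the lift of
  \<open>\<epsilon> s\<close>. Only the counit has to be constructed, which spares a second
  construction for transformations.\<close>

lemma equivalenceI_fully_faithful:
  assumes s: "s \<in> Ar B" and g: "g \<in> Ar B" "Src B g = Tgt B s" "Tgt B g = Src B s"
    and \<epsilon>: "invertible_cell B \<epsilon>" "Dm B \<epsilon> = Cmp B s g" "Cd B \<epsilon> = Idn B (Tgt B s)"
    and faithful: "\<And>c c'. c \<in> Cl B \<Longrightarrow> c' \<in> Cl B \<Longrightarrow> Dm B c = Dm B c' \<Longrightarrow> Cd B c = Cd B c' \<Longrightarrow>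
      Tgt B (Dm B c) = Src B s \<Longrightarrow> HC B (Id2 B s) c = HC B (Id2 B s) c' \<Longrightarrow> c = c'"
    and full: "\<And>a b \<beta>. a \<in> Ar B \<Longrightarrow> b \<in> Ar B \<Longrightarrow> Src B a = Src B b \<Longrightarrow> Tgt B a = Src B s \<Longrightarrow>
      Tgt B b = Src B s \<Longrightarrow> \<beta> \<in> Cl B \<Longrightarrow> Dm B \<beta> = Cmp B s a \<Longrightarrow> Cd B \<beta> = Cmp B s b \<Longrightarrow>
      \<exists>c. c \<in> Cl B \<and> Dm B c = a \<and> Cd B c = b \<and> HC B (Id2 B s) c = \<beta>"
  shows "equivalence B s"
proof -
  note [simp] = s g \<epsilon> invertible_Cl[OF \<epsilon>(1)]
  let ?e = "HC B \<epsilon> (Id2 B s)" and ?e' = "HC B (inv_cell B \<epsilon>) (Id2 B s)"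
  have inv: "VC B ?e ?e' = Id2 B s" "VC B ?e' ?e = Id2 B (Cmp B s (Cmp B g s))"
    using HC_simps(7)[of \<epsilon> "inv_cell B \<epsilon>" s, symmetric] HC_simps(7)[of "inv_cell B \<epsilon>" \<epsilon> s, symmetric]
    by simp_all
  obtain \<eta> where \<eta>: "\<eta> \<in> Cl B" "Dm B \<eta> = Idn B (Src B s)" "Cd B \<eta> = Cmp B g s"
    "HC B (Id2 B s) \<eta> = ?e'"
    using full[of "Idn B (Src B s)" "Cmp B g s" ?e'] by auto
  obtain \<eta>' where \<eta>': "\<eta>' \<in> Cl B" "Cd B \<eta>' = Idn B (Src B s)" "Dm B \<eta>' = Cmp B g s"
    "HC B (Id2 B s) \<eta>' = ?e"
    using full[of "Cmp B g s" "Idn B (Src B s)" ?e] by auto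
  have "VC B \<eta>' \<eta> = Id2 B (Idn B (Src B s))" "VC B \<eta> \<eta>' = Id2 B (Cmp B g s)"
    by (rule faithful; use \<eta> \<eta>' inv in simp)+
  then show ?thesis
    using \<eta> \<eta>' by (intro equivalenceI[of s g \<eta> \<eta>' \<epsilon> "inv_cell B \<epsilon>"]) (simp_all add: hom_def cell_iff)
qed

lemma equivalence_inverse:
  assumes "equivalence B s"
  obtains g \<epsilon> where "g \<in> Ar B" "Src B g = Tgt B s" "Tgt B g = Src B s" "equivalence B g"
    "invertible_cell B \<epsilon>" "Dm B \<epsilon> = Cmp B s g" "Cd B \<epsilon> = Idn B (Tgt B s)"
  using assms
proof (rule equivalenceE, goal_cases)
  case (1 g \<eta> \<eta>' \<epsilon> \<epsilon>')
  have "equivalence B g"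
    using 1 by (intro equivalenceI[of g s \<epsilon>' \<epsilon> \<eta>' \<eta>]) (auto simp: hom_def)
  moreover have "invertible_cell B \<epsilon>" using 1 by (intro invertible_cellI[of \<epsilon> \<epsilon>']) (auto simp: cell_iff)
  ultimately show ?case using 1 by (auto simp: hom_def cell_iff)
qed

lemma equivalence_Idn: "a \<in> Ob B \<Longrightarrow> equivalence B (Idn B a)"
  by (rule equivalenceI_fully_faithful[of _ "Idn B a" "Id2 B (Idn B a)"]) auto

text \<open>Full faithfulness of whiskering is inherited by composites, so a counit suffices:
  \<open>t s g h \<Rightarrow> t h \<Rightarrow> id\<close>, given by \<epsilon> whiskered on both
  sides and then \<delta>.\<close>

lemma equivalence_Cmp:
  assumes s: "equivalence B s" and t: "equivalence B t" and st: "Tgt B s = Src B t"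
  shows "equivalence B (Cmp B t s)"
proof -
  note [simp] = equivalence_Ar[OF s] equivalence_Ar[OF t] st
  obtain g \<epsilon> where g [simp]: "g \<in> Ar B" "Src B g = Src B t" "Tgt B g = Src B s"
    "invertible_cell B \<epsilon>" "Dm B \<epsilon> = Cmp B s g" "Cd B \<epsilon> = Idn B (Src B t)"
    using equivalence_inverse[OF s] st by metis
  obtain h \<delta> where h [simp]: "h \<in> Ar B" "Src B h = Tgt B t" "Tgt B h = Src B t"
    "invertible_cell B \<delta>" "Dm B \<delta> = Cmp B t h" "Cd B \<delta> = Idn B (Tgt B t)"
    using equivalence_inverse[OF t] by metis
  note [simp] = invertible_Cl[OF g(4)] invertible_Cl[OF h(4)]
  have e: "invertible_cell B (HC B (Id2 B t) (HC B \<epsilon> (Id2 B h)))"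
    by (intro invertible_whisker) simp_all
  show ?thesis
  proof (rule equivalenceI_fully_faithful[of _ "Cmp B g h"
        "VC B \<delta> (HC B (Id2 B t) (HC B \<epsilon> (Id2 B h)))"])
    show "invertible_cell B (VC B \<delta> (HC B (Id2 B t) (HC B \<epsilon> (Id2 B h))))"
      by (rule invertible_VC) (use e in simp_all)
  next
    fix c c' assume a: "c \<in> Cl B" "c' \<in> Cl B" "Dm B c = Dm B c'" "Cd B c = Cd B c'"
      "Tgt B (Dm B c) = Src B (Cmp B t s)" "HC B (Id2 B (Cmp B t s)) c = HC B (Id2 B (Cmp B t s)) c'"
    have "HC B (Id2 B s) c = HC B (Id2 B s) c'"
      by (rule equivalence_cancel[OF t]) (use a in simp_all)
    then show "c = c'" by (rule equivalence_cancel[OF s, rotated -1]) (use a in simp_all)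
  next
    fix a b \<beta> assume a: "a \<in> Ar B" "b \<in> Ar B" "Src B a = Src B b" "Tgt B a = Src B (Cmp B t s)"
      "Tgt B b = Src B (Cmp B t s)" "\<beta> \<in> Cl B" "Dm B \<beta> = Cmp B (Cmp B t s) a"
      "Cd B \<beta> = Cmp B (Cmp B t s) b"
    obtain d where d: "d \<in> Cl B" "Dm B d = Cmp B s a" "Cd B d = Cmp B s b" "HC B (Id2 B t) d = \<beta>"
      by (rule equivalence_lift[OF t, of "Cmp B s a" "Cmp B s b" \<beta>]) (use a in simp_all)
    obtain c where "c \<in> Cl B" "Dm B c = a" "Cd B c = b" "HC B (Id2 B s) c = d"
      by (rule equivalence_lift[OF s, of a b d]) (use a d in simp_all)
    then show "\<exists>c. c \<in> Cl B \<and> Dm B c = a \<and> Cd B c = b \<and> HC B (Id2 B (Cmp B t s)) c = \<beta>"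
      using a d by (intro exI[of _ c]) simp
  qed simp_all
qed

end

section \<open>Transformations whose components are equivalences\<close>

context two_category_pair
begin

interpretation H: two_category \<P> by (rule two_category_Hom_p)

text \<open>The modification square remains valid when both sides are composed with the inverse
  components, and this turns it into the square for the inverses.\<close>

lemma modification_inverse:
  assumes \<rho>: "modification B D \<rho>" and i: "\<And>X. X \<in> Ob B \<Longrightarrow> invertible_cell D (MC \<rho> X)"
  shows "invertible_cell \<P> \<rho>" (is ?A)
    and "X \<in> Ob B \<Longrightarrow> MC (inv_cell \<P> \<rho>) X = inv_cell D (MC \<rho> X)"
proof -
  define \<sigma> where "\<sigma> = \<lparr>MDom = MCod \<rho>, MCod = MDom \<rho>, MC = (\<lambda>X\<in>Ob B. inv_cell D (MC \<rho> X))\<rparr>"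
  have [simp]: "MDom \<sigma> = MCod \<rho>" "MCod \<sigma> = MDom \<rho>" "\<And>X. X \<in> Ob B \<Longrightarrow> MC \<sigma> X = inv_cell D (MC \<rho> X)"
    "MC \<sigma> \<in> extensional (Ob B)"
    by (simp_all add: \<sigma>_def)
  have \<sigma>: "modification B D \<sigma>"
  proof (rule modificationI, goal_cases)
    case f: (9 f)
    let ?X = "Src B f" and ?Y = "Tgt B f" and ?F = "FA (PDom (MDom \<rho>)) f" and ?G = "FA (PCod (MDom \<rho>)) f"
    have iX: "(\<iota> ?G \<star> MC \<rho> ?X) \<cdot> (\<iota> ?G \<star> inv_cell D (MC \<rho> ?X)) = \<iota> (Cmp D ?G (PO (MCod \<rho>) ?X))"
      "(inv_cell D (MC \<rho> ?Y) \<star> \<iota> ?F) \<cdot> (MC \<rho> ?Y \<star> \<iota> ?F) = \<iota> (Cmp D (PO (MDom \<rho>) ?Y) ?F)"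
      using D.HC_simps(6)[of "inv_cell D (MC \<rho> ?X)" "MC \<rho> ?X" ?G, symmetric]
        D.HC_simps(7)[of "MC \<rho> ?Y" "inv_cell D (MC \<rho> ?Y)" ?F, symmetric] f \<rho> i by simp_all
    have "(inv_cell D (MC \<rho> ?Y) \<star> \<iota> ?F) \<cdot> PA (MCod \<rho>) f =
      (inv_cell D (MC \<rho> ?Y) \<star> \<iota> ?F) \<cdot> PA (MCod \<rho>) f \<cdot> ((\<iota> ?G \<star> MC \<rho> ?X) \<cdot> (\<iota> ?G \<star> inv_cell D (MC \<rho> ?X)))"
      unfolding iX using f \<rho> i by simp
    also have "\<dots> = (inv_cell D (MC \<rho> ?Y) \<star> \<iota> ?F) \<cdot> (PA (MCod \<rho>) f \<cdot> (\<iota> ?G \<star> MC \<rho> ?X)) \<cdot>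
        (\<iota> ?G \<star> inv_cell D (MC \<rho> ?X))"
      using f \<rho> i by simp
    also have "\<dots> = ((inv_cell D (MC \<rho> ?Y) \<star> \<iota> ?F) \<cdot> (MC \<rho> ?Y \<star> \<iota> ?F)) \<cdot> PA (MDom \<rho>) f \<cdot>
        (\<iota> ?G \<star> inv_cell D (MC \<rho> ?X))"
      unfolding modification_nat[OF \<rho> f, symmetric] using f \<rho> i by simp
    also have "\<dots> = PA (MDom \<rho>) f \<cdot> (\<iota> ?G \<star> inv_cell D (MC \<rho> ?X))"
      unfolding iX using f \<rho> i by simp
    finally show ?case
      using f \<rho> by simp
  qed (use \<rho> i in simp_all)
  have v: "VC \<P> \<sigma> \<rho> = Id2 \<P> (MDom \<rho>)" "VC \<P> \<rho> \<sigma> = Id2 \<P> (MCod \<rho>)"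
    by (rule modification_eqI; use \<rho> i in simp)+
  show ?A by (rule H.invertible_cellI[of _ \<sigma>]) (use \<rho> \<sigma> v in simp_all)
  have "inv_cell \<P> \<rho> = \<sigma>" by (rule H.inv_cell_eqI) (use \<rho> \<sigma> v in simp_all)
  then show "X \<in> Ob B \<Longrightarrow> MC (inv_cell \<P> \<rho>) X = inv_cell D (MC \<rho> X)" by simp
qed

text \<open>The components are lifted separately at each object. They form a modification because
  the required equation holds after whiskering with \<open>\<theta>_Y\<close> and pasting with
  \<open>\<theta>_f\<close>, and both operations can be cancelled.\<close>

lemma modification_lift:
  assumes \<theta>: "pseudonatural B D \<theta>" and E: "\<And>X. X \<in> Ob B \<Longrightarrow> equivalence D (PO \<theta> X)"
    and \<alpha>: "pseudonatural B D \<alpha>" "PCod \<alpha> = PDom \<theta>" and \<beta>: "pseudonatural B D \<beta>" "PCod \<beta> = PDom \<theta>"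
    and eq: "PDom \<alpha> = PDom \<beta>"
    and \<rho>: "modification B D \<rho>" "MDom \<rho> = comp_pnat B D \<theta> \<alpha>" "MCod \<rho> = comp_pnat B D \<theta> \<beta>"
  shows "\<exists>\<sigma>. modification B D \<sigma> \<and> MDom \<sigma> = \<alpha> \<and> MCod \<sigma> = \<beta> \<and>
    HC \<P> (Id2 \<P> \<theta>) \<sigma> = \<rho>"
proof -
  have "\<forall>X\<in>Ob B. \<exists>c. c \<in> Cl D \<and> Dm D c = PO \<alpha> X \<and> Cd D c = PO \<beta> X \<and> \<iota> (PO \<theta> X) \<star> c = MC \<rho> X"
  proof
    fix X assume X: "X \<in> Ob B"
    show "\<exists>c. c \<in> Cl D \<and> Dm D c = PO \<alpha> X \<and> Cd D c = PO \<beta> X \<and> \<iota> (PO \<theta> X) \<star> c = MC \<rho> X"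
      by (rule D.equivalence_lift[OF E[OF X], of "PO \<alpha> X" "PO \<beta> X" "MC \<rho> X"])
        (use X \<theta> \<alpha> \<beta> eq \<rho> in auto)
  qed
  then obtain s where s [simp]: "\<And>X. X \<in> Ob B \<Longrightarrow> s X \<in> Cl D" "\<And>X. X \<in> Ob B \<Longrightarrow> Dm D (s X) = PO \<alpha> X"
    "\<And>X. X \<in> Ob B \<Longrightarrow> Cd D (s X) = PO \<beta> X" "\<And>X. X \<in> Ob B \<Longrightarrow> \<iota> (PO \<theta> X) \<star> s X = MC \<rho> X"
    by metis
  define \<sigma> where "\<sigma> = \<lparr>MDom = \<alpha>, MCod = \<beta>, MC = (\<lambda>X\<in>Ob B. s X)\<rparr>"
  have [simp]: "MDom \<sigma> = \<alpha>" "MCod \<sigma> = \<beta>" "\<And>X. X \<in> Ob B \<Longrightarrow> MC \<sigma> X = s X" "MC \<sigma> \<in> extensional (Ob B)"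
    by (simp_all add: \<sigma>_def)
  have \<sigma>: "modification B D \<sigma>"
  proof (rule modificationI, goal_cases)
    case f: (9 f)
    note [simp] = \<theta> \<alpha> \<beta> eq f
    let ?X = "Src B f" and ?Y = "Tgt B f"
    let ?F = "FA (PDom \<theta>) f" and ?G = "FA (PCod \<theta>) f" and ?K = "FA (PDom \<beta>) f"
    have "(s ?Y \<star> \<iota> ?K) \<cdot> PA \<alpha> f = PA \<beta> f \<cdot> (\<iota> ?F \<star> s ?X)"
    proof (rule D.equivalence_cancel[OF E[of ?Y]])
      have "(\<iota> (PO \<theta> ?Y) \<star> ((s ?Y \<star> \<iota> ?K) \<cdot> PA \<alpha> f)) \<cdot> (PA \<theta> f \<star> \<iota> (PO \<alpha> ?X)) =
        (\<iota> (PO \<theta> ?Y) \<star> s ?Y \<star> \<iota> ?K) \<cdot> (\<iota> (PO \<theta> ?Y) \<star> PA \<alpha> f) \<cdot> (PA \<theta> f \<star> \<iota> (PO \<alpha> ?X))"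
        by simp
      also have "\<iota> (PO \<theta> ?Y) \<star> s ?Y \<star> \<iota> ?K = MC \<rho> ?Y \<star> \<iota> ?K"
        using D.HC_simps(4)[of "\<iota> ?K" "s ?Y" "\<iota> (PO \<theta> ?Y)"] by simp
      also have "(MC \<rho> ?Y \<star> \<iota> ?K) \<cdot> (\<iota> (PO \<theta> ?Y) \<star> PA \<alpha> f) \<cdot> (PA \<theta> f \<star> \<iota> (PO \<alpha> ?X)) =
          (\<iota> (PO \<theta> ?Y) \<star> PA \<beta> f) \<cdot> (PA \<theta> f \<star> \<iota> (PO \<beta> ?X)) \<cdot> (\<iota> ?G \<star> (\<iota> (PO \<theta> ?X) \<star> s ?X))"
        using modification_nat[OF \<rho>(1) f] \<rho> by simp
      also have "(PA \<theta> f \<star> \<iota> (PO \<beta> ?X)) \<cdot> (\<iota> ?G \<star> (\<iota> (PO \<theta> ?X) \<star> s ?X)) =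
          (\<iota> (PO \<theta> ?Y) \<star> \<iota> ?F \<star> s ?X) \<cdot> (PA \<theta> f \<star> \<iota> (PO \<alpha> ?X))"
        using D.whisker_swap[of "s ?X" "PA \<theta> f"] by (simp del: s(4))
      also have "(\<iota> (PO \<theta> ?Y) \<star> PA \<beta> f) \<cdot> (\<iota> (PO \<theta> ?Y) \<star> \<iota> ?F \<star> s ?X) \<cdot> (PA \<theta> f \<star> \<iota> (PO \<alpha> ?X)) =
          (\<iota> (PO \<theta> ?Y) \<star> (PA \<beta> f \<cdot> (\<iota> ?F \<star> s ?X))) \<cdot> (PA \<theta> f \<star> \<iota> (PO \<alpha> ?X))"
        by simp
      finally show "\<iota> (PO \<theta> ?Y) \<star> ((s ?Y \<star> \<iota> ?K) \<cdot> PA \<alpha> f) = \<iota> (PO \<theta> ?Y) \<star> (PA \<beta> f \<cdot> (\<iota> ?F \<star> s ?X))"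
        by (rule D.invertible_cancel_right[rotated -1]) simp_all
    qed simp_all
    then show ?case by simp
  qed (use \<alpha> \<beta> eq in simp_all)
  have "HC \<P> (Id2 \<P> \<theta>) \<sigma> = \<rho>"
    by (rule modification_eqI) (use \<sigma> \<rho> modification_ext in simp_all)
  then show ?thesis using \<sigma> by auto
qed

text \<open>Pointwise quasi-inverses come without structure cells. Demanding that the counits
  \<open>e\<close> form a modification determines these cells uniquely, and uniqueness then proves
  the unit and composition laws: it is enough that both sides solve the same equation.\<close>

lemma pseudonatural_quasi_inverse:
  assumes \<theta>: "pseudonatural B D \<theta>" and E: "\<And>X. X \<in> Ob B \<Longrightarrow> equivalence D (PO \<theta> X)"
  obtains \<psi> \<epsilon> where "pseudonatural B D \<psi>" "PDom \<psi> = PCod \<theta>" "PCod \<psi> = PDom \<theta>"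
    "invertible_cell \<P> \<epsilon>" "MDom \<epsilon> = comp_pnat B D \<theta> \<psi>" "MCod \<epsilon> = id_pnat B D (PCod \<theta>)"
proof -
  let ?F = "PDom \<theta>" and ?G = "PCod \<theta>"
  note [simp] = \<theta>
  have "\<forall>X\<in>Ob B. \<exists>g \<epsilon>. g \<in> Ar D \<and> Src D g = FO ?G X \<and> Tgt D g = FO ?F X \<and>
    invertible_cell D \<epsilon> \<and> Dm D \<epsilon> = Cmp D (PO \<theta> X) g \<and> Cd D \<epsilon> = Idn D (FO ?G X)"
  proof
    fix X assume X: "X \<in> Ob B"
    then show "\<exists>g \<epsilon>. g \<in> Ar D \<and> Src D g = FO ?G X \<and> Tgt D g = FO ?F X \<and>
      invertible_cell D \<epsilon> \<and> Dm D \<epsilon> = Cmp D (PO \<theta> X) g \<and> Cd D \<epsilon> = Idn D (FO ?G X)"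
      using D.equivalence_inverse[OF E[OF X]] pseudonatural_simps(4,5)[OF \<theta> X] by metis
  qed
  then obtain g e where g [simp]:
    "\<And>X. X \<in> Ob B \<Longrightarrow> g X \<in> Ar D" "\<And>X. X \<in> Ob B \<Longrightarrow> Src D (g X) = FO ?G X"
    "\<And>X. X \<in> Ob B \<Longrightarrow> Tgt D (g X) = FO ?F X" "\<And>X. X \<in> Ob B \<Longrightarrow> invertible_cell D (e X)"
    "\<And>X. X \<in> Ob B \<Longrightarrow> Dm D (e X) = Cmp D (PO \<theta> X) (g X)"
    "\<And>X. X \<in> Ob B \<Longrightarrow> Cd D (e X) = Idn D (FO ?G X)"
    unfolding bchoice_iff by blast
  have [simp]: "\<And>X. X \<in> Ob B \<Longrightarrow> e X \<in> Cl D" using D.invertible_Cl g(4) by blast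
  \<comment> \<open>\<open>P f c\<close> says that \<open>e\<close> satisfies the modification axiom at \<open>f\<close> when \<open>c\<close> is the structure cell of
    the inverse; it determines \<open>c\<close> because \<open>\<theta>\<close> is pointwise an equivalence.\<close>
  define P where "P = (\<lambda>f c. c \<in> Cl D \<and> Dm D c = Cmp D (FA ?F f) (g (Src B f)) \<and>
    Cd D c = Cmp D (g (Tgt B f)) (FA ?G f) \<and>
    (e (Tgt B f) \<star> \<iota> (FA ?G f)) \<cdot> (\<iota> (PO \<theta> (Tgt B f)) \<star> c) \<cdot> (PA \<theta> f \<star> \<iota> (g (Src B f))) =
      \<iota> (FA ?G f) \<star> e (Src B f))"
  have P_unique: "c = c'" if f [simp]: "f \<in> Ar B" and c: "P f c" "P f c'" for f c c'
  proof (rule D.equivalence_cancel[OF E[of "Tgt B f"]])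
    note [simp] = c[unfolded P_def]
    have "(\<iota> (PO \<theta> (Tgt B f)) \<star> c) \<cdot> (PA \<theta> f \<star> \<iota> (g (Src B f))) =
        (\<iota> (PO \<theta> (Tgt B f)) \<star> c') \<cdot> (PA \<theta> f \<star> \<iota> (g (Src B f)))"
      by (rule D.invertible_cancel_left[of "e (Tgt B f) \<star> \<iota> (FA ?G f)"]) simp_all
    then show "\<iota> (PO \<theta> (Tgt B f)) \<star> c = \<iota> (PO \<theta> (Tgt B f)) \<star> c'"
      by (rule D.invertible_cancel_right[rotated -1]) simp_all
  qed (use c in \<open>simp_all add: P_def\<close>)
  have "\<exists>c. invertible_cell D c \<and> P f c" if f [simp]: "f \<in> Ar B" for f
  proof -
    let ?X = "Src B f" and ?Y = "Tgt B f"
    \<comment> \<open>\<open>?T\<close> is the equation of \<open>P\<close> solved for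
      \<open>c\<close> whiskered with \<open>\<theta>_Y\<close>; fullness of this whiskering
      supplies \<open>c\<close>.\<close>
    let ?T = "inv_cell D (e ?Y \<star> \<iota> (FA ?G f)) \<cdot> (\<iota> (FA ?G f) \<star> e ?X) \<cdot> inv_cell D (PA \<theta> f \<star> \<iota> (g ?X))"
    have [simp]: "invertible_cell D (PA \<theta> f \<star> \<iota> (g ?X))" "invertible_cell D (e ?Y \<star> \<iota> (FA ?G f))" by simp_all
    have T: "invertible_cell D ?T" by (intro D.invertible_VC) simp_all
    obtain c where c: "c \<in> Cl D" "Dm D c = Cmp D (FA ?F f) (g ?X)"
      "Cd D c = Cmp D (g ?Y) (FA ?G f)" "\<iota> (PO \<theta> ?Y) \<star> c = ?T"
      by (rule D.equivalence_lift[OF E[of ?Y], of "Cmp D (FA ?F f) (g ?X)" "Cmp D (g ?Y) (FA ?G f)" ?T])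
        simp_all
    have "invertible_cell D c" by (rule D.invertible_reflect[OF E[of ?Y]]) (use c T in simp_all)
    moreover have "P f c" using c(1-3) unfolding P_def c(4) by simp
    ultimately show ?thesis by blast
  qed
  then obtain p where p: "\<And>f. f \<in> Ar B \<Longrightarrow> invertible_cell D (p f)" "\<And>f. f \<in> Ar B \<Longrightarrow> P f (p f)"
    by metis
  have pc [simp]: "\<And>f. f \<in> Ar B \<Longrightarrow> p f \<in> Cl D"
    "\<And>f. f \<in> Ar B \<Longrightarrow> Dm D (p f) = Cmp D (FA ?F f) (g (Src B f))"
    "\<And>f. f \<in> Ar B \<Longrightarrow> Cd D (p f) = Cmp D (g (Tgt B f)) (FA ?G f)"
    using p(2) by (auto simp: P_def)
  have pe: "(e (Tgt B f) \<star> \<iota> (FA ?G f)) \<cdot> (\<iota> (PO \<theta> (Tgt B f)) \<star> p f) \<cdot> (PA \<theta> f \<star> \<iota> (g (Src B f))) =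
      \<iota> (FA ?G f) \<star> e (Src B f)" if "f \<in> Ar B" for f
    using p(2)[OF that] by (simp add: P_def)
  define \<psi> where "\<psi> = \<lparr>PDom = ?G, PCod = ?F, PO = (\<lambda>X\<in>Ob B. g X), PA = (\<lambda>f\<in>Ar B. p f)\<rparr>"
  have [simp]: "PDom \<psi> = ?G" "PCod \<psi> = ?F" "\<And>X. X \<in> Ob B \<Longrightarrow> PO \<psi> X = g X"
    "\<And>f. f \<in> Ar B \<Longrightarrow> PA \<psi> f = p f" "PO \<psi> \<in> extensional (Ob B)" "PA \<psi> \<in> extensional (Ar B)"
    by (simp_all add: \<psi>_def)
  have \<psi>: "pseudonatural B D \<psi>"
  proof (rule pseudonaturalI, goal_cases)
    case X: (11 X)
    have "P (Idn B X) (\<iota> (g X))" unfolding P_def using X by simp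
    then have "p (Idn B X) = \<iota> (g X)"
      by (rule P_unique[rotated 2]) (use p(2) X in simp_all)
    then show ?case using X by simp
  next
    case (12 f h)
    then have a [simp]: "f \<in> Ar B" "h \<in> Ar B" and fh [simp]: "Tgt B f = Src B h" .
    let ?X = "Src B f" and ?Y = "Src B h" and ?Z = "Tgt B h"
    have "(\<iota> (PO \<theta> ?Z) \<star> \<iota> (FA ?F h) \<star> p f) \<cdot> (PA \<theta> h \<star> \<iota> (Cmp D (FA ?F f) (g ?X))) =
      (PA \<theta> h \<star> \<iota> (Cmp D (g ?Y) (FA ?G f))) \<cdot> (\<iota> (FA ?G h) \<star> \<iota> (PO \<theta> ?Y) \<star> p f)"
      using D.whisker_swap[of "p f" "PA \<theta> h"] by simp
    note sw = D.VC_assoc_eq[OF this]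
    have "(e ?Z \<star> \<iota> (FA ?G (Cmp B h f))) \<cdot>
        (\<iota> (PO \<theta> ?Z) \<star> ((p h \<star> \<iota> (FA ?G f)) \<cdot> (\<iota> (FA ?F h) \<star> p f))) \<cdot> (PA \<theta> (Cmp B h f) \<star> \<iota> (g ?X)) =
      (((e ?Z \<star> \<iota> (FA ?G h)) \<cdot> (\<iota> (PO \<theta> ?Z) \<star> p h) \<cdot> (PA \<theta> h \<star> \<iota> (g ?Y))) \<star> \<iota> (FA ?G f)) \<cdot>
        (\<iota> (FA ?G h) \<star> ((\<iota> (PO \<theta> ?Y) \<star> p f) \<cdot> (PA \<theta> f \<star> \<iota> (g ?X))))"
      by (simp add: sw)
    also have "\<dots> = \<iota> (FA ?G h) \<star> ((e ?Y \<star> \<iota> (FA ?G f)) \<cdot> (\<iota> (PO \<theta> ?Y) \<star> p f) \<cdot> (PA \<theta> f \<star> \<iota> (g ?X)))"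
      unfolding pe[OF a(2)] by simp
    also have "\<dots> = \<iota> (FA ?G (Cmp B h f)) \<star> e ?X" using pe[OF a(1)] by simp
    \<comment> \<open>The pasting of the cells for \<open>f\<close> and \<open>h\<close> solves the
      equation for \<open>h f\<close>, because the equations for \<open>f\<close> and
      \<open>h\<close> can be pasted along \<open>e\<close> at the middle object.\<close>
    finally have "P (Cmp B h f) ((p h \<star> \<iota> (FA ?G f)) \<cdot> (\<iota> (FA ?F h) \<star> p f))"
      unfolding P_def by simp
    then have "p (Cmp B h f) = (p h \<star> \<iota> (FA ?G f)) \<cdot> (\<iota> (FA ?F h) \<star> p f)"
      by (rule P_unique[rotated 2]) (use p(2) in simp_all)
    then show ?case by simp
  next
    case \<gamma> [simp]: (13 \<gamma>)
    let ?f = "Dm B \<gamma>" and ?h = "Cd B \<gamma>"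
    let ?X = "Src B ?f" and ?Y = "Tgt B ?f"
    have "p ?h \<cdot> (FC ?F \<gamma> \<star> \<iota> (g ?X)) = (\<iota> (g ?Y) \<star> FC ?G \<gamma>) \<cdot> p ?f"
    \<comment> \<open>\<open>P_unique\<close> does not apply here: the domain of these cells belongs
      to \<open>?f\<close> and the codomain to \<open>?h\<close>. The same cancellations are carried
      out directly, with naturality of \<theta> at \<gamma> in between.\<close>
    proof (rule D.equivalence_cancel[OF E[of ?Y]])
      have "(e ?Y \<star> \<iota> (FA ?G ?h)) \<cdot> ((\<iota> (PO \<theta> ?Y) \<star> (p ?h \<cdot> (FC ?F \<gamma> \<star> \<iota> (g ?X)))) \<cdot> (PA \<theta> ?f \<star> \<iota> (g ?X))) =
        (e ?Y \<star> \<iota> (FA ?G ?h)) \<cdot> (\<iota> (PO \<theta> ?Y) \<star> p ?h) \<cdot>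
          (((\<iota> (PO \<theta> ?Y) \<star> FC ?F \<gamma>) \<cdot> PA \<theta> ?f) \<star> \<iota> (g ?X))" by simp
      also have "\<dots> = ((e ?Y \<star> \<iota> (FA ?G ?h)) \<cdot> (\<iota> (PO \<theta> ?Y) \<star> p ?h) \<cdot> (PA \<theta> ?h \<star> \<iota> (g ?X))) \<cdot>
          (FC ?G \<gamma> \<star> \<iota> (Cmp D (PO \<theta> ?X) (g ?X)))"
        unfolding pseudonatural_nat[OF \<theta> \<gamma>, symmetric] by simp
      also have "\<dots> = FC ?G \<gamma> \<cdot> (\<iota> (FA ?G ?f) \<star> e ?X)"
        using pe[of ?h] D.whisker_swap[of "e ?X" "FC ?G \<gamma>"] by simp
      also have "\<dots> = FC ?G \<gamma> \<cdot> ((e ?Y \<star> \<iota> (FA ?G ?f)) \<cdot> (\<iota> (PO \<theta> ?Y) \<star> p ?f) \<cdot> (PA \<theta> ?f \<star> \<iota> (g ?X)))"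
        using pe[of ?f] by simp
      also have "\<dots> = (FC ?G \<gamma> \<cdot> (e ?Y \<star> \<iota> (FA ?G ?f))) \<cdot> ((\<iota> (PO \<theta> ?Y) \<star> p ?f) \<cdot> (PA \<theta> ?f \<star> \<iota> (g ?X)))"
        by simp
      also have "FC ?G \<gamma> \<cdot> (e ?Y \<star> \<iota> (FA ?G ?f)) = (e ?Y \<star> \<iota> (FA ?G ?h)) \<cdot> (\<iota> (PO \<theta> ?Y) \<star> \<iota> (g ?Y) \<star> FC ?G \<gamma>)"
        using D.whisker_swap[of "FC ?G \<gamma>" "e ?Y"] by simp
      also have "((e ?Y \<star> \<iota> (FA ?G ?h)) \<cdot> (\<iota> (PO \<theta> ?Y) \<star> \<iota> (g ?Y) \<star> FC ?G \<gamma>)) \<cdot>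
          ((\<iota> (PO \<theta> ?Y) \<star> p ?f) \<cdot> (PA \<theta> ?f \<star> \<iota> (g ?X))) =
        (e ?Y \<star> \<iota> (FA ?G ?h)) \<cdot> ((\<iota> (PO \<theta> ?Y) \<star> ((\<iota> (g ?Y) \<star> FC ?G \<gamma>) \<cdot> p ?f)) \<cdot> (PA \<theta> ?f \<star> \<iota> (g ?X)))"
        by simp
      finally have "(\<iota> (PO \<theta> ?Y) \<star> (p ?h \<cdot> (FC ?F \<gamma> \<star> \<iota> (g ?X)))) \<cdot> (PA \<theta> ?f \<star> \<iota> (g ?X)) =
          (\<iota> (PO \<theta> ?Y) \<star> ((\<iota> (g ?Y) \<star> FC ?G \<gamma>) \<cdot> p ?f)) \<cdot> (PA \<theta> ?f \<star> \<iota> (g ?X))"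
        by (rule D.invertible_cancel_left[rotated -1]) simp_all
      then show "\<iota> (PO \<theta> ?Y) \<star> (p ?h \<cdot> (FC ?F \<gamma> \<star> \<iota> (g ?X))) = \<iota> (PO \<theta> ?Y) \<star> ((\<iota> (g ?Y) \<star> FC ?G \<gamma>) \<cdot> p ?f)"
        by (rule D.invertible_cancel_right[rotated -1]) simp_all
    qed simp_all
    then show ?case by simp
  qed (use p in simp_all)
  define \<epsilon> where "\<epsilon> = \<lparr>MDom = comp_pnat B D \<theta> \<psi>, MCod = id_pnat B D ?G, MC = (\<lambda>X\<in>Ob B. e X)\<rparr>"
  have [simp]: "MDom \<epsilon> = comp_pnat B D \<theta> \<psi>" "MCod \<epsilon> = id_pnat B D ?G"
    "\<And>X. X \<in> Ob B \<Longrightarrow> MC \<epsilon> X = e X" "MC \<epsilon> \<in> extensional (Ob B)"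
    by (simp_all add: \<epsilon>_def)
  have \<epsilon>: "modification B D \<epsilon>"
    by (rule modificationI) (use \<psi> pe in \<open>simp_all add: pseudonatural_comp pseudonatural_id\<close>)
  have "invertible_cell \<P> \<epsilon>" by (rule modification_inverse[OF \<epsilon>]) simp
  then show ?thesis by (rule that[OF \<psi>, rotated 2]) simp_all
qed

text \<open>Faithfulness of whiskering is tested at each object, fullness is
  \<open>modification_lift\<close>, and the counit comes with the quasi-inverse. No unit
  modification is ever written down.\<close>

lemma equivalence_Hom_p:
  assumes \<theta>: "pseudonatural B D \<theta>" and E: "\<And>X. X \<in> Ob B \<Longrightarrow> equivalence D (PO \<theta> X)"
  shows "equivalence \<P> \<theta>"
proof (rule pseudonatural_quasi_inverse[OF \<theta> E])
  fix \<psi> \<epsilon>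
  assume *: "pseudonatural B D \<psi>" "PDom \<psi> = PCod \<theta>" "PCod \<psi> = PDom \<theta>"
    "invertible_cell \<P> \<epsilon>" "MDom \<epsilon> = comp_pnat B D \<theta> \<psi>" "MCod \<epsilon> = id_pnat B D (PCod \<theta>)"
  show ?thesis
  proof (rule H.equivalenceI_fully_faithful[of _ \<psi> \<epsilon>])
    fix \<sigma> \<sigma>' assume a: "\<sigma> \<in> Cl \<P>" "\<sigma>' \<in> Cl \<P>"
      "Dm \<P> \<sigma> = Dm \<P> \<sigma>'" "Cd \<P> \<sigma> = Cd \<P> \<sigma>'"
      "Tgt \<P> (Dm \<P> \<sigma>) = Src \<P> \<theta>"
      and eq: "HC \<P> (Id2 \<P> \<theta>) \<sigma> = HC \<P> (Id2 \<P> \<theta>) \<sigma>'"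
    show "\<sigma> = \<sigma>'"
    proof (rule modification_eqI)
      fix X assume X: "X \<in> Ob B"
      have "\<iota> (PO \<theta> X) \<star> MC \<sigma> X = \<iota> (PO \<theta> X) \<star> MC \<sigma>' X"
        using arg_cong[OF eq, of "\<lambda>\<rho>. MC \<rho> X"] X by simp
      then show "MC \<sigma> X = MC \<sigma>' X"
        by (rule D.equivalence_cancel[OF E[OF X], rotated -1]) (use a X \<theta> in simp_all)
    qed (use a in \<open>simp_all add: modification_ext\<close>)
  next
    fix \<alpha> \<beta> \<rho> assume "\<alpha> \<in> Ar \<P>" "\<beta> \<in> Ar \<P>"
      "Src \<P> \<alpha> = Src \<P> \<beta>" "Tgt \<P> \<alpha> = Src \<P> \<theta>"
      "Tgt \<P> \<beta> = Src \<P> \<theta>" "\<rho> \<in> Cl \<P>"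
      "Dm \<P> \<rho> = Cmp \<P> \<theta> \<alpha>" "Cd \<P> \<rho> = Cmp \<P> \<theta> \<beta>"
    then show "\<exists>\<sigma>. \<sigma> \<in> Cl \<P> \<and> Dm \<P> \<sigma> = \<alpha> \<and> Cd \<P> \<sigma> = \<beta> \<and>
        HC \<P> (Id2 \<P> \<theta>) \<sigma> = \<rho>"
      using modification_lift[OF \<theta> E, of \<alpha> \<beta> \<rho>] by simp
  qed (use * \<theta> in simp_all)
qed

end

section \<open>The homotopy 2-category\<close>

lemma disc_sel:
  "Ob (disc A) = Ob A" "Ar (disc A) = Ar A" "Src (disc A) = Src A" "Tgt (disc A) = Tgt A"
  "Idn (disc A) = Idn A" "Cmp (disc A) = Cmp A" "Cl (disc A) = Ar A" "Dm (disc A) = (\<lambda>f. f)"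
  "Cd (disc A) = (\<lambda>f. f)" "Id2 (disc A) = (\<lambda>f. f)" "VC (disc A) = (\<lambda>g f. f)" "HC (disc A) = Cmp A"
  by (simp_all add: disc_def)

lemma two_category_disc:
  assumes "category A"
  shows "two_category (disc A)"
proof -
  interpret category A by (rule assms)
  show ?thesis by (rule two_categoryI) (auto simp: disc_sel)
qed

section \<open>Homotopies and the classes of their sequences\<close>

locale homotopy_base = category A for A :: "('o, 'm) cat" +
  fixes \<Sigma> :: "'m set"
  assumes Sigma_Ar: "\<Sigma> \<subseteq> Ar A" and Idn_Sigma: "a \<in> Ob A \<Longrightarrow> Idn A a \<in> \<Sigma>"
begin

lemma cylinder_simps [simp]:
  assumes "is_cylinder A \<Sigma> X c"
  shows "cyl_W c \<in> Ob A" "cyl_Z c \<in> Ob A" "cyl_d0 c \<in> Ar A" "Src A (cyl_d0 c) = X"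
    "Tgt A (cyl_d0 c) = cyl_W c" "cyl_d1 c \<in> Ar A" "Src A (cyl_d1 c) = X" "Tgt A (cyl_d1 c) = cyl_W c"
    "cyl_s c \<in> Ar A" "Src A (cyl_s c) = cyl_W c" "Tgt A (cyl_s c) = cyl_Z c" "cyl_s c \<in> \<Sigma>"
    "cyl_x c \<in> Ar A" "Src A (cyl_x c) = X" "Tgt A (cyl_x c) = cyl_Z c"
    "Cmp A (cyl_s c) (cyl_d0 c) = cyl_x c" "Cmp A (cyl_s c) (cyl_d1 c) = cyl_x c"
  using assms by (auto simp: is_cylinder_def hom_def)

lemma cylinder_comp:
  assumes "is_cylinder A \<Sigma> X c" "f \<in> Ar A" "Tgt A f = X"
  shows "Cmp A (cyl_s c) (Cmp A (cyl_d0 c) f) = Cmp A (cyl_x c) f"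
    "Cmp A (cyl_s c) (Cmp A (cyl_d1 c) f) = Cmp A (cyl_x c) f"
  using category_simps(11)[of f "cyl_d0 c" "cyl_s c"] category_simps(11)[of f "cyl_d1 c" "cyl_s c"]
    assms by auto

lemma homotopyE:
  assumes "is_homotopy A \<Sigma> f g H"
  obtains c h where "H = (c, h)" "is_cylinder A \<Sigma> (Src A f) c" "h \<in> Ar A" "Src A h = cyl_W c"
    "Cmp A h (cyl_d0 c) = f" "Cmp A h (cyl_d1 c) = g" "f \<in> Ar A" "g \<in> Ar A" "Src A g = Src A f"
    "Tgt A f = Tgt A h" "Tgt A g = Tgt A h"
  using assms by (auto simp: is_homotopy_def hom_def split: prod.splits)

lemma homotopyI:
  assumes "is_cylinder A \<Sigma> X c" "h \<in> Ar A" "Src A h = cyl_W c"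
    "f = Cmp A h (cyl_d0 c)" "g = Cmp A h (cyl_d1 c)"
  shows "is_homotopy A \<Sigma> f g (c, h)"
  unfolding is_homotopy_def using assms
  by (auto simp: hom_def intro!: exI[of _ X] exI[of _ "Tgt A h"])

lemma homotopy_seq_Ar:
  "homotopy_seq A \<Sigma> f g Hs \<Longrightarrow> f \<in> Ar A \<and> g \<in> Ar A \<and> Src A g = Src A f \<and> Tgt A g = Tgt A f"
proof (induction rule: homotopy_seq.induct)
  case (single f g H) then show ?case by (elim homotopyE) auto
next
  case (step f e Hs g H) from step(2) show ?case by (rule homotopyE) (use step(3) in auto)
qed

lemma homotopy_seq_append:
  "homotopy_seq A \<Sigma> g h Ks \<Longrightarrow> homotopy_seq A \<Sigma> f g Hs \<Longrightarrow> homotopy_seq A \<Sigma> f h (Ks @ Hs)"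
proof (induction rule: homotopy_seq.induct)
  case (single g h K)
  then show ?case by (simp add: homotopy_seq.step)
next
  case (step g e Ks h K)
  then show ?case by (simp add: homotopy_seq.step)
qed

lemma homotopy_whisker_left:
  assumes "is_homotopy A \<Sigma> f g H" "r \<in> Ar A" "Src A r = Tgt A f"
  shows "is_homotopy A \<Sigma> (Cmp A r f) (Cmp A r g) (whisker_left A r H)"
  using assms(1)
proof (rule homotopyE)
  fix c h assume *: "H = (c, h)" "is_cylinder A \<Sigma> (Src A f) c" "h \<in> Ar A" "Src A h = cyl_W c"
    "Cmp A h (cyl_d0 c) = f" "Cmp A h (cyl_d1 c) = g" "Tgt A f = Tgt A h"
  show ?thesis unfolding whisker_left_def *(1)
    using * assms(2,3) by (auto intro!: homotopyI[of "Src A f"])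
qed

lemma cylinder_whisker_right:
  assumes "is_cylinder A \<Sigma> X c" "l \<in> Ar A" "Tgt A l = X"
  shows "is_cylinder A \<Sigma> (Src A l)
    (c\<lparr>cyl_d0 := Cmp A (cyl_d0 c) l, cyl_d1 := Cmp A (cyl_d1 c) l, cyl_x := Cmp A (cyl_x c) l\<rparr>)"
  unfolding is_cylinder_def using assms cylinder_comp[OF assms] by (simp add: hom_def)

lemma homotopy_whisker_right:
  assumes "is_homotopy A \<Sigma> f g H" "l \<in> Ar A" "Tgt A l = Src A f"
  shows "is_homotopy A \<Sigma> (Cmp A f l) (Cmp A g l) (whisker_right A H l)"
  using assms(1)
proof (rule homotopyE)
  fix c h assume *: "H = (c, h)" "is_cylinder A \<Sigma> (Src A f) c" "h \<in> Ar A" "Src A h = cyl_W c"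
    "Cmp A h (cyl_d0 c) = f" "Cmp A h (cyl_d1 c) = g"
  show ?thesis unfolding whisker_right_def *(1) prod.case
    by (rule homotopyI[OF cylinder_whisker_right[OF *(2)]])
      (use * assms(2,3) category_simps(11)[of l "cyl_d0 c" h] category_simps(11)[of l "cyl_d1 c" h] in auto)
qed

lemma homotopy_seq_whisker_left:
  "homotopy_seq A \<Sigma> f g Hs \<Longrightarrow> r \<in> Ar A \<Longrightarrow> Src A r = Tgt A f \<Longrightarrow>
    homotopy_seq A \<Sigma> (Cmp A r f) (Cmp A r g) (map (whisker_left A r) Hs)"
proof (induction rule: homotopy_seq.induct)
  case (single f g H)
  then show ?case by (simp add: homotopy_seq.single homotopy_whisker_left)
next
  case (step f e Hs g H)
  show ?case
    using homotopy_seq.step[OF step.IH homotopy_whisker_left[OF step.hyps(2)]] step.prems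
      homotopy_seq_Ar[OF step.hyps(1)] by simp
qed

lemma homotopy_seq_whisker_right:
  "homotopy_seq A \<Sigma> f g Hs \<Longrightarrow> l \<in> Ar A \<Longrightarrow> Tgt A l = Src A f \<Longrightarrow>
    homotopy_seq A \<Sigma> (Cmp A f l) (Cmp A g l) (map (\<lambda>H. whisker_right A H l) Hs)"
proof (induction rule: homotopy_seq.induct)
  case (single f g H)
  then show ?case by (simp add: homotopy_seq.single homotopy_whisker_right)
next
  case (step f e Hs g H)
  show ?case
    using homotopy_seq.step[OF step.IH homotopy_whisker_right[OF step.hyps(2)]] step.prems
      homotopy_seq_Ar[OF step.hyps(1)] by simp
qed

lemma homotopy_id: "f \<in> Ar A \<Longrightarrow> is_homotopy A \<Sigma> f f (id_homotopy A f)"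
  unfolding id_homotopy_def Let_def
  by (rule homotopyI[of "Src A f"]) (auto simp: is_cylinder_def hom_def Idn_Sigma)

lemma homotopy_seq_id: "f \<in> Ar A \<Longrightarrow> homotopy_seq A \<Sigma> f f [id_homotopy A f]"
  by (rule homotopy_seq.single[OF homotopy_id])

lemma ho_rel_refl: "homotopy_seq A \<Sigma> f g Hs \<Longrightarrow> ho_rel A \<Sigma> f g Hs Hs"
  by (simp add: ho_rel_def)

lemma ho_class_eq:
  assumes "ho_rel A \<Sigma> f g Hs Ks"
  shows "ho_class A \<Sigma> f g Hs = ho_class A \<Sigma> f g Ks"
proof -
  have "ho_rel A \<Sigma> f g Hs = ho_rel A \<Sigma> f g Ks" using assms unfolding ho_rel_def fun_eq_iff by auto
  then show ?thesis by (simp add: ho_class_def)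
qed

lemma ho_rep:
  assumes "homotopy_seq A \<Sigma> f g Hs"
  shows "ho_rel A \<Sigma> f g Hs (ho_rep (ho_class A \<Sigma> f g Hs))"
proof -
  have "ho_rep (ho_class A \<Sigma> f g Hs) \<in> snd (snd (ho_class A \<Sigma> f g Hs))"
    unfolding ho_rep_def by (rule someI_ex) (use ho_rel_refl[OF assms] in \<open>auto simp: ho_class_def\<close>)
  then show ?thesis by (simp add: ho_class_def)
qed

abbreviation "\<H> \<equiv> Ho A \<Sigma>"

lemma Ho_sel [simp]:
  "Ob \<H> = Ob A" "Ar \<H> = Ar A" "Src \<H> = Src A" "Tgt \<H> = Tgt A"
  "Idn \<H> = Idn A" "Cmp \<H> = Cmp A"
  by (simp_all add: Ho_def)

lemma Ho_class:
  assumes "homotopy_seq A \<Sigma> f g Hs"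
  shows "ho_class A \<Sigma> f g Hs \<in> Cl \<H>" "Dm \<H> (ho_class A \<Sigma> f g Hs) = f"
    "Cd \<H> (ho_class A \<Sigma> f g Hs) = g"
  using assms by (auto simp: Ho_def ho_class_def)

lemma Ho_ClE:
  assumes "\<alpha> \<in> Cl \<H>"
  obtains Hs where "homotopy_seq A \<Sigma> (Dm \<H> \<alpha>) (Cd \<H> \<alpha>) Hs"
    "\<alpha> = ho_class A \<Sigma> (Dm \<H> \<alpha>) (Cd \<H> \<alpha>) Hs"
  using assms Ho_class by (fastforce simp: Ho_def)

lemma Ho_rep:
  assumes "\<alpha> \<in> Cl \<H>"
  shows "homotopy_seq A \<Sigma> (Dm \<H> \<alpha>) (Cd \<H> \<alpha>) (ho_rep \<alpha>)"
    and "ho_class A \<Sigma> (Dm \<H> \<alpha>) (Cd \<H> \<alpha>) (ho_rep \<alpha>) = \<alpha>"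
proof -
  obtain Hs where *: "homotopy_seq A \<Sigma> (Dm \<H> \<alpha>) (Cd \<H> \<alpha>) Hs"
    "\<alpha> = ho_class A \<Sigma> (Dm \<H> \<alpha>) (Cd \<H> \<alpha>) Hs" by (rule Ho_ClE[OF assms])
  have r: "ho_rel A \<Sigma> (Dm \<H> \<alpha>) (Cd \<H> \<alpha>) Hs (ho_rep \<alpha>)"
    using ho_rep[OF *(1)] *(2) by simp
  show "homotopy_seq A \<Sigma> (Dm \<H> \<alpha>) (Cd \<H> \<alpha>) (ho_rep \<alpha>)"
    using r by (simp add: ho_rel_def)
  show "ho_class A \<Sigma> (Dm \<H> \<alpha>) (Cd \<H> \<alpha>) (ho_rep \<alpha>) = \<alpha>"
    using ho_class_eq[OF r] *(2) by simp
qed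

end

section \<open>Evaluation of 2-cells by a 2-functor that sends \<Sigma> to equivalences\<close>

definition ho_hat :: "('p, 'n, 'd) twocat \<Rightarrow> ('o, 'm, 'm, 'p, 'n, 'd) twofun \<Rightarrow> ('o, 'm) ho_cell \<Rightarrow> 'd" where
  "ho_hat D F \<alpha> = hat_seq D F (ho_rep \<alpha>)"

locale localizing_functor = homotopy_base A \<Sigma> + D: two_category D
  for A :: "('o, 'm) cat" and \<Sigma> :: "'m set" and D :: "('p, 'n, 'd) twocat" +
  fixes F :: "('o, 'm, 'm, 'p, 'n, 'd) twofun"
  assumes F: "two_functor (disc A) D F" and E: "sends_to_equivalences D \<Sigma> F"
begin

lemma F_simps [simp]:
  "a \<in> Ob A \<Longrightarrow> FO F a \<in> Ob D"
  "f \<in> Ar A \<Longrightarrow> FA F f \<in> Ar D"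
  "f \<in> Ar A \<Longrightarrow> Src D (FA F f) = FO F (Src A f)"
  "f \<in> Ar A \<Longrightarrow> Tgt D (FA F f) = FO F (Tgt A f)"
  "a \<in> Ob A \<Longrightarrow> FA F (Idn A a) = Idn D (FO F a)"
  "f \<in> Ar A \<Longrightarrow> g \<in> Ar A \<Longrightarrow> Tgt A f = Src A g \<Longrightarrow> FA F (Cmp A g f) = Cmp D (FA F g) (FA F f)"
  "f \<in> Ar A \<Longrightarrow> FC F f = Id2 D (FA F f)"
  using F unfolding two_functor_def hom_def cell_def by (auto simp: disc_sel)

lemma F_equivalence: "w \<in> \<Sigma> \<Longrightarrow> equivalence D (FA F w)"
  using E by (simp add: sends_to_equivalences_def)

lemma hat_cyl_simps [simp]:
  assumes c: "is_cylinder A \<Sigma> X c"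
  shows "hat_cyl D F c \<in> Cl D" "Dm D (hat_cyl D F c) = FA F (cyl_d0 c)"
    "Cd D (hat_cyl D F c) = FA F (cyl_d1 c)"
    "HC D (Id2 D (FA F (cyl_s c))) (hat_cyl D F c) = Id2 D (FA F (cyl_x c))"
  using hat_cyl_props[OF F E c] by (auto simp: cell_def)

text \<open>Since \<open>F s\<close> is an equivalence, whiskering with it is faithful. To identify
  the cell of a cylinder it is thus enough to collapse it along \<open>s\<close>.\<close>

lemma hat_cyl_eqI:
  assumes c: "is_cylinder A \<Sigma> X c" and "\<gamma> \<in> Cl D" "Dm D \<gamma> = FA F (cyl_d0 c)"
    "Cd D \<gamma> = FA F (cyl_d1 c)" "HC D (Id2 D (FA F (cyl_s c))) \<gamma> = Id2 D (FA F (cyl_x c))"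
  shows "hat_cyl D F c = \<gamma>"
  by (rule D.equivalence_cancel[OF F_equivalence[of "cyl_s c"]]) (use assms in simp_all)

lemma hat_simps [simp]:
  assumes H: "is_homotopy A \<Sigma> f g H"
  shows "hat D F H \<in> Cl D" "Dm D (hat D F H) = FA F f" "Cd D (hat D F H) = FA F g"
  using hat_cell[OF F E H] by (auto simp: cell_def)

lemma hat_seq_simps [simp]:
  assumes H: "homotopy_seq A \<Sigma> f g Hs"
  shows "hat_seq D F Hs \<in> Cl D" "Dm D (hat_seq D F Hs) = FA F f" "Cd D (hat_seq D F Hs) = FA F g"
  using hat_seq_cell[OF F E H] by (auto simp: cell_def)

lemma hat_id:
  assumes f: "f \<in> Ar A"
  shows "hat D F (id_homotopy A f) = Id2 D (FA F f)"
proof -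
  let ?X = "Src A f"
  let ?c = "\<lparr>cyl_W = ?X, cyl_Z = ?X, cyl_d0 = Idn A ?X, cyl_d1 = Idn A ?X, cyl_s = Idn A ?X,
       cyl_x = Idn A ?X\<rparr>"
  have "is_cylinder A \<Sigma> ?X ?c" using f by (auto simp: is_cylinder_def hom_def Idn_Sigma)
  then have "hat_cyl D F ?c = Id2 D (FA F (Idn A ?X))" by (rule hat_cyl_eqI) (use f in simp_all)
  then show ?thesis using f by (simp add: hat_def id_homotopy_def Let_def)
qed

lemma hat_whisker_left:
  assumes "is_homotopy A \<Sigma> f g H" "r \<in> Ar A" "Src A r = Tgt A f"
  shows "hat D F (whisker_left A r H) = HC D (Id2 D (FA F r)) (hat D F H)"
  using assms(1)
proof (rule homotopyE)
  fix c h assume "H = (c, h)" "is_cylinder A \<Sigma> (Src A f) c" "h \<in> Ar A" "Src A h = cyl_W c"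
    "Tgt A f = Tgt A h"
  then show ?thesis using assms(2,3) by (simp add: hat_def whisker_left_def)
qed

text \<open>Precomposition with \<open>l\<close> changes the ends of the cylinder but not its
  collapse map, so the whiskered cell satisfies the equation that characterises the cell of the new
  cylinder.\<close>

lemma hat_whisker_right:
  assumes "is_homotopy A \<Sigma> f g H" "l \<in> Ar A" "Tgt A l = Src A f"
  shows "hat D F (whisker_right A H l) = HC D (hat D F H) (Id2 D (FA F l))"
  using assms(1)
proof (rule homotopyE)
  fix c h assume *: "H = (c, h)" "is_cylinder A \<Sigma> (Src A f) c" "h \<in> Ar A" "Src A h = cyl_W c"
  let ?cl = "c\<lparr>cyl_d0 := Cmp A (cyl_d0 c) l, cyl_d1 := Cmp A (cyl_d1 c) l, cyl_x := Cmp A (cyl_x c) l\<rparr>"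
  note cl = cylinder_whisker_right[OF *(2) assms(2,3)]
  have "hat_cyl D F ?cl = HC D (hat_cyl D F c) (Id2 D (FA F l))"
  proof (rule hat_cyl_eqI[OF cl])
    have "HC D (HC D (Id2 D (FA F (cyl_s c))) (hat_cyl D F c)) (Id2 D (FA F l)) =
        HC D (Id2 D (FA F (cyl_s c))) (HC D (hat_cyl D F c) (Id2 D (FA F l)))"
      by (rule D.HC_simps(4)) (use * assms in simp_all)
    then show "HC D (Id2 D (FA F (cyl_s ?cl))) (HC D (hat_cyl D F c) (Id2 D (FA F l))) =
        Id2 D (FA F (cyl_x ?cl))"
      using * assms(2,3) by simp
  qed (use * assms(2,3) in simp_all)
  then show ?thesis using * assms(2,3) by (simp add: hat_def whisker_right_def)
qed

lemma hat_seq_append: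
  "homotopy_seq A \<Sigma> g h Ks \<Longrightarrow> homotopy_seq A \<Sigma> f g Hs \<Longrightarrow>
    hat_seq D F (Ks @ Hs) = VC D (hat_seq D F Ks) (hat_seq D F Hs)"
proof (induction rule: homotopy_seq.induct)
  case (single g h K)
  then show ?case using homotopy_seq_nonempty[OF single(2)] by (simp add: hat_seq_Cons)
next
  case (step g e Ks h K)
  have "hat_seq D F ((K # Ks) @ Hs) = VC D (hat D F K) (VC D (hat_seq D F Ks) (hat_seq D F Hs))"
    using step homotopy_seq_nonempty[OF step(1)] by (simp add: hat_seq_Cons)
  also have "\<dots> = VC D (VC D (hat D F K) (hat_seq D F Ks)) (hat_seq D F Hs)"
    by (rule D.VC_simps(3)[symmetric]) (use step in simp_all)
  finally show ?case using homotopy_seq_nonempty[OF step(1)] by (simp add: hat_seq_Cons)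
qed

lemma hat_seq_whisker_left:
  "homotopy_seq A \<Sigma> f g Hs \<Longrightarrow> r \<in> Ar A \<Longrightarrow> Src A r = Tgt A f \<Longrightarrow>
    hat_seq D F (map (whisker_left A r) Hs) = HC D (Id2 D (FA F r)) (hat_seq D F Hs)"
proof (induction rule: homotopy_seq.induct)
  case (single f g H)
  then show ?case by (simp add: hat_whisker_left)
next
  case (step f e Hs g H)
  note n = homotopy_seq_nonempty[OF step(1)] and a = homotopy_seq_Ar[OF step(1)]
  have "hat_seq D F (map (whisker_left A r) (H # Hs)) =
      VC D (HC D (Id2 D (FA F r)) (hat D F H)) (HC D (Id2 D (FA F r)) (hat_seq D F Hs))"
    using step n a hat_whisker_left[OF step(2)] by (simp add: hat_seq_Cons)
  then show ?case using step n a by (simp add: hat_seq_Cons)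
qed

lemma hat_seq_whisker_right:
  "homotopy_seq A \<Sigma> f g Hs \<Longrightarrow> l \<in> Ar A \<Longrightarrow> Tgt A l = Src A f \<Longrightarrow>
    hat_seq D F (map (\<lambda>H. whisker_right A H l) Hs) = HC D (hat_seq D F Hs) (Id2 D (FA F l))"
proof (induction rule: homotopy_seq.induct)
  case (single f g H)
  then show ?case by (simp add: hat_whisker_right)
next
  case (step f e Hs g H)
  note n = homotopy_seq_nonempty[OF step(1)] and a = homotopy_seq_Ar[OF step(1)]
  have "hat_seq D F (map (\<lambda>H. whisker_right A H l) (H # Hs)) =
      VC D (HC D (hat D F H) (Id2 D (FA F l))) (HC D (hat_seq D F Hs) (Id2 D (FA F l)))"
    using step n a hat_whisker_right[OF step(2)] by (simp add: hat_seq_Cons)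
  then show ?case using step n a by (simp add: hat_seq_Cons)
qed

text \<open>\<open>ho_hat\<close> evaluates a chosen representative, and the choice does not matter.
  The relation itself quantifies over targets of one fixed type; \<open>ho_rel_hat_seq\<close>
  carries it over to the present \<open>D\<close>.\<close>

lemma ho_hat_class:
  "homotopy_seq A \<Sigma> f g Hs \<Longrightarrow> ho_hat D F (ho_class A \<Sigma> f g Hs) = hat_seq D F Hs"
  unfolding ho_hat_def using ho_rel_hat_seq[OF ho_rep Sigma_Ar F E] by metis

lemma ho_hat_simps [simp]:
  assumes "\<alpha> \<in> Cl \<H>"
  shows "ho_hat D F \<alpha> \<in> Cl D" "Dm D (ho_hat D F \<alpha>) = FA F (Dm \<H> \<alpha>)"
    "Cd D (ho_hat D F \<alpha>) = FA F (Cd \<H> \<alpha>)"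
  unfolding ho_hat_def using hat_seq_simps[OF Ho_rep(1)[OF assms]] by auto

end

section \<open>The operations of the homotopy 2-category and their laws\<close>

context homotopy_base
begin

lemma Ho_VC:
  assumes "\<alpha> \<in> Cl \<H>" "\<beta> \<in> Cl \<H>" "Cd \<H> \<alpha> = Dm \<H> \<beta>"
  shows "homotopy_seq A \<Sigma> (Dm \<H> \<alpha>) (Cd \<H> \<beta>) (ho_rep \<beta> @ ho_rep \<alpha>)"
    and "VC \<H> \<beta> \<alpha> = ho_class A \<Sigma> (Dm \<H> \<alpha>) (Cd \<H> \<beta>) (ho_rep \<beta> @ ho_rep \<alpha>)"
proof -
  show "homotopy_seq A \<Sigma> (Dm \<H> \<alpha>) (Cd \<H> \<beta>) (ho_rep \<beta> @ ho_rep \<alpha>)"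
    using homotopy_seq_append[OF Ho_rep(1)[OF assms(2)]] Ho_rep(1)[OF assms(1)] assms(3) by simp
  show "VC \<H> \<beta> \<alpha> = ho_class A \<Sigma> (Dm \<H> \<alpha>) (Cd \<H> \<beta>) (ho_rep \<beta> @ ho_rep \<alpha>)"
    by (simp add: Ho_def)
qed

lemma Ho_HC:
  assumes "\<alpha> \<in> Cl \<H>" "\<beta> \<in> Cl \<H>" "Tgt A (Dm \<H> \<alpha>) = Src A (Dm \<H> \<beta>)"
  shows "homotopy_seq A \<Sigma> (Cmp A (Dm \<H> \<beta>) (Dm \<H> \<alpha>)) (Cmp A (Cd \<H> \<beta>) (Cd \<H> \<alpha>))
      (map (\<lambda>H. whisker_right A H (Cd \<H> \<alpha>)) (ho_rep \<beta>) @
       map (whisker_left A (Dm \<H> \<beta>)) (ho_rep \<alpha>))"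
    and "HC \<H> \<beta> \<alpha> = ho_class A \<Sigma>
      (Cmp A (Dm \<H> \<beta>) (Dm \<H> \<alpha>)) (Cmp A (Cd \<H> \<beta>) (Cd \<H> \<alpha>))
      (map (\<lambda>H. whisker_right A H (Cd \<H> \<alpha>)) (ho_rep \<beta>) @
       map (whisker_left A (Dm \<H> \<beta>)) (ho_rep \<alpha>))"
proof -
  note a = Ho_rep(1)[OF assms(1)] and b = Ho_rep(1)[OF assms(2)]
  note aA = homotopy_seq_Ar[OF a] and bA = homotopy_seq_Ar[OF b]
  show "homotopy_seq A \<Sigma> (Cmp A (Dm \<H> \<beta>) (Dm \<H> \<alpha>)) (Cmp A (Cd \<H> \<beta>) (Cd \<H> \<alpha>))
      (map (\<lambda>H. whisker_right A H (Cd \<H> \<alpha>)) (ho_rep \<beta>) @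
       map (whisker_left A (Dm \<H> \<beta>)) (ho_rep \<alpha>))"
    by (rule homotopy_seq_append[OF homotopy_seq_whisker_right[OF b] homotopy_seq_whisker_left[OF a]])
      (use aA bA assms(3) in auto)
qed (simp add: Ho_def Let_def)

lemma Ho_Id2: "Id2 \<H> f = ho_class A \<Sigma> f f [id_homotopy A f]"
  by (simp add: Ho_def)

lemma Ho_simps [simp]:
  "\<alpha> \<in> Cl \<H> \<Longrightarrow> Dm \<H> \<alpha> \<in> Ar A"
  "\<alpha> \<in> Cl \<H> \<Longrightarrow> Cd \<H> \<alpha> \<in> Ar A"
  "\<alpha> \<in> Cl \<H> \<Longrightarrow> Src A (Cd \<H> \<alpha>) = Src A (Dm \<H> \<alpha>)"
  "\<alpha> \<in> Cl \<H> \<Longrightarrow> Tgt A (Cd \<H> \<alpha>) = Tgt A (Dm \<H> \<alpha>)"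
  "f \<in> Ar A \<Longrightarrow> Id2 \<H> f \<in> Cl \<H>"
  "f \<in> Ar A \<Longrightarrow> Dm \<H> (Id2 \<H> f) = f"
  "f \<in> Ar A \<Longrightarrow> Cd \<H> (Id2 \<H> f) = f"
  "\<alpha> \<in> Cl \<H> \<Longrightarrow> \<beta> \<in> Cl \<H> \<Longrightarrow> Cd \<H> \<alpha> = Dm \<H> \<beta> \<Longrightarrow> VC \<H> \<beta> \<alpha> \<in> Cl \<H>"
  "\<alpha> \<in> Cl \<H> \<Longrightarrow> \<beta> \<in> Cl \<H> \<Longrightarrow> Cd \<H> \<alpha> = Dm \<H> \<beta> \<Longrightarrow>
    Dm \<H> (VC \<H> \<beta> \<alpha>) = Dm \<H> \<alpha>"
  "\<alpha> \<in> Cl \<H> \<Longrightarrow> \<beta> \<in> Cl \<H> \<Longrightarrow> Cd \<H> \<alpha> = Dm \<H> \<beta> \<Longrightarrow>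
    Cd \<H> (VC \<H> \<beta> \<alpha>) = Cd \<H> \<beta>"
  "\<alpha> \<in> Cl \<H> \<Longrightarrow> \<beta> \<in> Cl \<H> \<Longrightarrow> Tgt A (Dm \<H> \<alpha>) = Src A (Dm \<H> \<beta>) \<Longrightarrow>
    HC \<H> \<beta> \<alpha> \<in> Cl \<H>"
  "\<alpha> \<in> Cl \<H> \<Longrightarrow> \<beta> \<in> Cl \<H> \<Longrightarrow> Tgt A (Dm \<H> \<alpha>) = Src A (Dm \<H> \<beta>) \<Longrightarrow>
    Dm \<H> (HC \<H> \<beta> \<alpha>) = Cmp A (Dm \<H> \<beta>) (Dm \<H> \<alpha>)"
  "\<alpha> \<in> Cl \<H> \<Longrightarrow> \<beta> \<in> Cl \<H> \<Longrightarrow> Tgt A (Dm \<H> \<alpha>) = Src A (Dm \<H> \<beta>) \<Longrightarrow>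
    Cd \<H> (HC \<H> \<beta> \<alpha>) = Cmp A (Cd \<H> \<beta>) (Cd \<H> \<alpha>)"
  using homotopy_seq_Ar[OF Ho_rep(1)] Ho_class[OF homotopy_seq_id] Ho_class[OF Ho_VC(1)] Ho_VC(2)
    Ho_class[OF Ho_HC(1)] Ho_HC(2)
  by (simp_all add: Ho_Id2)

end

context localizing_functor
begin

text \<open>For horizontal composites the definition in \<open>Ho\<close> lets \<alpha> act before
  \<beta>, which is the decomposition \<open>HC_left_first\<close> in \<open>D\<close>; the two
  whiskered sequences are evaluated separately.\<close>

lemma ho_hat_ops [simp]:
  "f \<in> Ar A \<Longrightarrow> ho_hat D F (Id2 \<H> f) = Id2 D (FA F f)"
  "\<alpha> \<in> Cl \<H> \<Longrightarrow> \<beta> \<in> Cl \<H> \<Longrightarrow> Cd \<H> \<alpha> = Dm \<H> \<beta> \<Longrightarrow>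
    ho_hat D F (VC \<H> \<beta> \<alpha>) = VC D (ho_hat D F \<beta>) (ho_hat D F \<alpha>)"
  "\<alpha> \<in> Cl \<H> \<Longrightarrow> \<beta> \<in> Cl \<H> \<Longrightarrow> Tgt A (Dm \<H> \<alpha>) = Src A (Dm \<H> \<beta>) \<Longrightarrow>
    ho_hat D F (HC \<H> \<beta> \<alpha>) = HC D (ho_hat D F \<beta>) (ho_hat D F \<alpha>)"
proof -
  show "ho_hat D F (Id2 \<H> f) = Id2 D (FA F f)" if "f \<in> Ar A"
    using ho_hat_class[OF homotopy_seq_id] hat_id that by (simp add: Ho_Id2)
  show "ho_hat D F (VC \<H> \<beta> \<alpha>) = VC D (ho_hat D F \<beta>) (ho_hat D F \<alpha>)"
    if a: "\<alpha> \<in> Cl \<H>" "\<beta> \<in> Cl \<H>" "Cd \<H> \<alpha> = Dm \<H> \<beta>"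
    using Ho_VC[OF a] hat_seq_append[OF Ho_rep(1)[OF a(2)], of _ "ho_rep \<alpha>"] Ho_rep(1)[OF a(1)] a(3)
    by (simp add: ho_hat_class) (simp add: ho_hat_def)
  show "ho_hat D F (HC \<H> \<beta> \<alpha>) = HC D (ho_hat D F \<beta>) (ho_hat D F \<alpha>)"
    if a: "\<alpha> \<in> Cl \<H>" "\<beta> \<in> Cl \<H>" "Tgt A (Dm \<H> \<alpha>) = Src A (Dm \<H> \<beta>)"
  proof -
    let ?l = "map (whisker_left A (Dm \<H> \<beta>)) (ho_rep \<alpha>)"
      and ?r = "map (\<lambda>H. whisker_right A H (Cd \<H> \<alpha>)) (ho_rep \<beta>)"
    note s = Ho_rep(1)[OF a(1)] Ho_rep(1)[OF a(2)]
    have w: "homotopy_seq A \<Sigma> (Cmp A (Dm \<H> \<beta>) (Cd \<H> \<alpha>)) (Cmp A (Cd \<H> \<beta>) (Cd \<H> \<alpha>)) ?r"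
      "homotopy_seq A \<Sigma> (Cmp A (Dm \<H> \<beta>) (Dm \<H> \<alpha>)) (Cmp A (Dm \<H> \<beta>) (Cd \<H> \<alpha>)) ?l"
      by (rule homotopy_seq_whisker_right[OF s(2)] homotopy_seq_whisker_left[OF s(1)]; use a in simp)+
    have h: "hat_seq D F ?r = HC D (ho_hat D F \<beta>) (Id2 D (FA F (Cd \<H> \<alpha>)))"
      unfolding ho_hat_def by (rule hat_seq_whisker_right[OF s(2)]) (use a in simp_all)
    have h': "hat_seq D F ?l = HC D (Id2 D (FA F (Dm \<H> \<beta>))) (ho_hat D F \<alpha>)"
      unfolding ho_hat_def by (rule hat_seq_whisker_left[OF s(1)]) (use a in simp_all)
    have "ho_hat D F (HC \<H> \<beta> \<alpha>) =
        VC D (HC D (ho_hat D F \<beta>) (Id2 D (FA F (Cd \<H> \<alpha>))))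
          (HC D (Id2 D (FA F (Dm \<H> \<beta>))) (ho_hat D F \<alpha>))"
      unfolding Ho_HC(2)[OF a] ho_hat_class[OF Ho_HC(1)[OF a]] hat_seq_append[OF w] h h' ..
    then show ?thesis using D.HC_left_first[of "ho_hat D F \<alpha>" "ho_hat D F \<beta>"] a by simp
  qed
qed

end

context homotopy_base
begin

text \<open>The relation on sequences is read here as an extensionality principle. It reduces each
  law of the homotopy 2-category to the same law in the target of a test 2-functor.\<close>

lemma Ho_eqI:
  assumes a: "\<alpha> \<in> Cl \<H>" "\<beta> \<in> Cl \<H>"
    "Dm \<H> \<alpha> = Dm \<H> \<beta>" "Cd \<H> \<alpha> = Cd \<H> \<beta>"
    and eq: "\<And>(D :: 'm test_twocat) F. localizing_functor A \<Sigma> D F \<Longrightarrow> ho_hat D F \<alpha> = ho_hat D F \<beta>"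
  shows "\<alpha> = \<beta>"
proof -
  have "ho_rel A \<Sigma> (Dm \<H> \<alpha>) (Cd \<H> \<alpha>) (ho_rep \<alpha>) (ho_rep \<beta>)"
    unfolding ho_rel_def
  proof (intro conjI allI impI)
    show "homotopy_seq A \<Sigma> (Dm \<H> \<alpha>) (Cd \<H> \<alpha>) (ho_rep \<alpha>)"
      "homotopy_seq A \<Sigma> (Dm \<H> \<alpha>) (Cd \<H> \<alpha>) (ho_rep \<beta>)"
      using Ho_rep(1)[OF a(1)] Ho_rep(1)[OF a(2)] a(3,4) by simp_all
  next
    fix D :: "'m test_twocat" and F assume *: "two_functor (disc A) D F \<and> sends_to_equivalences D \<Sigma> F"
    then have "localizing_functor A \<Sigma> D F"
      using homotopy_base_axioms two_functorD(2)
      by (auto simp: localizing_functor_def localizing_functor_axioms_def)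
    then show "hat_seq D F (ho_rep \<alpha>) = hat_seq D F (ho_rep \<beta>)"
      using eq by (simp add: ho_hat_def)
  qed
  then show ?thesis using ho_class_eq Ho_rep(2) a by metis
qed

lemma two_category_Ho: "two_category (Ho A \<Sigma>)"
proof -
  have lf: "two_category D" if "localizing_functor A \<Sigma> D F" for D :: "'m test_twocat" and F
    using that by (simp add: localizing_functor_def)
  \<comment> \<open>After \<open>Ho_eqI\<close> the test 2-functor is a bound variable, so its
    locale cannot be interpreted; the rules are added with the locale predicate as a
    premise.\<close>
  note [simp] = lf two_category.cell_simps two_category.VC_simps two_category.HC_simps
    localizing_functor.F_simps localizing_functor.ho_hat_simps localizing_functor.ho_hat_ops
  show ?thesis
  proof (rule two_categoryI)
    fix \<alpha> assume a: "\<alpha> \<in> Cl \<H>"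
    show "VC \<H> \<alpha> (Id2 \<H> (Dm \<H> \<alpha>)) = \<alpha>"
      "VC \<H> (Id2 \<H> (Cd \<H> \<alpha>)) \<alpha> = \<alpha>"
      "HC \<H> \<alpha> (Id2 \<H> (Idn \<H> (Src \<H> (Dm \<H> \<alpha>)))) = \<alpha>"
      "HC \<H> (Id2 \<H> (Idn \<H> (Tgt \<H> (Dm \<H> \<alpha>)))) \<alpha> = \<alpha>"
      by (rule Ho_eqI; use a in simp)+
  next
    fix \<alpha> \<beta> \<gamma> assume a: "\<alpha> \<in> Cl \<H>" "\<beta> \<in> Cl \<H>" "\<gamma> \<in> Cl \<H>"
    show "VC \<H> \<gamma> (VC \<H> \<beta> \<alpha>) = VC \<H> (VC \<H> \<gamma> \<beta>) \<alpha>"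
      if "Cd \<H> \<alpha> = Dm \<H> \<beta>" "Cd \<H> \<beta> = Dm \<H> \<gamma>"
      by (rule Ho_eqI; use a that in simp)
    show "HC \<H> \<gamma> (HC \<H> \<beta> \<alpha>) = HC \<H> (HC \<H> \<gamma> \<beta>) \<alpha>"
      if "Tgt \<H> (Dm \<H> \<alpha>) = Src \<H> (Dm \<H> \<beta>)"
        "Tgt \<H> (Dm \<H> \<beta>) = Src \<H> (Dm \<H> \<gamma>)"
      by (rule Ho_eqI; use a that in simp)
  next
    fix f g assume a: "f \<in> Ar \<H>" "g \<in> Ar \<H>" "Tgt \<H> f = Src \<H> g"
    show "HC \<H> (Id2 \<H> g) (Id2 \<H> f) = Id2 \<H> (Cmp \<H> g f)"
      by (rule Ho_eqI; use a in simp)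
  next
    fix \<alpha> \<alpha>' \<beta> \<beta>' assume a: "\<alpha> \<in> Cl \<H>" "\<alpha>' \<in> Cl \<H>" "\<beta> \<in> Cl \<H>" "\<beta>' \<in> Cl \<H>"
      "Cd \<H> \<alpha> = Dm \<H> \<alpha>'" "Cd \<H> \<beta> = Dm \<H> \<beta>'"
      "Tgt \<H> (Dm \<H> \<alpha>) = Src \<H> (Dm \<H> \<beta>)"
    \<comment> \<open>Composability of \<alpha>' with \<beta>' is needed on the right-hand side. The
      domains of \<alpha>' and \<beta>' are only given as codomains of \<alpha> and \<beta>, so
      their endpoints have to be traced back.\<close>
    have "Src A (Dm \<H> \<beta>') = Src A (Dm \<H> \<beta>)" "Tgt A (Dm \<H> \<alpha>') = Tgt A (Dm \<H> \<alpha>)"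
      using a(5,6)[symmetric] a(1-4) by simp_all
    with a show "HC \<H> (VC \<H> \<beta>' \<beta>) (VC \<H> \<alpha>' \<alpha>) =
        VC \<H> (HC \<H> \<beta>' \<alpha>') (HC \<H> \<beta> \<alpha>)"
      by (intro Ho_eqI) (simp_all add: two_category.HC_VC)
  qed simp_all
qed

end

section \<open>Precomposition and extension to the homotopy 2-category\<close>

context two_category_pair
begin

lemma Hom_p_plus_sel [simp]:
  "Ob (Hom_p_plus B W D) = {F. two_functor B D F \<and> sends_to_equivalences D W F}"
  "Ar (Hom_p_plus B W D) = {\<theta>. pseudonatural B D \<theta> \<and> sends_to_equivalences D W (PDom \<theta>) \<and>
    sends_to_equivalences D W (PCod \<theta>)}"
  "Cl (Hom_p_plus B W D) = {\<rho>. modification B D \<rho> \<and> sends_to_equivalences D W (PDom (MDom \<rho>)) \<and>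
    sends_to_equivalences D W (PCod (MDom \<rho>))}"
  "Src (Hom_p_plus B W D) = PDom" "Tgt (Hom_p_plus B W D) = PCod" "Idn (Hom_p_plus B W D) = id_pnat B D"
  "Cmp (Hom_p_plus B W D) = comp_pnat B D" "Dm (Hom_p_plus B W D) = MDom" "Cd (Hom_p_plus B W D) = MCod"
  "Id2 (Hom_p_plus B W D) = Id2 (Hom_p B D)" "VC (Hom_p_plus B W D) = VC (Hom_p B D)"
  "HC (Hom_p_plus B W D) = HC (Hom_p B D)"
  by (auto simp: Hom_p_plus_def full_sub_two_category_def)

lemma two_category_Hom_p_plus: "two_category (Hom_p_plus B W D)"
proof -
  interpret H: two_category "Hom_p B D" by (rule two_category_Hom_p)
  show ?thesis
    unfolding Hom_p_plus_def full_sub_two_category_def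
    by (rule two_category_sub[OF two_category_Hom_p])
      (auto simp: pseudonatural_id pseudonatural_comp modification_Id2 modification_VC modification_HC)
qed

end

lemma Hom_p_plus_empty: "Hom_p_plus B {} D = Hom_p B D"
  by (simp add: Hom_p_plus_def full_sub_two_category_def sends_to_equivalences_def)

lemma comp_twofun_sel [simp]:
  "a \<in> Ob B \<Longrightarrow> FO (comp_twofun B G F) a = FO G (FO F a)"
  "f \<in> Ar B \<Longrightarrow> FA (comp_twofun B G F) f = FA G (FA F f)"
  "\<alpha> \<in> Cl B \<Longrightarrow> FC (comp_twofun B G F) \<alpha> = FC G (FC F \<alpha>)"
  "FO (comp_twofun B G F) \<in> extensional (Ob B)" "FA (comp_twofun B G F) \<in> extensional (Ar B)"
  "FC (comp_twofun B G F) \<in> extensional (Cl B)"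
  by (simp_all add: comp_twofun_def)

lemma twofun_eqI:
  fixes F G :: "('o, 'm, 'c, 'p, 'n, 'd) twofun"
  assumes "\<And>a. a \<in> Ob B \<Longrightarrow> FO F a = FO G a" "\<And>f. f \<in> Ar B \<Longrightarrow> FA F f = FA G f"
    "\<And>\<alpha>. \<alpha> \<in> Cl B \<Longrightarrow> FC F \<alpha> = FC G \<alpha>"
    "FO F \<in> extensional (Ob B)" "FO G \<in> extensional (Ob B)" "FA F \<in> extensional (Ar B)"
    "FA G \<in> extensional (Ar B)" "FC F \<in> extensional (Cl B)" "FC G \<in> extensional (Cl B)"
  shows "F = G"
proof -
  have "FO F = FO G" using extensionalityI[OF assms(4,5)] assms(1) by blast
  moreover have "FA F = FA G" using extensionalityI[OF assms(6,7)] assms(2) by blast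
  moreover have "FC F = FC G" using extensionalityI[OF assms(8,9)] assms(3) by blast
  ultimately show ?thesis by simp
qed

lemma two_functor_ext:
  "two_functor B D F \<Longrightarrow> FO F \<in> extensional (Ob B)" "two_functor B D F \<Longrightarrow> FA F \<in> extensional (Ar B)"
  "two_functor B D F \<Longrightarrow> FC F \<in> extensional (Cl B)"
  by (simp_all add: two_functor_def)

text \<open>One construction serves three purposes: restriction to fibrant-cofibrant objects,
  precomposition with endofunctors of the model category and, with \<open>S\<close> empty, the
  2-functor \<open>q^*\<close> of the theorem.\<close>

definition precomposition_plus ::
  "('o, 'm, 'c) twocat \<Rightarrow> ('p, 'n, 'd) twocat \<Rightarrow> 'n set \<Rightarrow> ('r, 'k, 'e) twocat \<Rightarrow>
   ('o, 'm, 'c, 'p, 'n, 'd) twofun \<Rightarrow>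
   (('p, 'n, 'd, 'r, 'k, 'e) twofun, ('p, 'n, 'd, 'r, 'k, 'e) pnat, ('p, 'n, 'd, 'r, 'k, 'e) modif,
    ('o, 'm, 'c, 'r, 'k, 'e) twofun, ('o, 'm, 'c, 'r, 'k, 'e) pnat, ('o, 'm, 'c, 'r, 'k, 'e) modif)
   twofun" where
  "precomposition_plus B H S D q = \<lparr>FO = (\<lambda>F\<in>Ob (Hom_p_plus H S D). comp_twofun B F q),
     FA = (\<lambda>\<theta>\<in>Ar (Hom_p_plus H S D). precomp_pnat B q \<theta>),
     FC = (\<lambda>\<rho>\<in>Cl (Hom_p_plus H S D). precomp_modif B q \<rho>)\<rparr>"

lemma precomposition_plus_empty: "precomposition_plus B H {} D q = precomposition B H D q"
  by (simp add: precomposition_plus_def precomposition_def Hom_p_plus_empty)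

lemma precomposition_plus_sel [simp]:
  "F \<in> Ob (Hom_p_plus H S D) \<Longrightarrow> FO (precomposition_plus B H S D q) F = comp_twofun B F q"
  "\<theta> \<in> Ar (Hom_p_plus H S D) \<Longrightarrow> FA (precomposition_plus B H S D q) \<theta> = precomp_pnat B q \<theta>"
  "\<rho> \<in> Cl (Hom_p_plus H S D) \<Longrightarrow> FC (precomposition_plus B H S D q) \<rho> = precomp_modif B q \<rho>"
  "FO (precomposition_plus B H S D q) \<in> extensional (Ob (Hom_p_plus H S D))"
  "FA (precomposition_plus B H S D q) \<in> extensional (Ar (Hom_p_plus H S D))"
  "FC (precomposition_plus B H S D q) \<in> extensional (Cl (Hom_p_plus H S D))"
  by (simp_all add: precomposition_plus_def)

lemma precomp_pnat_sel [simp]: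
  "PDom (precomp_pnat B q \<theta>) = comp_twofun B (PDom \<theta>) q"
  "PCod (precomp_pnat B q \<theta>) = comp_twofun B (PCod \<theta>) q"
  "X \<in> Ob B \<Longrightarrow> PO (precomp_pnat B q \<theta>) X = PO \<theta> (FO q X)"
  "f \<in> Ar B \<Longrightarrow> PA (precomp_pnat B q \<theta>) f = PA \<theta> (FA q f)"
  "PO (precomp_pnat B q \<theta>) \<in> extensional (Ob B)" "PA (precomp_pnat B q \<theta>) \<in> extensional (Ar B)"
  by (simp_all add: precomp_pnat_def)

lemma precomp_modif_sel [simp]:
  "MDom (precomp_modif B q \<rho>) = precomp_pnat B q (MDom \<rho>)"
  "MCod (precomp_modif B q \<rho>) = precomp_pnat B q (MCod \<rho>)"
  "X \<in> Ob B \<Longrightarrow> MC (precomp_modif B q \<rho>) X = MC \<rho> (FO q X)"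
  "MC (precomp_modif B q \<rho>) \<in> extensional (Ob B)"
  by (simp_all add: precomp_modif_def)

locale two_category_triple = BH: two_category_pair B H + BD: two_category_pair B D + HD: two_category_pair H D
  for B :: "('o, 'm, 'c) twocat" and H :: "('p, 'n, 'd) twocat" and D :: "('r, 'k, 'e) twocat" +
  fixes q :: "('o, 'm, 'c, 'p, 'n, 'd) twofun"
  assumes q: "two_functor B H q"
begin

lemma pseudonatural_precomp:
  assumes \<theta>: "pseudonatural H D \<theta>"
  shows "pseudonatural B D (precomp_pnat B q \<theta>)"
proof (rule pseudonaturalI, goal_cases)
  show "two_functor B D (PDom (precomp_pnat B q \<theta>))" "two_functor B D (PCod (precomp_pnat B q \<theta>))"
    using \<theta> by (simp_all add: two_functor_comp[OF q])
next
  case \<gamma>: (13 \<gamma>)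
  then show ?case
    using HD.pseudonatural_nat[OF \<theta>, of "FC q \<gamma>"] \<gamma> q by simp
qed (use \<theta> q in simp_all)

lemma modification_precomp:
  assumes \<rho>: "modification H D \<rho>"
  shows "modification B D (precomp_modif B q \<rho>)"
proof (rule modificationI, goal_cases)
  case f: (9 f)
  then show ?case
    using HD.modification_nat[OF \<rho>, of "FA q f"] f q by simp
qed (use \<rho> q in \<open>simp_all add: pseudonatural_precomp\<close>)

text \<open>Transformations and modifications are composed pointwise, so precomposition preserves
  all operations strictly. \<open>SW\<close> ensures that the values lie in the full
  sub-2-category.\<close>

lemma two_functor_precomposition_plus:
  assumes SW: "\<And>F. two_functor H D F \<Longrightarrow> sends_to_equivalences D S F \<Longrightarrow>
    sends_to_equivalences D W (comp_twofun B F q)"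
  shows "two_functor (Hom_p_plus H S D) (Hom_p_plus B W D) (precomposition_plus B H S D q)"
proof (rule two_functorI, goal_cases)
  case 3 show ?case by (rule precomposition_plus_sel)
next
  case 4 show ?case by (rule precomposition_plus_sel)
next
  case 5 show ?case by (rule precomposition_plus_sel)
next
  case (13 F)
  then show ?case
    by (intro BD.pseudonatural_eqI) (use q in \<open>simp_all add: HD.pseudonatural_id\<close>)
next
  case (14 \<theta> \<phi>)
  then show ?case
    by (intro BD.pseudonatural_eqI) (use q in \<open>simp_all add: HD.pseudonatural_comp\<close>)
next
  case (15 \<theta>)
  then show ?case
    by (intro BD.modification_eqI) (use q in \<open>simp_all add: HD.modification_Id2\<close>)
next
  case (16 \<rho> \<sigma>)
  then show ?case
    by (intro BD.modification_eqI) (use q in \<open>simp_all add: HD.modification_VC\<close>)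
next
  case (17 \<rho> \<sigma>)
  have c: "precomp_pnat B q (comp_pnat H D \<phi> \<theta>) = comp_pnat B D (precomp_pnat B q \<phi>) (precomp_pnat B q \<theta>)"
    for \<phi> \<theta> :: "('p, 'n, 'd, 'r, 'k, 'e) pnat"
    by (rule BD.pseudonatural_eqI) (use q in simp_all)
  show ?case
    by (rule BD.modification_eqI) (use 17 q in \<open>simp_all add: HD.modification_HC c\<close>)
qed (use SW q in \<open>simp_all add: two_functor_comp[OF q] HD.two_category_Hom_p_plus BD.two_category_Hom_p_plus
      pseudonatural_precomp modification_precomp\<close>)

end


section \<open>Extension of 2-functors, transformations and modifications to the homotopy
  2-category\<close>

definition ho_ext ::
  "('o, 'm) cat \<Rightarrow> 'm set \<Rightarrow> ('p, 'n, 'd) twocat \<Rightarrow> ('o, 'm, 'm, 'p, 'n, 'd) twofun \<Rightarrow>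
   ('o, 'm, ('o, 'm) ho_cell, 'p, 'n, 'd) twofun" where
  "ho_ext A \<Sigma> D F = \<lparr>FO = FO F, FA = FA F, FC = (\<lambda>\<alpha>\<in>Cl (Ho A \<Sigma>). ho_hat D F \<alpha>)\<rparr>"

text \<open>The homotopy 2-category has the objects and arrows of \<open>A\<close>, so all
  components are kept and only the boundary 2-functors change. What has to be proved is naturality
  in the new 2-cells.\<close>

definition ho_ext_pnat ::
  "('o, 'm) cat \<Rightarrow> 'm set \<Rightarrow> ('p, 'n, 'd) twocat \<Rightarrow> ('o, 'm, 'm, 'p, 'n, 'd) pnat \<Rightarrow>
   ('o, 'm, ('o, 'm) ho_cell, 'p, 'n, 'd) pnat" where
  "ho_ext_pnat A \<Sigma> D \<theta> = \<lparr>PDom = ho_ext A \<Sigma> D (PDom \<theta>), PCod = ho_ext A \<Sigma> D (PCod \<theta>),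
     PO = PO \<theta>, PA = PA \<theta>\<rparr>"

definition ho_ext_modif ::
  "('o, 'm) cat \<Rightarrow> 'm set \<Rightarrow> ('p, 'n, 'd) twocat \<Rightarrow> ('o, 'm, 'm, 'p, 'n, 'd) modif \<Rightarrow>
   ('o, 'm, ('o, 'm) ho_cell, 'p, 'n, 'd) modif" where
  "ho_ext_modif A \<Sigma> D \<rho> = \<lparr>MDom = ho_ext_pnat A \<Sigma> D (MDom \<rho>), MCod = ho_ext_pnat A \<Sigma> D (MCod \<rho>),
     MC = MC \<rho>\<rparr>"

lemma ho_ext_sel [simp]:
  "FO (ho_ext A \<Sigma> D F) = FO F" "FA (ho_ext A \<Sigma> D F) = FA F"
  "\<alpha> \<in> Cl (Ho A \<Sigma>) \<Longrightarrow> FC (ho_ext A \<Sigma> D F) \<alpha> = ho_hat D F \<alpha>"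
  "FC (ho_ext A \<Sigma> D F) \<in> extensional (Cl (Ho A \<Sigma>))"
  "PDom (ho_ext_pnat A \<Sigma> D \<theta>) = ho_ext A \<Sigma> D (PDom \<theta>)"
  "PCod (ho_ext_pnat A \<Sigma> D \<theta>) = ho_ext A \<Sigma> D (PCod \<theta>)"
  "PO (ho_ext_pnat A \<Sigma> D \<theta>) = PO \<theta>" "PA (ho_ext_pnat A \<Sigma> D \<theta>) = PA \<theta>"
  "MDom (ho_ext_modif A \<Sigma> D \<rho>) = ho_ext_pnat A \<Sigma> D (MDom \<rho>)"
  "MCod (ho_ext_modif A \<Sigma> D \<rho>) = ho_ext_pnat A \<Sigma> D (MCod \<rho>)"
  "MC (ho_ext_modif A \<Sigma> D \<rho>) = MC \<rho>"
  by (simp_all add: ho_ext_def ho_ext_pnat_def ho_ext_modif_def)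

lemma (in localizing_functor) two_functor_ho_ext: "two_functor \<H> D (ho_ext A \<Sigma> D F)"
proof (rule two_functorI)
  show "FO (ho_ext A \<Sigma> D F) \<in> extensional (Ob \<H>)" "FA (ho_ext A \<Sigma> D F) \<in> extensional (Ar \<H>)"
    using two_functor_ext[OF F] by (simp_all add: disc_sel)
qed (simp_all add: two_category_Ho D.two_category_axioms)

locale localizing_transformation = homotopy_base A \<Sigma> + D: two_category D
  for A :: "('o, 'm) cat" and \<Sigma> :: "'m set" and D :: "('p, 'n, 'd) twocat" +
  fixes \<theta> :: "('o, 'm, 'm, 'p, 'n, 'd) pnat"
  assumes \<theta>: "pseudonatural (disc A) D \<theta>" and E_PDom: "sends_to_equivalences D \<Sigma> (PDom \<theta>)"
    and E_PCod: "sends_to_equivalences D \<Sigma> (PCod \<theta>)"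
begin

sublocale P: two_category_pair "disc A" D
  by (simp add: two_category_pair_def two_category_disc category_axioms D.two_category_axioms)

sublocale S: localizing_functor A \<Sigma> D "PDom \<theta>"
  by unfold_locales (use \<theta> E_PDom in simp_all)

sublocale T: localizing_functor A \<Sigma> D "PCod \<theta>"
  by unfold_locales (use \<theta> E_PCod in simp_all)

lemmas \<theta>_simps [simp] = P.pseudonatural_simps(3-)[OF \<theta>, unfolded disc_sel]

text \<open>The cell of \<theta> at \<open>x\<close> expands in two ways, through
  \<open>s d0\<close> and through \<open>s d1\<close>. Comparing the expansions gives the claim
  whiskered with the image of \<open>s\<close> under the codomain 2-functor and pasted with the
  invertible cell \<open>\<theta>_s\<close>; both can be cancelled, the whiskering because
  \<open>s\<close> goes to an equivalence.\<close>

lemma hat_cyl_nat: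
  assumes c [simp]: "is_cylinder A \<Sigma> X c" and X [simp]: "X \<in> Ob A"
  shows "VC D (PA \<theta> (cyl_d1 c)) (HC D (hat_cyl D (PCod \<theta>) c) (Id2 D (PO \<theta> X))) =
    VC D (HC D (Id2 D (PO \<theta> (cyl_W c))) (hat_cyl D (PDom \<theta>) c)) (PA \<theta> (cyl_d0 c))"
proof -
  let ?F = "FA (PDom \<theta>)" and ?G = "FA (PCod \<theta>)"
  let ?f = "hat_cyl D (PDom \<theta>) c" and ?g = "hat_cyl D (PCod \<theta>) c"
  let ?s = "cyl_s c" and ?d0 = "cyl_d0 c" and ?d1 = "cyl_d1 c" and ?x = "cyl_x c" and ?W = "cyl_W c"
  note [simp] = S.hat_cyl_simps(1-3)[OF c] T.hat_cyl_simps(1-3)[OF c] cylinder_simps[OF c]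
  have x0: "PA \<theta> ?x = VC D (HC D (PA \<theta> ?s) (Id2 D (?F ?d0))) (HC D (Id2 D (?G ?s)) (PA \<theta> ?d0))"
    using \<theta>_simps(9)[of ?d0 ?s] by simp
  have x1: "PA \<theta> ?x = VC D (HC D (PA \<theta> ?s) (Id2 D (?F ?d1))) (HC D (Id2 D (?G ?s)) (PA \<theta> ?d1))"
    using \<theta>_simps(9)[of ?d1 ?s] by simp
  show ?thesis
  proof (rule D.equivalence_cancel[OF T.F_equivalence[of ?s]])
    have "VC D (HC D (PA \<theta> ?s) (Id2 D (?F ?d1)))
        (HC D (Id2 D (?G ?s)) (VC D (PA \<theta> ?d1) (HC D ?g (Id2 D (PO \<theta> X))))) =
      VC D (VC D (HC D (PA \<theta> ?s) (Id2 D (?F ?d1))) (HC D (Id2 D (?G ?s)) (PA \<theta> ?d1)))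
        (HC D (HC D (Id2 D (?G ?s)) ?g) (Id2 D (PO \<theta> X)))"
      by simp
    also have "\<dots> = PA \<theta> ?x"
      unfolding x1[symmetric] T.hat_cyl_simps(4)[OF c] by simp
    also have "\<dots> = VC D (HC D (Id2 D (PO \<theta> (cyl_Z c))) (HC D (Id2 D (?F ?s)) ?f)) (PA \<theta> ?x)"
      unfolding S.hat_cyl_simps(4)[OF c] by simp
    also have "\<dots> = VC D (VC D (HC D (Id2 D (PO \<theta> (cyl_Z c))) (HC D (Id2 D (?F ?s)) ?f))
        (HC D (PA \<theta> ?s) (Id2 D (?F ?d0)))) (HC D (Id2 D (?G ?s)) (PA \<theta> ?d0))"
      unfolding x0 by (rule D.VC_simps(3)[symmetric]) simp_all
    also have "VC D (HC D (Id2 D (PO \<theta> (cyl_Z c))) (HC D (Id2 D (?F ?s)) ?f)) (HC D (PA \<theta> ?s) (Id2 D (?F ?d0)))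
      = VC D (HC D (PA \<theta> ?s) (Id2 D (?F ?d1))) (HC D (Id2 D (?G ?s)) (HC D (Id2 D (PO \<theta> ?W)) ?f))"
      using D.whisker_swap[of ?f "PA \<theta> ?s"] by simp
    also have "VC D (VC D (HC D (PA \<theta> ?s) (Id2 D (?F ?d1))) (HC D (Id2 D (?G ?s)) (HC D (Id2 D (PO \<theta> ?W)) ?f)))
        (HC D (Id2 D (?G ?s)) (PA \<theta> ?d0)) =
      VC D (HC D (PA \<theta> ?s) (Id2 D (?F ?d1)))
        (HC D (Id2 D (?G ?s)) (VC D (HC D (Id2 D (PO \<theta> ?W)) ?f) (PA \<theta> ?d0)))"
      by simp
    finally show "HC D (Id2 D (?G ?s)) (VC D (PA \<theta> ?d1) (HC D ?g (Id2 D (PO \<theta> X)))) =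
        HC D (Id2 D (?G ?s)) (VC D (HC D (Id2 D (PO \<theta> ?W)) ?f) (PA \<theta> ?d0))"
      by (rule D.invertible_cancel_left[rotated -1]) simp_all
  qed simp_all
qed

text \<open>The cell of a homotopy is that of its cylinder whiskered with \<open>h\<close>. The
  square for the cylinder is pasted with \<open>\<theta>_h\<close>, and the cells of \<theta> at the
  two ends are expanded through \<open>h\<close>.\<close>

lemma hat_nat:
  assumes H: "is_homotopy A \<Sigma> f g H"
  shows "VC D (PA \<theta> g) (HC D (hat D (PCod \<theta>) H) (Id2 D (PO \<theta> (Src A f)))) =
    VC D (HC D (Id2 D (PO \<theta> (Tgt A f))) (hat D (PDom \<theta>) H)) (PA \<theta> f)"
  using H
proof (rule homotopyE)
  fix c h assume a [simp]: "H = (c, h)" "is_cylinder A \<Sigma> (Src A f) c" "h \<in> Ar A" "Src A h = cyl_W c"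
    "f \<in> Ar A" "g \<in> Ar A" "Src A g = Src A f" "Tgt A f = Tgt A h" "Tgt A g = Tgt A h"
    and fg: "Cmp A h (cyl_d0 c) = f" "Cmp A h (cyl_d1 c) = g"
  let ?F = "FA (PDom \<theta>)" and ?G = "FA (PCod \<theta>)" and ?X = "Src A f"
  let ?f = "hat_cyl D (PDom \<theta>) c" and ?g = "hat_cyl D (PCod \<theta>) c"
  let ?d0 = "cyl_d0 c" and ?d1 = "cyl_d1 c"
  note [simp] = S.hat_cyl_simps[OF a(2)] T.hat_cyl_simps[OF a(2)] cylinder_simps[OF a(2)]
  have f: "PA \<theta> f = VC D (HC D (PA \<theta> h) (Id2 D (?F ?d0))) (HC D (Id2 D (?G h)) (PA \<theta> ?d0))"
    using \<theta>_simps(9)[of ?d0 h] unfolding fg by simp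
  have g: "PA \<theta> g = VC D (HC D (PA \<theta> h) (Id2 D (?F ?d1))) (HC D (Id2 D (?G h)) (PA \<theta> ?d1))"
    using \<theta>_simps(9)[of ?d1 h] unfolding fg by simp
  have "VC D (PA \<theta> g) (HC D (HC D (Id2 D (?G h)) ?g) (Id2 D (PO \<theta> ?X))) =
    VC D (HC D (PA \<theta> h) (Id2 D (?F ?d1))) (HC D (Id2 D (?G h)) (VC D (PA \<theta> ?d1) (HC D ?g (Id2 D (PO \<theta> ?X)))))"
    unfolding g by simp
  also have "\<dots> = VC D (VC D (HC D (PA \<theta> h) (Id2 D (?F ?d1))) (HC D (Id2 D (?G h)) (HC D (Id2 D (PO \<theta> (cyl_W c))) ?f)))
      (HC D (Id2 D (?G h)) (PA \<theta> ?d0))"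
    using hat_cyl_nat[of ?X c] by simp
  also have "VC D (HC D (PA \<theta> h) (Id2 D (?F ?d1))) (HC D (Id2 D (?G h)) (HC D (Id2 D (PO \<theta> (cyl_W c))) ?f)) =
      VC D (HC D (Id2 D (PO \<theta> (Tgt A h))) (HC D (Id2 D (?F h)) ?f)) (HC D (PA \<theta> h) (Id2 D (?F ?d0)))"
    using D.whisker_swap[of ?f "PA \<theta> h"] by simp
  also have "VC D (VC D (HC D (Id2 D (PO \<theta> (Tgt A h))) (HC D (Id2 D (?F h)) ?f)) (HC D (PA \<theta> h) (Id2 D (?F ?d0))))
      (HC D (Id2 D (?G h)) (PA \<theta> ?d0)) =
    VC D (HC D (Id2 D (PO \<theta> (Tgt A h))) (HC D (Id2 D (?F h)) ?f)) (PA \<theta> f)"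
    unfolding f by simp
  finally show ?thesis by (simp add: hat_def)
qed

lemma hat_seq_nat:
  "homotopy_seq A \<Sigma> f g Hs \<Longrightarrow> VC D (PA \<theta> g) (HC D (hat_seq D (PCod \<theta>) Hs) (Id2 D (PO \<theta> (Src A f)))) =
    VC D (HC D (Id2 D (PO \<theta> (Tgt A f))) (hat_seq D (PDom \<theta>) Hs)) (PA \<theta> f)"
proof (induction rule: homotopy_seq.induct)
  case (single f g H)
  then show ?case using hat_nat by simp
next
  case (step f e Hs g H)
  note n = homotopy_seq_nonempty[OF step(1)]
  note s = homotopy_seq_Ar[OF step(1)]
  have g: "g \<in> Ar A" "Src A g = Src A e" "Tgt A g = Tgt A e"
    using homotopy_seq_Ar[OF homotopy_seq.single[OF step(2)]] by simp_all
  note [simp] = S.hat_simps[OF step(2)] T.hat_simps[OF step(2)] S.hat_seq_simps[OF step(1)]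
    T.hat_seq_simps[OF step(1)] g
  let ?X = "Src A f" and ?Y = "Tgt A f"
  let ?h = "hat D (PCod \<theta>) H" and ?k = "hat_seq D (PCod \<theta>) Hs"
    and ?h' = "hat D (PDom \<theta>) H" and ?k' = "hat_seq D (PDom \<theta>) Hs"
  have "VC D (PA \<theta> g) (HC D (VC D ?h ?k) (Id2 D (PO \<theta> ?X))) =
      VC D (VC D (PA \<theta> g) (HC D ?h (Id2 D (PO \<theta> ?X)))) (HC D ?k (Id2 D (PO \<theta> ?X)))"
    using s by simp
  also have "VC D (PA \<theta> g) (HC D ?h (Id2 D (PO \<theta> ?X))) = VC D (HC D (Id2 D (PO \<theta> ?Y)) ?h') (PA \<theta> e)"
    using hat_nat[OF step(2)] s by metis
  also have "VC D (VC D (HC D (Id2 D (PO \<theta> ?Y)) ?h') (PA \<theta> e)) (HC D ?k (Id2 D (PO \<theta> ?X))) =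
      VC D (HC D (Id2 D (PO \<theta> ?Y)) ?h') (VC D (PA \<theta> e) (HC D ?k (Id2 D (PO \<theta> ?X))))"
    using s by simp
  also have "\<dots> = VC D (HC D (Id2 D (PO \<theta> ?Y)) (VC D ?h' ?k')) (PA \<theta> f)"
    unfolding step.IH using s by simp
  finally show ?case using n by (simp add: hat_seq_Cons)
qed

lemma pseudonatural_ho_ext: "pseudonatural \<H> D (ho_ext_pnat A \<Sigma> D \<theta>)"
proof (rule pseudonaturalI, goal_cases)
  show "PO (ho_ext_pnat A \<Sigma> D \<theta>) \<in> extensional (Ob \<H>)"
    "PA (ho_ext_pnat A \<Sigma> D \<theta>) \<in> extensional (Ar \<H>)"
    using P.pseudonatural_ext[OF \<theta>] by (simp_all add: disc_sel)
next
  case (13 \<gamma>)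
  then show ?case
    using hat_seq_nat[OF Ho_rep(1)] by (simp add: ho_hat_def)
qed (simp_all add: S.two_functor_ho_ext T.two_functor_ho_ext)

end

definition Ho_ext ::
  "('o, 'm) cat \<Rightarrow> 'm set \<Rightarrow> ('p, 'n, 'd) twocat \<Rightarrow>
   (('o, 'm, 'm, 'p, 'n, 'd) twofun, ('o, 'm, 'm, 'p, 'n, 'd) pnat, ('o, 'm, 'm, 'p, 'n, 'd) modif,
    ('o, 'm, ('o, 'm) ho_cell, 'p, 'n, 'd) twofun, ('o, 'm, ('o, 'm) ho_cell, 'p, 'n, 'd) pnat,
    ('o, 'm, ('o, 'm) ho_cell, 'p, 'n, 'd) modif) twofun" where
  "Ho_ext A \<Sigma> D = \<lparr>FO = (\<lambda>F\<in>Ob (Hom_p_plus (disc A) \<Sigma> D). ho_ext A \<Sigma> D F),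
     FA = (\<lambda>\<theta>\<in>Ar (Hom_p_plus (disc A) \<Sigma> D). ho_ext_pnat A \<Sigma> D \<theta>),
     FC = (\<lambda>\<rho>\<in>Cl (Hom_p_plus (disc A) \<Sigma> D). ho_ext_modif A \<Sigma> D \<rho>)\<rparr>"

lemma Ho_ext_sel [simp]:
  "F \<in> Ob (Hom_p_plus (disc A) \<Sigma> D) \<Longrightarrow> FO (Ho_ext A \<Sigma> D) F = ho_ext A \<Sigma> D F"
  "\<theta> \<in> Ar (Hom_p_plus (disc A) \<Sigma> D) \<Longrightarrow> FA (Ho_ext A \<Sigma> D) \<theta> = ho_ext_pnat A \<Sigma> D \<theta>"
  "\<rho> \<in> Cl (Hom_p_plus (disc A) \<Sigma> D) \<Longrightarrow> FC (Ho_ext A \<Sigma> D) \<rho> = ho_ext_modif A \<Sigma> D \<rho>"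
  "FO (Ho_ext A \<Sigma> D) \<in> extensional (Ob (Hom_p_plus (disc A) \<Sigma> D))"
  "FA (Ho_ext A \<Sigma> D) \<in> extensional (Ar (Hom_p_plus (disc A) \<Sigma> D))"
  "FC (Ho_ext A \<Sigma> D) \<in> extensional (Cl (Hom_p_plus (disc A) \<Sigma> D))"
  by (simp_all add: Ho_ext_def)

context homotopy_base
begin

lemma localizing_functorI:
  "two_functor (disc A) D F \<Longrightarrow> sends_to_equivalences D \<Sigma> F \<Longrightarrow> localizing_functor A \<Sigma> D F"
  using homotopy_base_axioms two_functorD(2)
  by (auto simp: localizing_functor_def localizing_functor_axioms_def)

lemma two_functor_Ho_ext:
  fixes D :: "('p, 'n, 'd) twocat"
  assumes "two_category D"
  shows "two_functor (Hom_p_plus (disc A) \<Sigma> D) (Hom_p \<H> D) (Ho_ext A \<Sigma> D)"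
proof -
  interpret D: two_category D by (rule assms)
  interpret P: two_category_pair "disc A" D
    by (simp add: two_category_pair_def two_category_disc category_axioms assms)
  interpret H: two_category_pair \<H> D
    by (simp add: two_category_pair_def two_category_Ho assms)
  have F: "two_functor \<H> D (ho_ext A \<Sigma> D F)"
    if "two_functor (disc A) D F" "sends_to_equivalences D \<Sigma> F" for F
    using localizing_functor.two_functor_ho_ext[OF localizing_functorI] that by blast
  have \<theta>: "pseudonatural \<H> D (ho_ext_pnat A \<Sigma> D \<theta>)"
    if "pseudonatural (disc A) D \<theta>" "sends_to_equivalences D \<Sigma> (PDom \<theta>)"
      "sends_to_equivalences D \<Sigma> (PCod \<theta>)" for \<theta>
  proof -
    have "localizing_transformation A \<Sigma> D \<theta>" by unfold_locales (use that in auto)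
    then show ?thesis by (rule localizing_transformation.pseudonatural_ho_ext)
  qed
  \<comment> \<open>The modification axiom speaks of objects and arrows only, so the new 2-cells add
    no condition.\<close>
  have \<rho>: "modification \<H> D (ho_ext_modif A \<Sigma> D \<rho>)"
    if r: "modification (disc A) D \<rho>" "sends_to_equivalences D \<Sigma> (PDom (MDom \<rho>))"
      "sends_to_equivalences D \<Sigma> (PCod (MDom \<rho>))" for \<rho>
  proof (rule modificationI, goal_cases)
    case (9 f)
    then show ?case
      using P.modification_nat[OF r(1), of f] by (simp add: disc_sel)
  next
    show "MC (ho_ext_modif A \<Sigma> D \<rho>) \<in> extensional (Ob \<H>)"
      using P.modification_ext[OF r(1)] by (simp add: disc_sel)
  qed (use r P.modification_simps(5-7)[OF r(1), unfolded disc_sel] in \<open>simp_all add: \<theta>\<close>)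
  note ext = P.pseudonatural_ext[unfolded disc_sel] P.modification_ext[unfolded disc_sel]
    P.comp_pnat_sel(5,6)[unfolded disc_sel] P.id_pnat_sel(5,6)[unfolded disc_sel]
    P.Hom_p_cells(7-9)[unfolded disc_sel] H.comp_pnat_sel(5,6)[unfolded Ho_sel]
    H.id_pnat_sel(5,6)[unfolded Ho_sel] H.Hom_p_cells(7-9)[unfolded Ho_sel]
  have c: "ho_ext_pnat A \<Sigma> D (comp_pnat (disc A) D \<phi> \<theta>) =
      comp_pnat \<H> D (ho_ext_pnat A \<Sigma> D \<phi>) (ho_ext_pnat A \<Sigma> D \<theta>)"
    for \<phi> \<theta> :: "('o, 'm, 'm, 'p, 'n, 'd) pnat"
    by (rule H.pseudonatural_eqI) (simp_all add: disc_sel ext)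
  show ?thesis
  proof (rule two_functorI, goal_cases)
    case 3 show ?case by (rule Ho_ext_sel)
  next
    case 4 show ?case by (rule Ho_ext_sel)
  next
    case 5 show ?case by (rule Ho_ext_sel)
  next
    case (13 F)
    then show ?case
      by (intro H.pseudonatural_eqI) (simp_all add: P.pseudonatural_id disc_sel ext)
  next
    case (14 \<theta> \<phi>)
    then show ?case by (simp add: P.pseudonatural_comp c)
  next
    case (15 \<theta>)
    then show ?case
      by (intro H.modification_eqI) (simp_all add: P.modification_Id2 disc_sel ext)
  next
    case (16 \<rho> \<sigma>)
    then show ?case
      by (intro H.modification_eqI) (simp_all add: P.modification_VC disc_sel ext)
  next
    case (17 \<rho> \<sigma>)
    then show ?case
      by (intro H.modification_eqI) (simp_all add: P.modification_HC disc_sel ext c)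
  qed (simp_all add: F \<theta> \<rho> H.two_category_Hom_p P.two_category_Hom_p_plus)
qed

section \<open>The inclusion into the homotopy 2-category and the uniqueness of extensions\<close>

lemma ho_inclusion_sel [simp]:
  "X \<in> Ob A \<Longrightarrow> FO (ho_inclusion A \<Sigma>) X = X" "f \<in> Ar A \<Longrightarrow> FA (ho_inclusion A \<Sigma>) f = f"
  "f \<in> Ar A \<Longrightarrow> FC (ho_inclusion A \<Sigma>) f = Id2 \<H> f"
  by (simp_all add: ho_inclusion_def)

lemma two_functor_ho_inclusion: "two_functor (disc A) \<H> (ho_inclusion A \<Sigma>)"
proof -
  interpret H: two_category \<H> by (rule two_category_Ho)
  have "Id2 \<H> (Cmp A g f) = HC \<H> (Id2 \<H> g) (Id2 \<H> f)"
    if "f \<in> Ar A" "g \<in> Ar A" "Tgt A f = Src A g" for f g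
    using H.HC_simps(3)[of f g] that by simp
  moreover have "VC \<H> (Id2 \<H> f) (Id2 \<H> f) = Id2 \<H> f" if "f \<in> Ar A" for f
    using that by simp
  moreover have "FO (ho_inclusion A \<Sigma>) \<in> extensional (Ob A)" "FA (ho_inclusion A \<Sigma>) \<in> extensional (Ar A)"
    "FC (ho_inclusion A \<Sigma>) \<in> extensional (Ar A)" by (simp_all add: ho_inclusion_def)
  ultimately show ?thesis
    by (intro two_functorI) (simp_all add: disc_sel two_category_disc category_axioms two_category_Ho)
qed

lemma ho_ext_inclusion:
  assumes "localizing_functor A \<Sigma> D F"
  shows "comp_twofun (disc A) (ho_ext A \<Sigma> D F) (ho_inclusion A \<Sigma>) = F"
proof -
  interpret F: localizing_functor A \<Sigma> D F by (rule assms)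
  show ?thesis
    by (rule twofun_eqI[of "disc A"]) (simp_all add: two_functor_ext[OF F.F], simp_all add: disc_sel)
qed

text \<open>If \<open>s i = id\<close>, then \<open>s (i s) = s id\<close>, so \<open>i s\<close> and \<open>id\<close> are the ends of a cylinder with
  collapse map \<open>s\<close>, which gives a homotopy between them.\<close>

lemma retraction_equivalence:
  assumes i: "i \<in> Ar A" and s: "s \<in> Ar A" "s \<in> \<Sigma>" and st: "Src A s = Tgt A i" "Tgt A s = Src A i"
    and si: "Cmp A s i = Idn A (Src A i)"
  shows "equivalence \<H> i" "equivalence \<H> s"
proof -
  let ?Z = "Tgt A i" and ?X = "Src A i"
  interpret H: two_category \<H> by (rule two_category_Ho)
  note [simp] = i s st si
  have sis: "Cmp A s (Cmp A i s) = s" using category_simps(11)[of s i s] by simp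
  define c where "c = (\<lambda>d e. \<lparr>cyl_W = ?Z, cyl_Z = ?X, cyl_d0 = d, cyl_d1 = e, cyl_s = s, cyl_x = s\<rparr>)"
  have csel [simp]: "cyl_W (c d e) = ?Z" "cyl_Z (c d e) = ?X" "cyl_d0 (c d e) = d" "cyl_d1 (c d e) = e"
    "cyl_s (c d e) = s" "cyl_x (c d e) = s" for d e by (simp_all add: c_def)
  have c: "is_cylinder A \<Sigma> ?Z (c (Cmp A i s) (Idn A ?Z))" "is_cylinder A \<Sigma> ?Z (c (Idn A ?Z) (Cmp A i s))"
    using sis by (simp_all add: is_cylinder_def hom_def)
  let ?u = "[(c (Cmp A i s) (Idn A ?Z), Idn A ?Z)]" and ?v = "[(c (Idn A ?Z) (Cmp A i s), Idn A ?Z)]"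
  have h: "homotopy_seq A \<Sigma> (Cmp A i s) (Idn A ?Z) ?u" "homotopy_seq A \<Sigma> (Idn A ?Z) (Cmp A i s) ?v"
    by (rule homotopy_seq.single[OF homotopyI[OF c(1)]] homotopy_seq.single[OF homotopyI[OF c(2)]];
        simp)+
  let ?a = "ho_class A \<Sigma> (Cmp A i s) (Idn A ?Z) ?u" and ?b = "ho_class A \<Sigma> (Idn A ?Z) (Cmp A i s) ?v"
  note [simp] = Ho_class[OF h(1)] Ho_class[OF h(2)]
  \<comment> \<open>The two cells come from the same data with the ends exchanged. A test 2-functor
    followed by whiskering with \<open>F s\<close> sends each of them to the identity of
    \<open>F s\<close>, and this whiskering is faithful.\<close>
  have inv: "VC \<H> ?b ?a = Id2 \<H> (Cmp A i s)" "VC \<H> ?a ?b = Id2 \<H> (Idn A ?Z)"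
  proof (rule_tac [!] Ho_eqI)
    fix D :: "'m test_twocat" and F assume "localizing_functor A \<Sigma> D F"
    then interpret F: localizing_functor A \<Sigma> D F .
    note [simp] = F.hat_cyl_simps[OF c(1), unfolded csel] F.hat_cyl_simps[OF c(2), unfolded csel]
    have [simp]: "ho_hat D F ?a = hat_cyl D F (c (Cmp A i s) (Idn A ?Z))"
      "ho_hat D F ?b = hat_cyl D F (c (Idn A ?Z) (Cmp A i s))"
      unfolding F.ho_hat_class[OF h(1)] F.ho_hat_class[OF h(2)] by (simp_all add: hat_def)
    have [simp]: "Cmp D (FA F s) (Cmp D (FA F i) (FA F s)) = FA F s"
      using F.F_simps(6)[of "Cmp A i s" s] sis by simp
    show "ho_hat D F (VC \<H> ?b ?a) = ho_hat D F (Id2 \<H> (Cmp A i s))"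
      "ho_hat D F (VC \<H> ?a ?b) = ho_hat D F (Id2 \<H> (Idn A ?Z))"
      by (rule F.D.equivalence_cancel[OF F.F_equivalence[OF s(2)]]; simp)+
  qed simp_all
  have "Id2 \<H> (Idn A ?X) \<in> cell \<H> (Idn A ?X) (Cmp A s i)"
    "Id2 \<H> (Idn A ?X) \<in> cell \<H> (Cmp A s i) (Idn A ?X)"
    by (simp_all add: H.cell_iff)
  then show "equivalence \<H> i" "equivalence \<H> s"
    using H.equivalenceI[of i s "Id2 \<H> (Idn A ?X)" "Id2 \<H> (Idn A ?X)" ?a ?b]
      H.equivalenceI[of s i ?b ?a "Id2 \<H> (Idn A ?X)" "Id2 \<H> (Idn A ?X)"] inv
    by (simp_all add: H.cell_iff hom_def)
qed

end

text \<open>The assumption makes the inclusion itself a localizing 2-functor, so that homotopies can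
  be evaluated in the homotopy 2-category. It presupposes that \<open>Ho A \<Sigma>\<close> is a
  2-category, whence the separate locale.\<close>

locale homotopy_localization = homotopy_base A \<Sigma>
  for A :: "('o, 'm) cat" and \<Sigma> :: "'m set" +
  assumes Sigma_equivalence: "w \<in> \<Sigma> \<Longrightarrow> equivalence (Ho A \<Sigma>) w"
begin

lemma localizing_ho_inclusion: "localizing_functor A \<Sigma> \<H> (ho_inclusion A \<Sigma>)"
proof (rule localizing_functorI[OF two_functor_ho_inclusion])
  show "sends_to_equivalences \<H> \<Sigma> (ho_inclusion A \<Sigma>)"
    unfolding sends_to_equivalences_def using Sigma_equivalence Sigma_Ar by (metis ho_inclusion_sel(2) subsetD)
qed

text \<open>The inclusion is the universal example: each test 2-functor \<open>F\<close> factors as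
  the inclusion followed by \<open>ho_ext A \<Sigma> D F\<close>, and evaluation is compatible with
  composition of 2-functors. Hence every \<open>F\<close> takes the same value on both
  sides.\<close>

lemma hat_seq_inclusion:
  assumes H: "homotopy_seq A \<Sigma> f g Hs"
  shows "hat_seq \<H> (ho_inclusion A \<Sigma>) Hs = ho_class A \<Sigma> f g Hs"
proof -
  interpret I: localizing_functor A \<Sigma> \<H> "ho_inclusion A \<Sigma>" by (rule localizing_ho_inclusion)
  note fg = homotopy_seq_Ar[OF H]
  show ?thesis
  proof (rule Ho_eqI)
    fix D :: "'m test_twocat" and F assume l: "localizing_functor A \<Sigma> D F"
    then interpret F: localizing_functor A \<Sigma> D F .
    have "hat_seq D F Hs = FC (ho_ext A \<Sigma> D F) (hat_seq \<H> (ho_inclusion A \<Sigma>) Hs)"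
      using hat_seq_comp[OF I.F I.E Sigma_Ar F.two_functor_ho_ext H] ho_ext_inclusion[OF l] by simp
    then show "ho_hat D F (hat_seq \<H> (ho_inclusion A \<Sigma>) Hs) = ho_hat D F (ho_class A \<Sigma> f g Hs)"
      using F.ho_hat_class[OF H] I.hat_seq_simps(1)[OF H] by simp
  qed (use Ho_class[OF H] I.hat_seq_simps[OF H] fg in simp_all)
qed

text \<open>By \<open>hat_seq_inclusion\<close> every 2-cell is the evaluation of its representative
  at the inclusion. A 2-functor \<open>K\<close> sends it to the evaluation at \<open>K\<close>
  composed with the inclusion, so its values on 2-cells are forced by those on arrows.\<close>

lemma ho_ext_unique:
  assumes K: "two_functor \<H> D K"
  shows "localizing_functor A \<Sigma> D (comp_twofun (disc A) K (ho_inclusion A \<Sigma>))"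
    and "ho_ext A \<Sigma> D (comp_twofun (disc A) K (ho_inclusion A \<Sigma>)) = K"
proof -
  interpret I: localizing_functor A \<Sigma> \<H> "ho_inclusion A \<Sigma>" by (rule localizing_ho_inclusion)
  let ?F = "comp_twofun (disc A) K (ho_inclusion A \<Sigma>)"
  show l: "localizing_functor A \<Sigma> D ?F"
    using localizing_functorI[OF two_functor_comp[OF I.F K] sends_to_equivalences_comp[OF K I.E]]
      Sigma_Ar by (simp add: disc_sel)
  interpret F: localizing_functor A \<Sigma> D ?F by (rule l)
  show "ho_ext A \<Sigma> D ?F = K"
  proof (rule twofun_eqI[of \<H>])
    fix \<alpha> assume \<alpha>: "\<alpha> \<in> Cl \<H>"
    have "hat_seq D ?F (ho_rep \<alpha>) = FC K \<alpha>"
      using hat_seq_comp[OF I.F I.E Sigma_Ar K Ho_rep(1)[OF \<alpha>]] hat_seq_inclusion[OF Ho_rep(1)[OF \<alpha>]]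
        Ho_rep(2)[OF \<alpha>] by simp
    then show "FC (ho_ext A \<Sigma> D ?F) \<alpha> = FC K \<alpha>" using \<alpha> by (simp add: ho_hat_def)
  qed (use two_functor_ext[OF K] two_functor_ext[OF F.F] in \<open>simp_all add: disc_sel\<close>)
qed

end

section \<open>Model categories with normal factorizations\<close>

lemma category_full_subcategory: "category C \<Longrightarrow> category (full_subcategory C S)"
proof -
  assume "category C"
  then interpret category C .
  show ?thesis
    by unfold_locales (auto simp: full_subcategory_def hom_def)
qed

locale normal_model_category = model_category C W Fib Cof
  for C :: "('o, 'm) cat" and W Fib Cof +
  fixes z t :: 'o and \<Phi> \<Psi> :: "'m factorization"
  assumes z: "initial C z" and t: "terminal C t"
    and \<Phi>: "functorial_factorization C Cof (W \<inter> Fib) \<Phi>"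
    and \<Psi>: "functorial_factorization C (W \<inter> Cof) Fib \<Psi>"
    and normal: "normal_factorizations C Fib Cof z t \<Phi> \<Psi>"
begin

lemma W_3for2:
  assumes "f \<in> Ar C" "g \<in> Ar C" "Tgt C f = Src C g"
  shows "f \<in> W \<Longrightarrow> g \<in> W \<Longrightarrow> Cmp C g f \<in> W" "f \<in> W \<Longrightarrow> Cmp C g f \<in> W \<Longrightarrow> g \<in> W"
    "g \<in> W \<Longrightarrow> Cmp C g f \<in> W \<Longrightarrow> f \<in> W"
  using W_three_for_two assms unfolding three_for_two_def by blast+

text \<open>Factoring the identity yields some \<open>r\<close> in \<open>W\<close> with target
  \<open>X\<close>. Since \<open>id r = r\<close>, 3-for-2 puts the identity in
  \<open>W\<close>.\<close>

lemma Idn_W: "X \<in> Ob C \<Longrightarrow> Idn C X \<in> W"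
proof -
  assume X: "X \<in> Ob C"
  then obtain r where r: "r \<in> W" "Tgt C r = X"
    using factorization_triv_fib unfolding factorizes_def
    by (metis IntD1 category_simps(3,5))
  then have "r \<in> Ar C" using W_Ar by blast
  then show "Idn C X \<in> W" using W_3for2(2)[of r "Idn C X"] X r by simp
qed

lemma comp_closed:
  "f \<in> Cof \<Longrightarrow> g \<in> Cof \<Longrightarrow> Tgt C f = Src C g \<Longrightarrow> Cmp C g f \<in> Cof"
  "f \<in> Fib \<Longrightarrow> g \<in> Fib \<Longrightarrow> Tgt C f = Src C g \<Longrightarrow> Cmp C g f \<in> Fib"
  using compositions[of Cof] compositions[of Fib] unfolding closed_under_composition_def by auto

abbreviation "from_z \<equiv> from_initial C z"
abbreviation "to_t \<equiv> to_terminal C t"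

lemma z_Ob [simp]: "z \<in> Ob C" and t_Ob [simp]: "t \<in> Ob C"
  using z t by (auto simp: initial_def terminal_def)

lemma from_z [simp]:
  assumes "X \<in> Ob C"
  shows "from_z X \<in> Ar C" "Src C (from_z X) = z" "Tgt C (from_z X) = X"
proof -
  have "from_z X \<in> hom C z X"
    unfolding from_initial_def by (rule theI') (use z assms in \<open>auto simp: initial_def\<close>)
  then show "from_z X \<in> Ar C" "Src C (from_z X) = z" "Tgt C (from_z X) = X" by (auto simp: hom_def)
qed

lemma from_z_eq: "f \<in> Ar C \<Longrightarrow> Src C f = z \<Longrightarrow> Tgt C f = X \<Longrightarrow> f = from_z X"
proof -
  assume f: "f \<in> Ar C" "Src C f = z" "Tgt C f = X"
  then have "X \<in> Ob C" by auto
  moreover from this have "f \<in> hom C z X" "from_z X \<in> hom C z X" using f by (auto simp: hom_def)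
  ultimately show "f = from_z X" using z unfolding initial_def by blast
qed

lemma to_t [simp]:
  assumes "X \<in> Ob C"
  shows "to_t X \<in> Ar C" "Tgt C (to_t X) = t" "Src C (to_t X) = X"
proof -
  have "to_t X \<in> hom C X t"
    unfolding to_terminal_def by (rule theI') (use t assms in \<open>auto simp: terminal_def\<close>)
  then show "to_t X \<in> Ar C" "Tgt C (to_t X) = t" "Src C (to_t X) = X" by (auto simp: hom_def)
qed

lemma to_t_eq: "f \<in> Ar C \<Longrightarrow> Tgt C f = t \<Longrightarrow> Src C f = X \<Longrightarrow> f = to_t X"
proof -
  assume f: "f \<in> Ar C" "Tgt C f = t" "Src C f = X"
  then have "X \<in> Ob C" by auto
  moreover from this have "f \<in> hom C X t" "to_t X \<in> hom C X t" using f by (auto simp: hom_def)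
  ultimately show "f = to_t X" using t unfolding terminal_def by blast
qed

section \<open>The functors \<open>Q\<close> and \<open>R\<close> and their natural
  transformations\<close>

lemma factorization_simps:
  assumes F: "functorial_factorization C L R \<Theta>" and f: "f \<in> Ar C"
  shows "Lam \<Theta> f \<in> L" "Rho \<Theta> f \<in> R" "Lam \<Theta> f \<in> Ar C" "Src C (Lam \<Theta> f) = Src C f"
    "Rho \<Theta> f \<in> Ar C" "Src C (Rho \<Theta> f) = Tgt C (Lam \<Theta> f)" "Tgt C (Rho \<Theta> f) = Tgt C f"
  using F f unfolding functorial_factorization_def hom_def by auto

lemma Fmap_simps:
  assumes F: "functorial_factorization C L R \<Theta>" and s: "comm_square C f g u v"
  shows "Fmap \<Theta> f g u v \<in> Ar C" "Src C (Fmap \<Theta> f g u v) = Tgt C (Lam \<Theta> f)"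
    "Tgt C (Fmap \<Theta> f g u v) = Tgt C (Lam \<Theta> g)"
    "Cmp C (Fmap \<Theta> f g u v) (Lam \<Theta> f) = Cmp C (Lam \<Theta> g) u"
    "Cmp C (Rho \<Theta> g) (Fmap \<Theta> f g u v) = Cmp C v (Rho \<Theta> f)"
  using F s unfolding functorial_factorization_def hom_def by auto

abbreviation "Qo \<equiv> Q_ob C z \<Phi>"
abbreviation "Qa \<equiv> Q_ar C z \<Phi>"
abbreviation "Ro \<equiv> R_ob C t \<Psi>"
abbreviation "Ra \<equiv> R_ar C t \<Psi>"
abbreviation "p X \<equiv> Rho \<Phi> (from_z X)"
abbreviation "v X \<equiv> Lam \<Psi> (to_t X)"

lemma p_simps [simp]:
  assumes "X \<in> Ob C"
  shows "p X \<in> Ar C" "Src C (p X) = Qo X" "Tgt C (p X) = X" "p X \<in> W"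
  using factorization_simps[OF \<Phi>, of "from_z X"] assms by (auto simp: Q_ob_def)

lemma v_simps [simp]:
  assumes "X \<in> Ob C"
  shows "v X \<in> Ar C" "Src C (v X) = X" "Tgt C (v X) = Ro X" "v X \<in> W" "v X \<in> Cof"
  using factorization_simps[OF \<Psi>, of "to_t X"] assms by (auto simp: R_ob_def)

lemma Qo_Ob [simp]: "X \<in> Ob C \<Longrightarrow> Qo X \<in> Ob C"
  using p_simps category_simps(1) by metis

lemma Ro_Ob [simp]: "X \<in> Ob C \<Longrightarrow> Ro X \<in> Ob C"
  using v_simps category_simps(2) by metis

lemma Q_square: "f \<in> Ar C \<Longrightarrow> comm_square C (from_z (Src C f)) (from_z (Tgt C f)) (Idn C z) f"
  using from_z_eq[of "Cmp C f (from_z (Src C f))" "Tgt C f"] by (simp add: comm_square_def hom_def)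

lemma R_square: "f \<in> Ar C \<Longrightarrow> comm_square C (to_t (Src C f)) (to_t (Tgt C f)) f (Idn C t)"
  using to_t_eq[of "Cmp C (to_t (Tgt C f)) f" "Src C f"] by (simp add: comm_square_def hom_def)

lemma Qa_simps [simp]:
  assumes f: "f \<in> Ar C"
  shows "Qa f \<in> Ar C" "Src C (Qa f) = Qo (Src C f)" "Tgt C (Qa f) = Qo (Tgt C f)"
    "Cmp C (p (Tgt C f)) (Qa f) = Cmp C f (p (Src C f))"
  using Fmap_simps[OF \<Phi> Q_square[OF f]] by (simp_all add: Q_ar_def Q_ob_def)

lemma Ra_simps [simp]:
  assumes f: "f \<in> Ar C"
  shows "Ra f \<in> Ar C" "Src C (Ra f) = Ro (Src C f)" "Tgt C (Ra f) = Ro (Tgt C f)"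
    "Cmp C (Ra f) (v (Src C f)) = Cmp C (v (Tgt C f)) f"
  \<comment> \<open>\<open>v_simps\<close> folds \<open>Tgt C (v X)\<close> into
    \<open>Ro X\<close>, which \<open>R_ob_def\<close> unfolds again; one of them must be switched
    off.\<close>
  using Fmap_simps[OF \<Psi> R_square[OF f]] by (simp_all add: R_ar_def R_ob_def del: v_simps)

text \<open>These are the laws of \<open>Fmap\<close> for squares whose side at \<open>z\<close> is
  an identity; in a composite of two such squares that side is again the identity.\<close>

lemma Qa_functor [simp]:
  "X \<in> Ob C \<Longrightarrow> Qa (Idn C X) = Idn C (Qo X)"
  "f \<in> Ar C \<Longrightarrow> g \<in> Ar C \<Longrightarrow> Tgt C f = Src C g \<Longrightarrow> Qa (Cmp C g f) = Cmp C (Qa g) (Qa f)"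
proof -
  have 1: "\<forall>f\<in>Ar C. Fmap \<Phi> f f (Idn C (Src C f)) (Idn C (Tgt C f)) = Idn C (Tgt C (Lam \<Phi> f))"
    and 2: "\<forall>f g h u v u' v'. comm_square C f g u' v' \<and> comm_square C g h u v \<longrightarrow>
      Fmap \<Phi> f h (Cmp C u u') (Cmp C v v') = Cmp C (Fmap \<Phi> g h u v) (Fmap \<Phi> f g u' v')"
    using \<Phi> unfolding functorial_factorization_def by blast+
  show "Qa (Idn C X) = Idn C (Qo X)" if "X \<in> Ob C"
    using 1[rule_format, of "from_z X"] that by (simp add: Q_ar_def Q_ob_def)
  show "Qa (Cmp C g f) = Cmp C (Qa g) (Qa f)" if "f \<in> Ar C" "g \<in> Ar C" "Tgt C f = Src C g"
    using 2[rule_format, OF conjI, OF Q_square[of f], of "from_z (Tgt C g)" "Idn C z" g] Q_square[of g] that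
    by (simp add: Q_ar_def)
qed

lemma Ra_functor [simp]:
  "X \<in> Ob C \<Longrightarrow> Ra (Idn C X) = Idn C (Ro X)"
  "f \<in> Ar C \<Longrightarrow> g \<in> Ar C \<Longrightarrow> Tgt C f = Src C g \<Longrightarrow> Ra (Cmp C g f) = Cmp C (Ra g) (Ra f)"
proof -
  have 1: "\<forall>f\<in>Ar C. Fmap \<Psi> f f (Idn C (Src C f)) (Idn C (Tgt C f)) = Idn C (Tgt C (Lam \<Psi> f))"
    and 2: "\<forall>f g h u v u' v'. comm_square C f g u' v' \<and> comm_square C g h u v \<longrightarrow>
      Fmap \<Psi> f h (Cmp C u u') (Cmp C v v') = Cmp C (Fmap \<Psi> g h u v) (Fmap \<Psi> f g u' v')"
    using \<Psi> unfolding functorial_factorization_def by blast+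
  show "Ra (Idn C X) = Idn C (Ro X)" if "X \<in> Ob C"
    using 1[rule_format, of "to_t X"] that by (simp add: R_ar_def R_ob_def del: v_simps)
  show "Ra (Cmp C g f) = Cmp C (Ra g) (Ra f)" if "f \<in> Ar C" "g \<in> Ar C" "Tgt C f = Src C g"
    using 2[rule_format, OF conjI, OF R_square[of f], of "to_t (Tgt C g)" g "Idn C t"] R_square[of g] that
    by (simp add: R_ar_def)
qed

text \<open>In the naturality square of \<open>p\<close> three of the four sides are weak
  equivalences, so 3-for-2 gives the fourth.\<close>

lemma Qa_W: "f \<in> W \<Longrightarrow> Qa f \<in> W"
proof -
  assume f: "f \<in> W"
  then have [simp]: "f \<in> Ar C" using W_Ar by blast
  have "Cmp C (p (Tgt C f)) (Qa f) \<in> W" using f by (simp add: W_3for2(1))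
  then show "Qa f \<in> W" by (rule W_3for2(3)[rotated -1]) simp_all
qed

lemma Ra_W: "f \<in> W \<Longrightarrow> Ra f \<in> W"
proof -
  assume f: "f \<in> W"
  then have [simp]: "f \<in> Ar C" using W_Ar by blast
  have "Cmp C (Ra f) (v (Src C f)) \<in> W" using f by (simp add: W_3for2(1))
  then show "Ra f \<in> W" by (rule W_3for2(2)[rotated -1]) simp_all
qed

lemma cofibrant_Qo: "X \<in> Ob C \<Longrightarrow> cofibrant C Cof z (Qo X)"
  using factorization_simps[OF \<Phi>, of "from_z X"] from_z_eq[of "Lam \<Phi> (from_z X)" "Qo X"]
  by (simp add: cofibrant_def Q_ob_def)

lemma fibrant_Ro: "X \<in> Ob C \<Longrightarrow> fibrant C Fib t (Ro X)"
  using factorization_simps[OF \<Psi>, of "to_t X"] to_t_eq[of "Rho \<Psi> (to_t X)" "Ro X"]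
  by (simp add: fibrant_def R_ob_def del: v_simps)

lemma cofibrant_comp:
  assumes "cofibrant C Cof z X" "f \<in> Cof" "Src C f = X"
  shows "cofibrant C Cof z (Tgt C f)"
proof -
  have f [simp]: "f \<in> Ar C" using assms Cof_Ar by blast
  have X: "X \<in> Ob C" "from_z X \<in> Cof" using assms by (auto simp: cofibrant_def)
  have "Cmp C f (from_z X) = from_z (Tgt C f)" by (rule from_z_eq) (use assms X in simp_all)
  moreover have "Cmp C f (from_z X) \<in> Cof" using comp_closed(1)[of "from_z X" f] assms X by simp
  ultimately show ?thesis by (simp add: cofibrant_def)
qed

lemma fibrant_comp:
  assumes "fibrant C Fib t Y" "f \<in> Fib" "Tgt C f = Y"
  shows "fibrant C Fib t (Src C f)"
proof -
  have f [simp]: "f \<in> Ar C" using assms Fib_Ar by blast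
  have Y: "Y \<in> Ob C" "to_t Y \<in> Fib" using assms by (auto simp: fibrant_def)
  have "Cmp C (to_t Y) f = to_t (Src C f)" by (rule to_t_eq) (use assms Y in simp_all)
  moreover have "Cmp C (to_t Y) f \<in> Fib" using comp_closed(2)[of f "to_t Y"] assms Y by simp
  ultimately show ?thesis by (simp add: fibrant_def)
qed

text \<open>\<open>v (Qo X)\<close> is a cofibration out of a cofibrant object, so applying
  \<open>R\<close> after \<open>Q\<close> does not destroy cofibrancy.\<close>

lemma cofibrant_RQ: "X \<in> Ob C \<Longrightarrow> cofibrant C Cof z (Ro (Qo X))"
  using cofibrant_comp[OF cofibrant_Qo, of X "v (Qo X)"] by simp

section \<open>Fibrant-cofibrant objects and the weak equivalences between them\<close>

abbreviation "Cfc \<equiv> fibrant_cofibrant C Fib Cof z t"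
abbreviation "\<Sigma> \<equiv> W \<inter> Ar Cfc"

lemma Cfc_sel [simp]:
  "X \<in> Ob Cfc \<longleftrightarrow> fibrant C Fib t X \<and> cofibrant C Cof z X"
  "f \<in> Ar Cfc \<longleftrightarrow> f \<in> Ar C \<and> Src C f \<in> Ob Cfc \<and> Tgt C f \<in> Ob Cfc"
  "Src Cfc = Src C" "Tgt Cfc = Tgt C" "Idn Cfc = Idn C" "Cmp Cfc = Cmp C"
  by (auto simp: fibrant_cofibrant_def full_subcategory_def fibrant_def)

lemma fc_Ob: "fibrant C Fib t X \<Longrightarrow> X \<in> Ob C"
  by (simp add: fibrant_def)

text \<open>Normality is assumed for objects and for \<open>p\<close>. On arrows it follows from
  naturality of \<open>p\<close>, whose two components are then identities.\<close>

lemma Q_normal: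
  "cofibrant C Cof z X \<Longrightarrow> Qo X = X"
  "f \<in> Ar C \<Longrightarrow> cofibrant C Cof z (Src C f) \<Longrightarrow> cofibrant C Cof z (Tgt C f) \<Longrightarrow> Qa f = f"
proof -
  have n: "Qo X = X" "p X = Idn C X" if "cofibrant C Cof z X" for X
    using normal that by (auto simp: normal_factorizations_def)
  show "cofibrant C Cof z X \<Longrightarrow> Qo X = X" by (rule n)
  show "Qa f = f" if f: "f \<in> Ar C" "cofibrant C Cof z (Src C f)" "cofibrant C Cof z (Tgt C f)"
    using Qa_simps(4)[OF f(1)] f n[OF f(2)] n[OF f(3)] by simp
qed

lemma R_normal:
  "fibrant C Fib t X \<Longrightarrow> Ro X = X"
  "f \<in> Ar C \<Longrightarrow> fibrant C Fib t (Src C f) \<Longrightarrow> fibrant C Fib t (Tgt C f) \<Longrightarrow> Ra f = f"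
proof -
  have n: "Ro X = X" "v X = Idn C X" if "fibrant C Fib t X" for X
    using normal that by (auto simp: normal_factorizations_def)
  show "fibrant C Fib t X \<Longrightarrow> Ro X = X" by (rule n)
  show "Ra f = f" if f: "f \<in> Ar C" "fibrant C Fib t (Src C f)" "fibrant C Fib t (Tgt C f)"
    using Ra_simps(4)[OF f(1)] f n[OF f(2)] n[OF f(3)] by simp
qed

sublocale fc: homotopy_base Cfc \<Sigma>
proof -
  have "category Cfc"
    unfolding fibrant_cofibrant_def by (rule category_full_subcategory) (rule category_axioms)
  then interpret c: category Cfc .
  show "homotopy_base Cfc \<Sigma>"
    by unfold_locales (auto simp: Idn_W fc_Ob)
qed

text \<open>A weak equivalence factors as a trivial cofibration, which has a retraction because its
  source is fibrant, followed by a trivial fibration, which has a section because its target is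
  cofibrant.\<close>

lemma weak_equivalence_Ho:
  assumes w: "w \<in> \<Sigma>"
  shows "equivalence (Ho Cfc \<Sigma>) w"
proof -
  interpret H: two_category "Ho Cfc \<Sigma>" by (rule fc.two_category_Ho)
  define X Y where "X = Src C w" and "Y = Tgt C w"
  have XY: "w \<in> Ar C" "w \<in> W" "fibrant C Fib t X" "cofibrant C Cof z X" "fibrant C Fib t Y"
    "cofibrant C Cof z Y" "Src C w = X" "Tgt C w = Y"
    using w by (auto simp: X_def Y_def)
  note ob [simp] = XY fc_Ob[OF XY(3)] fc_Ob[OF XY(5)]
  obtain l q where lq: "l \<in> W \<inter> Cof" "q \<in> Fib" "Src C l = X" "Tgt C l = Src C q" "Tgt C q = Y"
    "Cmp C q l = w"
    using factorization_triv_cof XY(1) unfolding factorizes_def by (metis X_def Y_def)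
  define Z where "Z = Tgt C l"
  have l [simp]: "l \<in> Ar C" "l \<in> W" "l \<in> Cof" "Src C l = X" "Tgt C l = Z" "Src C q = Z" "Tgt C q = Y"
    "q \<in> Ar C" "q \<in> Fib" "Cmp C q l = w"
    using lq Cof_Ar Fib_Ar by (auto simp: Z_def)
  have q [simp]: "q \<in> W" using W_3for2(2)[of l q] by simp
  \<comment> \<open>The middle object stays in \<open>Cfc\<close>: \<open>q\<close> is a fibration
    onto the fibrant \<open>Y\<close> and \<open>l\<close> a cofibration out of the cofibrant
    \<open>X\<close>. This is why the factorization can be used inside
    \<open>\<Sigma>\<close>.\<close>
  have Z [simp]: "Z \<in> Ob C" "fibrant C Fib t Z" "cofibrant C Cof z Z"
    using category_simps(2)[of l] fibrant_comp[of Y q] cofibrant_comp[of X l] by (simp_all del: category_simps)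
  \<comment> \<open>The identity of \<open>X\<close> is extended along \<open>l\<close>; the lower
    side is determined because its target is terminal. The lift is the retraction
    \<open>s\<close>.\<close>
  have "comm_square C l (to_t X) (Idn C X) (to_t Z)"
    using to_t_eq[of "Cmp C (to_t Z) l" X] by (simp add: comm_square_def hom_def)
  moreover have "lifting_property C l (to_t X)"
    by (rule lifting_triv_cof) (use XY in \<open>simp_all add: fibrant_def\<close>)
  ultimately obtain s where s: "s \<in> hom C (Tgt C l) (Src C (to_t X))" "Cmp C s l = Idn C X"
    unfolding lifting_property_def by blast
  then have s [simp]: "s \<in> Ar C" "Src C s = Z" "Tgt C s = X" "Cmp C s l = Idn C X"
    by (simp_all add: hom_def)
  have [simp]: "s \<in> W" using W_3for2(2)[of l s] Idn_W by simp
  \<comment> \<open>Dually, the identity of \<open>Y\<close> is lifted through \<open>q\<close>,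
    starting from the initial object. The lift is the section \<open>h\<close>.\<close>
  have "comm_square C (from_z Y) q (from_z Z) (Idn C Y)"
    using from_z_eq[of "Cmp C q (from_z Z)" Y] by (simp add: comm_square_def hom_def)
  moreover have "lifting_property C (from_z Y) q"
    by (rule lifting_triv_fib) (use XY in \<open>simp_all add: cofibrant_def\<close>)
  ultimately obtain h where h: "h \<in> hom C (Tgt C (from_z Y)) (Src C q)" "Cmp C q h = Idn C Y"
    unfolding lifting_property_def by blast
  then have h [simp]: "h \<in> Ar C" "Src C h = Y" "Tgt C h = Z" "Cmp C q h = Idn C Y"
    by (simp_all add: hom_def)
  have "equivalence (Ho Cfc \<Sigma>) l" by (rule fc.retraction_equivalence(1)[of l s]) simp_all
  moreover have "equivalence (Ho Cfc \<Sigma>) q" by (rule fc.retraction_equivalence(2)[of h q]) simp_all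
  ultimately have "equivalence (Ho Cfc \<Sigma>) (Cmp (Ho Cfc \<Sigma>) q l)" by (rule H.equivalence_Cmp) simp
  then show ?thesis by simp
qed

sublocale fc: homotopy_localization Cfc \<Sigma>
  by unfold_locales (rule weak_equivalence_Ho)

lemma two_category_discs: "two_category (disc C)" "two_category (disc Cfc)"
  by (simp_all add: two_category_disc category_axioms fc.category_axioms)

abbreviation "r \<equiv> fc_replacement C z t \<Phi> \<Psi>"

definition "Qf = \<lparr>FO = (\<lambda>X\<in>Ob C. Qo X), FA = (\<lambda>f\<in>Ar C. Qa f), FC = (\<lambda>f\<in>Ar C. Qa f)\<rparr>"
definition "inc = \<lparr>FO = (\<lambda>X\<in>Ob Cfc. X), FA = (\<lambda>f\<in>Ar Cfc. f), FC = (\<lambda>f\<in>Ar Cfc. f)\<rparr>"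

lemma functor_sel [simp]:
  "X \<in> Ob C \<Longrightarrow> FO Qf X = Qo X" "f \<in> Ar C \<Longrightarrow> FA Qf f = Qa f" "f \<in> Ar C \<Longrightarrow> FC Qf f = Qa f"
  "X \<in> Ob Cfc \<Longrightarrow> FO inc X = X" "f \<in> Ar Cfc \<Longrightarrow> FA inc f = f" "f \<in> Ar Cfc \<Longrightarrow> FC inc f = f"
  "X \<in> Ob C \<Longrightarrow> FO r X = Ro (Qo X)" "f \<in> Ar C \<Longrightarrow> FA r f = Ra (Qa f)" "f \<in> Ar C \<Longrightarrow> FC r f = Ra (Qa f)"
  by (simp_all add: Qf_def inc_def fc_replacement_def del: Cfc_sel)

lemma two_functor_Qf: "two_functor (disc C) (disc C) Qf"
  by (rule two_functorI) (simp_all add: disc_sel two_category_discs, simp_all add: Qf_def)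

lemma two_functor_r: "two_functor (disc C) (disc Cfc) r"
  by (rule two_functorI)
    (simp_all add: disc_sel two_category_discs fibrant_Ro cofibrant_RQ, simp_all add: fc_replacement_def)

lemma two_functor_inc: "two_functor (disc Cfc) (disc C) inc"
  by (rule two_functorI)
    (simp_all add: disc_sel two_category_discs fc_Ob del: Cfc_sel(1,2), simp_all add: inc_def fc_Ob)

lemma r_W: "w \<in> W \<Longrightarrow> FA r w \<in> \<Sigma>"
  using W_Ar by (auto simp: Ra_W Qa_W fibrant_Ro cofibrant_RQ)

lemma r_normal:
  "X \<in> Ob Cfc \<Longrightarrow> FO r X = X" "f \<in> Ar Cfc \<Longrightarrow> FA r f = f"
  by (simp_all add: Q_normal R_normal fc_Ob)

end

section \<open>Precomposition with naturally weakly equivalent functors\<close>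

lemma equivalence_full_sub_two_category:
  assumes B: "two_category B" and S: "two_category (full_sub_two_category B S)"
    and s: "equivalence B s" and st: "Src B s \<in> S" "Tgt B s \<in> S"
  shows "equivalence (full_sub_two_category B S) s"
proof -
  interpret B: two_category B by (rule B)
  interpret S: two_category "full_sub_two_category B S" by (rule S)
  have h: "hom (full_sub_two_category B S) a b = {f \<in> hom B a b. a \<in> S \<and> b \<in> S}" for a b
    by (auto simp: hom_def full_sub_two_category_def)
  have c: "\<alpha> \<in> cell (full_sub_two_category B S) f g" if "\<alpha> \<in> cell B f g" "Src B f \<in> S" "Tgt B f \<in> S"
    for \<alpha> f g using that by (auto simp: cell_def full_sub_two_category_def)
  show ?thesis
    using s
  proof (rule B.equivalenceE, goal_cases)
    case (1 g \<eta> \<eta>' \<epsilon> \<epsilon>')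
    then have g: "g \<in> Ar B" "Src B g = Tgt B s" "Tgt B g = Src B s" by (auto simp: hom_def)
    note e = c[OF 1(3)] c[OF 1(4)] c[OF 1(7)] c[OF 1(8)]
    have sel: "Src (full_sub_two_category B S) = Src B" "Tgt (full_sub_two_category B S) = Tgt B"
      "Idn (full_sub_two_category B S) = Idn B" "Cmp (full_sub_two_category B S) = Cmp B"
      "VC (full_sub_two_category B S) = VC B" "Id2 (full_sub_two_category B S) = Id2 B"
      by (auto simp: full_sub_two_category_def)
    show ?case
      by (rule S.equivalenceI[of s g \<eta> \<eta>' \<epsilon> \<epsilon>'], unfold sel h)
        (use 1(1,2,5,6,9,10) g e st in \<open>auto simp: full_sub_two_category_def\<close>)
  qed
qed

text \<open>Both legs of the span are instances: \<open>S\<close> is \<open>Qf\<close> each time,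
  while \<open>T\<close> and \<open>n\<close> are the identity with \<open>p\<close>, or
  \<open>RQ\<close> with \<open>v\<close> at \<open>Q\<close>.\<close>

locale natural_weak_equivalence = category C + D: two_category D
  for C :: "('o, 'm) cat" and D :: "('p, 'n, 'd) twocat" +
  fixes W :: "'m set" and S T :: "('o, 'm, 'm, 'o, 'm, 'm) twofun" and n :: "'o \<Rightarrow> 'm"
  assumes S: "two_functor (disc C) (disc C) S" and T: "two_functor (disc C) (disc C) T"
    and SW: "w \<in> W \<Longrightarrow> FA S w \<in> W" and TW: "w \<in> W \<Longrightarrow> FA T w \<in> W" and W: "W \<subseteq> Ar C"
    and n: "X \<in> Ob C \<Longrightarrow> n X \<in> Ar C" "X \<in> Ob C \<Longrightarrow> Src C (n X) = FO S X"
      "X \<in> Ob C \<Longrightarrow> Tgt C (n X) = FO T X" "X \<in> Ob C \<Longrightarrow> n X \<in> W"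
    and n_nat: "f \<in> Ar C \<Longrightarrow> Cmp C (n (Tgt C f)) (FA S f) = Cmp C (FA T f) (n (Src C f))"
begin

lemma two_category_disc_C: "two_category (disc C)"
  by (rule two_category_disc) (rule category_axioms)

sublocale P: two_category_pair "disc C" D
  by (simp add: two_category_pair_def two_category_disc_C D.two_category_axioms)

sublocale H: two_category "Hom_p (disc C) D" by (rule P.two_category_Hom_p)

sublocale CC: two_category_pair "disc C" "disc C"
  by (simp add: two_category_pair_def two_category_disc_C)

sublocale S: two_category_triple "disc C" "disc C" D S
  by unfold_locales (rule S)

sublocale T: two_category_triple "disc C" "disc C" D T
  by unfold_locales (rule T)

abbreviation "\<P> \<equiv> Hom_p (disc C) D"
abbreviation "E \<equiv> Hom_p_plus (disc C) W D"

sublocale E: two_category E by (rule P.two_category_Hom_p_plus)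

sublocale EE: two_category_pair E E
  by (simp add: two_category_pair_def E.two_category_axioms)

abbreviation "precomp_S \<equiv> precomposition_plus (disc C) (disc C) W D S"
abbreviation "precomp_T \<equiv> precomposition_plus (disc C) (disc C) W D T"

lemma sends_to_equivalences_precomp:
  "sends_to_equivalences D W F \<Longrightarrow> sends_to_equivalences D W (comp_twofun (disc C) F S)"
  "sends_to_equivalences D W F \<Longrightarrow> sends_to_equivalences D W (comp_twofun (disc C) F T)"
  using W SW TW by (auto simp: sends_to_equivalences_def disc_sel subset_iff)

lemma two_functor_precomp: "two_functor E E precomp_S" "two_functor E E precomp_T"
  by (rule S.two_functor_precomposition_plus T.two_functor_precomposition_plus,
      erule sends_to_equivalences_precomp)+

text \<open>\<open>n\<close> is strictly natural, so its image under \<open>F\<close> is a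
  pseudonatural transformation with identity structure cells. The two composites around the square
  are equal arrows, and the identity cell is named after one of them.\<close>

definition whisker_comp :: "('o, 'm, 'm, 'p, 'n, 'd) twofun \<Rightarrow> ('o, 'm, 'm, 'p, 'n, 'd) pnat" where
  "whisker_comp F = \<lparr>PDom = comp_twofun (disc C) F S, PCod = comp_twofun (disc C) F T,
     PO = (\<lambda>X\<in>Ob C. FA F (n X)), PA = (\<lambda>f\<in>Ar C. Id2 D (FA F (Cmp C (n (Tgt C f)) (FA S f))))\<rparr>"

text \<open>The cell \<open>PA \<theta> (n X)\<close> points in the direction opposite to a structure cell of a pseudonatural
  transformation, so \<open>whisker_pnat\<close> uses the inverse modification.\<close>

definition whisker_cell :: "('o, 'm, 'm, 'p, 'n, 'd) pnat \<Rightarrow> ('o, 'm, 'm, 'p, 'n, 'd) modif" where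
  "whisker_cell \<theta> = \<lparr>MDom = comp_pnat (disc C) D (whisker_comp (PCod \<theta>)) (precomp_pnat (disc C) S \<theta>),
     MCod = comp_pnat (disc C) D (precomp_pnat (disc C) T \<theta>) (whisker_comp (PDom \<theta>)),
     MC = (\<lambda>X\<in>Ob C. PA \<theta> (n X))\<rparr>"

definition whisker_pnat where
  "whisker_pnat = \<lparr>PDom = precomp_S, PCod = precomp_T, PO = (\<lambda>F\<in>Ob E. whisker_comp F),
     PA = (\<lambda>\<theta>\<in>Ar E. inv_cell \<P> (whisker_cell \<theta>))\<rparr>"

lemma whisker_sel [simp]:
  "PDom (whisker_comp F) = comp_twofun (disc C) F S" "PCod (whisker_comp F) = comp_twofun (disc C) F T"
  "X \<in> Ob C \<Longrightarrow> PO (whisker_comp F) X = FA F (n X)"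
  "f \<in> Ar C \<Longrightarrow> PA (whisker_comp F) f = Id2 D (FA F (Cmp C (n (Tgt C f)) (FA S f)))"
  "PO (whisker_comp F) \<in> extensional (Ob C)" "PA (whisker_comp F) \<in> extensional (Ar C)"
  "MDom (whisker_cell \<theta>) = comp_pnat (disc C) D (whisker_comp (PCod \<theta>)) (precomp_pnat (disc C) S \<theta>)"
  "MCod (whisker_cell \<theta>) = comp_pnat (disc C) D (precomp_pnat (disc C) T \<theta>) (whisker_comp (PDom \<theta>))"
  "X \<in> Ob C \<Longrightarrow> MC (whisker_cell \<theta>) X = PA \<theta> (n X)"
  "MC (whisker_cell \<theta>) \<in> extensional (Ob C)"
  by (simp_all add: whisker_comp_def whisker_cell_def)

lemmas n_simps [simp] = n
lemmas ST_simps [simp] = CC.two_functor_simps(1-4,8-10)[OF S, unfolded disc_sel]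
  CC.two_functor_simps(1-4,8-10)[OF T, unfolded disc_sel]
lemmas F_simps [simp] = P.two_functor_simps(1-4,8-10)[unfolded disc_sel]
lemmas pnat_simps [simp] = P.pseudonatural_simps(3-11)[unfolded disc_sel]

text \<open>The second equation carries a tail \<open>x\<close>, since composites are nested to the
  right and the first one would not match inside a longer composite.\<close>

lemma F_n_nat:
  assumes "two_functor (disc C) D F" "f \<in> Ar C"
  shows "Cmp D (FA F (n (Tgt C f))) (FA F (FA S f)) = Cmp D (FA F (FA T f)) (FA F (n (Src C f)))"
    and "x \<in> Ar D \<Longrightarrow> Tgt D x = FO F (FO S (Src C f)) \<Longrightarrow>
      Cmp D (FA F (n (Tgt C f))) (Cmp D (FA F (FA S f)) x) = Cmp D (FA F (FA T f)) (Cmp D (FA F (n (Src C f))) x)"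
proof -
  show 1: "Cmp D (FA F (n (Tgt C f))) (FA F (FA S f)) = Cmp D (FA F (FA T f)) (FA F (n (Src C f)))"
    using arg_cong[OF n_nat[OF assms(2)], of "FA F"] assms by simp
  show "Cmp D (FA F (n (Tgt C f))) (Cmp D (FA F (FA S f)) x) = Cmp D (FA F (FA T f)) (Cmp D (FA F (n (Src C f))) x)"
    if "x \<in> Ar D" "Tgt D x = FO F (FO S (Src C f))"
    using arg_cong[OF 1, of "\<lambda>y. Cmp D y x"] assms that by simp
qed

lemma pseudonatural_whisker_comp:
  assumes F: "two_functor (disc C) D F"
  shows "pseudonatural (disc C) D (whisker_comp F)"
proof (rule pseudonaturalI, goal_cases)
  show "two_functor (disc C) D (PDom (whisker_comp F))" "two_functor (disc C) D (PCod (whisker_comp F))"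
    using F by (simp_all add: two_functor_comp[OF S] two_functor_comp[OF T])
next
  case (9 f)
  then show ?case
    using F F_n_nat[OF F, of f] by (simp add: disc_sel)
next
  case a: (12 f g)
  then show ?case
    using a F F_n_nat[OF F, of f] F_n_nat[OF F, of g] by (simp add: disc_sel)
next
  case f: (13 f)
  then show ?case
    using f F F_n_nat[OF F, of f] by (simp add: disc_sel)
qed (use F in \<open>simp_all add: disc_sel\<close>)

text \<open>The cell of \<theta> at the diagonal of the naturality square of \<open>n\<close> is
  expanded along both sides of the square. The result is the modification axiom for
  \<open>whisker_cell\<close>.\<close>

lemma PA_n_nat:
  assumes \<theta>: "pseudonatural (disc C) D \<theta>" and f: "f \<in> Ar C"
  shows "VC D (HC D (PA \<theta> (n (Tgt C f))) (Id2 D (FA (PDom \<theta>) (FA S f))))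
      (HC D (Id2 D (FA (PCod \<theta>) (n (Tgt C f)))) (PA \<theta> (FA S f))) =
    VC D (HC D (PA \<theta> (FA T f)) (Id2 D (FA (PDom \<theta>) (n (Src C f)))))
      (HC D (Id2 D (FA (PCod \<theta>) (FA T f))) (PA \<theta> (n (Src C f))))"
  using arg_cong[OF n_nat[OF f], of "PA \<theta>"] assms by simp

lemma modification_whisker_cell:
  assumes \<theta>: "pseudonatural (disc C) D \<theta>"
  shows "modification (disc C) D (whisker_cell \<theta>)"
proof (rule modificationI, goal_cases)
  show "pseudonatural (disc C) D (MDom (whisker_cell \<theta>))" "pseudonatural (disc C) D (MCod (whisker_cell \<theta>))"
    using \<theta> by (simp_all add: P.pseudonatural_comp pseudonatural_whisker_comp S.pseudonatural_precomp
        T.pseudonatural_precomp)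
next
  case (9 f)
  then have f [simp]: "f \<in> Ar C" by (simp add: disc_sel)
  let ?F = "PDom \<theta>" and ?G = "PCod \<theta>"
  note [simp] = \<theta> F_n_nat[of "PDom \<theta>" f] F_n_nat[of "PCod \<theta>" f]
  show ?case
    using PA_n_nat[OF \<theta> f] by (simp add: disc_sel)
qed (use \<theta> in \<open>simp_all add: disc_sel\<close>)

lemma invertible_whisker_cell:
  assumes \<theta>: "pseudonatural (disc C) D \<theta>"
  shows "invertible_cell \<P> (whisker_cell \<theta>)"
    and "X \<in> Ob C \<Longrightarrow> MC (inv_cell \<P> (whisker_cell \<theta>)) X = inv_cell D (PA \<theta> (n X))"
proof -
  have i: "invertible_cell D (MC (whisker_cell \<theta>) X)" if "X \<in> Ob (disc C)" for X
    using \<theta> that by (simp add: disc_sel)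
  show "invertible_cell \<P> (whisker_cell \<theta>)"
    by (rule P.modification_inverse(1)[OF modification_whisker_cell[OF \<theta>] i])
  show "MC (inv_cell \<P> (whisker_cell \<theta>)) X = inv_cell D (PA \<theta> (n X))" if "X \<in> Ob C"
    using P.modification_inverse(2)[OF modification_whisker_cell[OF \<theta>] i, of X] that by (simp add: disc_sel)
qed

lemma inv_whisker_cell [simp]:
  assumes "pseudonatural (disc C) D \<theta>"
  shows "modification (disc C) D (inv_cell \<P> (whisker_cell \<theta>))"
    "MDom (inv_cell \<P> (whisker_cell \<theta>)) =
      comp_pnat (disc C) D (precomp_pnat (disc C) T \<theta>) (whisker_comp (PDom \<theta>))"
    "MCod (inv_cell \<P> (whisker_cell \<theta>)) =
      comp_pnat (disc C) D (whisker_comp (PCod \<theta>)) (precomp_pnat (disc C) S \<theta>)"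
    "X \<in> Ob C \<Longrightarrow> MC (inv_cell \<P> (whisker_cell \<theta>)) X = inv_cell D (PA \<theta> (n X))"
  using H.inv_cell(1-3)[OF invertible_whisker_cell(1)[OF assms]] invertible_whisker_cell(2)[OF assms]
  by simp_all

lemma whisker_pnat_sel [simp]:
  "PDom whisker_pnat = precomp_S" "PCod whisker_pnat = precomp_T"
  "two_functor (disc C) D F \<Longrightarrow> sends_to_equivalences D W F \<Longrightarrow> PO whisker_pnat F = whisker_comp F"
  "pseudonatural (disc C) D \<theta> \<Longrightarrow> sends_to_equivalences D W (PDom \<theta>) \<Longrightarrow>
    sends_to_equivalences D W (PCod \<theta>) \<Longrightarrow> PA whisker_pnat \<theta> = inv_cell \<P> (whisker_cell \<theta>)"
  "PO whisker_pnat \<in> extensional (Ob E)" "PA whisker_pnat \<in> extensional (Ar E)"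
  by (simp_all add: whisker_pnat_def)

lemma precomp_pnat_comp:
  assumes "pseudonatural (disc C) D \<theta>" "pseudonatural (disc C) D \<phi>" "PDom \<phi> = PCod \<theta>"
  shows "precomp_pnat (disc C) S (comp_pnat (disc C) D \<phi> \<theta>) =
      comp_pnat (disc C) D (precomp_pnat (disc C) S \<phi>) (precomp_pnat (disc C) S \<theta>)"
    "precomp_pnat (disc C) T (comp_pnat (disc C) D \<phi> \<theta>) =
      comp_pnat (disc C) D (precomp_pnat (disc C) T \<phi>) (precomp_pnat (disc C) T \<theta>)"
  using assms
  by (rule_tac [!] P.pseudonatural_eqI) (simp_all add: disc_sel, simp_all add: comp_pnat_def disc_sel precomp_pnat_def)

text \<open>At \<open>X\<close> the structure cell for \<theta> is the inverse of
  \<open>\<theta>_n\<close>. The law on composites is then the formula for the cell of a composite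
  transformation at \<open>n\<close>, inverted: the order is reversed, and inversion commutes with
  whiskering. Naturality in \<rho> is the modification axiom of \<rho> at \<open>n\<close>, composed
  with inverses on both sides.\<close>

lemma pseudonatural_whisker_pnat: "pseudonatural E E whisker_pnat"
proof -
  note [simp] = S.pseudonatural_precomp T.pseudonatural_precomp pseudonatural_whisker_comp
    S.modification_precomp T.modification_precomp P.pseudonatural_comp P.pseudonatural_id
    P.modification_VC P.modification_HC P.modification_Id2 P.modification_ext
    P.modification_ext[unfolded disc_sel] P.Hom_p_cells(7-9)[unfolded disc_sel]
    two_functor_comp[OF S] two_functor_comp[OF T] sends_to_equivalences_precomp precomp_pnat_comp
  note Hom_simps [simp] = H.category_simps(9-11)[unfolded P.Hom_p_sel mem_Collect_eq]
  have precomp_id [simp]: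
    "precomp_pnat (disc C) S (id_pnat (disc C) D F) = id_pnat (disc C) D (comp_twofun (disc C) F S)"
    "precomp_pnat (disc C) T (id_pnat (disc C) D F) = id_pnat (disc C) D (comp_twofun (disc C) F T)"
    if "two_functor (disc C) D F" for F
    using that by (rule_tac [!] P.pseudonatural_eqI)
      (simp_all add: disc_sel, simp_all add: id_pnat_def disc_sel precomp_pnat_def)
  show ?thesis
  proof (rule pseudonaturalI, goal_cases)
    show "two_functor E E (PDom whisker_pnat)" "two_functor E E (PCod whisker_pnat)"
      using two_functor_precomp by simp_all
  next
    fix \<theta> assume \<theta>: "\<theta> \<in> Ar E"
    have "invertible_cell E (inv_cell \<P> (whisker_cell \<theta>))"
      by (rule E.invertible_cellI[of _ "whisker_cell \<theta>"])
        (use \<theta> invertible_whisker_cell(1)[of \<theta>] in \<open>simp_all add: modification_whisker_cell\<close>)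
    then show "invertible_cell E (PA whisker_pnat \<theta>)" using \<theta> by simp
  next
    fix F assume F: "F \<in> Ob E"
    show "PA whisker_pnat (Idn E F) = Id2 E (PO whisker_pnat F)"
      by (rule P.modification_eqI) (use F in \<open>simp_all add: disc_sel\<close>)
  next
    case a: (12 \<theta> \<phi>)
    show ?case
    proof (rule P.modification_eqI, goal_cases)
      case (3 X)
      then show ?case
        using a by (simp add: disc_sel D.invertible_VC_inverse(2) D.invertible_lwhisker_inverse(2)
            D.invertible_rwhisker_inverse(2))
    qed (use a in simp_all)
  next
    case \<rho>: (13 \<rho>)
    show ?case
    proof (rule P.modification_eqI, goal_cases)
      case (3 X)
      then have X [simp]: "X \<in> Ob C" by (simp add: disc_sel)
      have m [simp]: "modification (disc C) D \<rho>" using \<rho> by simp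
      let ?\<theta> = "MDom \<rho>" and ?\<theta>' = "MCod \<rho>"
      let ?F = "FA (PDom ?\<theta>) (n X)" and ?G = "FA (PCod ?\<theta>) (n X)"
      have m' [simp]: "\<And>Y. Y \<in> Ob C \<Longrightarrow> MC \<rho> Y \<in> Cl D" "\<And>Y. Y \<in> Ob C \<Longrightarrow> Dm D (MC \<rho> Y) = PO ?\<theta> Y"
        "\<And>Y. Y \<in> Ob C \<Longrightarrow> Cd D (MC \<rho> Y) = PO ?\<theta>' Y"
        using P.modification_simps(5-7)[OF m] by (simp_all add: disc_sel)
      have nat: "VC D (HC D (MC \<rho> (FO T X)) (Id2 D ?F)) (PA ?\<theta> (n X)) =
          VC D (PA ?\<theta>' (n X)) (HC D (Id2 D ?G) (MC \<rho> (FO S X)))"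
        using P.modification_nat[OF m, of "n X"] by (simp add: disc_sel)
      have "VC D (inv_cell D (PA ?\<theta>' (n X))) (HC D (MC \<rho> (FO T X)) (Id2 D ?F)) =
          VC D (inv_cell D (PA ?\<theta>' (n X))) (VC D (VC D (HC D (MC \<rho> (FO T X)) (Id2 D ?F)) (PA ?\<theta> (n X)))
            (inv_cell D (PA ?\<theta> (n X))))"
        by simp
      also have "\<dots> = VC D (HC D (Id2 D ?G) (MC \<rho> (FO S X))) (inv_cell D (PA ?\<theta> (n X)))"
        unfolding nat by simp
      finally show ?case
        using \<rho> by (simp add: disc_sel)
    qed (use \<rho> in simp_all)
  next
    show "PO whisker_pnat \<in> extensional (Ob E)" "PA whisker_pnat \<in> extensional (Ar E)"
      by (rule whisker_pnat_sel)+
  qed simp_all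
qed

text \<open>For fixed \<open>F\<close> the components of \<open>whisker_comp F\<close> are images of
  weak equivalences, hence equivalences in \<open>D\<close>. So \<open>whisker_comp F\<close> is an
  equivalence in \<open>\<P>\<close> and also in its full sub-2-category \<open>E\<close>. As these
  are the components of \<open>whisker_pnat\<close>, the pointwise criterion applies once
  more.\<close>

lemma equivalence_whisker_pnat: "equivalence (Hom_p E E) whisker_pnat"
proof (rule EE.equivalence_Hom_p[OF pseudonatural_whisker_pnat])
  fix F assume "F \<in> Ob E"
  then have F: "two_functor (disc C) D F" "sends_to_equivalences D W F" by simp_all
  have "equivalence \<P> (whisker_comp F)"
    using F by (intro P.equivalence_Hom_p pseudonatural_whisker_comp)
      (simp_all add: disc_sel sends_to_equivalences_def)
  then show "equivalence E (PO whisker_pnat F)"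
    unfolding Hom_p_plus_def
    using F by (intro equivalence_full_sub_two_category)
      (simp_all add: P.two_category_Hom_p sends_to_equivalences_precomp
        P.two_category_Hom_p_plus[unfolded Hom_p_plus_def])
qed

end

section \<open>The localization\<close>

lemma id_twofun_sel [simp]:
  "a \<in> Ob B \<Longrightarrow> FO (id_twofun B) a = a" "f \<in> Ar B \<Longrightarrow> FA (id_twofun B) f = f"
  "\<alpha> \<in> Cl B \<Longrightarrow> FC (id_twofun B) \<alpha> = \<alpha>" "FO (id_twofun B) \<in> extensional (Ob B)"
  "FA (id_twofun B) \<in> extensional (Ar B)" "FC (id_twofun B) \<in> extensional (Cl B)"
  by (simp_all add: id_twofun_def)

lemma (in two_category) two_functor_id: "two_functor B B (id_twofun B)"
  by (rule two_functorI) (simp_all add: two_category_axioms)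

context normal_model_category
begin

abbreviation "\<H> \<equiv> Ho Cfc \<Sigma>"
abbreviation "q \<equiv> comp_twofun (disc C) (ho_inclusion Cfc \<Sigma>) r"

lemma two_functor_q: "two_functor (disc C) \<H> q"
  by (rule two_functor_comp[OF two_functor_r fc.two_functor_ho_inclusion])

lemma q_equivalences: "sends_to_equivalences \<H> W q"
  unfolding sends_to_equivalences_def
proof
  fix w assume w: "w \<in> W"
  then have "w \<in> Ar C" "FA r w \<in> \<Sigma>" using W_Ar r_W[OF w] by auto
  moreover from this have "FA q w = FA r w" by (simp add: disc_sel del: functor_sel Cfc_sel)
  ultimately show "equivalence \<H> (FA q w)" using weak_equivalence_Ho by metis
qed

end

section \<open>Restriction followed by extension, compared with precomposition with
  \<open>q\<close>\<close>

locale normal_model_category_functors = normal_model_category C W Fib Cof z t \<Phi> \<Psi> + D: two_category D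
  for C :: "('o, 'm) cat" and W Fib Cof z t \<Phi> \<Psi> and D :: "('p, 'n, 'd) twocat"
begin

abbreviation "E \<equiv> Hom_p_plus (disc C) W D"
abbreviation "restriction \<equiv> precomposition_plus (disc Cfc) (disc C) W D inc"
abbreviation "G \<equiv> comp_twofun E (Ho_ext Cfc \<Sigma> D) restriction"
abbreviation "RQ \<equiv> comp_twofun (disc C) inc r"

sublocale CD: two_category_pair "disc C" D
  by (simp add: two_category_pair_def two_category_discs D.two_category_axioms)

sublocale AD: two_category_pair "disc Cfc" D
  by (simp add: two_category_pair_def two_category_discs D.two_category_axioms)

sublocale HD: two_category_pair \<H> D
  by (simp add: two_category_pair_def fc.two_category_Ho D.two_category_axioms)

sublocale ACD: two_category_triple "disc Cfc" "disc C" D inc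
  by unfold_locales (simp_all add: two_category_discs[unfolded two_category_def] two_functor_inc)

sublocale CHD: two_category_triple "disc C" \<H> D q
  by unfold_locales (rule two_functor_q)

lemma inc_equivalences:
  "sends_to_equivalences D W F \<Longrightarrow> sends_to_equivalences D \<Sigma> (comp_twofun (disc Cfc) F inc)"
  by (simp add: sends_to_equivalences_def disc_sel)

lemma two_functor_restriction: "two_functor E (Hom_p_plus (disc Cfc) \<Sigma> D) restriction"
  by (rule ACD.two_functor_precomposition_plus) (rule inc_equivalences)

lemma two_functor_G: "two_functor E (Hom_p \<H> D) G"
  by (rule two_functor_comp[OF two_functor_restriction fc.two_functor_Ho_ext]) (rule D.two_category_axioms)

lemma two_functor_precomposition_q: "two_functor (Hom_p \<H> D) E (precomposition (disc C) \<H> D q)"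
proof -
  have "two_functor (Hom_p_plus \<H> {} D) E (precomposition_plus (disc C) \<H> {} D q)"
  proof (rule CHD.two_functor_precomposition_plus)
    fix F :: "('o, 'm, ('o, 'm) ho_cell, 'p, 'n, 'd) twofun" assume "two_functor \<H> D F"
    then show "sends_to_equivalences D W (comp_twofun (disc C) F q)"
      by (rule sends_to_equivalences_comp) (use q_equivalences W_Ar in \<open>simp_all add: disc_sel\<close>)
  qed
  then show ?thesis by (simp add: Hom_p_plus_empty precomposition_plus_empty)
qed

text \<open>One leg of the span ends at precomposition with the identity, whereas a
  pseudoequivalence asks for the identity of \<open>E\<close> itself. The two are equal because all
  data are extensional.\<close>

lemma precomposition_id: "precomposition_plus (disc C) (disc C) W D (id_twofun (disc C)) = id_twofun E"
proof (rule twofun_eqI[of E])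
  have c: "comp_twofun (disc C) F (id_twofun (disc C)) = F" if "two_functor (disc C) D F" for F
    by (rule twofun_eqI[of "disc C"]) (simp_all add: two_functor_ext[OF that])
  have \<theta>: "precomp_pnat (disc C) (id_twofun (disc C)) \<theta> = \<theta>" if "pseudonatural (disc C) D \<theta>" for \<theta>
    by (rule CD.pseudonatural_eqI) (use that in \<open>simp_all add: c CD.pseudonatural_ext\<close>)
  show "FO (precomposition_plus (disc C) (disc C) W D (id_twofun (disc C))) F = FO (id_twofun E) F"
    if "F \<in> Ob E" for F using that by (simp add: c)
  show "FA (precomposition_plus (disc C) (disc C) W D (id_twofun (disc C))) \<theta> = FA (id_twofun E) \<theta>"
    if "\<theta> \<in> Ar E" for \<theta> using that by (simp add: \<theta>)
  show "FC (precomposition_plus (disc C) (disc C) W D (id_twofun (disc C))) \<rho> = FC (id_twofun E) \<rho>"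
    if "\<rho> \<in> Cl E" for \<rho>
  proof (rule CD.modification_eqI)
    show "MDom (FC (precomposition_plus (disc C) (disc C) W D (id_twofun (disc C))) \<rho>) = MDom (FC (id_twofun E) \<rho>)"
      "MCod (FC (precomposition_plus (disc C) (disc C) W D (id_twofun (disc C))) \<rho>) = MCod (FC (id_twofun E) \<rho>)"
      using that by (simp_all add: \<theta>)
  qed (use that in \<open>simp_all add: CD.modification_ext\<close>)
qed (rule precomposition_plus_sel id_twofun_sel)+

lemma G_sel:
  "F \<in> Ob E \<Longrightarrow> FO G F = ho_ext Cfc \<Sigma> D (comp_twofun (disc Cfc) F inc)"
  "\<theta> \<in> Ar E \<Longrightarrow> FA G \<theta> = ho_ext_pnat Cfc \<Sigma> D (precomp_pnat (disc Cfc) inc \<theta>)"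
  "\<rho> \<in> Cl E \<Longrightarrow> FC G \<rho> = ho_ext_modif Cfc \<Sigma> D (precomp_modif (disc Cfc) inc \<rho>)"
  using two_functorD(3)[OF two_functor_restriction, of F] two_functor_Ar[OF two_functor_restriction, of \<theta>]
    two_functorD(5)[OF two_functor_restriction, of \<rho> "Dm E \<rho>" "Cd E \<rho>"]
  by (simp_all add: hom_def cell_def)

lemmas precomposition_q_sel = precomposition_plus_sel(1-3)[of _ \<H> "{}" D "disc C" q,
    unfolded precomposition_plus_empty Hom_p_plus_empty HD.Hom_p_sel mem_Collect_eq]

text \<open>The equality is strict: \<open>q\<close> takes each arrow of \<open>C\<close>, seen as
  an identity 2-cell, to an identity 2-cell of the homotopy 2-category, where evaluation of
  homotopies returns the identity.\<close>

lemma precomposition_RQ: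
  "precomposition_plus (disc C) (disc C) W D RQ = comp_twofun E (precomposition (disc C) \<H> D q) G"
    (is "?L = ?R")
proof (rule twofun_eqI[of E])
  have rA: "f \<in> Ar C \<Longrightarrow> FA r f \<in> Ar Cfc" "X \<in> Ob C \<Longrightarrow> FO r X \<in> Ob Cfc" for f X
    by (simp_all add: fibrant_Ro cofibrant_RQ)
  have rC: "f \<in> Ar C \<Longrightarrow> FC r f = FA r f" for f by simp
  \<comment> \<open>Values of \<open>r\<close> are kept folded, so that \<open>rA\<close> recognises
    them as objects and arrows of \<open>Cfc\<close> and the rules for \<open>inc\<close>
    apply.\<close>
  note [simp del] = functor_sel(7-9) Cfc_sel(1,2)
  have c: "comp_twofun (disc C) F RQ =
      comp_twofun (disc C) (ho_ext Cfc \<Sigma> D (comp_twofun (disc Cfc) F inc)) q"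
    if F: "two_functor (disc C) D F" "sends_to_equivalences D W F" for F
  proof -
    have "localizing_functor Cfc \<Sigma> D (comp_twofun (disc Cfc) F inc)"
      by (rule fc.localizing_functorI[OF two_functor_comp[OF two_functor_inc F(1)] inc_equivalences[OF F(2)]])
    then interpret l: localizing_functor Cfc \<Sigma> D "comp_twofun (disc Cfc) F inc" .
    show ?thesis
    proof (rule twofun_eqI[of "disc C"])
      fix f assume "f \<in> Cl (disc C)"
      then have f: "f \<in> Ar C" "FA r f \<in> Ar Cfc" "FC r f = FA r f" using rA rC by (simp_all add: disc_sel)
      then have "FA r f \<in> Ar C" by (simp add: Cfc_sel)
      then show "FC (comp_twofun (disc C) F RQ) f =
          FC (comp_twofun (disc C) (ho_ext Cfc \<Sigma> D (comp_twofun (disc Cfc) F inc)) q) f"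
        using f CD.two_functor_simps(10)[OF F(1), of "FA r f"] by (simp add: disc_sel)
    qed (rule comp_twofun_sel(4-6) | use rA in \<open>simp add: disc_sel\<close>)+
  qed
  have \<theta>: "precomp_pnat (disc C) RQ \<theta> =
      precomp_pnat (disc C) q (ho_ext_pnat Cfc \<Sigma> D (precomp_pnat (disc Cfc) inc \<theta>))"
    if "pseudonatural (disc C) D \<theta>" "sends_to_equivalences D W (PDom \<theta>)" "sends_to_equivalences D W (PCod \<theta>)"
    for \<theta>
    by (rule CD.pseudonatural_eqI) (use that rA in \<open>simp_all add: c\<close>, use rA in \<open>simp_all add: disc_sel\<close>)
  have e: "two_functor \<H> D (FO G F)" if "F \<in> Ob E" for F
    using HD.Hom_p_sel(1) two_functorD(3)[OF two_functor_G that] by simp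
  have e': "pseudonatural \<H> D (FA G \<theta>)" if "\<theta> \<in> Ar E" for \<theta>
    using two_functor_Ar[OF two_functor_G that] by (simp add: hom_def)
  have e'': "modification \<H> D (FC G \<rho>)" if "\<rho> \<in> Cl E" for \<rho>
    using two_functorD(5)[OF two_functor_G, of \<rho> "Dm E \<rho>" "Cd E \<rho>"] that by (simp add: cell_def)
  show "FO ?L F = FO ?R F" if F: "F \<in> Ob E" for F
    unfolding comp_twofun_sel(1)[OF F, of "precomposition (disc C) \<H> D q" G] precomposition_q_sel(1)[OF e[OF F]]
    unfolding G_sel(1)[OF F]
    using F by (simp add: c)
  show "FA ?L \<theta> = FA ?R \<theta>" if F: "\<theta> \<in> Ar E" for \<theta>
    unfolding comp_twofun_sel(2)[OF F, of "precomposition (disc C) \<H> D q" G] precomposition_q_sel(2)[OF e'[OF F]]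
    unfolding G_sel(2)[OF F]
    using F by (simp add: \<theta>)
  show "FC ?L \<rho> = FC ?R \<rho>" if F: "\<rho> \<in> Cl E" for \<rho>
    unfolding comp_twofun_sel(3)[OF F, of "precomposition (disc C) \<H> D q" G] precomposition_q_sel(3)[OF e''[OF F]]
    unfolding G_sel(3)[OF F]
    by (rule CD.modification_eqI) (use F in \<open>simp_all add: \<theta>\<close>, use rA in \<open>simp_all add: disc_sel\<close>)
qed (rule precomposition_plus_sel comp_twofun_sel)+

lemma G_precomposition: "comp_twofun (Hom_p \<H> D) G (precomposition (disc C) \<H> D q) = id_twofun (Hom_p \<H> D)"
    (is "?L = ?R")
proof (rule twofun_eqI[of "Hom_p \<H> D"])
  have rn: "X \<in> Ob Cfc \<Longrightarrow> FO r X = X" "f \<in> Ar Cfc \<Longrightarrow> FA r f = f" "X \<in> Ob Cfc \<Longrightarrow> X \<in> Ob C"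
    "f \<in> Ar Cfc \<Longrightarrow> f \<in> Ar C" for X f using r_normal by (simp_all add: fc_Ob)
  note ext = precomp_pnat_sel(5,6)[of "disc Cfc", unfolded disc_sel]
    precomp_modif_sel(4)[of "disc Cfc", unfolded disc_sel] HD.pseudonatural_ext[unfolded fc.Ho_sel]
    HD.modification_ext[unfolded fc.Ho_sel]
  \<comment> \<open>On \<open>Cfc\<close> the composite \<open>q inc\<close> agrees with the
    inclusion, which brings \<open>K q\<close> restricted to \<open>Cfc\<close> into the form
    required by \<open>ho_ext_unique\<close>.\<close>
  have c0: "comp_twofun (disc Cfc) (comp_twofun (disc C) K q) inc =
      comp_twofun (disc Cfc) K (ho_inclusion Cfc \<Sigma>)"
    if K: "two_functor \<H> D K" for K
  proof (rule twofun_eqI[of "disc Cfc"])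
    fix f assume "f \<in> Cl (disc Cfc)"
    then have f: "f \<in> Ar Cfc" "f \<in> Ar C" "FC r f = f" using r_normal(2)[of f] by (simp_all add: disc_sel)
    then show "FC (comp_twofun (disc Cfc) (comp_twofun (disc C) K q) inc) f =
        FC (comp_twofun (disc Cfc) K (ho_inclusion Cfc \<Sigma>)) f"
      by (simp add: disc_sel del: Cfc_sel functor_sel(7-9))
  qed (rule comp_twofun_sel(4-6) | use rn in \<open>simp add: disc_sel del: Cfc_sel(1,2) functor_sel(7-9)\<close>)+
  have c: "ho_ext Cfc \<Sigma> D (comp_twofun (disc Cfc) (comp_twofun (disc C) K q) inc) = K"
    if "two_functor \<H> D K" for K
    using fc.ho_ext_unique(2)[OF that] c0[OF that] by simp
  have \<theta>: "ho_ext_pnat Cfc \<Sigma> D (precomp_pnat (disc Cfc) inc (precomp_pnat (disc C) q \<theta>)) = \<theta>"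
    if "pseudonatural \<H> D \<theta>" for \<theta>
    by (rule HD.pseudonatural_eqI)
      (use that rn in \<open>simp_all add: c HD.pseudonatural_ext disc_sel ext del: Cfc_sel(1,2) functor_sel(7-9)\<close>)
  have e: "comp_twofun (disc C) F q \<in> Ob E" if "two_functor \<H> D F" for F
    using two_functorD(3)[OF two_functor_precomposition_q, of F] that by (simp add: precomposition_q_sel)
  have e': "precomp_pnat (disc C) q \<theta> \<in> Ar E" if "pseudonatural \<H> D \<theta>" for \<theta>
    using two_functor_Ar[OF two_functor_precomposition_q, of \<theta>] that
    by (simp add: hom_def precomposition_q_sel)
  have e'': "precomp_modif (disc C) q \<rho> \<in> Cl E" if "modification \<H> D \<rho>" for \<rho>
    using two_functorD(5)[OF two_functor_precomposition_q, of \<rho> "MDom \<rho>" "MCod \<rho>"] that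
    by (simp add: cell_def precomposition_q_sel)
  show "FO ?L F = FO ?R F" if "F \<in> Ob (Hom_p \<H> D)" for F
  proof -
    have F: "two_functor \<H> D F" using that by simp
    have "FO ?L F = FO G (comp_twofun (disc C) F q)"
      unfolding comp_twofun_sel(1)[OF that] precomposition_q_sel(1)[OF F] ..
    then show ?thesis unfolding G_sel(1)[OF e[OF F]] c[OF F] using F by simp
  qed
  show "FA ?L \<theta> = FA ?R \<theta>" if "\<theta> \<in> Ar (Hom_p \<H> D)" for \<theta>
  proof -
    have F: "pseudonatural \<H> D \<theta>" using that by simp
    have "FA ?L \<theta> = FA G (precomp_pnat (disc C) q \<theta>)"
      unfolding comp_twofun_sel(2)[OF that] precomposition_q_sel(2)[OF F] ..
    then show ?thesis unfolding G_sel(2)[OF e'[OF F]] \<theta>[OF F] using F by simp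
  qed
  show "FC ?L \<rho> = FC ?R \<rho>" if "\<rho> \<in> Cl (Hom_p \<H> D)" for \<rho>
  proof -
    have F: "modification \<H> D \<rho>" using that by simp
    have "FC ?L \<rho> = FC G (precomp_modif (disc C) q \<rho>)"
      unfolding comp_twofun_sel(3)[OF that] precomposition_q_sel(3)[OF F] ..
    moreover have "ho_ext_modif Cfc \<Sigma> D (precomp_modif (disc Cfc) inc (precomp_modif (disc C) q \<rho>)) = \<rho>"
      by (rule HD.modification_eqI)
        (use F rn in \<open>simp_all add: \<theta> HD.modification_ext disc_sel ext del: Cfc_sel(1,2) functor_sel(7-9)\<close>)
    ultimately show ?thesis unfolding G_sel(3)[OF e''[OF F]] using F by simp
  qed
qed (rule precomposition_plus_sel comp_twofun_sel id_twofun_sel)+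

lemma v_Q_nat:
  "f \<in> Ar C \<Longrightarrow> Cmp C (Ra (Qa f)) (v (Qo (Src C f))) = Cmp C (v (Qo (Tgt C f))) (Qa f)"
  using Ra_simps(4)[of "Qa f"] by simp

lemma pseudoequivalence_precomposition_q: "pseudoequivalence (Hom_p \<H> D) E (precomposition (disc C) \<H> D q)"
proof -
  let ?P = "Hom_p \<H> D"
  let ?PP = "Hom_p ?P ?P"
  interpret H: two_category "?P" by (rule HD.two_category_Hom_p)
  interpret HH: two_category_pair "?P" "?P"
    by (simp add: two_category_pair_def H.two_category_axioms)
  interpret HHH: two_category ?PP by (rule HH.two_category_Hom_p)
  interpret p: natural_weak_equivalence C D W Qf "id_twofun (disc C)" p
    by unfold_locales (use W_Ar in \<open>auto simp: two_functor_Qf two_category.two_functor_id two_category_discs disc_sel Qa_W\<close>)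
  interpret v: natural_weak_equivalence C D W Qf RQ "\<lambda>X. v (Qo X)"
    by unfold_locales (use W_Ar in \<open>auto simp: two_functor_Qf two_functor_comp[OF two_functor_r two_functor_inc]
      disc_sel Qa_W Ra_W v_Q_nat fibrant_Ro cofibrant_RQ\<close>)
  interpret EE: two_category "Hom_p E E" by (rule p.EE.two_category_Hom_p)
  note v = v.pseudonatural_whisker_pnat v.equivalence_whisker_pnat
  note p = p.pseudonatural_whisker_pnat p.equivalence_whisker_pnat
  \<comment> \<open>A quasi-inverse of the leg given by \<open>v\<close>; it leads from
    precomposition with \<open>RQ\<close> back to precomposition with \<open>Qf\<close>.\<close>
  obtain \<psi> where \<psi>: "\<psi> \<in> Ar (Hom_p E E)" "Src (Hom_p E E) \<psi> = Tgt (Hom_p E E) v.whisker_pnat"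
    "Tgt (Hom_p E E) \<psi> = Src (Hom_p E E) v.whisker_pnat" "equivalence (Hom_p E E) \<psi>"
    using EE.equivalence_inverse[OF v(2)] by metis
  have eq: "Tgt (Hom_p E E) \<psi> = Src (Hom_p E E) p.whisker_pnat" using \<psi>(3) by simp
  \<comment> \<open>By \<open>precomposition_RQ\<close> and \<open>precomposition_id\<close> this
    zigzag runs from the composite of \<open>G\<close> and \<open>q^*\<close> to the identity of
    \<open>E\<close>.\<close>
  let ?\<phi> = "Cmp (Hom_p E E) p.whisker_pnat \<psi>"
  have "?\<phi> \<in> hom (Hom_p E E) (comp_twofun E (precomposition (disc C) \<H> D q) G) (id_twofun E)"
    using EE.category_simps(6-8)[OF \<psi>(1) _ eq] \<psi>(2) p(1) precomposition_RQ precomposition_id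
    by (simp add: hom_def)
  moreover have "equivalence (Hom_p E E) ?\<phi>" by (rule EE.equivalence_Cmp[OF \<psi>(4) p(2) eq])
  \<comment> \<open>The other composite equals the identity by \<open>G_precomposition\<close>, so
    an identity transformation serves as the comparison.\<close>
  moreover have "Idn ?PP (id_twofun ?P) \<in>
      hom ?PP (id_twofun ?P)
        (comp_twofun ?P G (precomposition (disc C) \<H> D q))"
    unfolding G_precomposition by (rule HHH.Idn_hom) (simp add: H.two_functor_id)
  moreover have "equivalence ?PP
      (Idn ?PP (id_twofun ?P))"
    by (rule HHH.equivalence_Idn) (simp add: H.two_functor_id)
  ultimately show ?thesis
    unfolding pseudoequivalence_def using two_functor_precomposition_q two_functor_G by blast
qed

end

theorem theorem3p28:
  fixes C :: "('o, 'm) cat" and W Fib Cof :: "'m set" and z t :: 'o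
    and \<Phi> \<Psi> :: "'m factorization"
  defines "Cfc \<equiv> fibrant_cofibrant C Fib Cof z t"
  defines "H \<equiv> Ho Cfc (W \<inter> Ar Cfc)"
  defines "r \<equiv> fc_replacement C z t \<Phi> \<Psi>"
  defines "i' \<equiv> ho_inclusion Cfc (W \<inter> Ar Cfc)"
  defines "q \<equiv> comp_twofun (disc C) i' r"
  assumes "model_category C W Fib Cof"
    and "initial C z" and "terminal C t"
    and "functorial_factorization C Cof (W \<inter> Fib) \<Phi>"
    and "functorial_factorization C (W \<inter> Cof) Fib \<Psi>"
    and "normal_factorizations C Fib Cof z t \<Phi> \<Psi>"
  shows "two_functor (disc C) H q \<and> sends_to_equivalences H W q \<and>
    (\<forall>D :: ('p, 'n, 'd) twocat. two_category D \<longrightarrow>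
       pseudoequivalence (Hom_p H D) (Hom_p_plus (disc C) W D) (precomposition (disc C) H D q))"
proof -
  interpret normal_model_category C W Fib Cof z t \<Phi> \<Psi>
    using assms(6-11) by (simp add: normal_model_category_def normal_model_category_axioms_def)
  have "pseudoequivalence (Hom_p H D) (Hom_p_plus (disc C) W D) (precomposition (disc C) H D q)"
    if "two_category D" for D :: "('p, 'n, 'd) twocat"
  proof -
    interpret D: two_category D by (rule that)
    interpret normal_model_category_functors C W Fib Cof z t \<Phi> \<Psi> D ..
    show ?thesis unfolding assms(1-5) by (rule pseudoequivalence_precomposition_q)
  qed
  then show ?thesis unfolding assms(1-5) using two_functor_q q_equivalences by blast
qed

end
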